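(* For all $\Xi,\mathrm H\in\mathcal S^\Lambda_{fin}(\mathcal H)=\Lambda\otimes\mathcal S_{fin}(\mathcal H)$, $$(\Xi\mid\mathrm H)=\int\big(\varphi_\Xi(\xi,\mathrm j\eta^* )\big)^*\,\varphi_{\mathrm H}(\xi,\eta^* )\,dv(\xi,\xi^* )\,dv(\eta,\eta^* ),$$ where the integration extends over two independent copies (variables $\xi$ and $\eta$) of $\mathcal E_{\Lambda}$ (regarded as a real space).
   Context: Fock space. $\mathcal H=\mathcal H_{\bar0}\oplus\mathcal H_{\bar1}$ is a $\mathbb Z_2$-graded complex separable Hilbert space (inner product antilinear in the first argument), $\mathcal H_{\bar k}=\mathcal E_{\bar k}\oplus\mathcal E_{\bar k}^*$, with an antiunitary involution $f\mapsto f^*$, $f^{**}=f$, exchanging $\mathcal E_{\bar k}$ and its dual $\mathcal E_{\bar k}^*$; $\mathcal E=\mathcal E_{\bar0}\oplus\mathcal E_{\bar1}$. Parity: $\pi(f)=k$ for $0\ne f\in\mathcal H_{\bar k}$. Let $P^{(n)}f_1\otimes\cdots\otimes f_n=\frac1{n!}\sum_\sigma\chi_\sigma(f_1,\dots,f_n) f_{\sigma(1)}\otimes\cdots\otimes f_{\sigma(n)}$ for vectors of definite parity, where $\chi_\sigma=(-1)^{N_\sigma}$, $N_\sigma$ the number of pairs $i<j$ with $\sigma(i)>\sigma(j)$ and $\pi(f_{\sigma(i)})=\pi(f_{\sigma(j)})=1$; it extends to a projection. $\mathcal H^{\odot n}=P^{(n)}\mathcal H^{\otimes n}$ (algebraic),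 $\mathcal S_{fin}(\mathcal H)=\bigoplus_n\mathcal H^{\odot n}$ (algebraic sum) with product $F\odot G=\sqrt{\frac{(p+q)!}{p!q!}}P^{(p+q)}F\otimes G$ ($F\in\mathcal H^{\odot p}$, $G\in\mathcal H^{\odot q}$), norm inherited from $\|f_1\otimes\cdots\otimes f_n\|_n=\prod\|f_a\|$, $\|F\|^2=\sum_n\|F_n\|_n^2$; its completion is $\mathcal S(\mathcal H)$. The involution extends to an antiunitary involution of $\mathcal S(\mathcal H)$ with $(F\odot G)^*=G^*\odot F^*$, and $\langle F\mid G\rangle:=(F^*\mid G)$. The linear map $j:\mathcal H\to\mathcal H$ is the identity on $\mathcal H_{\bar0}\oplus\mathcal E_{\bar1}$ and $-1$ on $\mathcal E_{\bar1}^*$; $\omega(f,g)=\langle f\mid jg\rangle$. Grassmann extension. $\Lambda$ is the completion of the antisymmetric tensor algebra over a separable infinite-dimensional complex Hilbert space $\Lambda_1$, $\Lambda=\bigoplus_p\Lambda_p$, unit $\kappa_0$, product $\lambda\mu=\sqrt{\frac{(p+q)!}{p!q!}}\mathrm{Alt}(\lambda\otimes\mu)$ for $\lambda\in\Lambda_p,\mu\in\Lambda_q$, norm $\|\lambda\|_\Lambda^2=\sum_p(p!)^{-2}\|\lambda_p\|_p^2$, and an antiunitary involution preserving each $\Lambda_p$ with $(\lambda\mu)^*=\mu^*\lambda^*$; $\Lambda_{\bar0},\Lambda_{\bar1}$ are the even and odd parts. $\mathcal S^\Lambda(\mathcal H)=\Lambda\widehat\otimes\mathcal S(\mathcal H)$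 (Hilbert tensor product), with $(\lambda_1\otimes F_1)(\lambda_2\otimes F_2)=\lambda_1\lambda_2\otimes(F_1\odot F_2)$ where defined, $(\lambda\otimes F)^*=\lambda^*\otimes F^*$, the continuous $\Lambda$-valued bilinear form $\langle\lambda_1\otimes F_1\mid\lambda_2\otimes F_2\rangle=\lambda_1\lambda_2\langle F_1\mid F_2\rangle$ and the sesquilinear form $(\Xi_1\mid\Xi_2)=\langle\Xi_1^*\mid\Xi_2\rangle\in\Lambda$. $\mathcal H_\Lambda=(\Lambda_{\bar0}\widehat\otimes\mathcal H_{\bar0})\oplus(\Lambda_{\bar1}\widehat\otimes\mathcal H_{\bar1})$, $\mathcal E_\Lambda=(\Lambda_{\bar0}\widehat\otimes\mathcal E_{\bar0})\oplus(\Lambda_{\bar1}\widehat\otimes\mathcal E_{\bar1})$, $\mathcal E_\Lambda^*=\{\xi^*:\xi\in\mathcal E_\Lambda\}$, $\exp\zeta=\sum_p\frac1{p!}\zeta^p\in\mathcal S^\Lambda(\mathcal H)$ for $\zeta\in\mathcal H_\Lambda$. $\mathrm j$ is the $\Lambda$-linear extension of $j$. Functions. $\varphi_\Xi(\xi,\eta^* )=\langle\exp(\xi+\eta^* )\mid\Xi\rangle\in\Lambda$ for independent $\xi\in\mathcal E_\Lambda$, $\eta^*\in\mathcal E^*_\Lambda$; in particular $\varphi_\Xi(\xi,\mathrm j\eta^* )=\langle\exp(\xi+\mathrm j\eta^* )\mid\Xi\rangle$. Gaussian supermeasure. Let $L$ be the linear functional on $\mathcal S_{fin}(\mathcal H)$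 with $L(1)=1$, zero on products of an odd number of vectors, and $L(f_1\odot\cdots\odot f_{2n})=\frac1{2^nn!}\sum_\sigma\chi_\sigma(f_1,\dots,f_{2n})\,\omega(f_{\sigma(1)},f_{\sigma(2)})\cdots\omega(f_{\sigma(2n-1)},f_{\sigma(2n)})$ for $f_a$ of definite parity; extend it $\Lambda$-linearly to $\mathcal S^\Lambda_{fin}(\mathcal H)$ by $L(\lambda\otimes F)=\lambda L(F)$. For a function on $\mathcal E_\Lambda$ of the form $\xi\mapsto\varphi_\Xi(\xi,\xi^* )$, $\Xi\in\mathcal S_{fin}^\Lambda(\mathcal H)$ (such $\Xi$ is uniquely determined by the function, and these functions are closed under pointwise products and multiplication by elements of $\Lambda$), $\int\varphi_\Xi(\xi,\xi^* )\,dv(\xi,\xi^* ):=L(\Xi)\in\Lambda$. The double integral means this integration carried out successively in the two variables. *)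

theory Defs
  imports "HOL-Analysis.Analysis" "HOL-Combinatorics.Permutations" "HOL-Library.Function_Algebras"
begin

section \<open>Hilbert spaces\<close>

text \<open>Separable complex Hilbert spaces; the inner product is antilinear in its first argument.\<close>

class chilbert_space = banach + second_countable_topology +
  fixes scaleC :: "complex \<Rightarrow> 'a \<Rightarrow> 'a"
    and cinner :: "'a \<Rightarrow> 'a \<Rightarrow> complex"
  assumes scaleC_add_right: "scaleC a (x + y) = scaleC a x + scaleC a y"
    and scaleC_add_left: "scaleC (a + b) x = scaleC a x + scaleC b x"
    and scaleC_scaleC: "scaleC a (scaleC b x) = scaleC (a * b) x"
    and scaleC_of_real: "scaleC (complex_of_real r) x = r *\<^sub>R x"
    and cinner_commute: "cinner x y = cnj (cinner y x)"
    and cinner_add_right: "cinner x (y + z) = cinner x y + cinner x z"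
    and cinner_scaleC_right: "cinner x (scaleC a y) = a * cinner x y"
    and cinner_self: "cinner x x = complex_of_real ((norm x)\<^sup>2)"

text \<open>An antiunitary involution \<open>invol\<close>, written \<open>f\<^sup>*\<close> in the comments.\<close>

class involutive_hilbert_space = chilbert_space +
  fixes invol :: "'a \<Rightarrow> 'a"
  assumes invol_add: "invol (x + y) = invol x + invol y"
    and invol_scaleC: "invol (scaleC a x) = scaleC (cnj a) (invol x)"
    and invol_invol: "invol (invol x) = x"
    and cinner_invol: "cinner (invol x) (invol y) = cnj (cinner x y)"

text \<open>The one-particle space \<open>(E0 \<oplus> E0\<^sup>*) \<oplus> (E1 \<oplus> E1\<^sup>*)\<close>, an orthogonal sum of closed subspaces.\<close>

class super_hilbert_space = involutive_hilbert_space +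
  fixes E0 :: "'a set" and E1 :: "'a set"
  assumes zero_E0: "0 \<in> E0" and zero_E1: "0 \<in> E1"
    and add_E0: "\<lbrakk>x \<in> E0; y \<in> E0\<rbrakk> \<Longrightarrow> x + y \<in> E0"
    and add_E1: "\<lbrakk>x \<in> E1; y \<in> E1\<rbrakk> \<Longrightarrow> x + y \<in> E1"
    and scaleC_E0: "x \<in> E0 \<Longrightarrow> scaleC c x \<in> E0"
    and scaleC_E1: "x \<in> E1 \<Longrightarrow> scaleC c x \<in> E1"
    and closed_E0: "closed E0" and closed_E1: "closed E1"
    and orth_E0_E1: "\<lbrakk>x \<in> E0; y \<in> E1\<rbrakk> \<Longrightarrow> cinner x y = 0"
    and orth_E0_E0s: "\<lbrakk>x \<in> E0; y \<in> E0\<rbrakk> \<Longrightarrow> cinner x (invol y) = 0"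
    and orth_E1_E1s: "\<lbrakk>x \<in> E1; y \<in> E1\<rbrakk> \<Longrightarrow> cinner x (invol y) = 0"
    and orth_E0_E1s: "\<lbrakk>x \<in> E0; y \<in> E1\<rbrakk> \<Longrightarrow> cinner x (invol y) = 0"
    and decomposition: "\<exists>a\<in>E0. \<exists>b\<in>E0. \<exists>c\<in>E1. \<exists>d\<in>E1. x = (a + invol b) + (c + invol d)"

definition H0 :: "'h::super_hilbert_space set" where
  "H0 = {a + invol b | a b. a \<in> E0 \<and> b \<in> E0}"

definition H1 :: "'h::super_hilbert_space set" where
  "H1 = {a + invol b | a b. a \<in> E1 \<and> b \<in> E1}"

definition even_part :: "'h::super_hilbert_space \<Rightarrow> 'h" where
  "even_part x = (THE a. a \<in> H0 \<and> x - a \<in> H1)"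

definition odd_part :: "'h::super_hilbert_space \<Rightarrow> 'h" where
  "odd_part x = x - even_part x"

definition jmap :: "'h::super_hilbert_space \<Rightarrow> 'h" where
  "jmap x = (THE y. \<exists>a\<in>H0. \<exists>b\<in>E1. \<exists>c\<in>invol ` E1. x = a + b + c \<and> y = a + b - c)"

definition omega :: "'h::super_hilbert_space \<Rightarrow> 'h \<Rightarrow> complex" where
  "omega f g = cinner (invol f) (jmap g)"

definition orthonormal :: "'a::chilbert_space set \<Rightarrow> bool" where
  "orthonormal B \<longleftrightarrow> (\<forall>x\<in>B. \<forall>y\<in>B. cinner x y = (if x = y then 1 else 0))"

definition orthonormal_basis :: "'a::chilbert_space set \<Rightarrow> bool" where
  "orthonormal_basis B \<longleftrightarrow> orthonormal B \<and> closure (module.span scaleC B) = UNIV"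

definition onb :: "'a::chilbert_space set" where
  "onb = (SOME B. orthonormal_basis B)"

definition infinite_dimensional :: "'a::chilbert_space itself \<Rightarrow> bool" where
  "infinite_dimensional _ \<longleftrightarrow> \<not> (\<exists>B::'a set. finite B \<and> module.span scaleC B = UNIV)"

definition multi_antilinear :: "('a::chilbert_space list \<Rightarrow> complex) \<Rightarrow> bool" where
  "multi_antilinear F \<longleftrightarrow> (\<forall>us vs x y a b.
     F (us @ (scaleC a x + scaleC b y) # vs) =
       cnj a * F (us @ x # vs) + cnj b * F (us @ y # vs))"


section \<open>The Fock space\<close>

text \<open>
  A (possibly infinite) sum of tensors over \<open>V\<close> is represented by the functional on lists over
  \<open>V\<close> sending \<open>[g\<^sub>1, \<dots>, g\<^sub>n]\<close> to its inner product with \<open>g\<^sub>1 \<otimes> \<dots> \<otimes> g\<^sub>n\<close>. Algebraic tensors are the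
  span of the functionals \<open>tens fs\<close>; Hilbert tensor products are the multi-antilinear
  functionals of finite Hilbert-Schmidt norm.
\<close>

type_synonym 'a tensor = "'a list \<Rightarrow> complex"

definition tens :: "'a::chilbert_space list \<Rightarrow> 'a tensor" where
  "tens fs = (\<lambda>gs. if length gs = length fs then \<Prod>i<length fs. cinner (gs ! i) (fs ! i) else 0)"

definition chi :: "(nat \<Rightarrow> nat) \<Rightarrow> 'h::super_hilbert_space list \<Rightarrow> complex" where
  "chi s fs = (-1) ^ card {(i, j). i < j \<and> j < length fs \<and> s i > s j \<and>
                             fs ! s i \<in> H1 \<and> fs ! s j \<in> H1}"

text \<open>
  The sum of the projections \<open>P\<^sup>(\<^sup>n\<^sup>)\<close>. Since they are self-adjoint, the value of \<open>P\<^sup>(\<^sup>n\<^sup>) F\<close> at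
  vectors \<open>fs\<close> of definite parity is
  \<open>(P\<^sup>(\<^sup>n\<^sup>) (f\<^sub>1 \<otimes> \<dots> \<otimes> f\<^sub>n) | F)\<close>; other arguments are split into their homogeneous parts. If such a
  part is zero, its parity is irrelevant because \<open>F\<close> vanishes.
\<close>

definition supersym :: "'h::super_hilbert_space tensor \<Rightarrow> 'h tensor" where
  "supersym F = (\<lambda>gs. \<Sum>fs\<leftarrow>product_lists (map (\<lambda>g. [even_part g, odd_part g]) gs).
     (\<Sum>s | s permutes {..<length gs}. chi s fs * F (permute_list s fs)) / fact (length gs))"

definition Sfin :: "'h::super_hilbert_space tensor set" where
  "Sfin = supersym ` module.span (\<lambda>c F gs. c * F gs) (range tens)"

definition grade_weight :: "nat \<Rightarrow> nat \<Rightarrow> complex" where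
  "grade_weight n p = complex_of_real (sqrt (fact n / (fact p * fact (n - p))))"

definition fmul :: "'h::super_hilbert_space tensor \<Rightarrow> 'h tensor \<Rightarrow> 'h tensor" where
  "fmul F G = supersym (\<lambda>gs. \<Sum>p\<le>length gs.
     grade_weight (length gs) p * (F (take p gs) * G (drop p gs)))"

definition fprod :: "'h::super_hilbert_space list \<Rightarrow> 'h tensor" where
  "fprod fs = foldr fmul (map (\<lambda>f. tens [f]) fs) (tens [])"

text \<open>The involution \<open>f\<^sub>1 \<otimes> \<dots> \<otimes> f\<^sub>n \<mapsto> f\<^sub>n\<^sup>* \<otimes> \<dots> \<otimes> f\<^sub>1\<^sup>*\<close>, extended antiunitarily.\<close>

definition tstar :: "'a::involutive_hilbert_space tensor \<Rightarrow> 'a tensor" where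
  "tstar F = (\<lambda>gs. cnj (F (rev (map invol gs))))"

definition tinner :: "'a::chilbert_space tensor \<Rightarrow> 'a tensor \<Rightarrow> complex" where
  "tinner F G = (\<Sum>\<^sub>\<infinity>bs\<in>lists onb. cnj (F bs) * G bs)"

definition tform :: "'a::involutive_hilbert_space tensor \<Rightarrow> 'a tensor \<Rightarrow> complex" where
  "tform F G = tinner (tstar F) G"


section \<open>The Grassmann algebra\<close>

definition alt :: "'l::chilbert_space tensor \<Rightarrow> 'l tensor" where
  "alt F = (\<lambda>ls. (\<Sum>s | s permutes {..<length ls}.
     of_int (sign s) * F (permute_list s ls)) / fact (length ls))"

definition gmul :: "'l::chilbert_space tensor \<Rightarrow> 'l tensor \<Rightarrow> 'l tensor" where
  "gmul l m = alt (\<lambda>ls. \<Sum>p\<le>length ls.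
     grade_weight (length ls) p * (l (take p ls) * m (drop p ls)))"

text \<open>Finiteness of \<open>\<Sum>\<^sub>p (p!)\<^sup>-\<^sup>2 \<parallel>l\<^sub>p\<parallel>\<^sup>2\<close>, the Hilbert-Schmidt norms being
  suprema over finite orthonormal families.\<close>

definition Lam :: "'l::involutive_hilbert_space tensor set" where
  "Lam = {l. multi_antilinear l \<and> alt l = l \<and>
     (\<exists>C. \<forall>A N. finite A \<and> orthonormal A \<longrightarrow>
        (\<Sum>as\<in>{as \<in> lists A. length as \<le> N}. (cmod (l as) / fact (length as))\<^sup>2) \<le> C)}"


section \<open>The Grassmann extension of the Fock space\<close>

type_synonym ('l, 'h) stensor = "'l list \<Rightarrow> 'h list \<Rightarrow> complex"

definition tprod :: "'l tensor \<Rightarrow> 'h tensor \<Rightarrow> ('l, 'h) stensor" where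
  "tprod l F = (\<lambda>ls hs. l ls * F hs)"

definition SLam :: "('l::involutive_hilbert_space, 'h::super_hilbert_space) stensor set" where
  "SLam = {X. (\<forall>hs. multi_antilinear (\<lambda>ls. X ls hs)) \<and> (\<forall>ls. multi_antilinear (X ls)) \<and>
     (\<forall>hs. alt (\<lambda>ls. X ls hs) = (\<lambda>ls. X ls hs)) \<and> (\<forall>ls. supersym (X ls) = X ls) \<and>
     (\<exists>C. \<forall>A B N. finite A \<and> orthonormal A \<and> finite B \<and> orthonormal B \<longrightarrow>
        (\<Sum>as\<in>{as \<in> lists A. length as \<le> N}. \<Sum>bs\<in>{bs \<in> lists B. length bs \<le> N}.
            (cmod (X as bs) / fact (length as))\<^sup>2) \<le> C)}"

definition SfinLam :: "('l::involutive_hilbert_space, 'h::super_hilbert_space) stensor set" where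
  "SfinLam = module.span (\<lambda>c X ls hs. c * X ls hs) {tprod l F | l F. l \<in> Lam \<and> F \<in> Sfin}"

definition smul :: "('l::involutive_hilbert_space, 'h::super_hilbert_space) stensor \<Rightarrow>
    ('l, 'h) stensor \<Rightarrow> ('l, 'h) stensor" where
  "smul X Y = (\<lambda>ls hs. alt (\<lambda>ls'. supersym (\<lambda>hs'. \<Sum>p\<le>length ls'. \<Sum>q\<le>length hs'.
     grade_weight (length ls') p * grade_weight (length hs') q *
     (X (take p ls') (take q hs') * Y (drop p ls') (drop q hs'))) hs) ls)"

definition sstar :: "('l::involutive_hilbert_space, 'h::super_hilbert_space) stensor \<Rightarrow>
    ('l, 'h) stensor" where
  "sstar X = (\<lambda>ls hs. cnj (X (rev (map invol ls)) (rev (map invol hs))))"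

text \<open>
  The \<open>\<Lambda>\<close>-valued bilinear form \<open>\<langle>X | Y\<rangle>\<close>: expand both arguments with respect to the orthonormal
  bases \<open>bs\<^sup>*\<close> and \<open>bs\<close> of the tensor algebra and multiply the \<open>\<Lambda>\<close>-coefficients. On \<open>SLam\<close> the
  series converges absolutely and does not depend on the basis.
\<close>

definition sform :: "('l::involutive_hilbert_space, 'h::super_hilbert_space) stensor \<Rightarrow>
    ('l, 'h) stensor \<Rightarrow> 'l tensor" where
  "sform X Y = (\<lambda>ls. \<Sum>\<^sub>\<infinity>bs\<in>lists onb.
     gmul (\<lambda>as. X as (rev (map invol bs))) (\<lambda>as. Y as bs) ls)"

definition sinner :: "('l::involutive_hilbert_space, 'h::super_hilbert_space) stensor \<Rightarrow>
    ('l, 'h) stensor \<Rightarrow> 'l tensor" where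
  "sinner X Y = sform (sstar X) Y"

text \<open>The operations have the expected values on elementary tensors.\<close>

lemma tstar_tens: "tstar (tens fs) = tens (rev (map invol fs))"
proof
  fix gs :: "'a list"
  show "tstar (tens fs) gs = tens (rev (map invol fs)) gs"
  proof (cases "length gs = length fs")
    case True
    let ?n = "length fs"
    have c: "cnj (cinner (invol x) y) = cinner x (invol y)" for x y :: 'a
      by (metis cinner_invol invol_invol)
    have "tstar (tens fs) gs = (\<Prod>i<?n. cinner (rev gs ! i) (invol (fs ! i)))"
      using True by (auto simp: tstar_def tens_def rev_map c intro!: prod.cong simp flip: c)
    also have "\<dots> = (\<Prod>i<?n. cinner (rev gs ! (?n - Suc i)) (invol (fs ! (?n - Suc i))))"
      by (rule prod.nat_diff_reindex [symmetric])
    also have "\<dots> = tens (rev (map invol fs)) gs"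
      using True by (auto simp: tens_def rev_nth intro!: prod.cong)
    finally show ?thesis .
  qed (simp add: tstar_def tens_def)
qed

lemma sform_tprod: "sform (tprod l F) (tprod m G) = (\<lambda>ls. gmul l m ls * tform F G)"
proof
  fix ls
  have "gmul (\<lambda>as. l as * a) (\<lambda>as. m as * b) ls = gmul l m ls * (a * b)" for a b
    by (simp add: gmul_def alt_def sum_distrib_right sum_distrib_left sum_divide_distrib mult_ac)
  moreover have "cnj (tstar F bs) = F (rev (map invol bs))" for bs
    by (simp add: tstar_def)
  ultimately show "sform (tprod l F) (tprod m G) ls = gmul l m ls * tform F G"
    by (simp add: sform_def tprod_def tform_def tinner_def infsum_cmult_right')
qed

lemma supersym_cmult: "supersym (\<lambda>gs. c * F gs) hs = c * supersym F hs"
  by (simp add: supersym_def sum_list_const_mult [symmetric] sum_distrib_left mult_ac)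

lemma alt_cmult: "alt (\<lambda>gs. F gs * c) hs = alt F hs * c"
  by (simp add: alt_def sum_distrib_right sum_distrib_left mult_ac)

lemma smul_tprod: "smul (tprod l F) (tprod m G) = tprod (gmul l m) (fmul F G)"
proof (intro ext)
  fix ls hs
  let ?w = "grade_weight"
  let ?a = "\<lambda>ls'. \<Sum>p\<le>length ls'. ?w (length ls') p * (l (take p ls') * m (drop p ls'))"
  let ?b = "\<lambda>hs'. \<Sum>q\<le>length hs'. ?w (length hs') q * (F (take q hs') * G (drop q hs'))"
  have "smul (tprod l F) (tprod m G) ls hs = alt (\<lambda>ls'. supersym (\<lambda>hs'. ?a ls' * ?b hs') hs) ls"
    unfolding smul_def tprod_def sum_product by (simp only: mult_ac)
  then show "smul (tprod l F) (tprod m G) ls hs = tprod (gmul l m) (fmul F G) ls hs"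
    by (simp add: supersym_cmult alt_cmult tprod_def gmul_def fmul_def)
qed

text \<open>\<open>lam_tensor d V\<close> is the Hilbert tensor product of the part of \<open>\<Lambda>\<close> of parity \<open>d mod 2\<close> with
  the closed subspace \<open>V\<close> of the one-particle space.\<close>

definition lam_tensor :: "nat \<Rightarrow> 'h::super_hilbert_space set \<Rightarrow>
    ('l::involutive_hilbert_space, 'h) stensor set" where
  "lam_tensor d V = {X \<in> SLam.
     (\<forall>ls hs. X ls hs \<noteq> 0 \<longrightarrow> length hs = 1 \<and> length ls mod 2 = d mod 2) \<and>
     (\<forall>ls g. (\<forall>v\<in>V. cinner g v = 0) \<longrightarrow> X ls [g] = 0)}"

definition ELam :: "('l::involutive_hilbert_space, 'h::super_hilbert_space) stensor set" where
  "ELam = {x + y | x y. x \<in> lam_tensor 0 E0 \<and> y \<in> lam_tensor 1 E1}"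

primrec spow :: "('l::involutive_hilbert_space, 'h::super_hilbert_space) stensor \<Rightarrow> nat \<Rightarrow>
    ('l, 'h) stensor" where
  "spow z 0 = tprod (tens []) (tens [])"
| "spow z (Suc n) = smul z (spow z n)"

text \<open>The series is evaluated pointwise; as \<open>z\<^sup>p\<close> lives in degree \<open>p\<close> of the Fock space for \<open>z\<close> in
  the one-particle space, at each argument only one term contributes.\<close>

definition sexp :: "('l::involutive_hilbert_space, 'h::super_hilbert_space) stensor \<Rightarrow>
    ('l, 'h) stensor" where
  "sexp z = (\<lambda>ls hs. \<Sum>p. spow z p ls hs / fact p)"

text \<open>The \<open>\<Lambda>\<close>-linear extension of \<open>jmap\<close>; note that \<open>jmap\<close> is self-adjoint.\<close>

definition jext :: "('l::involutive_hilbert_space, 'h::super_hilbert_space) stensor \<Rightarrow>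
    ('l, 'h) stensor" where
  "jext z = (\<lambda>ls hs. z ls (map jmap hs))"

definition phi :: "('l::involutive_hilbert_space, 'h::super_hilbert_space) stensor \<Rightarrow>
    ('l, 'h) stensor \<Rightarrow> ('l, 'h) stensor \<Rightarrow> 'l tensor" where
  "phi X x y = sform (sexp (x + y)) X"


section \<open>The Gaussian supermeasure\<close>

definition is_gauss_functional :: "('h::super_hilbert_space tensor \<Rightarrow> complex) \<Rightarrow> bool" where
  "is_gauss_functional L \<longleftrightarrow>
     (\<forall>F\<in>Sfin. \<forall>G\<in>Sfin. L (F + G) = L F + L G) \<and>
     (\<forall>c. \<forall>F\<in>Sfin. L (\<lambda>gs. c * F gs) = c * L F) \<and>
     L (tens []) = 1 \<and>
     (\<forall>fs. set fs \<subseteq> H0 \<union> H1 \<and> odd (length fs) \<longrightarrow> L (fprod fs) = 0) \<and>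
     (\<forall>fs n. set fs \<subseteq> H0 \<union> H1 \<and> length fs = 2 * n \<longrightarrow>
        L (fprod fs) = (\<Sum>s | s permutes {..<2 * n}.
           chi s fs * (\<Prod>k<n. omega (fs ! s (2 * k)) (fs ! s (2 * k + 1)))) / (2 ^ n * fact n))"

text \<open>These conditions determine the functional on \<open>Sfin\<close>.\<close>

definition gauss_functional :: "'h::super_hilbert_space tensor \<Rightarrow> complex" where
  "gauss_functional = (SOME L. is_gauss_functional L)"

text \<open>The extension \<open>l \<otimes> F \<mapsto> l L(F)\<close> to \<open>SfinLam\<close>: apply \<open>L\<close> for fixed Grassmann argument.\<close>

definition gauss_functional_ext :: "('l::involutive_hilbert_space, 'h::super_hilbert_space) stensor \<Rightarrow>
    'l tensor" where
  "gauss_functional_ext X = (\<lambda>ls. gauss_functional (X ls))"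

definition represents :: "('l::involutive_hilbert_space, 'h::super_hilbert_space) stensor \<Rightarrow>
    (('l, 'h) stensor \<Rightarrow> 'l tensor) \<Rightarrow> bool" where
  "represents X f \<longleftrightarrow> X \<in> SfinLam \<and> (\<forall>x\<in>ELam. f x = phi X x (sstar x))"

definition gauss_integrable :: "(('l::involutive_hilbert_space, 'h::super_hilbert_space) stensor \<Rightarrow>
    'l tensor) \<Rightarrow> bool" where
  "gauss_integrable f \<longleftrightarrow> (\<exists>X. represents X f)"

definition gauss_integral :: "(('l::involutive_hilbert_space, 'h::super_hilbert_space) stensor \<Rightarrow>
    'l tensor) \<Rightarrow> 'l tensor" where
  "gauss_integral f = gauss_functional_ext (THE X. represents X f)"

end

theory Submission
  imports Defs
begin

text \<open>
  Both sides are biadditive, so one may take \<open>X\<close> and \<open>Y\<close> to be products \<open>M as bs\<close>, \<open>M' cs ds\<close> with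
  \<open>as, cs \<subseteq> E\<^sup>*\<close>, \<open>bs, ds \<subseteq> E\<close>. Then \<open>\<langle>exp z | M f\<^sub>1 \<dots> f\<^sub>n\<rangle>\<close> is the product of the Grassmann numbers
  \<open>\<langle>z | f\<^sub>i\<rangle>\<close>, so after supercommuting factors the integrand splits into a monomial \<open>cs as\<^sup>*\<close> in \<open>\<xi>\<close> and
  a monomial \<open>ds bs\<^sup>*\<close> in \<open>\<eta>\<close>. Wick's formula for such a monomial is a superdeterminant, which is
  the inner product of \<open>as\<close> with \<open>cs\<close> and of \<open>bs\<close> with \<open>ds\<close>, respectively; the sign produced by \<open>j\<close>
  in the integrand cancels the one in \<open>\<omega>\<close>, and the commutation signs vanish unless the integral does.

  The integral is well defined because a function \<open>\<phi>\<^sub>X(\<xi>, \<xi>\<^sup>*)\<close> determines \<open>X\<close>: inserting a point \<open>\<xi>\<close>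
  built from sufficiently many independent Grassmann generators isolates each component of \<open>X\<close>.
\<close>

section \<open>Signed sums over permutations\<close>

text \<open>The integral is defined by a definite description and the form by \<open>infsum\<close>;
  both return default values when uniqueness or convergence fails. The additive arguments therefore
  run on relations (\<open>phi_sums\<close>, \<open>sinner_sums\<close>,
  \<open>has_gauss_integral\<close>, \<open>has_double_integral\<close>) that combine existence with
  the value and are turned into equations only at the end.

  For uniqueness the obstacle is that a real point contains each generator together with its
  conjugate. The generators are therefore chosen orthogonal to their own conjugates, and the
  infinite dimension of the generating space provides them.

  With the \<open>E\<^sup>*\<close> factors sorted to the front, the monomial in \<xi> reads
  \<open>cs @ rev (map invol as)\<close>, and this nesting is what makes Wick's formula a
  superdeterminant with no extra sign. A nonzero superdeterminant matches odd vectors with odd ones,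
  so the monomial then has an even number of odd factors; hence the commutation signs disappear.

  The Gaussian functional is selected by its defining conditions, so one that satisfies them must be
  constructed; otherwise its values would be unknown.\<close>

definition koszul :: "('a \<Rightarrow> bool) \<Rightarrow> 'a \<Rightarrow> 'a \<Rightarrow> complex" where
  "koszul P x y = (if P x \<and> P y then -1 else 1)"

text \<open>The sign \<open>chi\<close> with parity abstracted to a predicate: for the constantly
  true predicate it is the ordinary sign of a permutation, so one development serves both
  \<open>alt\<close> and \<open>supersym\<close>.\<close>

definition perm_koszul :: "('a \<Rightarrow> bool) \<Rightarrow> (nat \<Rightarrow> nat) \<Rightarrow> 'a list \<Rightarrow> complex" where
  "perm_koszul P s xs =
     (-1) ^ card {(i, j). i < j \<and> j < length xs \<and> s i > s j \<and> P (xs ! s i) \<and> P (xs ! s j)}"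

definition perm_sum :: "('a \<Rightarrow> bool) \<Rightarrow> ('a list \<Rightarrow> complex) \<Rightarrow> 'a list \<Rightarrow> complex" where
  "perm_sum P G xs =
     (\<Sum>s | s permutes {..<length xs}. perm_koszul P s xs * G (permute_list s xs))"

text \<open>The sum over all ways of pulling one entry to the front, with the sign of doing so.\<close>

primrec pull_sum :: "('a \<Rightarrow> bool) \<Rightarrow> ('a \<Rightarrow> 'a list \<Rightarrow> complex) \<Rightarrow> 'a list \<Rightarrow> complex" where
  "pull_sum P G [] = 0"
| "pull_sum P G (x # xs) = G x xs + pull_sum P (\<lambda>y r. koszul P y x * G y (x # r)) xs"

lemma koszul_commute: "koszul P x y = koszul P y x"
  by (auto simp: koszul_def)

lemma koszul_self [simp]: "koszul P x y * koszul P x y = 1"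
  "koszul P x y * (koszul P x y * z) = z"
  "koszul P x y * koszul P y x = 1"
  "koszul P x y * (koszul P y x * z) = z"
  by (auto simp: koszul_def)

text \<open>Factors equal to 1 for the other pairs turn the cardinality into a product over all
  pairs, which can be reindexed and split.\<close>

lemma perm_koszul_alt:
  "perm_koszul P s xs = (\<Prod>(i, j) | i < j \<and> j < length xs.
     if s i > s j \<and> P (xs ! s i) \<and> P (xs ! s j) then -1 else 1)"
proof -
  have fin: "finite {(i, j). i < j \<and> j < length xs}"
    by (rule finite_subset[of _ "{..<length xs} \<times> {..<length xs}"]) auto
  have "(\<Prod>(i, j) | i < j \<and> j < length xs.
     if s i > s j \<and> P (xs ! s i) \<and> P (xs ! s j) then -1 else 1 :: complex)
    = (\<Prod>p\<in>{(i, j). i < j \<and> j < length xs \<and> s i > s j \<and> P (xs ! s i) \<and> P (xs ! s j)}. -1)"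
    by (rule prod.mono_neutral_cong_right[OF fin]) (auto split: if_splits)
  then show ?thesis by (simp add: perm_koszul_def)
qed

lemma perm_koszul_square [simp]: "perm_koszul P s xs * perm_koszul P s xs = 1"
  "perm_koszul P s xs * (perm_koszul P s xs * z) = z"
  by (auto simp: perm_koszul_def simp flip: power_add mult.assoc mult_2)

text \<open>The cocycle identity. A pair is inverted by \<open>s \<circ> t\<close> exactly when one
  but not both of the following holds: \<open>t\<close> inverts it, or \<open>s\<close> inverts its
  image under \<open>t\<close>. The two entries tested for parity are the same in all three
  signs.\<close>

lemma perm_koszul_comp:
  assumes s: "s permutes {..<length xs}" and t: "t permutes {..<length xs}"
  shows "perm_koszul P (s \<circ> t) xs = perm_koszul P s xs * perm_koszul P t (permute_list s xs)"
proof -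
  let ?n = "length xs" let ?I = "{(i, j). i < j \<and> j < length xs}"
  define q where "q i = P (xs ! i)" for i
  \<comment> \<open>Inversion expressed as disagreement of two orders makes the factor symmetric in
    \<open>i\<close> and \<open>j\<close>; it then lives on unordered pairs and can be reindexed by
    \<open>t\<close>.\<close>
  define H where "H s i j = (if ((i < j) \<noteq> (s i < s j)) \<and> q (s i) \<and> q (s j) then -1 else 1 :: complex)"
    for s :: "nat \<Rightarrow> nat" and i j
  have inj: "i < ?n \<Longrightarrow> j < ?n \<Longrightarrow> t i = t j \<longleftrightarrow> i = j"
    "s i = s j \<longleftrightarrow> i = j" "t i = t j \<longleftrightarrow> i = j" for i j
    using permutes_inj[OF t] permutes_inj[OF s] by (auto dest: injD)
  have lt: "t i < ?n \<longleftrightarrow> i < ?n" for i using permutes_in_image[OF t] by auto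
  have it: "inv t permutes {..<?n}" by (rule permutes_inv[OF t])
  have lti: "inv t i < ?n \<longleftrightarrow> i < ?n" for i using permutes_in_image[OF it] by auto
  have A: "perm_koszul P s xs = (\<Prod>(i,j)\<in>?I. H s i j)"
    unfolding perm_koszul_alt
    by (rule prod.cong) (auto simp: H_def q_def not_less_iff_gr_or_eq inj)
  have B: "perm_koszul P (s \<circ> t) xs = (\<Prod>(i,j)\<in>?I. H (s \<circ> t) i j)"
    unfolding perm_koszul_alt
    by (rule prod.cong) (auto simp: H_def q_def not_less_iff_gr_or_eq inj)
  have C: "perm_koszul P t (permute_list s xs) =
     (\<Prod>(i,j)\<in>?I. if ((i < j) \<noteq> (t i < t j)) \<and> q (s (t i)) \<and> q (s (t j)) then -1 else 1)"
    unfolding perm_koszul_alt length_permute_list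
  proof (rule prod.cong[OF refl], clarify)
    fix i j assume ij: "i < j" "j < ?n"
    then have "(i < j) \<noteq> (t i < t j) \<longleftrightarrow> t j < t i"
      using inj(3)[of i j] by linarith
    with ij show "(if t j < t i \<and> P (permute_list s xs ! t i) \<and> P (permute_list s xs ! t j) then - 1 else 1) =
      (if (i < j) \<noteq> (t i < t j) \<and> q (s (t i)) \<and> q (s (t j)) then - 1 else 1 :: complex)"
      using lt by (simp add: permute_list_nth[OF s] q_def)
  qed
  have sy: "H s i j = H s j i" for i j
    by (auto simp: H_def inj not_less_iff_gr_or_eq)
  have mm: "H s (min a b) (max a b) = H s a b" for a b :: nat
    using sy[of a b] by (simp add: min_def max_def)
  \<comment> \<open>\<open>mp u\<close> takes an unordered pair, stored in increasing order, to its
    image under \<open>u\<close>, again in increasing order.\<close>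
  define mp where "mp u = (\<lambda>p::nat\<times>nat. (min (u (fst p)) (u (snd p) :: nat), max (u (fst p)) (u (snd p))))" for u
  have mpI: "mp u p \<in> ?I" if "p \<in> ?I" "inj u" "\<And>i. u i < ?n \<longleftrightarrow> i < ?n" for u p
  proof -
    obtain i j where p: "p = (i, j)" "i < j" "j < ?n" using \<open>p \<in> ?I\<close> by auto
    then have "u i \<noteq> u j" using \<open>inj u\<close> by (simp add: inj_eq)
    moreover have "u i < ?n" "u j < ?n" using p that(3) by auto
    ultimately show ?thesis by (auto simp: mp_def p(1) min_def max_def)
  qed
  have mpi: "mp v (mp u p) = p" if "p \<in> ?I" "\<And>i. v (u i) = i" for u v p
    using that by (auto simp: mp_def min_def max_def)
  have D: "(\<Prod>(i,j)\<in>?I. H s i j) = (\<Prod>(i,j)\<in>?I. H s (t i) (t j))"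
  proof (rule sym, rule prod.reindex_bij_witness[of _ "mp (inv t)" "mp t"])
    show "mp (inv t) (mp t p) = p" if "p \<in> ?I" for p
      by (rule mpi[OF that]) (simp add: permutes_inverses(2)[OF t])
    show "mp t (mp (inv t) p) = p" if "p \<in> ?I" for p
      by (rule mpi[OF that]) (simp add: permutes_inverses(1)[OF t])
    show "mp t p \<in> ?I" if "p \<in> ?I" for p
      by (rule mpI[OF that permutes_inj[OF t] lt])
    show "mp (inv t) p \<in> ?I" if "p \<in> ?I" for p
      by (rule mpI[OF that permutes_inj[OF it] lti])
    show "(case mp t p of (i, j) \<Rightarrow> H s i j) = (case p of (i, j) \<Rightarrow> H s (t i) (t j))" for p
      by (simp add: mp_def mm split_def)
  qed
  show ?thesis
    unfolding A B C D prod.distrib[symmetric]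
    by (rule prod.cong) (auto simp: H_def)
qed

lemma perm_sum_permute:
  assumes t: "t permutes {..<length xs}"
  shows "perm_sum P G (permute_list t xs) = perm_koszul P t xs * perm_sum P G xs"
proof -
  have "perm_sum P G xs =
      (\<Sum>s | s permutes {..<length xs}. perm_koszul P (t \<circ> s) xs * G (permute_list (t \<circ> s) xs))"
    unfolding perm_sum_def by (rule setum_permutations_compose_left[OF t])
  also have "\<dots> = perm_koszul P t xs * perm_sum P G (permute_list t xs)"
    by (simp add: perm_sum_def sum_distrib_left perm_koszul_comp[OF t] permute_list_compose mult.assoc)
  finally show ?thesis by simp
qed

text \<open>The counterpart of \<open>perm_sum_permute\<close> with \<open>t\<close> acting on the
  function instead of the list: the sum is reindexed by composition on the right, and the cocycle
  identity absorbs the sign.\<close>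

lemma perm_sum_twist:
  assumes t: "t permutes {..<length xs}"
  shows "perm_sum P (\<lambda>ys. perm_koszul P t ys * G (permute_list t ys)) xs = perm_sum P G xs"
proof -
  have "perm_sum P G xs =
      (\<Sum>s | s permutes {..<length xs}. perm_koszul P (s \<circ> t) xs * G (permute_list (s \<circ> t) xs))"
    unfolding perm_sum_def by (rule sum_permutations_compose_right[OF t])
  also have "\<dots> = perm_sum P (\<lambda>ys. perm_koszul P t ys * G (permute_list t ys)) xs"
    unfolding perm_sum_def
    by (intro sum.cong) (simp_all add: perm_koszul_comp[OF _ t] permute_list_compose[OF t] mult.assoc)
  finally show ?thesis by simp
qed

lemma perm_sum_cong:
  assumes "\<And>ys. mset ys = mset xs \<Longrightarrow> G ys = H ys"
  shows "perm_sum P G xs = perm_sum P H xs"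
  unfolding perm_sum_def by (intro sum.cong) (auto intro!: assms)

lemma perm_sum_cmult: "perm_sum P (\<lambda>ys. c * G ys) xs = c * perm_sum P G xs"
  by (simp add: perm_sum_def sum_distrib_left mult_ac)

lemma perm_sum_add: "perm_sum P (\<lambda>ys. G ys + H ys) xs = perm_sum P G xs + perm_sum P H xs"
  by (simp add: perm_sum_def sum.distrib algebra_simps)

lemma perm_sum_sum: "perm_sum P (\<lambda>ys. \<Sum>i\<in>I. G i ys) xs = (\<Sum>i\<in>I. perm_sum P (G i) xs)"
  unfolding perm_sum_def by (simp add: sum_distrib_left) (rule sum.swap)

lemma perm_sum_Nil [simp]: "perm_sum P G [] = G []"
  by (simp add: perm_sum_def perm_koszul_def)

section \<open>Signed sums over tensor products of two functions\<close>

definition shift_perm :: "nat \<Rightarrow> (nat \<Rightarrow> nat) \<Rightarrow> nat \<Rightarrow> nat" where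
  "shift_perm p t i = (if i < p then i else p + t (i - p))"

lemma shift_perm_permutes:
  assumes "t permutes {..<n}"
  shows "shift_perm p t permutes {..<p + n}"
proof (rule bij_imp_permutes)
  have "inj_on (shift_perm p t) {..<p + n}"
    by (rule inj_onI) (auto simp: shift_perm_def inj_eq[OF permutes_inj[OF assms]] split: if_splits)
  moreover have "shift_perm p t ` {..<p + n} \<subseteq> {..<p + n}"
  proof (intro image_subsetI)
    fix i assume i: "i \<in> {..<p + n}"
    have "t (i - p) < n \<longleftrightarrow> i - p < n" using permutes_in_image[OF assms, of "i - p"] by simp
    then show "shift_perm p t i \<in> {..<p + n}" using i by (auto simp: shift_perm_def)
  qed
  ultimately show "bij_betw (shift_perm p t) {..<p + n} {..<p + n}"
    by (simp add: bij_betw_def endo_inj_surj)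
  fix i assume i: "i \<notin> {..<p + n}"
  then have "t (i - p) = i - p" using permutes_not_in[OF assms, of "i - p"] by simp
  then show "shift_perm p t i = i" using i by (simp add: shift_perm_def)
qed

lemma permute_list_shift_perm:
  assumes "t permutes {..<length vs}"
  shows "permute_list (shift_perm (length us) t) (us @ vs) = us @ permute_list t vs"
proof (rule nth_equalityI)
  fix i assume "i < length (permute_list (shift_perm (length us) t) (us @ vs))"
  then have i: "i < length us + length vs" by simp
  show "permute_list (shift_perm (length us) t) (us @ vs) ! i = (us @ permute_list t vs) ! i"
  proof (cases "i < length us")
    case False
    with i have "i - length us < length vs" by simp
    with False i show ?thesis by (simp add: permute_list_def shift_perm_def nth_append)
  qed (use i in \<open>simp add: permute_list_def shift_perm_def nth_append\<close>)
qed simp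

lemma perm_koszul_shift_perm:
  assumes "t permutes {..<length vs}"
  shows "perm_koszul P (shift_perm (length us) t) (us @ vs) = perm_koszul P t vs"
proof -
  let ?p = "length us" let ?t = "shift_perm ?p t"
  have "{(i, j). i < j \<and> j < length (us @ vs) \<and> ?t i > ?t j \<and> P ((us @ vs) ! ?t i) \<and> P ((us @ vs) ! ?t j)}
    = (\<lambda>(i, j). (?p + i, ?p + j)) ` {(i, j). i < j \<and> j < length vs \<and> t i > t j \<and> P (vs ! t i) \<and> P (vs ! t j)}"
    (is "?A = ?f ` ?B")
  proof (intro set_eqI iffI)
    fix x assume "x \<in> ?A"
    then obtain i j where x: "x = (i, j)" and *: "i < j" "j < length (us @ vs)" "?t i > ?t j"
      "P ((us @ vs) ! ?t i)" "P ((us @ vs) ! ?t j)" by auto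
    then have i: "i \<ge> ?p" by (auto simp: shift_perm_def split: if_splits)
    with * have "x = ?f (i - ?p, j - ?p)" "(i - ?p, j - ?p) \<in> ?B"
      by (auto simp: x shift_perm_def)
    then show "x \<in> ?f ` ?B" by blast
  qed (auto simp: shift_perm_def)
  moreover have "inj_on ?f ?B" by (auto simp: inj_on_def)
  ultimately show ?thesis by (simp add: perm_koszul_def card_image)
qed

lemma permute_list_append:
  assumes "t permutes {..<length us}"
  shows "permute_list t (us @ vs) = permute_list t us @ vs"
proof (rule nth_equalityI)
  fix i assume "i < length (permute_list t (us @ vs))"
  then show "permute_list t (us @ vs) ! i = (permute_list t us @ vs) ! i"
    using permutes_in_image[OF assms, of i] permutes_not_in[OF assms, of i]
    by (cases "i < length us") (simp_all add: permute_list_def nth_append)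
qed simp

lemma perm_koszul_append:
  assumes "t permutes {..<length us}"
  shows "perm_koszul P t (us @ vs) = perm_koszul P t us"
proof -
  have 1: "t i < length us" if "i < length us" for i using that permutes_in_image[OF assms] by auto
  have 2: "t i = i" if "\<not> i < length us" for i using that permutes_not_in[OF assms] by auto
  have "{(i, j). i < j \<and> j < length (us @ vs) \<and> t i > t j \<and> P ((us @ vs) ! t i) \<and> P ((us @ vs) ! t j)}
    = {(i, j). i < j \<and> j < length us \<and> t i > t j \<and> P (us ! t i) \<and> P (us ! t j)}" (is "?A = ?B")
  proof (intro set_eqI)
    fix x :: "nat \<times> nat"
    obtain i j where x: "x = (i, j)" by force
    show "x \<in> ?A \<longleftrightarrow> x \<in> ?B"
      using 1[of i] 1[of j] 2[of i] 2[of j]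
      by (cases "i < length us"; cases "j < length us") (auto simp: x nth_append)
  qed
  then show ?thesis by (simp add: perm_koszul_def)
qed

text \<open>Each permutation of the last entries is one of the whole list and is absorbed by
  \<open>perm_sum_twist\<close>, so only their number remains. This underlies the associativity of
  \<open>gmul\<close>.\<close>

lemma perm_sum_tensor_right:
  assumes p: "p \<le> length xs"
  shows "perm_sum P (\<lambda>ys. F (take p ys) * perm_sum P G (drop p ys)) xs =
    fact (length xs - p) * perm_sum P (\<lambda>ys. F (take p ys) * G (drop p ys)) xs"
proof -
  let ?H = "\<lambda>ys. F (take p ys) * G (drop p ys)"
  let ?S = "{t. t permutes {..<length xs - p}}"
  have "perm_sum P (\<lambda>ys. F (take p ys) * perm_sum P G (drop p ys)) xs =
    perm_sum P (\<lambda>ys. \<Sum>t\<in>?S. perm_koszul P (shift_perm p t) ys * ?H (permute_list (shift_perm p t) ys)) xs"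
  proof (rule perm_sum_cong)
    fix ys assume "mset ys = mset xs"
    then have l: "length ys = length xs" by (metis size_mset)
    define us vs where uv: "us = take p ys" "vs = drop p ys"
    then have ys: "ys = us @ vs" and p': "p = length us" and lv: "length xs - p = length vs"
      using p l by auto
    show "F (take p ys) * perm_sum P G (drop p ys) = 
      (\<Sum>t\<in>?S. perm_koszul P (shift_perm p t) ys * ?H (permute_list (shift_perm p t) ys))"
      unfolding lv unfolding p' ys perm_sum_def
      by (simp add: perm_koszul_shift_perm permute_list_shift_perm sum_distrib_left mult_ac)
  qed
  also have "\<dots> = (\<Sum>t\<in>?S. perm_sum P ?H xs)"
    unfolding perm_sum_sum
    by (intro sum.cong refl perm_sum_twist) (use p shift_perm_permutes[of _ "length xs - p" p] in auto)
  finally show ?thesis by (simp add: card_permutations[OF refl])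
qed

lemma perm_sum_tensor_left:
  assumes p: "p \<le> length xs"
  shows "perm_sum P (\<lambda>ys. perm_sum P F (take p ys) * G (drop p ys)) xs =
    fact p * perm_sum P (\<lambda>ys. F (take p ys) * G (drop p ys)) xs"
proof -
  let ?H = "\<lambda>ys. F (take p ys) * G (drop p ys)"
  let ?S = "{t. t permutes {..<p}}"
  have "perm_sum P (\<lambda>ys. perm_sum P F (take p ys) * G (drop p ys)) xs =
    perm_sum P (\<lambda>ys. \<Sum>t\<in>?S. perm_koszul P t ys * ?H (permute_list t ys)) xs"
  proof (rule perm_sum_cong)
    fix ys assume "mset ys = mset xs"
    then have l: "length ys = length xs" by (metis size_mset)
    define us vs where uv: "us = take p ys" "vs = drop p ys"
    then have ys: "ys = us @ vs" and p': "p = length us"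
      using p l by auto
    show "perm_sum P F (take p ys) * G (drop p ys) = 
      (\<Sum>t\<in>?S. perm_koszul P t ys * ?H (permute_list t ys))"
      unfolding p' ys perm_sum_def
      by (simp add: perm_koszul_append permute_list_append sum_distrib_right sum_distrib_left mult_ac)
  qed
  also have "\<dots> = (\<Sum>t\<in>?S. perm_sum P ?H xs)"
    unfolding perm_sum_sum
    by (intro sum.cong refl perm_sum_twist) (use p in \<open>auto intro: permutes_subset\<close>)
  finally show ?thesis by (simp add: card_permutations[OF refl])
qed

lemma perm_sum_perm_sum: "perm_sum P (perm_sum P G) xs = fact (length xs) * perm_sum P G xs"
  using perm_sum_tensor_right[of 0 xs P "\<lambda>_. 1" G] by simp

text \<open>Rotating one block past the other inverts exactly the pairs across the two blocks, and
  all of them count because every entry is odd. Graded commutativity of the Grassmann algebra rests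
  on this.\<close>

lemma perm_sum_append_commute:
  assumes p: "p \<le> length xs" and P: "\<And>x. x \<in> set xs \<Longrightarrow> P x"
  shows "perm_sum P (\<lambda>ys. F (take p ys) * G (drop p ys)) xs =
    (-1) ^ (p * (length xs - p)) *
    perm_sum P (\<lambda>ys. G (take (length xs - p) ys) * F (drop (length xs - p) ys)) xs"
proof -
  define n q where "n = length xs" and "q = n - p"
  have pq: "n = p + q" "q \<le> n" "n - q = p" using p by (auto simp: q_def n_def)
  define t where "t i = (if i < q then p + i else if i < n then i - q else i)" for i
  have t: "t permutes {..<n}"
  proof (rule bij_imp_permutes)
    have "inj_on t {..<n}" by (auto simp: inj_on_def t_def pq split: if_splits)
    moreover have "t ` {..<n} \<subseteq> {..<n}" by (auto simp: t_def pq)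
    ultimately show "bij_betw t {..<n} {..<n}" by (simp add: bij_betw_def endo_inj_surj)
  qed (auto simp: t_def pq)
  have k: "perm_koszul P t ys = (-1) ^ (p * q)" and r: "permute_list t ys = drop p ys @ take p ys"
    if "mset ys = mset xs" for ys
  proof -
    have l: "length ys = n" using that unfolding n_def by (metis size_mset)
    have P': "P (ys ! i)" if "i < n" for i
      using that l \<open>mset ys = mset xs\<close> P by (metis mset_eq_setD nth_mem)
    have tn: "t i < n \<longleftrightarrow> i < n" for i using permutes_in_image[OF t] by auto
    have "{(i, j). i < j \<and> j < length ys \<and> t i > t j \<and> P (ys ! t i) \<and> P (ys ! t j)}
      = {(i, j). i < j \<and> j < n \<and> t i > t j}"
      using P' by (auto simp: l tn)
    also have "\<dots> = {..<q} \<times> {q..<n}"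
      by (auto simp: t_def pq split: if_splits)
    finally show "perm_koszul P t ys = (-1) ^ (p * q)"
      by (simp add: perm_koszul_def pq mult.commute)
    show "permute_list t ys = drop p ys @ take p ys"
      by (rule nth_equalityI) (auto simp: permute_list_def l t_def nth_append pq)
  qed
  have "perm_sum P (\<lambda>ys. G (take q ys) * F (drop q ys)) xs =
    perm_sum P (\<lambda>ys. perm_koszul P t ys * (\<lambda>ys. G (take q ys) * F (drop q ys)) (permute_list t ys)) xs"
    by (rule perm_sum_twist[symmetric]) (use t n_def in simp)
  also have "\<dots> = perm_sum P (\<lambda>ys. (-1) ^ (p * q) * (F (take p ys) * G (drop p ys))) xs"
  proof (rule perm_sum_cong)
    fix ys assume m: "mset ys = mset xs"
    then have l: "length ys = n" unfolding n_def by (metis size_mset)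
    show "perm_koszul P t ys * (\<lambda>ys. G (take q ys) * F (drop q ys)) (permute_list t ys) =
      (-1) ^ (p * q) * (F (take p ys) * G (drop p ys))"
      by (simp add: k[OF m] r[OF m] l pq)
  qed
  finally show ?thesis
    by (simp add: perm_sum_cmult n_def[symmetric] q_def[symmetric])
qed

lemma perm_sum_swap:
  "perm_sum P G (us @ x # y # vs) = koszul P x y * perm_sum P G (us @ y # x # vs)"
proof -
  let ?k = "length us" let ?xs = "us @ y # x # vs"
  let ?t = "Transposition.transpose ?k (Suc ?k)"
  have t: "?t permutes {..<length ?xs}"
    by (rule permutes_swap_id) auto
  have "permute_list ?t ?xs = us @ x # y # vs"
  proof (rule nth_equalityI)
    fix i assume "i < length (permute_list ?t ?xs)"
    then have i: "i < length ?xs" by simp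
    have "i < ?k \<or> i = ?k \<or> i = Suc ?k \<or> (\<exists>j. i = Suc (Suc (?k + j)))"
      by (metis less_iff_Suc_add linorder_neqE_nat not_less_eq add_Suc)
    then show "permute_list ?t ?xs ! i = (us @ x # y # vs) ! i"
      using i by (auto simp: permute_list_nth[OF t] nth_append Transposition.transpose_def)
  qed simp
  moreover have "perm_koszul P ?t ?xs = koszul P x y"
  proof -
    have "i < j \<and> ?t i > ?t j \<longleftrightarrow> i = ?k \<and> j = Suc ?k" for i j
      unfolding Transposition.transpose_def by (auto split: if_split_asm)
    then have "{(i, j). i < j \<and> j < length ?xs \<and> ?t i > ?t j \<and> P (?xs ! ?t i) \<and> P (?xs ! ?t j)}
      = {(i, j). (i = ?k \<and> j = Suc ?k) \<and> j < length ?xs \<and> P (?xs ! ?t i) \<and> P (?xs ! ?t j)}"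
      by (metis (lifting))
    also have "\<dots> = (if P x \<and> P y then {(?k, Suc ?k)} else {})"
      by (auto simp: nth_append)
    finally have "{(i, j). i < j \<and> j < length ?xs \<and> ?t i > ?t j \<and> P (?xs ! ?t i) \<and> P (?xs ! ?t j)}
      = (if P x \<and> P y then {(?k, Suc ?k)} else {})" .
    then show ?thesis by (simp add: perm_koszul_def koszul_def)
  qed
  ultimately show ?thesis using perm_sum_permute[OF t, of P G] by simp
qed

section \<open>Expansion along the first slot\<close>

lemma pull_sum_sum:
  "pull_sum P G xs = (\<Sum>k<length xs. (\<Prod>i<k. koszul P (xs ! k) (xs ! i)) *
     G (xs ! k) (take k xs @ drop (Suc k) xs))"
proof (induction xs arbitrary: G)
  case (Cons x xs)
  show ?case
    by (simp add: Cons.IH sum.lessThan_Suc_shift prod.lessThan_Suc_shift mult_ac del: sum.lessThan_Suc prod.lessThan_Suc)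
qed simp

definition front_perm :: "nat \<Rightarrow> nat \<Rightarrow> nat" where
  "front_perm k i = (if i = 0 then k else if i \<le> k then i - 1 else i)"

lemma front_perm_permutes:
  assumes "k < n"
  shows "front_perm k permutes {..<n}"
proof (rule bij_imp_permutes)
  have "inj_on (front_perm k) {..<n}"
    by (auto simp: inj_on_def front_perm_def split: if_splits)
  moreover have "front_perm k ` {..<n} \<subseteq> {..<n}" using assms by (auto simp: front_perm_def)
  ultimately show "bij_betw (front_perm k) {..<n} {..<n}" by (simp add: bij_betw_def endo_inj_surj)
qed (use assms in \<open>auto simp: front_perm_def\<close>)

lemma permute_list_front_perm:
  assumes "k < length xs"
  shows "permute_list (front_perm k) xs = xs ! k # take k xs @ drop (Suc k) xs"
  using assms
  by (intro nth_equalityI) (auto simp: permute_list_def front_perm_def nth_append nth_Cons' min_def)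

lemma perm_koszul_front_perm:
  assumes "k < length xs"
  shows "perm_koszul P (front_perm k) xs = (\<Prod>i<k. koszul P (xs ! k) (xs ! i))"
proof -
  let ?t = "front_perm k"
  have "{(i, j). i < j \<and> j < length xs \<and> ?t i > ?t j \<and> P (xs ! ?t i) \<and> P (xs ! ?t j)}
     = (\<lambda>i. (0, Suc i)) ` {i. i < k \<and> P (xs ! k) \<and> P (xs ! i)}" (is "?A = ?f ` ?B")
  proof (intro set_eqI iffI)
    fix p assume "p \<in> ?A"
    then obtain i j where p: "p = (i, j)" "i < j" "j < length xs" "?t i > ?t j" "P (xs ! ?t i)" "P (xs ! ?t j)"
      by auto
    then have "i = 0" "j \<le> k" by (auto simp: front_perm_def split: if_splits)
    with p have "p = ?f (j - 1)" "j - 1 \<in> ?B" by (auto simp: front_perm_def)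
    then show "p \<in> ?f ` ?B" by blast
  qed (use assms in \<open>auto simp: front_perm_def\<close>)
  moreover have "inj_on ?f ?B" by (auto simp: inj_on_def)
  ultimately have "perm_koszul P ?t xs = (-1) ^ card ?B" by (simp add: perm_koszul_def card_image)
  also have "\<dots> = (\<Prod>i\<in>?B. -1)" by simp
  also have "\<dots> = (\<Prod>i<k. koszul P (xs ! k) (xs ! i))"
    by (rule prod.mono_neutral_cong_left) (auto simp: koszul_def)
  finally show ?thesis .
qed

text \<open>Laplace expansion: a permutation of \<open>Suc n\<close> positions is uniquely a cycle
  bringing some entry to the front followed by a permutation of the remaining ones, and the cocycle
  identity splits its sign accordingly.\<close>

lemma perm_sum_pull:
  assumes "xs \<noteq> []"
  shows "perm_sum P G xs = pull_sum P (\<lambda>y r. perm_sum P (\<lambda>r'. G (y # r')) r) xs"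
proof -
  obtain n where n: "length xs = Suc n" using assms by (cases xs) auto
  let ?A = "{..<Suc n} \<times> {s. s permutes {..<n}}"
  let ?h = "\<lambda>(k, s). front_perm k \<circ> shift_perm 1 s"
  have sp: "shift_perm 1 s permutes {..<Suc n}" if "s permutes {..<n}" for s
    using shift_perm_permutes[OF that, of 1] by simp
  have inj: "inj_on ?h ?A"
  proof (rule inj_onI, clarify)
    fix k s k' s' assume k: "k < Suc n" "k' < Suc n" and eq: "front_perm k \<circ> shift_perm 1 s = front_perm k' \<circ> shift_perm 1 s'"
    from fun_cong[OF eq, of 0] have kk: "k = k'" by (simp add: front_perm_def shift_perm_def)
    have "s i = s' i" for i
      using fun_cong[OF eq, of "Suc i"] inj_eq[OF permutes_inj[OF front_perm_permutes[OF k(1)]]]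
      by (auto simp: kk shift_perm_def)
    then show "k = k' \<and> s = s'" using kk by auto
  qed
  have sub: "?h ` ?A \<subseteq> {s. s permutes {..<Suc n}}"
    using sp front_perm_permutes by (auto intro!: permutes_compose)
  \<comment> \<open>Surjectivity by counting: an injective image of size
    \<open>Suc n * fact n\<close> inside the permutations of \<open>Suc n\<close> points is
    everything.\<close>
  have "card (?h ` ?A) = fact (Suc n)"
    using inj by (simp add: card_image card_cartesian_product card_permutations[OF refl] del: fact_Suc) simp
  then have img: "?h ` ?A = {s. s permutes {..<Suc n}}"
    by (intro card_subset_eq sub finite_permutations) (simp_all add: card_permutations[OF refl])
  have "perm_sum P G xs = (\<Sum>p\<in>?A. perm_koszul P (?h p) xs * G (permute_list (?h p) xs))"
    unfolding perm_sum_def n img[symmetric] by (rule sum.reindex_cong[OF inj refl refl])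
  also have "\<dots> = (\<Sum>k<Suc n. \<Sum>s | s permutes {..<n}. perm_koszul P (front_perm k \<circ> shift_perm 1 s) xs *
     G (permute_list (front_perm k \<circ> shift_perm 1 s) xs))"
    by (simp add: sum.cartesian_product split_def)
  also have "\<dots> = (\<Sum>k<Suc n. (\<Prod>i<k. koszul P (xs ! k) (xs ! i)) *
     perm_sum P (\<lambda>r'. G (xs ! k # r')) (take k xs @ drop (Suc k) xs))"
  proof (rule sum.cong[OF refl])
    fix k assume "k \<in> {..<Suc n}"
    then have k: "k < length xs" using n by simp
    let ?r = "take k xs @ drop (Suc k) xs"
    have lr: "length ?r = n" using k n by auto
    have "perm_koszul P (front_perm k \<circ> shift_perm 1 s) xs =
         (\<Prod>i<k. koszul P (xs ! k) (xs ! i)) * perm_koszul P s ?r"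
      "permute_list (front_perm k \<circ> shift_perm 1 s) xs = xs ! k # permute_list s ?r"
      if s: "s permutes {..<n}" for s
      using perm_koszul_comp[of "front_perm k" xs "shift_perm 1 s" P] sp[OF s]
        front_perm_permutes[OF k] n permute_list_compose[of "shift_perm 1 s" xs "front_perm k"]
        perm_koszul_shift_perm[of s ?r P "[xs ! k]"] permute_list_shift_perm[of s ?r "[xs ! k]"] s lr
      by (simp_all add: permute_list_front_perm[OF k] perm_koszul_front_perm[OF k])
    then show "(\<Sum>s | s permutes {..<n}. perm_koszul P (front_perm k \<circ> shift_perm 1 s) xs *
       G (permute_list (front_perm k \<circ> shift_perm 1 s) xs)) = (\<Prod>i<k. koszul P (xs ! k) (xs ! i)) *
     perm_sum P (\<lambda>r'. G (xs ! k # r')) ?r"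
      unfolding perm_sum_def lr by (simp add: sum_distrib_left mult_ac)
  qed
  finally show ?thesis by (simp only: pull_sum_sum n)
qed

lemma pull_sum_cong:
  assumes "\<And>y r us vs. xs = us @ y # vs \<Longrightarrow> r = us @ vs \<Longrightarrow> G y r = H y r"
  shows "pull_sum P G xs = pull_sum P H xs"
  unfolding pull_sum_sum
  by (intro sum.cong arg_cong2[where f = "(*)"] refl assms) (auto simp: id_take_nth_drop)

lemma pull_sum_cong':
  assumes "\<And>y r. length xs = Suc (length r) \<Longrightarrow> y \<in> set xs \<Longrightarrow> set r \<subseteq> set xs \<Longrightarrow> G y r = H y r"
  shows "pull_sum P G xs = pull_sum P H xs"
  by (rule pull_sum_cong) (auto intro!: assms)

lemma pull_sum_eq_0:
  assumes "\<And>y r us vs. xs = us @ y # vs \<Longrightarrow> r = us @ vs \<Longrightarrow> G y r = 0"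
  shows "pull_sum P G xs = 0"
  using pull_sum_cong[of xs G "\<lambda>_ _. 0" P] assms by (simp add: pull_sum_sum)

lemma pull_sum_cmult: "pull_sum P (\<lambda>y r. c * G y r) xs = c * pull_sum P G xs"
  by (simp add: pull_sum_sum sum_distrib_left mult_ac)

lemma pull_sum_add: "pull_sum P (\<lambda>y r. G y r + H y r) xs = pull_sum P G xs + pull_sum P H xs"
  by (simp add: pull_sum_sum sum.distrib algebra_simps)

text \<open>In one of the two orders the first entry pulled has to pass the second, in the other it
  does not; the results differ by just their mutual sign.\<close>

lemma pull_sum_pull_sum:
  "pull_sum P (\<lambda>y r. pull_sum P (\<lambda>w r'. G y w r') r) xs =
   pull_sum P (\<lambda>w r. pull_sum P (\<lambda>y r'. koszul P y w * G y w r') r) xs"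
proof (induction xs arbitrary: G)
  case (Cons x xs)
  have "pull_sum P (\<lambda>y r. pull_sum P (\<lambda>w r'. G y w r') r) (x # xs) =
    pull_sum P (\<lambda>w r'. G x w r') xs +
    pull_sum P (\<lambda>y r. koszul P y x * G y x r) xs +
    pull_sum P (\<lambda>y r. pull_sum P (\<lambda>w r'. koszul P y x * koszul P w x * G y w (x # r')) r) xs"
    by (simp add: pull_sum_add pull_sum_cmult[symmetric] algebra_simps)
  also have "pull_sum P (\<lambda>y r. pull_sum P (\<lambda>w r'. koszul P y x * koszul P w x * G y w (x # r')) r) xs =
    pull_sum P (\<lambda>w r. pull_sum P (\<lambda>y r'. koszul P y w * (koszul P y x * koszul P w x * G y w (x # r'))) r) xs"
    by (rule Cons.IH)
  finally show ?case
    by (simp add: pull_sum_add pull_sum_cmult[symmetric] algebra_simps koszul_commute)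
qed simp

text \<open>For a function with the exchange symmetry, the sign of pulling an entry forward is
  undone by moving it back, so every position contributes the same. The set \<open>S\<close>
  restricts the symmetry to admissible entries, such as vectors of definite parity.\<close>

lemma pull_sum_symmetric:
  assumes "\<And>us x y vs. set (us @ x # y # vs) \<subseteq> S \<Longrightarrow> G (us @ x # y # vs) = koszul P x y * G (us @ y # x # vs)"
    and "set xs \<subseteq> S"
  shows "pull_sum P (\<lambda>y r. G (y # r)) xs = of_nat (length xs) * G xs"
  using assms
proof (induction xs arbitrary: G)
  case (Cons x xs)
  have "pull_sum P (\<lambda>y r. koszul P y x * G (y # x # r)) xs = pull_sum P (\<lambda>y r. G (x # y # r)) xs"
    by (rule pull_sum_cong', subst Cons.prems(1)[of "[]", simplified])
       (use Cons.prems(2) in \<open>auto simp: koszul_commute\<close>)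
  also have "\<dots> = of_nat (length xs) * G (x # xs)"
  proof (rule Cons.IH[of "\<lambda>r. G (x # r)"])
    fix us y z vs assume "set (us @ y # z # vs) \<subseteq> S"
    then show "G (x # us @ y # z # vs) = koszul P y z * G (x # us @ z # y # vs)"
      using Cons.prems(1)[of "x # us" y z vs] Cons.prems(2) by simp
  qed (use Cons.prems(2) in simp)
  finally show ?case by (simp add: algebra_simps)
qed simp

lemma perm_sum_symmetric:
  assumes "\<And>us x y vs. set (us @ x # y # vs) \<subseteq> S \<Longrightarrow> G (us @ x # y # vs) = koszul P x y * G (us @ y # x # vs)"
    and "set xs \<subseteq> S"
  shows "perm_sum P G xs = fact (length xs) * G xs"
  using assms
proof (induction "length xs" arbitrary: xs G)
  case (Suc n)
  then have "xs \<noteq> []" by auto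
  have "pull_sum P (\<lambda>y r. perm_sum P (\<lambda>r'. G (y # r')) r) xs = pull_sum P (\<lambda>y r. fact n * G (y # r)) xs"
  proof (rule pull_sum_cong')
    fix y r assume r: "length xs = Suc (length r)" "y \<in> set xs" "set r \<subseteq> set xs"
    then have "perm_sum P (\<lambda>r'. G (y # r')) r = fact (length r) * G (y # r)"
    proof (intro Suc.hyps(1))
      fix us x z vs assume "set (us @ x # z # vs) \<subseteq> S"
      then show "G (y # us @ x # z # vs) = koszul P x z * G (y # us @ z # x # vs)"
        using Suc.prems(1)[of "y # us" x z vs] Suc.prems(2) r by auto
    qed (use r Suc.hyps(2) Suc.prems(2) in auto)
    then show "perm_sum P (\<lambda>r'. G (y # r')) r = fact n * G (y # r)" using r Suc.hyps(2) by simp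
  qed
  also have "\<dots> = fact n * (of_nat (length xs) * G xs)"
    by (simp only: pull_sum_cmult pull_sum_symmetric[OF Suc.prems])
  finally show ?case by (simp add: perm_sum_pull[OF \<open>xs \<noteq> []\<close>] Suc.hyps(2)[symmetric] algebra_simps)
qed simp

section \<open>Comparison with the ordinary sign of a permutation\<close>

lemma perm_koszul_id [simp]: "perm_koszul P id xs = 1"
  using perm_koszul_comp[OF permutes_id permutes_id, of P xs] by simp

lemma perm_koszul_True_transpose:
  assumes ab: "a < b" "b < length xs"
  shows "perm_koszul (\<lambda>_. True) (Transposition.transpose a b) xs = -1"
proof -
  let ?t = "Transposition.transpose a b"
  \<comment> \<open>Inverted pairs have \<open>a\<close> on the left or \<open>b\<close> on the
    right; the pair \<open>(a, b)\<close> is counted in the first family only, which makes the total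
    odd.\<close>
  have "{(i, j). i < j \<and> j < length xs \<and> ?t i > ?t j} = Pair a ` {a<..b} \<union> (\<lambda>i. (i, b)) ` {a<..<b}"
    using ab by (auto simp: Transposition.transpose_def split: if_split_asm)
  moreover have "card (Pair a ` {a<..b} \<union> (\<lambda>i. (i, b)) ` {a<..<b}) = (b - a) + (b - a - 1)"
    by (subst card_Un_disjoint) (auto simp: card_image inj_on_def)
  moreover have "b - a + (b - a - 1) = Suc (2 * (b - a - 1))" using ab by simp
  ultimately show ?thesis by (simp add: perm_koszul_def)
qed

text \<open>By the cocycle identity the sign with all entries odd is multiplicative, and it is -1 on
  transpositions; these two properties determine \<open>sign\<close>.\<close>

lemma perm_koszul_True:
  assumes "s permutes {..<length xs}"
  shows "perm_koszul (\<lambda>_. True) s xs = of_int (sign s)"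
  using finite_lessThan assms
proof (induction rule: permutes_rev_induct)
  case id
  show ?case by (rule trans[OF perm_koszul_id]) simp
next
  case (swap a b p)
  have tr: "perm_koszul (\<lambda>_. True) (Transposition.transpose a b) ys = -1"
    if "length ys = length xs" "a \<noteq> b" for ys :: "'a list"
  proof (cases "a < b")
    case True
    then show ?thesis using swap(1-3) that by (intro perm_koszul_True_transpose) auto
  next
    case False
    then have "perm_koszul (\<lambda>_. True) (Transposition.transpose b a) ys = -1"
      using swap(1-3) that by (intro perm_koszul_True_transpose) auto
    then show ?thesis by (simp add: transpose_commute)
  qed
  have t: "Transposition.transpose a b permutes {..<length xs}"
    using swap(1-3) by (auto intro: permutes_swap_id)
  have 1: "sign (p \<circ> Transposition.transpose a b) = sign p * sign (Transposition.transpose a b)"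
    by (rule sign_compose) (use \<open>p permutes {..<length xs}\<close> t in \<open>auto intro: permutes_imp_permutation[OF finite_lessThan]\<close>)
  have "perm_koszul (\<lambda>_. True) (p \<circ> Transposition.transpose a b) xs = of_int (sign p) * (-1)"
    unfolding perm_koszul_comp[OF \<open>p permutes {..<length xs}\<close> t] using swap tr by simp
  then show ?case by (simp only: 1 sign_swap_id \<open>a \<noteq> b\<close> if_False of_int_mult) simp
qed

lemma pull_sum_append:
  "pull_sum P G (us @ vs) = pull_sum P (\<lambda>y r. G y (r @ vs)) us +
     pull_sum P (\<lambda>y r. prod_list (map (koszul P y) us) * G y (us @ r)) vs"
  by (induction us arbitrary: G) (simp_all add: mult_ac)

text \<open>In the reversed list an entry passes those that originally followed it. Multiplying by
  its signs with all other entries exchanges these for the entries it passes in \<open>xs\<close>,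
  because every sign squares to 1.\<close>

lemma pull_sum_rev:
  "pull_sum P G (rev xs) =
     pull_sum P (\<lambda>y r. prod_list (map (koszul P y) r) * G y (rev r)) xs"
  by (induction xs arbitrary: G)
     (simp_all add: pull_sum_append mult_ac prod_list.rev flip: rev_map)

lemma pull_sum_map:
  assumes "\<And>y. y \<in> set xs \<Longrightarrow> P (v y) = P y"
  shows "pull_sum P G (map v xs) = pull_sum P (\<lambda>y r. G (v y) (map v r)) xs"
  using assms
proof (induction xs arbitrary: G)
  case (Cons x xs)
  have "pull_sum P (\<lambda>y r. koszul P (v y) (v x) * G (v y) (v x # map v r)) xs =
    pull_sum P (\<lambda>y r. koszul P y x * G (v y) (v x # map v r)) xs"
    by (rule pull_sum_cong') (use Cons.prems in \<open>auto simp: koszul_def\<close>)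
  then show ?case using Cons by simp
qed simp

lemma pull_sum_commute:
  "pull_sum P (\<lambda>y r. pull_sum P' (\<lambda>z r'. G y r z r') ys) xs =
   pull_sum P' (\<lambda>z r'. pull_sum P (\<lambda>y r. G y r z r') xs) ys"
  unfolding pull_sum_sum sum_distrib_left
  by (subst sum.swap) (simp add: mult_ac)

lemma pull_sum_neq_0:
  assumes "pull_sum P G xs \<noteq> 0"
  obtains us y vs where "xs = us @ y # vs" "G y (us @ vs) \<noteq> 0"
  using pull_sum_eq_0[of xs G P] assms by blast

section \<open>Wick sums and determinants\<close>

fun pairing :: "('a \<Rightarrow> 'a \<Rightarrow> complex) \<Rightarrow> 'a list \<Rightarrow> complex" where
  "pairing w [] = 1"
| "pairing w [x] = 0"
| "pairing w (x # y # xs) = w x y * pairing w xs"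

lemma pairing_prod:
  "length xs = 2 * n \<Longrightarrow> pairing w xs = (\<Prod>k<n. w (xs ! (2 * k)) (xs ! (2 * k + 1)))"
proof (induction n arbitrary: xs)
  case (Suc n)
  then obtain x y ys where "xs = x # y # ys" by (auto simp: length_Suc_conv)
  then show ?case using Suc by (simp add: prod.lessThan_Suc_shift del: prod.lessThan_Suc)
qed simp

lemma pairing_odd: "odd (length xs) \<Longrightarrow> pairing w xs = 0"
  by (induction w xs rule: pairing.induct) auto

text \<open>Each perfect matching of \<open>2 * n\<close> positions arises from
  \<open>2 ^ n * fact n\<close> permutations, by reversing and permuting pairs, which explains the
  denominator. On lists of odd length the value is 0 because \<open>pairing\<close> ends in a single
  entry.\<close>

definition wick :: "('a \<Rightarrow> bool) \<Rightarrow> ('a \<Rightarrow> 'a \<Rightarrow> complex) \<Rightarrow> 'a list \<Rightarrow> complex" where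
  "wick P w xs = perm_sum P (pairing w) xs / (2 ^ (length xs div 2) * fact (length xs div 2))"

lemma wick_Nil [simp]: "wick P w [] = 1"
  by (simp add: wick_def)

lemma wick_odd: 
  assumes "odd (length xs)" shows "wick P w xs = 0"
proof -
  have "perm_sum P (pairing w) xs = perm_sum P (\<lambda>_. 0) xs"
    using assms by (intro perm_sum_cong pairing_odd) (metis size_mset)
  then show ?thesis by (simp add: wick_def perm_sum_def)
qed

text \<open>The first contracted pair is pulled out of the list; the factor \<open>2 * Suc n\<close>
  is the quotient of the two normalisations.\<close>

lemma wick_pull_pull:
  assumes "length xs = 2 * Suc n"
  shows "of_nat (2 * Suc n) * wick P w xs =
    pull_sum P (\<lambda>y r. pull_sum P (\<lambda>z r'. w y z * wick P w r') r) xs"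
proof -
  let ?c = "2 ^ n * fact n :: complex"
  have "perm_sum P (pairing w) xs = pull_sum P (\<lambda>y r. perm_sum P (\<lambda>r'. pairing w (y # r')) r) xs"
    by (rule perm_sum_pull) (use assms in auto)
  also have "\<dots> = pull_sum P (\<lambda>y r. pull_sum P (\<lambda>z r'. ?c * (w y z * wick P w r')) r) xs"
  proof (rule pull_sum_cong')
    fix y :: 'a and r :: "'a list" assume r: "length xs = Suc (length r)"
    then have "r \<noteq> []" using assms by auto
    show "perm_sum P (\<lambda>r'. pairing w (y # r')) r = pull_sum P (\<lambda>z r'. ?c * (w y z * wick P w r')) r"
      unfolding perm_sum_pull[OF \<open>r \<noteq> []\<close>]
    proof (rule pull_sum_cong')
      fix z :: 'a and r' :: "'a list" assume "length r = Suc (length r')"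
      then have "length r' = 2 * n" using r assms by simp
      then show "perm_sum P (\<lambda>r'. pairing w (y # z # r')) r' = ?c * (w y z * wick P w r')"
        by (simp add: wick_def perm_sum_cmult)
    qed
  qed
  also have "\<dots> = ?c * pull_sum P (\<lambda>y r. pull_sum P (\<lambda>z r'. w y z * wick P w r') r) xs"
    by (simp only: pull_sum_cmult)
  finally have *: "perm_sum P (pairing w) xs =
      ?c * pull_sum P (\<lambda>y r. pull_sum P (\<lambda>z r'. w y z * wick P w r') r) xs" (is "_ = _ * ?T") .
  have "wick P w xs = perm_sum P (pairing w) xs / (2 ^ Suc n * fact (Suc n))"
    using assms by (simp add: wick_def)
  moreover have "of_nat (2 * Suc n) * (?c * T / (2 ^ Suc n * fact (Suc n))) = T" for T :: complex
  proof -
    have "2 ^ Suc n * fact (Suc n) = of_nat (2 * Suc n) * ?c" by (simp add: algebra_simps)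
    moreover have "of_nat (2 * Suc n) \<noteq> (0 :: complex)" by (simp only: of_nat_eq_0_iff) simp
    ultimately show ?thesis by (simp del: of_nat_mult of_nat_Suc power_Suc fact_Suc)
  qed
  ultimately show ?thesis by (simp only: *)
qed

text \<open>Wick expansion along the first entry. In the average over all first pairs from
  \<open>wick_pull_pull\<close>, the pairs starting with \<open>x\<close> and those ending with
  \<open>x\<close> each give the claimed sum, by symmetry of \<open>w\<close>; the pairs avoiding
  \<open>x\<close> give \<open>2 * n\<close> copies of it by induction. Together this is the factor
  \<open>2 * Suc n\<close>.\<close>

lemma wick_Cons:
  assumes sym: "\<And>x y. x \<in> S \<Longrightarrow> y \<in> S \<Longrightarrow> w y x = koszul P x y * w x y"
    and par: "\<And>x y. x \<in> S \<Longrightarrow> y \<in> S \<Longrightarrow> w x y \<noteq> 0 \<Longrightarrow> P x = P y"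
    and S: "set (x # xs) \<subseteq> S"
  shows "wick P w (x # xs) = pull_sum P (\<lambda>y r. w x y * wick P w r) xs"
  using S
proof (induction "length xs" arbitrary: x xs rule: less_induct)
  case less
  show ?case
  proof (cases "even (length (x # xs))")
    case False
    then have "pull_sum P (\<lambda>y r. w x y * wick P w r) xs = pull_sum P (\<lambda>y r. 0) xs"
      by (intro pull_sum_cong') (auto simp: wick_odd)
    then show ?thesis using wick_odd[OF False] pull_sum_cmult[of P 0 "\<lambda>_ _. 0" xs] by simp
  next
    case True
    then obtain m where "length (x # xs) = 2 * m" by (rule evenE)
    then obtain n where n: "length (x # xs) = 2 * Suc n" by (cases m) auto
    define T where "T = pull_sum P (\<lambda>y r. w x y * wick P w r) xs"
    have "of_nat (2 * Suc n) * wick P w (x # xs) = T +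
      pull_sum P (\<lambda>y r. koszul P y x * w y x * wick P w r) xs +
      pull_sum P (\<lambda>y r. pull_sum P (\<lambda>z r'. koszul P y x * koszul P z x * w y z * wick P w (x # r')) r) xs"
      unfolding wick_pull_pull[OF n] T_def
      by (simp add: pull_sum_add pull_sum_cmult[symmetric] algebra_simps)
    also have "pull_sum P (\<lambda>y r. koszul P y x * w y x * wick P w r) xs = T"
      unfolding T_def
      by (rule pull_sum_cong') (use sym[of x] less.prems in \<open>auto simp: koszul_commute[of P _ x]\<close>)
    also have "pull_sum P (\<lambda>y r. pull_sum P (\<lambda>z r'. koszul P y x * koszul P z x * w y z * wick P w (x # r')) r) xs
      = pull_sum P (\<lambda>y r. pull_sum P (\<lambda>z r'. pull_sum P (\<lambda>v q. w y z * w x v * wick P w q) r') r) xs"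
    proof (intro pull_sum_cong')
      fix y r z r' assume r: "length xs = Suc (length r)" "y \<in> set xs" "set r \<subseteq> set xs"
        "length r = Suc (length r')" "z \<in> set r" "set r' \<subseteq> set r"
      then have "wick P w (x # r') = pull_sum P (\<lambda>v q. w x v * wick P w q) r'"
        by (intro less.hyps) (use less.prems in auto)
      \<comment> \<open>Contracted entries have equal parity, so together they pass any third entry
        without a sign.\<close>
      moreover have *: "koszul P y x * koszul P z x * w y z = w y z"
        using par[of y z] less.prems r by (cases "w y z = 0") (auto simp: koszul_def)
      ultimately show "koszul P y x * koszul P z x * w y z * wick P w (x # r') =
        pull_sum P (\<lambda>v q. w y z * w x v * wick P w q) r'"
        unfolding * by (simp add: pull_sum_cmult mult.assoc)
    qed
    \<comment> \<open>The partner \<open>v\<close> of \<open>x\<close> is moved to the outermost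
      position, past the contracted pair \<open>y\<close>, \<open>z\<close>.\<close>
    also have "\<dots> = pull_sum P (\<lambda>v r. pull_sum P (\<lambda>y r'. pull_sum P (\<lambda>z q.
         w x v * (w y z * wick P w q)) r') r) xs"
    proof -
      have "pull_sum P (\<lambda>y r. pull_sum P (\<lambda>z r'. pull_sum P (\<lambda>v q. w y z * w x v * wick P w q) r') r) xs =
        pull_sum P (\<lambda>y r. pull_sum P (\<lambda>v r'. pull_sum P (\<lambda>z q. koszul P z v * (w y z * w x v * wick P w q)) r') r) xs"
        by (subst pull_sum_pull_sum) (rule refl)
      also have "\<dots> = pull_sum P (\<lambda>v r. pull_sum P (\<lambda>y r'. pull_sum P (\<lambda>z q.
         koszul P y v * koszul P z v * (w y z * w x v * wick P w q)) r') r) xs"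
        by (subst pull_sum_pull_sum) (simp add: pull_sum_cmult[symmetric] mult_ac)
      also have "\<dots> = pull_sum P (\<lambda>v r. pull_sum P (\<lambda>y r'. pull_sum P (\<lambda>z q.
         w x v * (w y z * wick P w q)) r') r) xs"
      proof (intro pull_sum_cong')
        fix v r y r' z q assume r: "v \<in> set xs" "set r \<subseteq> set xs"
          "y \<in> set r" "set r' \<subseteq> set r" "z \<in> set r'" 
        have *: "koszul P y v * koszul P z v * w y z = w y z"
          using par[of y z] less.prems r by (cases "w y z = 0") (auto simp: koszul_def)
        have "koszul P y v * koszul P z v * (w y z * w x v * wick P w q) =
            (koszul P y v * koszul P z v * w y z) * (w x v * wick P w q)"
          by (simp only: mult.assoc)
        then show "koszul P y v * koszul P z v * (w y z * w x v * wick P w q) = w x v * (w y z * wick P w q)"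
          by (rule trans) (subst *, simp only: mult_ac)
      qed
      finally show ?thesis .
    qed
    also have "\<dots> = pull_sum P (\<lambda>v r. of_nat (2 * n) * (w x v * wick P w r)) xs"
    proof (rule pull_sum_cong')
      fix v :: 'a and r :: "'a list" assume r: "length xs = Suc (length r)"
      show "pull_sum P (\<lambda>y r'. pull_sum P (\<lambda>z q. w x v * (w y z * wick P w q)) r') r =
        of_nat (2 * n) * (w x v * wick P w r)"
      proof (cases n)
        case 0
        then have "r = []" using r n by simp
        then show ?thesis using 0 by simp
      next
        case (Suc k)
        then have "length r = 2 * Suc k" using r n by simp
        from wick_pull_pull[OF this, of P w] show ?thesis
          unfolding pull_sum_cmult by (simp add: Suc)
      qed
    qed
    also have "\<dots> = of_nat (2 * n) * T" unfolding T_def by (rule pull_sum_cmult)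
    finally have "of_nat (2 * Suc n) * wick P w (x # xs) = of_nat (2 * Suc n) * T"
      by (simp add: algebra_simps)
    then show ?thesis by (simp add: T_def del: of_nat_mult of_nat_Suc)
  qed
qed

text \<open>Expansion along the first row of a signed permanent: a determinant if \<open>P\<close>
  is always true, a permanent if it is always false. It is not the Berezinian. Lists of different
  lengths give 0.\<close>

primrec super_det :: "('a \<Rightarrow> bool) \<Rightarrow> ('a \<Rightarrow> 'a \<Rightarrow> complex) \<Rightarrow> 'a list \<Rightarrow> 'a list \<Rightarrow> complex" where
  "super_det P b [] gs = (if gs = [] then 1 else 0)"
| "super_det P b (f # fs) gs = pull_sum P (\<lambda>g r. b f g * super_det P b fs r) gs"

lemma super_det_perm_sum:
  "perm_sum P (\<lambda>hs. if length hs = length fs then \<Prod>i<length fs. b (fs ! i) (hs ! i) else 0) gs =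
     super_det P b fs gs"
proof (induction fs arbitrary: gs)
  case Nil
  have "perm_sum P (\<lambda>hs. if length hs = length [] then \<Prod>i<length []. b ([] ! i) (hs ! i) else 0) gs =
    perm_sum P (\<lambda>hs. (if gs = [] then 1 else 0)) gs"
    by (rule perm_sum_cong) auto
  also have "\<dots> = super_det P b [] gs"
    by (cases "gs = []") (simp, simp add: perm_sum_def)
  finally show ?case .
next
  case (Cons f fs)
  show ?case
  proof (cases "gs = []")
    case False
    show ?thesis unfolding perm_sum_pull[OF False] super_det.simps
    proof (rule pull_sum_cong')
      fix y r
      have "perm_sum P (\<lambda>r'. if length (y # r') = length (f # fs)
              then \<Prod>i<length (f # fs). b ((f # fs) ! i) ((y # r') ! i) else 0) r =
        perm_sum P (\<lambda>r'. b f y * (if length r' = length fs then \<Prod>i<length fs. b (fs ! i) (r' ! i) else 0)) r"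
        by (rule perm_sum_cong) (simp add: prod.lessThan_Suc_shift del: prod.lessThan_Suc)
      then show "perm_sum P (\<lambda>r'. if length (y # r') = length (f # fs)
              then \<Prod>i<length (f # fs). b ((f # fs) ! i) ((y # r') ! i) else 0) r =
        b f y * super_det P b fs r"
        by (simp add: perm_sum_cmult Cons.IH)
    qed
  qed simp
qed

text \<open>Expansion along the first column. Column signs turn into row signs because a nonzero
  product matches each row with a column of the same parity.\<close>

lemma super_det_Cons_right:
  assumes par: "\<And>x y. b x y \<noteq> 0 \<Longrightarrow> x \<in> set fs \<Longrightarrow> y \<in> set (g # gs) \<Longrightarrow> P x = P y"
  shows "super_det P b fs (g # gs) = pull_sum P (\<lambda>f r. b f g * super_det P b r gs) fs"
  using assms
proof (induction fs arbitrary: g gs)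
  case (Cons f fs)
  have "super_det P b (f # fs) (g # gs) = b f g * super_det P b fs gs +
    pull_sum P (\<lambda>y r. koszul P y g * (b f y * super_det P b fs (g # r))) gs"
    by simp
  also have "pull_sum P (\<lambda>y r. koszul P y g * (b f y * super_det P b fs (g # r))) gs =
    pull_sum P (\<lambda>y r. pull_sum P (\<lambda>x q. koszul P x f * (b f y * b x g * super_det P b q r)) fs) gs"
  proof (rule pull_sum_cong')
    fix y r assume y: "y \<in> set gs" "set r \<subseteq> set gs"
    have "super_det P b fs (g # r) = pull_sum P (\<lambda>x q. b x g * super_det P b q r) fs"
      using y Cons.prems by (intro Cons.IH) auto
    then have "koszul P y g * (b f y * super_det P b fs (g # r)) =
      pull_sum P (\<lambda>x q. koszul P y g * b f y * (b x g * super_det P b q r)) fs"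
      by (simp only: pull_sum_cmult mult.assoc)
    also have "\<dots> = pull_sum P (\<lambda>x q. koszul P x f * (b f y * b x g * super_det P b q r)) fs"
    proof (rule pull_sum_cong')
      fix x q assume x: "x \<in> set fs"
      have "koszul P y g * b f y * b x g = koszul P x f * b f y * b x g"
        using Cons.prems[of f y] Cons.prems[of x g] x y
        by (cases "b f y = 0"; cases "b x g = 0") (auto simp: koszul_def)
      then show "koszul P y g * b f y * (b x g * super_det P b q r) = koszul P x f * (b f y * b x g * super_det P b q r)"
        by (simp add: mult.assoc[symmetric])
    qed
    finally show "koszul P y g * (b f y * super_det P b fs (g # r)) =
      pull_sum P (\<lambda>x q. koszul P x f * (b f y * b x g * super_det P b q r)) fs" .
  qed
  also have "\<dots> = pull_sum P (\<lambda>x q. koszul P x f * (b x g * super_det P b (f # q) gs)) fs"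
    by (subst pull_sum_commute) (simp add: pull_sum_cmult[symmetric] mult_ac)
  finally show ?case by simp
qed simp

text \<open>A nonvanishing term pairs the two lists off entry by entry with equal parities. Later
  this makes commutation signs trivial whenever the integral is nonzero.\<close>

lemma super_det_parity:
  assumes "\<And>x y. b x y \<noteq> 0 \<Longrightarrow> x \<in> set fs \<Longrightarrow> y \<in> set gs \<Longrightarrow> P x = P y"
    and "super_det P b fs gs \<noteq> 0"
  shows "even (length (filter P fs)) = even (length (filter P gs))"
  using assms
proof (induction fs arbitrary: gs)
  case (Cons f fs)
  from Cons.prems(2) have "pull_sum P (\<lambda>y r. b f y * super_det P b fs r) gs \<noteq> 0" by simp
  then obtain us y vs where g: "gs = us @ y # vs" "b f y * super_det P b fs (us @ vs) \<noteq> 0"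
    by (rule pull_sum_neq_0)
  have "even (length (filter P fs)) = even (length (filter P (us @ vs)))"
    by (rule Cons.IH) (use g Cons.prems(1) in auto)
  moreover have "P f = P y" using g Cons.prems(1)[of f y] by auto
  ultimately show ?case using g(1) by auto
qed (auto split: if_splits)

lemma prod_list_koszul:
  "prod_list (map (koszul P y) xs) = (if P y then (-1) ^ length (filter P xs) else 1)"
  by (induction xs) (auto simp: koszul_def)

text \<open>Both \<open>A\<close> and its image under \<open>v\<close> are isotropic for
  \<open>w\<close>, so only entries of \<open>gs\<close> are contracted with entries of the reversed
  list. Contracting the first \<open>g\<close> with \<open>v y\<close> costs the sign of pulling
  \<open>y\<close> out of \<open>fs\<close>, times the signs of \<open>v y\<close> with all entries
  of the two remaining lists; the latter cancel because these lists together contain an even number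
  of odd entries, unless the remaining value is 0.\<close>

lemma wick_conv_super_det:
  assumes sym: "\<And>x y. x \<in> S \<Longrightarrow> y \<in> S \<Longrightarrow> w y x = koszul P x y * w x y"
    and par: "\<And>x y. x \<in> S \<Longrightarrow> y \<in> S \<Longrightarrow> w x y \<noteq> 0 \<Longrightarrow> P x = P y"
    and A: "A \<subseteq> S" "\<And>x y. x \<in> A \<Longrightarrow> y \<in> A \<Longrightarrow> w x y = 0"
    and B: "v ` A \<subseteq> S" "\<And>x y. x \<in> A \<Longrightarrow> y \<in> A \<Longrightarrow> w (v x) (v y) = 0"
    and v: "\<And>x. x \<in> A \<Longrightarrow> P (v x) = P x"
    and b: "\<And>x y. x \<in> A \<Longrightarrow> y \<in> A \<Longrightarrow> w y (v x) = b x y"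
    and sub: "set fs \<subseteq> A" "set gs \<subseteq> A"
  shows "wick P w (gs @ rev (map v fs)) = super_det P b fs gs"
  using sub
proof (induction gs arbitrary: fs)
  case Nil
  have "wick P w (rev (map v fs)) = 0" if "fs \<noteq> []"
  proof -
    obtain f fs' where f: "rev fs = f # fs'" using \<open>fs \<noteq> []\<close> by (cases "rev fs") auto
    then have s: "set (f # fs') \<subseteq> A" using Nil(1) f by (metis set_rev)
    have "wick P w (rev (map v fs)) = wick P w (v f # map v fs')" by (simp add: rev_map f)
    also have "\<dots> = pull_sum P (\<lambda>y r. w (v f) y * wick P w r) (map v fs')"
      by (rule wick_Cons[OF sym par]) (use s B in \<open>auto simp: image_subset_iff\<close>)
    also have "\<dots> = 0"
    proof (rule pull_sum_eq_0)
      fix y r us vs assume "map v fs' = us @ y # vs"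
      then have "y \<in> v ` set fs'" by (metis in_set_conv_decomp list.set_map)
      then show "w (v f) y * wick P w r = 0" using B(2) s by auto
    qed
    finally show ?thesis .
  qed
  moreover have "super_det P b fs [] = 0" if "fs \<noteq> []" using that by (cases fs) auto
  ultimately show ?case by (cases "fs = []") auto
next
  case (Cons g gs)
  have pb: "P x = P y" if "b x y \<noteq> 0" "x \<in> A" "y \<in> A" for x y
    using par[of y "v x"] b[of x y] v[of x] that A B by (auto simp: image_subset_iff subset_iff)
  let ?R = "rev (map v fs)"
  have "wick P w ((g # gs) @ ?R) = pull_sum P (\<lambda>y r. w g y * wick P w r) (gs @ ?R)"
    unfolding append_Cons by (rule wick_Cons[OF sym par]) (use Cons.prems A B in \<open>auto simp: image_subset_iff subset_iff\<close>)
  also have "\<dots> = pull_sum P (\<lambda>y r. prod_list (map (koszul P y) gs) * (w g y * wick P w (gs @ r))) ?R"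
  proof -
    have "pull_sum P (\<lambda>y r. w g y * wick P w (r @ ?R)) gs = 0"
      by (rule pull_sum_eq_0) (use A(2) Cons.prems in auto)
    then show ?thesis by (simp add: pull_sum_append)
  qed
  also have "\<dots> = pull_sum P (\<lambda>y r. prod_list (map (koszul P (v y)) (map v r)) *
      (prod_list (map (koszul P (v y)) gs) * (w g (v y) * wick P w (gs @ rev (map v r))))) fs"
    unfolding pull_sum_rev
    by (rule pull_sum_map) (use v Cons.prems in auto)
  also have "\<dots> = pull_sum P (\<lambda>y r. b y g * super_det P b r gs) fs"
  proof (rule pull_sum_cong')
    fix y r assume y: "y \<in> set fs" "set r \<subseteq> set fs"
    have IH: "wick P w (gs @ rev (map v r)) = super_det P b r gs"
      using y Cons.prems by (intro Cons.IH) auto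
    have fl: "length (filter P (map v r)) = length (filter P r)"
      unfolding filter_map length_map using v y Cons.prems by (intro arg_cong[of _ _ length] filter_cong) auto
    have "prod_list (map (koszul P (v y)) (map v r)) * prod_list (map (koszul P (v y)) gs) = 1"
      if "super_det P b r gs \<noteq> 0"
    proof -
      have "even (length (filter P r)) = even (length (filter P gs))"
        by (rule super_det_parity[OF _ that])
          (use pb y Cons.prems in \<open>auto simp: subset_iff\<close>)
      then show ?thesis unfolding prod_list_koszul fl by (auto simp: minus_one_power_iff)
    qed
    then show "prod_list (map (koszul P (v y)) (map v r)) *
      (prod_list (map (koszul P (v y)) gs) * (w g (v y) * wick P w (gs @ rev (map v r)))) = b y g * super_det P b r gs"
      using b[of y g] y Cons.prems unfolding IH
      by (cases "super_det P b r gs = 0") (auto simp: mult.assoc[symmetric])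
  qed
  also have "\<dots> = super_det P b fs (g # gs)"
    by (rule super_det_Cons_right[symmetric]) (use pb Cons.prems in auto)
  finally show ?case .
qed

text \<open>A block diagonal superdeterminant factorises: entries of \<open>as\<close> are only
  matched within \<open>cs\<close>, which stands in front, so no sign arises.\<close>

lemma super_det_append:
  assumes "\<And>x y. x \<in> set as \<Longrightarrow> y \<in> set ds \<Longrightarrow> b x y = 0"
    and "\<And>x y. x \<in> set bs \<Longrightarrow> y \<in> set cs \<Longrightarrow> b x y = 0"
  shows "super_det P b (as @ bs) (cs @ ds) = super_det P b as cs * super_det P b bs ds"
  using assms
proof (induction as arbitrary: cs)
  case Nil
  have "super_det P b bs (cs @ ds) = 0" if "cs \<noteq> []"
    using Nil(2)
  proof (induction bs arbitrary: ds)
    case (Cons f bs)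
    have "pull_sum P (\<lambda>y r. b f y * super_det P b bs (r @ ds)) cs = 0"
      by (rule pull_sum_eq_0) (use Cons.prems in auto)
    moreover have "super_det P b bs (cs @ r) = 0" for r
      using Cons by auto
    ultimately show ?case by (simp add: pull_sum_append pull_sum_eq_0)
  qed (use that in auto)
  then show ?case by (cases "cs = []") auto
next
  case (Cons a as)
  have 1: "pull_sum P (\<lambda>y r. prod_list (map (koszul P y) cs) * (b a y * super_det P b (as @ bs) (cs @ r))) ds = 0"
    by (rule pull_sum_eq_0) (use Cons.prems in auto)
  have 2: "pull_sum P (\<lambda>y r. b a y * super_det P b (as @ bs) (r @ ds)) cs =
    pull_sum P (\<lambda>y r. super_det P b bs ds * (b a y * super_det P b as r)) cs"
  proof (rule pull_sum_cong')
    fix y r assume "set r \<subseteq> set cs"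
    then have "super_det P b (as @ bs) (r @ ds) = super_det P b as r * super_det P b bs ds"
      using Cons.prems by (intro Cons.IH) auto
    then show "b a y * super_det P b (as @ bs) (r @ ds) = super_det P b bs ds * (b a y * super_det P b as r)"
      by simp
  qed
  show ?case using 1 2 by (simp add: pull_sum_append pull_sum_cmult mult.commute)
qed

section \<open>Hilbert spaces\<close>

interpretation chilbert: module "scaleC :: complex \<Rightarrow> 'a \<Rightarrow> 'a::chilbert_space"
proof
  show "scaleC 1 x = x" for x :: 'a using scaleC_of_real[of 1 x] by simp
qed (simp_all add: scaleC_add_right scaleC_add_left scaleC_scaleC)

lemma cinner_add_left: "cinner (x + y) z = cinner x z + cinner (y :: 'a::chilbert_space) z"
  using cinner_commute[of "x + y" z] cinner_commute[of z x] cinner_commute[of z y]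
  by (simp add: cinner_add_right)

lemma cinner_scaleC_left: "cinner (scaleC a x) y = cnj a * cinner x (y :: 'a::chilbert_space)"
  using cinner_commute[of "scaleC a x" y] cinner_commute[of y x] by (simp add: cinner_scaleC_right)

lemma cinner_0_right [simp]: "cinner x (0 :: 'a::chilbert_space) = 0"
  using cinner_add_right[of x 0 0] by simp

lemma cinner_0_left [simp]: "cinner (0 :: 'a::chilbert_space) x = 0"
  using cinner_add_left[of 0 0 x] by simp

lemma cinner_minus_right: "cinner x (- y) = - cinner x (y :: 'a::chilbert_space)"
  using cinner_add_right[of x y "- y"] by (simp add: eq_neg_iff_add_eq_0 add.commute)

lemma cinner_minus_left: "cinner (- x) y = - cinner x (y :: 'a::chilbert_space)"
  using cinner_add_left[of x "- x" y] by (simp add: eq_neg_iff_add_eq_0 add.commute)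

lemma cinner_diff_right: "cinner x (y - z) = cinner x y - cinner x (z :: 'a::chilbert_space)"
  using cinner_add_right[of x y "- z"] by (simp add: cinner_minus_right)

lemma cinner_diff_left: "cinner (x - y) z = cinner x z - cinner y (z :: 'a::chilbert_space)"
  using cinner_add_left[of x "- y" z] by (simp add: cinner_minus_left)

lemma cinner_sum_right: "cinner x (\<Sum>i\<in>A. f i) = (\<Sum>i\<in>A. cinner x (f i :: 'a::chilbert_space))"
  by (induction A rule: infinite_finite_induct) (simp_all add: cinner_add_right)

lemma cinner_sum_left: "cinner (\<Sum>i\<in>A. f i) x = (\<Sum>i\<in>A. cinner (f i :: 'a::chilbert_space) x)"
  by (induction A rule: infinite_finite_induct) (simp_all add: cinner_add_left)

lemma cinner_self_eq_0 [simp]: "cinner x x = 0 \<longleftrightarrow> (x :: 'a::chilbert_space) = 0"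
  by (simp add: cinner_self)

lemma norm_scaleC: "norm (scaleC a (x :: 'a::chilbert_space)) = cmod a * norm x"
proof -
  have "complex_of_real ((norm (scaleC a x))\<^sup>2) = complex_of_real ((cmod a * norm x)\<^sup>2)"
  proof -
    have "complex_of_real ((norm (scaleC a x))\<^sup>2) = (a * cnj a) * cinner x x"
      unfolding cinner_self[symmetric] by (simp add: cinner_scaleC_left cinner_scaleC_right)
    then show ?thesis by (simp only: complex_norm_square[symmetric] cinner_self power_mult_distrib of_real_mult)
  qed
  then have "(norm (scaleC a x))\<^sup>2 = (cmod a * norm x)\<^sup>2" by (simp only: of_real_eq_iff)
  then show ?thesis by (simp add: power2_eq_iff_nonneg)
qed

lemma orthonormal_subset: "orthonormal B \<Longrightarrow> A \<subseteq> B \<Longrightarrow> orthonormal A"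
  unfolding orthonormal_def by blast

definition orth_proj :: "'a::chilbert_space set \<Rightarrow> 'a \<Rightarrow> 'a" where
  "orth_proj S g = (\<Sum>b\<in>S. scaleC (cinner b g) b)"

lemma orth_proj_in_span: "orth_proj S g \<in> chilbert.span S"
  unfolding orth_proj_def by (intro chilbert.span_sum chilbert.span_scale chilbert.span_base)

lemma cinner_orth_proj:
  assumes "orthonormal S" "finite S" "b \<in> S"
  shows "cinner b (orth_proj S g) = cinner b g"
proof -
  have "cinner b (orth_proj S g) = (\<Sum>c\<in>S. if b = c then cinner c g else 0)"
    unfolding orth_proj_def cinner_sum_right
    using assms by (intro sum.cong) (auto simp: cinner_scaleC_right orthonormal_def)
  then show ?thesis using assms by simp
qed

lemma cinner_span_residual:
  assumes "orthonormal S" "finite S" "s \<in> chilbert.span S"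
  shows "cinner s (g - orth_proj S g) = 0"
  using assms(3)
  by (induction rule: chilbert.span_induct_alt)
     (simp_all add: cinner_add_left cinner_scaleC_left cinner_diff_right cinner_orth_proj[OF assms(1,2)])

lemma norm_add_orthogonal:
  fixes x y :: "'a::chilbert_space"
  assumes "cinner x y = 0"
  shows "(norm (x + y))\<^sup>2 = (norm x)\<^sup>2 + (norm y)\<^sup>2"
proof -
  have "cinner y x = 0" using assms cinner_commute[of y x] by simp
  then have "complex_of_real ((norm (x + y))\<^sup>2) = complex_of_real ((norm x)\<^sup>2 + (norm y)\<^sup>2)"
    unfolding of_real_add cinner_self[symmetric]
    using assms by (simp add: cinner_add_left cinner_add_right)
  then show ?thesis by (simp only: of_real_eq_iff)
qed

lemma norm_residual_le:
  assumes "orthonormal S" "finite S" "s \<in> chilbert.span S"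
  shows "norm (g - orth_proj S g) \<le> norm (g - s)"
proof -
  have "cinner (orth_proj S g - s) (g - orth_proj S g) = 0"
    by (rule cinner_span_residual[OF assms(1,2)]) (intro chilbert.span_diff orth_proj_in_span assms(3))
  from norm_add_orthogonal[OF this] have "(norm (g - orth_proj S g))\<^sup>2 \<le> (norm (g - s))\<^sup>2"
    by simp
  then show ?thesis by (rule power2_le_imp_le) simp
qed

lemma bessel:
  assumes "orthonormal S" "finite S"
  shows "(\<Sum>b\<in>S. (cmod (cinner b g))\<^sup>2) \<le> (norm (g :: 'a::chilbert_space))\<^sup>2"
proof -
  let ?p = "orth_proj S g"
  have "cinner ?p (g - ?p) = 0" by (rule cinner_span_residual[OF assms orth_proj_in_span])
  from norm_add_orthogonal[OF this] have 1: "(norm ?p)\<^sup>2 \<le> (norm g)\<^sup>2" by simp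
  have "complex_of_real ((norm ?p)\<^sup>2) = (\<Sum>b\<in>S. cnj (cinner b g) * cinner b ?p)"
    unfolding cinner_self[symmetric]
    by (subst (1) orth_proj_def) (simp add: cinner_sum_left cinner_scaleC_left)
  also have "\<dots> = (\<Sum>b\<in>S. complex_of_real ((cmod (cinner b g))\<^sup>2))"
    by (intro sum.cong refl) (simp only: cinner_orth_proj[OF assms] complex_norm_square[symmetric] mult.commute[of "cnj _"])
  also have "\<dots> = complex_of_real (\<Sum>b\<in>S. (cmod (cinner b g))\<^sup>2)" by simp
  finally show ?thesis using 1 by (simp only: of_real_eq_iff)
qed

section \<open>Gram-Schmidt and orthonormal bases\<close>

lemma orthonormal_singleton: "norm (b :: 'a::chilbert_space) = 1 \<Longrightarrow> orthonormal {b}"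
  by (simp add: orthonormal_def cinner_self)

lemma norm_sgn_scaleC:
  "x \<noteq> 0 \<Longrightarrow> norm (scaleC (complex_of_real (1 / norm x)) (x :: 'a::chilbert_space)) = 1"
  by (simp add: norm_scaleC norm_divide)

lemma cauchy_schwarz: "cmod (cinner x y) \<le> norm x * norm (y :: 'a::chilbert_space)"
proof (cases "x = 0")
  case False
  let ?b = "scaleC (complex_of_real (1 / norm x)) x"
  have "(cmod (cinner ?b y))\<^sup>2 \<le> (norm y)\<^sup>2"
    using bessel[OF orthonormal_singleton[OF norm_sgn_scaleC[OF False]], of y] by simp
  then have "cmod (cinner ?b y) \<le> norm y" by (rule power2_le_imp_le) simp
  then show ?thesis using False
    by (simp add: cinner_scaleC_left norm_mult norm_divide field_simps)
qed simp

text \<open>One Gram-Schmidt step: the normalised residual of \<open>v\<close> is added unless it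
  vanishes.\<close>

lemma orthonormal_extend:
  assumes "orthonormal A" "finite A"
  shows "\<exists>A'. finite A' \<and> orthonormal A' \<and> A \<subseteq> A' \<and> (v :: 'a::chilbert_space) \<in> chilbert.span A'"
proof (cases "v = orth_proj A v")
  case True
  then have "v \<in> chilbert.span A" by (metis orth_proj_in_span)
  then show ?thesis using assms by auto
next
  case False
  define r where "r = v - orth_proj A v"
  have r: "r \<noteq> 0" using False by (simp add: r_def)
  define b where "b = scaleC (complex_of_real (1 / norm r)) r"
  have nb: "norm b = 1" unfolding b_def by (rule norm_sgn_scaleC[OF r])
  have ab: "cinner a b = 0" if "a \<in> A" for a
    using cinner_span_residual[OF assms chilbert.span_base[OF that]]
    by (simp add: b_def cinner_scaleC_right r_def)
  then have ba: "cinner b a = 0" if "a \<in> A" for a using that cinner_commute[of b a] by simp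
  have "b \<notin> A" using ab[of b] nb by (auto simp: cinner_self)
  then have o: "orthonormal (insert b A)"
    using assms(1) ab ba nb unfolding orthonormal_def by (auto simp: cinner_self)
  have "r = scaleC (complex_of_real (norm r)) b" using r by (simp add: b_def flip: of_real_mult)
  then have "r \<in> chilbert.span (insert b A)"
    by (metis chilbert.span_base chilbert.span_scale insertI1)
  moreover have "orth_proj A v \<in> chilbert.span (insert b A)"
    using orth_proj_in_span chilbert.span_mono[of A "insert b A"] by blast
  ultimately have "r + orth_proj A v \<in> chilbert.span (insert b A)" by (rule chilbert.span_add)
  then have "v \<in> chilbert.span (insert b A)" by (simp add: r_def)
  then show ?thesis using o assms(2) by blast
qed

lemma orthonormal_finite_span:
  assumes "finite (V :: 'a::chilbert_space set)"
  shows "\<exists>A. finite A \<and> orthonormal A \<and> V \<subseteq> chilbert.span A"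
  using assms
proof induction
  case empty
  show ?case by (intro exI[of _ "{}"]) (simp add: orthonormal_def)
next
  case (insert v V)
  then obtain A where A: "finite A" "orthonormal A" "V \<subseteq> chilbert.span A" by blast
  with orthonormal_extend[OF A(2,1), of v] obtain A' where
    "finite A'" "orthonormal A'" "A \<subseteq> A'" "v \<in> chilbert.span A'" by blast
  then show ?case using A(3) chilbert.span_mono[of A A'] by blast
qed

text \<open>Gram-Schmidt along a countable dense sequence. Without existence the choice in
  \<open>onb\<close> would say nothing.\<close>

lemma orthonormal_basis_exists: "\<exists>B :: 'a::chilbert_space set. orthonormal_basis B"
proof -
  obtain D :: "'a set" where D: "countable D" "\<And>X. open X \<Longrightarrow> X \<noteq> {} \<Longrightarrow> \<exists>d\<in>D. d \<in> X"
    by (rule countable_dense_setE) blast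
  have ne: "D \<noteq> {}" using D(2)[of UNIV] by auto
  define d where "d = from_nat_into D"
  have rd: "range d = D" unfolding d_def by (rule range_from_nat_into[OF ne D(1)])
  define Q where "Q n A \<longleftrightarrow> finite A \<and> orthonormal A \<and> d n \<in> chilbert.span A" for n A
  have "\<exists>A. Q 0 A" using orthonormal_finite_span[of "{d 0}"] by (auto simp: Q_def)
  moreover have "\<exists>A'. Q (Suc n) A' \<and> A \<subseteq> A'" if "Q n A" for n A
    using orthonormal_extend[of A "d (Suc n)"] that by (auto simp: Q_def)
  ultimately obtain f where f: "\<And>n. Q n (f n)" "\<And>n. f n \<subseteq> f (Suc n)"
    using dependent_nat_choice[of Q "\<lambda>_ A A'. A \<subseteq> A'"] by blast
  then have mono: "m \<le> n \<Longrightarrow> f m \<subseteq> f n" for m n using lift_Suc_mono_le[of f m n] by blast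
  define B where "B = (\<Union>n. f n)"
  have "orthonormal B"
    unfolding orthonormal_def
  proof (intro ballI)
    fix x y assume "x \<in> B" "y \<in> B"
    then obtain m n where "x \<in> f m" "y \<in> f n" by (auto simp: B_def)
    then have "x \<in> f (max m n)" "y \<in> f (max m n)" using mono[of m "max m n"] mono[of n "max m n"] by auto
    then show "cinner x y = (if x = y then 1 else 0)"
      using f(1)[of "max m n"] by (auto simp: Q_def orthonormal_def)
  qed
  moreover have "closure (chilbert.span B) = UNIV"
  proof -
    have "D \<subseteq> chilbert.span B"
    proof
      fix x assume "x \<in> D"
      then obtain n where "x = d n" using rd by auto
      then have "x \<in> chilbert.span (f n)" using f(1)[of n] by (simp add: Q_def)
      moreover have "chilbert.span (f n) \<subseteq> chilbert.span B" by (rule chilbert.span_mono) (auto simp: B_def)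
      ultimately show "x \<in> chilbert.span B" by blast
    qed
    moreover have "closure D = UNIV"
    proof (rule ccontr)
      assume "closure D \<noteq> UNIV"
      then have "- closure D \<noteq> {}" by auto
      from D(2)[OF _ this] show False using closure_subset[of D] by auto
    qed
    ultimately show ?thesis using closure_mono[of D "chilbert.span B"] by auto
  qed
  ultimately show ?thesis unfolding orthonormal_basis_def by blast
qed

lemma orthonormal_basis_onb: "orthonormal_basis (onb :: 'a::chilbert_space set)"
  unfolding onb_def by (rule someI_ex[OF orthonormal_basis_exists])

text \<open>Convergence holds along the directed set of finite subsets: once a subset contains the
  support of an approximant of \<open>g\<close>, its projection is at least as close to
  \<open>g\<close>.\<close>

lemma has_sum_onb: "((\<lambda>b. scaleC (cinner b g) b) has_sum (g :: 'a::chilbert_space)) onb"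
  unfolding has_sum_def tendsto_iff
proof (intro allI impI)
  fix e :: real assume e: "e > 0"
  have o: "orthonormal (onb :: 'a set)" and "g \<in> closure (chilbert.span onb)"
    using orthonormal_basis_onb by (auto simp: orthonormal_basis_def)
  then obtain s where s: "s \<in> chilbert.span onb" "dist s g < e"
    using e unfolding closure_approachable by blast
  then obtain t r where t: "finite t" "t \<subseteq> onb" "s = (\<Sum>a\<in>t. scaleC (r a) a)"
    unfolding chilbert.span_explicit by blast
  have st: "s \<in> chilbert.span t"
    unfolding t(3) by (intro chilbert.span_sum chilbert.span_scale chilbert.span_base)
  show "\<forall>\<^sub>F S in finite_subsets_at_top onb. dist (\<Sum>b\<in>S. scaleC (cinner b g) b) g < e"
    unfolding eventually_finite_subsets_at_top
  proof (intro exI[of _ t] conjI allI impI t(1,2))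
    fix Y assume Y: "finite Y \<and> t \<subseteq> Y \<and> Y \<subseteq> onb"
    have "norm (g - orth_proj Y g) \<le> norm (g - s)"
      using Y orthonormal_subset[OF o, of Y] st chilbert.span_mono[of t Y]
      by (intro norm_residual_le) auto
    also have "\<dots> < e" using s(2) by (simp add: dist_norm norm_minus_commute)
    finally show "dist (\<Sum>b\<in>Y. scaleC (cinner b g) b) g < e"
      by (simp add: dist_norm orth_proj_def norm_minus_commute)
  qed
qed

lemma has_sum_onb_functional:
  fixes T :: "'a::chilbert_space \<Rightarrow> complex"
  assumes add: "\<And>x y. T (x + y) = T x + T y" and scale: "\<And>c x. T (scaleC c x) = c * T x"
    and bound: "\<And>x. cmod (T x) \<le> norm x * K"
  shows "((\<lambda>b. cinner b g * T b) has_sum T g) onb"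
proof -
  have "bounded_linear T"
    by (rule bounded_linear_intro[OF add _ bound])
       (metis scale scaleC_of_real scaleR_conv_of_real)
  from has_sum_bounded_linear[OF this has_sum_onb[of g]] show ?thesis
    by (simp add: scale)
qed

lemma parseval: "((\<lambda>b. cinner f b * cinner b g) has_sum cinner f (g :: 'a::chilbert_space)) onb"
  using has_sum_onb_functional[of "cinner f" "norm f" g] cauchy_schwarz[of f]
  by (simp add: cinner_add_right cinner_scaleC_right mult.commute)

lemma has_sum_times:
  fixes f :: "'a \<Rightarrow> complex" and g :: "'b \<Rightarrow> complex"
  assumes f: "(f has_sum a) A" and g: "(g has_sum b) B"
  shows "((\<lambda>(x, y). f x * g y) has_sum (a * b)) (A \<times> B)"
proof (rule has_sum_SigmaI[where g = "\<lambda>x. f x * b"])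
  show "((\<lambda>y. case (x, y) of (x, y) \<Rightarrow> f x * g y) has_sum f x * b) B" for x
    using has_sum_cmult_right[OF g] by simp
  show "((\<lambda>x. f x * b) has_sum a * b) A" by (rule has_sum_cmult_left[OF f])
  have "f summable_on A" "g summable_on B" using f g by (auto intro: has_sum_imp_summable)
  then have *: "(\<lambda>x. norm (f x)) summable_on A" "(\<lambda>x. norm (g x)) summable_on B"
    by (simp_all add: summable_on_iff_abs_summable_on_complex)
  have "(\<lambda>p. norm ((\<lambda>(x, y). f x * g y) p)) summable_on A \<times> B"
    unfolding Infinite_Sum.abs_summable_on_Sigma_iff prod.case
  proof (intro conjI ballI)
    fix x assume "x \<in> A"
    show "(\<lambda>y. norm (f x * g y)) summable_on B"
      using summable_on_cmult_right[OF *(2), of "cmod (f x)"] by (simp add: norm_mult)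
  next
    have "(\<lambda>x. cmod (f x) * infsum (\<lambda>y. cmod (g y)) B) summable_on A"
      by (rule summable_on_cmult_left[OF *(1)])
    moreover have "infsum (\<lambda>y. cmod (g y)) B \<ge> 0" by (rule infsum_nonneg) simp
    ultimately show "(\<lambda>x. norm (\<Sum>\<^sub>\<infinity>y\<in>B. norm (f x * g y))) summable_on A"
      by (simp add: norm_mult infsum_cmult_right' abs_mult)
  qed
  then show "(\<lambda>(x, y). f x * g y) summable_on A \<times> B"
    by (rule Infinite_Sum.abs_summable_summable)
qed

text \<open>The workhorse for sums over \<open>lists onb\<close>: a product of functions of single
  entries is summed slot by slot, lists of any other length contributing 0.\<close>

lemma has_sum_prod_lists:
  fixes u :: "nat \<Rightarrow> 'a \<Rightarrow> complex"
  assumes "\<And>i. i < n \<Longrightarrow> (u i has_sum v i) B"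
  shows "((\<lambda>bs. if length bs = n then \<Prod>i<n. u i (bs ! i) else 0) has_sum (\<Prod>i<n. v i)) (lists B)"
  using assms
proof (induction n arbitrary: u v)
  case 0
  have "((\<lambda>bs. 1) has_sum 1) {[]::'a list}" by (rule has_sum_finiteI) auto
  then show ?case
    by (subst lessThan_0, subst prod.empty, rule has_sum_cong_neutral[THEN iffD1, rotated 3]) auto
next
  case (Suc n)
  let ?f = "\<lambda>bs. if length bs = n then \<Prod>i<n. u (Suc i) (bs ! i) else 0"
  have "(?f has_sum (\<Prod>i<n. v (Suc i))) (lists B)"
    using Suc.prems by (intro Suc.IH) auto
  from has_sum_times[OF Suc.prems[of 0] this]
  have "((\<lambda>(b, bs). u 0 b * ?f bs) has_sum (\<Prod>i<Suc n. v i)) (B \<times> lists B)"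
    by (simp add: prod.lessThan_Suc_shift del: prod.lessThan_Suc)
  then have "((\<lambda>bs. case bs of [] \<Rightarrow> 0 | b # bs \<Rightarrow> u 0 b * ?f bs) has_sum (\<Prod>i<Suc n. v i))
      ((\<lambda>(b, bs). b # bs) ` (B \<times> lists B))"
    by (subst has_sum_reindex) (auto simp: inj_on_def o_def split_def)
  then show ?case
  proof (rule has_sum_cong_neutral[THEN iffD1, rotated 3])
    fix bs assume "bs \<in> lists B - (\<lambda>(b, bs). b # bs) ` (B \<times> lists B)"
    then have "bs = []" by (cases bs) auto
    then show "(if length bs = Suc n then \<Prod>i<Suc n. u i (bs ! i) else 0) = 0" by simp
  qed (auto simp: prod.lessThan_Suc_shift simp del: prod.lessThan_Suc)
qed

section \<open>The Grassmann algebra as a ring\<close>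

text \<open>The product before projection. It is associative by itself, so for \<open>gmul\<close>
  it remains to see that projecting a factor first changes nothing.\<close>

definition tmul :: "'a tensor \<Rightarrow> 'a tensor \<Rightarrow> 'a tensor" where
  "tmul l m = (\<lambda>ls. \<Sum>p\<le>length ls. grade_weight (length ls) p * (l (take p ls) * m (drop p ls)))"

lemma gmul_alt_tmul: "gmul l m = alt (tmul l m)"
  by (simp add: gmul_def tmul_def)

lemma fmul_supersym_tmul: "fmul F G = supersym (tmul F G)"
  by (simp add: fmul_def tmul_def)

lemma alt_perm_sum: "alt F ls = perm_sum (\<lambda>_. True) F ls / fact (length ls)"
  by (simp add: alt_def perm_sum_def perm_koszul_True)

lemma perm_sum_alt: "perm_sum (\<lambda>_. True) F ls = fact (length ls) * alt F ls"
  by (simp add: alt_perm_sum)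

lemma alt_cong:
  assumes "\<And>ys. length ys = length xs \<Longrightarrow> G ys = H ys"
  shows "alt G xs = alt H xs"
  unfolding alt_perm_sum by (subst perm_sum_cong[of xs G H]) (auto intro!: assms dest: mset_eq_length)

lemma alt_add: "alt (\<lambda>ls. F ls + G ls) = (\<lambda>ls. alt F ls + alt G ls)"
  by (auto simp: alt_perm_sum perm_sum_add add_divide_distrib)

lemma alt_scale: "alt (\<lambda>ls. c * F ls) = (\<lambda>ls. c * alt F ls)"
  by (auto simp: alt_perm_sum perm_sum_cmult)

lemma alt_sum: "alt (\<lambda>ls. \<Sum>i\<in>I. F i ls) = (\<lambda>ls. \<Sum>i\<in>I. alt (F i) ls)"
  by (auto simp: alt_perm_sum perm_sum_sum sum_divide_distrib)

lemma alt_alt [simp]: "alt (alt F) = alt F"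
proof
  fix ls
  have "alt (alt F) ls = alt (\<lambda>ys. perm_sum (\<lambda>_. True) F ys / fact (length ls)) ls"
    by (rule alt_cong) (simp add: alt_perm_sum)
  then show "alt (alt F) ls = alt F ls"
    using perm_sum_perm_sum[of "\<lambda>_. True" F ls] perm_sum_cmult[of "\<lambda>_. True" "1 / fact (length ls)" "perm_sum (\<lambda>_. True) F" ls]
    by (simp add: alt_perm_sum)
qed

lemma alt_tmul_sum:
  "alt (tmul l m) ls = (\<Sum>p\<le>length ls. grade_weight (length ls) p *
     (perm_sum (\<lambda>_. True) (\<lambda>ys. l (take p ys) * m (drop p ys)) ls / fact (length ls)))"
proof -
  have "alt (tmul l m) ls =
      alt (\<lambda>ys. \<Sum>p\<le>length ls. grade_weight (length ls) p * (l (take p ys) * m (drop p ys))) ls"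
    by (rule alt_cong) (simp add: tmul_def)
  then show ?thesis by (simp add: alt_sum alt_scale alt_perm_sum)
qed

lemma alt_tmul_alt_right [simp]: "alt (tmul l (alt m)) = alt (tmul l m)"
proof
  fix ls
  show "alt (tmul l (alt m)) ls = alt (tmul l m) ls"
    unfolding alt_tmul_sum
  proof (intro sum.cong refl arg_cong2[where f = "(*)"] arg_cong2[where f = "(/)"])
    fix p assume p: "p \<in> {..length ls}"
    let ?T = "\<lambda>_::'a. True"
    have "perm_sum ?T (\<lambda>ys. l (take p ys) * alt m (drop p ys)) ls =
      perm_sum ?T (\<lambda>ys. (1 / fact (length ls - p)) * (l (take p ys) * perm_sum ?T m (drop p ys))) ls"
      by (rule perm_sum_cong) (auto simp: alt_perm_sum dest: mset_eq_length)
    then show "perm_sum ?T (\<lambda>ys. l (take p ys) * alt m (drop p ys)) ls =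
      perm_sum ?T (\<lambda>ys. l (take p ys) * m (drop p ys)) ls"
      using p by (simp only: perm_sum_cmult) (simp add: perm_sum_tensor_right)
  qed
qed

lemma alt_tmul_alt_left [simp]: "alt (tmul (alt l) m) = alt (tmul l m)"
proof
  fix ls
  show "alt (tmul (alt l) m) ls = alt (tmul l m) ls"
    unfolding alt_tmul_sum
  proof (intro sum.cong refl arg_cong2[where f = "(*)"] arg_cong2[where f = "(/)"])
    fix p assume p: "p \<in> {..length ls}"
    let ?T = "\<lambda>_::'a. True"
    have "perm_sum ?T (\<lambda>ys. alt l (take p ys) * m (drop p ys)) ls =
      perm_sum ?T (\<lambda>ys. (1 / fact p) * (perm_sum ?T l (take p ys) * m (drop p ys))) ls"
      by (rule perm_sum_cong) (use p in \<open>auto simp: alt_perm_sum min_def dest!: mset_eq_length\<close>)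
    then show "perm_sum ?T (\<lambda>ys. alt l (take p ys) * m (drop p ys)) ls =
      perm_sum ?T (\<lambda>ys. l (take p ys) * m (drop p ys)) ls"
      using p by (simp only: perm_sum_cmult) (simp add: perm_sum_tensor_left)
  qed
qed

lemma grade_weight_0 [simp]: "grade_weight n 0 = 1" and grade_weight_same [simp]: "grade_weight n n = 1"
  by (simp_all add: grade_weight_def)

lemma grade_weight_diff: "p \<le> n \<Longrightarrow> grade_weight n (n - p) = grade_weight n p"
  by (simp add: grade_weight_def mult.commute)

text \<open>Both sides are the square root of the multinomial coefficient of \<open>p\<close>,
  \<open>q\<close>, \<open>r\<close>.\<close>

lemma grade_weight_assoc:
  "grade_weight (p + q + r) p * grade_weight (q + r) q =
   grade_weight (p + q + r) (p + q) * grade_weight (p + q) p"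
  by (simp add: grade_weight_def real_sqrt_mult[symmetric] flip: of_real_mult)

lemma tmul_assoc: "tmul l (tmul m k) = tmul (tmul l m) k"
proof
  fix ls :: "'a list"
  let ?n = "length ls"
  let ?g = "\<lambda>p q. grade_weight ?n p * grade_weight (?n - p) q *
     (l (take p ls) * m (take q (drop p ls)) * k (drop (p + q) ls))"
  have "tmul l (tmul m k) ls = (\<Sum>p\<le>?n. \<Sum>q\<le>?n - p. ?g p q)"
    by (simp add: tmul_def sum_distrib_left mult_ac add.commute)
  also have "\<dots> = (\<Sum>(p, q)\<in>(SIGMA p:{..?n}. {..?n - p}). ?g p q)"
    by (simp add: sum.Sigma)
  also have "\<dots> = (\<Sum>(s, p)\<in>(SIGMA s:{..?n}. {..s}). grade_weight ?n s * grade_weight s p *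
     (l (take p ls) * m (take (s - p) (drop p ls)) * k (drop s ls)))"
  proof (rule sum.reindex_bij_witness[where i = "\<lambda>(s, p). (p, s - p)" and j = "\<lambda>(p, q). (p + q, p)"], goal_cases)
    case (5 a)
    then obtain p q where a: "a = (p, q)" "p + q \<le> ?n" by auto
    then obtain r where "?n = p + q + r" by (metis le_Suc_ex)
    then show ?case using a grade_weight_assoc[of p q r] by simp
  qed auto
  also have "\<dots> = (\<Sum>s\<le>?n. \<Sum>p\<le>s. grade_weight ?n s * grade_weight s p *
     (l (take p ls) * m (take (s - p) (drop p ls)) * k (drop s ls)))"
    by (simp add: sum.Sigma)
  also have "\<dots> = tmul (tmul l m) k ls"
    unfolding tmul_def sum_distrib_left sum_distrib_right
    by (intro sum.cong refl) (auto simp: sum_distrib_left sum_distrib_right min_def drop_take mult_ac intro!: sum.cong)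
  finally show "tmul l (tmul m k) ls = tmul (tmul l m) k ls" .
qed

lemma tmul_one_left: "tmul (tens []) l = l"
proof
  fix ls :: "'a list"
  have "tmul (tens []) l ls = (\<Sum>p\<le>length ls. if p = 0 then l ls else 0)"
    unfolding tmul_def by (intro sum.cong refl) (auto simp: tens_def)
  then show "tmul (tens []) l ls = l ls" by simp
qed

lemma tmul_one_right: "tmul l (tens []) = l"
proof
  fix ls :: "'a list"
  have "tmul l (tens []) ls = (\<Sum>p\<le>length ls. if p = length ls then l ls else 0)"
    unfolding tmul_def by (intro sum.cong refl) (auto simp: tens_def)
  then show "tmul l (tens []) ls = l ls" by simp
qed

lemma tmul_add_left: "tmul (\<lambda>ls. l ls + l' ls) m = (\<lambda>ls. tmul l m ls + tmul l' m ls)"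
  by (auto simp: tmul_def sum.distrib algebra_simps)

lemma tmul_add_right: "tmul m (\<lambda>ls. l ls + l' ls) = (\<lambda>ls. tmul m l ls + tmul m l' ls)"
  by (auto simp: tmul_def sum.distrib algebra_simps)

lemma tmul_scale_left: "tmul (\<lambda>ls. c * l ls) m = (\<lambda>ls. c * tmul l m ls)"
  by (auto simp: tmul_def sum_distrib_left mult_ac)

lemma tmul_scale_right: "tmul m (\<lambda>ls. c * l ls) = (\<lambda>ls. c * tmul m l ls)"
  by (auto simp: tmul_def sum_distrib_left mult_ac)

lemma alt_tens_short: "length ks \<le> 1 \<Longrightarrow> alt (tens ks) = tens ks"
proof
  fix ls :: "'a list"
  assume ks: "length ks \<le> 1"
  have "perm_sum (\<lambda>_. True) (tens ks) ls = fact (length ls) * tens ks ls"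
  proof (cases "length ls \<le> 1")
    case True
    then consider "ls = []" | x where "ls = [x]" by (cases ls) auto
    then show ?thesis by cases (simp_all add: perm_sum_pull[of "[_]"])
  next
    case False
    have "perm_sum (\<lambda>_. True) (tens ks) ls = perm_sum (\<lambda>_. True) (\<lambda>_. 0) ls"
      by (rule perm_sum_cong) (use False ks in \<open>auto simp: tens_def dest: mset_eq_length\<close>)
    then show ?thesis using False ks by (auto simp: perm_sum_def tens_def)
  qed
  then show "alt (tens ks) ls = tens ks ls" by (simp add: alt_perm_sum)
qed

text \<open>Only antisymmetry enters the type, so the product is total and the type is a ring with
  unit; antilinearity and the norm condition of \<open>Lam\<close> are tracked separately by
  \<open>glam\<close>.\<close>

typedef (overloaded) 'l grass = "{l :: 'l::chilbert_space tensor. alt l = l}"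
  morphisms gval Grass
  by (rule exI[of _ "tens []"]) (simp add: alt_tens_short)

setup_lifting type_definition_grass

instantiation grass :: (chilbert_space) ring_1
begin

lift_definition zero_grass :: "'a grass" is "\<lambda>_. 0" by (auto simp: alt_def)
lift_definition one_grass :: "'a grass" is "tens []" by (simp add: alt_tens_short)
lift_definition plus_grass :: "'a grass \<Rightarrow> 'a grass \<Rightarrow> 'a grass" is "\<lambda>l m ls. l ls + m ls"
  by (simp add: alt_add)
lift_definition uminus_grass :: "'a grass \<Rightarrow> 'a grass" is "\<lambda>l ls. - l ls"
  subgoal for l using alt_scale[of "-1" l] by simp
  done
lift_definition minus_grass :: "'a grass \<Rightarrow> 'a grass \<Rightarrow> 'a grass" is "\<lambda>l m ls. l ls - m ls"
  subgoal for l m using alt_add[of l "\<lambda>ls. - m ls"] alt_scale[of "-1" m] by simp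
  done
lift_definition times_grass :: "'a grass \<Rightarrow> 'a grass \<Rightarrow> 'a grass" is gmul
  by (simp add: gmul_alt_tmul)

instance
proof
  fix a b c :: "'a grass"
  show "a * b * c = a * (b * c)" by transfer (simp add: gmul_alt_tmul tmul_assoc)
  show "1 * a = a" by transfer (simp add: gmul_alt_tmul tmul_one_left)
  show "a * 1 = a" by transfer (simp add: gmul_alt_tmul tmul_one_right)
  show "(a + b) * c = a * c + b * c" by transfer (simp add: gmul_alt_tmul tmul_add_left alt_add)
  show "a * (b + c) = a * b + a * c" by transfer (simp add: gmul_alt_tmul tmul_add_right alt_add)
  show "(0 :: 'a grass) \<noteq> 1" by transfer (auto simp: tens_def fun_eq_iff)
qed (transfer; simp add: algebra_simps fun_eq_iff)+

end

lemma gval_sum: "gval (\<Sum>i\<in>I. f i) ls = (\<Sum>i\<in>I. gval (f i) ls)"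
  by (induction I rule: infinite_finite_induct) (simp_all add: zero_grass.rep_eq plus_grass.rep_eq)

text \<open>Scalars are embedded as central elements, so that all scalar bookkeeping stays inside
  ring arithmetic.\<close>

lift_definition gscal :: "complex \<Rightarrow> 'l::chilbert_space grass" is "\<lambda>c ls. c * tens [] ls"
  by (simp add: alt_scale alt_tens_short)

lemma gval_gscal_mult: "gval (gscal c * a) ls = c * gval a ls"
  by transfer (simp add: gmul_alt_tmul tmul_scale_left tmul_one_left alt_scale)

lemma gscal_commute: "a * gscal c = gscal c * a"
  by transfer (simp add: gmul_alt_tmul tmul_scale_left tmul_scale_right tmul_one_left tmul_one_right)

lemma gscal_left_commute: "a * (gscal c * b) = gscal c * (a * b)"
  by (metis gscal_commute mult.assoc)

lemma gscal_0 [simp]: "gscal 0 = 0" by transfer simp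
lemma gscal_1 [simp]: "gscal 1 = 1" by transfer simp

lemma gscal_mult: "gscal (c * d) = gscal c * gscal d"
  by (rule gval_inject[THEN iffD1], rule ext, subst gval_gscal_mult) (transfer, simp)

lemma grass_eqI: "(\<And>ls. gval a ls = gval b ls) \<Longrightarrow> a = b"
  by (metis ext gval_inject)

lift_definition ggen :: "'l::chilbert_space \<Rightarrow> 'l grass" is "\<lambda>k. tens [k]"
  by (simp add: alt_tens_short)

text \<open>The \<open>d\<close>-th power of the grading automorphism: what an element picks up when
  something of degree parity \<open>d\<close> moves past it.\<close>

lift_definition galpha :: "nat \<Rightarrow> 'l::chilbert_space grass \<Rightarrow> 'l grass" is
  "\<lambda>d l ls. (-1) ^ (d * length ls) * l ls"
proof
  fix d and l :: "'l tensor" and ls :: "'l list" assume "alt l = l"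
  have "alt (\<lambda>ls. (-1) ^ (d * length ls) * l ls) ls = alt (\<lambda>ys. (-1) ^ (d * length ls) * l ys) ls"
    by (rule alt_cong) simp
  then show "alt (\<lambda>ls. (-1) ^ (d * length ls) * l ls) ls = (-1) ^ (d * length ls) * l ls"
    using \<open>alt l = l\<close> by (simp add: alt_scale)
qed

definition ghom :: "nat \<Rightarrow> 'l::chilbert_space grass \<Rightarrow> bool" where
  "ghom d a \<longleftrightarrow> (\<forall>ls. gval a ls \<noteq> 0 \<longrightarrow> even (length ls + d))"

lemma galpha_mult: "galpha d (a * b) = galpha d a * galpha d b"
proof (transfer, rule ext)
  fix d and a b :: "'a tensor" and ls :: "'a list"
  have "tmul (\<lambda>ls. (-1) ^ (d * length ls) * a ls) (\<lambda>ls. (-1) ^ (d * length ls) * b ls) ys =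
     (-1) ^ (d * length ys) * tmul a b ys" for ys
    unfolding tmul_def sum_distrib_left
    by (intro sum.cong refl)
       (auto simp: min_def mult_ac simp flip: power_add add_mult_distrib2 distrib_left)
  then have "gmul (\<lambda>ls. (-1) ^ (d * length ls) * a ls) (\<lambda>ls. (-1) ^ (d * length ls) * b ls) ls =
     alt (\<lambda>ys. (-1) ^ (d * length ys) * tmul a b ys) ls"
    unfolding gmul_alt_tmul by (intro alt_cong)
  also have "\<dots> = alt (\<lambda>ys. (-1) ^ (d * length ls) * tmul a b ys) ls"
    by (rule alt_cong) simp
  finally show "(-1) ^ (d * length ls) * gmul a b ls =
     gmul (\<lambda>ls. (-1) ^ (d * length ls) * a ls) (\<lambda>ls. (-1) ^ (d * length ls) * b ls) ls"
    by (simp add: gmul_alt_tmul alt_scale)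
qed

lemma galpha_even: "even d \<Longrightarrow> galpha d a = a"
  by transfer (auto simp: fun_eq_iff)

lemma galpha_ghom: "ghom e a \<Longrightarrow> galpha d a = gscal ((-1) ^ (d * e)) * a"
proof (rule grass_eqI)
  fix ls assume "ghom e a"
  then have "gval a ls = 0 \<or> even (length ls + e)" by (auto simp: ghom_def)
  then show "gval (galpha d a) ls = gval (gscal ((-1) ^ (d * e)) * a) ls"
    by (auto simp: galpha.rep_eq gval_gscal_mult minus_one_power_iff)
qed

text \<open>Graded commutativity with only \<open>a\<close> homogeneous; the sign depends on the
  degree in \<open>b\<close> and is carried by the automorphism.\<close>

lemma ghom_commute:
  assumes "ghom d a"
  shows "b * a = a * galpha d b"
proof (rule grass_eqI)
  fix ls
  have "alt (tmul (gval b) (gval a)) ls = alt (tmul (gval a) (gval (galpha d b))) ls"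
    unfolding alt_tmul_sum
  proof (rule sum.reindex_bij_witness[where i = "\<lambda>p. length ls - p" and j = "\<lambda>p. length ls - p"], goal_cases)
    case (5 p)
    let ?n = "length ls" let ?T = "\<lambda>_::'a. True"
    have "perm_sum ?T (\<lambda>ys. gval a (take (?n - p) ys) * gval (galpha d b) (drop (?n - p) ys)) ls =
      perm_sum ?T (\<lambda>ys. (-1) ^ (p * (?n - p)) * (gval a (take (?n - p) ys) * gval b (drop (?n - p) ys))) ls"
    proof (rule perm_sum_cong)
      fix ys assume "mset ys = mset ls"
      then have l: "length ys = ?n" by (rule mset_eq_length)
      have "gval a (take (?n - p) ys) = 0 \<or> even (?n - p + d)"
        using assms l unfolding ghom_def by (metis diff_le_self length_take min.absorb2)
      then show "gval a (take (?n - p) ys) * gval (galpha d b) (drop (?n - p) ys) =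
        (-1) ^ (p * (?n - p)) * (gval a (take (?n - p) ys) * gval b (drop (?n - p) ys))"
        using 5 l by (auto simp: galpha.rep_eq minus_one_power_iff)
    qed
    then show ?case
      using 5 perm_sum_append_commute[of p ls ?T "gval b" "gval a"]
      by (simp add: perm_sum_cmult grade_weight_diff)
  qed auto
  then show "gval (b * a) ls = gval (a * galpha d b) ls"
    by (simp add: times_grass.rep_eq gmul_alt_tmul)
qed

lemma ghom_1: "ghom 0 1"
  unfolding ghom_def by transfer (auto simp: tens_def)

lemma ghom_ggen: "ghom 1 (ggen k)"
  unfolding ghom_def by transfer (auto simp: tens_def split: if_splits)

lemma ghom_galpha: "ghom d a \<longleftrightarrow> (\<forall>ls. gval (galpha 1 a) ls = (-1) ^ d * gval a ls)"
proof -
  have "(gval a ls \<noteq> 0 \<longrightarrow> even (length ls + d)) = (gval (galpha 1 a) ls = (-1) ^ d * gval a ls)" for ls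
    by (auto simp: galpha.rep_eq minus_one_power_iff)
  then show ?thesis by (simp add: ghom_def)
qed

text \<open>Homogeneous elements are eigenvectors of the ring automorphism \<open>galpha 1\<close>,
  from which the product rule \<open>ghom_mult\<close> follows at once.\<close>

lemma ghom_iff: "ghom d a \<longleftrightarrow> galpha 1 a = gscal ((-1) ^ d) * a"
  unfolding ghom_galpha by (metis grass_eqI gval_gscal_mult)

lemma ghom_mult:
  assumes "ghom d a" "ghom e b" shows "ghom (d + e) (a * b)"
  using assms unfolding ghom_iff
  by (simp only: galpha_mult power_add gscal_mult mult.assoc gscal_left_commute[of a])

lemma ghom_cong: "ghom d a \<Longrightarrow> even d = even e \<Longrightarrow> ghom e a"
  by (auto simp: ghom_def)

text \<open>Only the split at \<open>p = 1\<close> survives. Its weight, the square root of the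
  length \<open>Suc n\<close>, meets \<open>fact n / fact (Suc n)\<close> from the two
  symmetrisations and leaves the inverse square root.\<close>

lemma gval_ggen_mult:
  assumes "ls \<noteq> []"
  shows "gval (ggen k * b) ls = complex_of_real (1 / sqrt (length ls)) *
    pull_sum (\<lambda>_. True) (\<lambda>y r. cinner y k * gval b r) ls"
proof -
  let ?T = "\<lambda>_::'a. True"
  obtain n where n: "length ls = Suc n" using assms by (cases ls) auto
  have ab: "perm_sum ?T (gval b) r = fact (length r) * gval b r" for r
    using gval[of b] by (simp add: perm_sum_alt)
  have "gval (ggen k * b) ls = alt (tmul (tens [k]) (gval b)) ls"
    by (simp add: times_grass.rep_eq gmul_alt_tmul ggen.rep_eq)
  also have "\<dots> = (\<Sum>p\<le>length ls. if p = 1 then grade_weight (Suc n) 1 *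
     (perm_sum ?T (\<lambda>ys. tens [k] (take 1 ys) * gval b (drop 1 ys)) ls / fact (Suc n)) else 0)"
    unfolding alt_tmul_sum
  proof (intro sum.cong refl)
    fix p assume "p \<in> {..length ls}"
    then have "perm_sum ?T (\<lambda>ys. tens [k] (take p ys) * gval b (drop p ys)) ls = perm_sum ?T (\<lambda>ys. 0) ls"
      if "p \<noteq> 1"
      using that by (intro perm_sum_cong) (auto simp: tens_def dest!: mset_eq_length)
    then show "grade_weight (length ls) p * (perm_sum ?T (\<lambda>ys. tens [k] (take p ys) * gval b (drop p ys)) ls / fact (length ls)) =
      (if p = 1 then grade_weight (Suc n) 1 *
     (perm_sum ?T (\<lambda>ys. tens [k] (take 1 ys) * gval b (drop 1 ys)) ls / fact (Suc n)) else 0)"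
      by (auto simp: n perm_sum_def)
  qed
  also have "\<dots> = grade_weight (Suc n) 1 *
     (perm_sum ?T (\<lambda>ys. tens [k] (take 1 ys) * gval b (drop 1 ys)) ls / fact (Suc n))"
    using n by simp
  also have "perm_sum ?T (\<lambda>ys. tens [k] (take 1 ys) * gval b (drop 1 ys)) ls =
    pull_sum ?T (\<lambda>y r. fact n * (cinner y k * gval b r)) ls"
    unfolding perm_sum_pull[OF assms]
  proof (rule pull_sum_cong')
    fix y :: 'a and r :: "'a list" assume "length ls = Suc (length r)"
    then show "perm_sum ?T (\<lambda>r'. tens [k] (take 1 (y # r')) * gval b (drop 1 (y # r'))) r =
      fact n * (cinner y k * gval b r)"
      using n by (simp add: perm_sum_cmult ab) (simp add: tens_def)
  qed
  also have "\<dots> = fact n * pull_sum ?T (\<lambda>y r. cinner y k * gval b r) ls"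
    by (rule pull_sum_cmult)
  also have "grade_weight (Suc n) 1 * (fact n * x / fact (Suc n)) = complex_of_real (1 / sqrt (Suc n)) * x" for x
  proof -
    define s where "s = complex_of_real (sqrt (Suc n))"
    have "grade_weight (Suc n) 1 = s"
      by (simp add: grade_weight_def fact_reduce s_def)
    moreover have "s * s = of_nat (Suc n)"
      unfolding s_def of_real_mult[symmetric] by simp
    then have "fact (Suc n) = s * s * fact n" by simp
    moreover have "s \<noteq> 0" by (simp add: s_def)
    moreover have "complex_of_real (1 / sqrt (Suc n)) = 1 / s" by (simp add: s_def)
    ultimately show ?thesis by (simp only:) (simp add: field_simps)
  qed
  finally show ?thesis by (simp add: n)
qed

section \<open>The involution on the Grassmann algebra\<close>

lemma invol_0 [simp]: "invol (0 :: 'a::involutive_hilbert_space) = 0"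
  using invol_add[of 0 0] by simp

lemma norm_invol: "norm (invol (x :: 'a::involutive_hilbert_space)) = norm x"
proof -
  have "complex_of_real ((norm (invol x))\<^sup>2) = complex_of_real ((norm x)\<^sup>2)"
    unfolding cinner_self[symmetric] by (simp add: cinner_invol) (simp add: cinner_self)
  then have "(norm (invol x))\<^sup>2 = (norm x)\<^sup>2" by (simp only: of_real_eq_iff)
  then show ?thesis by (simp add: power2_eq_iff_nonneg)
qed

lemma inj_invol: "inj (invol :: 'a::involutive_hilbert_space \<Rightarrow> 'a)"
  by (metis injI invol_invol)

lemma cinner_invol_swap: "cinner (invol x) y = cinner (invol y) (x :: 'a::involutive_hilbert_space)"
  by (metis cinner_invol invol_invol cinner_commute)

lemma orthonormal_invol:
  assumes "orthonormal (A :: 'a::involutive_hilbert_space set)" shows "orthonormal (invol ` A)"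
  using assms by (auto simp: orthonormal_def cinner_invol inj_eq[OF inj_invol])

text \<open>Reversal is a permutation whose sign depends only on the length; acting on the function
  or on the list it produces the same sign.\<close>

lemma alt_rev: "alt (\<lambda>ls. F (rev ls)) ls = alt F (rev ls)"
proof -
  let ?n = "length ls" let ?T = "\<lambda>_::'a. True"
  define t where "t i = (if i < ?n then ?n - Suc i else i)" for i
  have t: "t permutes {..<?n}"
  proof (rule bij_imp_permutes)
    have "inj_on t {..<?n}" by (auto simp: inj_on_def t_def)
    moreover have "t ` {..<?n} \<subseteq> {..<?n}" by (auto simp: t_def)
    ultimately show "bij_betw t {..<?n} {..<?n}" by (simp add: bij_betw_def endo_inj_surj)
  qed (auto simp: t_def)
  have r: "permute_list t ys = rev ys" if "length ys = ?n" for ys :: "'a list"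
    by (rule nth_equalityI) (auto simp: permute_list_def that t_def rev_nth)
  define c where "c = complex_of_int (sign t)"
  have k: "perm_koszul ?T t ys = c" if "length ys = ?n" for ys :: "'a list"
    using perm_koszul_True[of t ys] t that by (simp add: c_def)
  have "perm_sum ?T (\<lambda>ls. F (rev ls)) ls =
    perm_sum ?T (\<lambda>ys. c * (perm_koszul ?T t ys * F (permute_list t ys))) ls"
    by (rule perm_sum_cong) (auto simp: k r c_def sign_def dest!: mset_eq_length)
  also have "\<dots> = perm_sum ?T F (rev ls)"
    using perm_sum_permute[OF t, of ?T F] perm_sum_twist[OF t, of ?T F]
    by (simp add: perm_sum_cmult r k)
  finally show ?thesis by (simp add: alt_perm_sum)
qed

lemma alt_map: "alt (\<lambda>ls. F (map f ls)) ls = alt F (map f ls)"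
  unfolding alt_def by (auto simp: permute_list_map intro!: arg_cong2[where f = "(/)"] sum.cong)

lemma alt_cnj: "alt (\<lambda>ls. cnj (F ls)) ls = cnj (alt F ls)"
  by (simp add: alt_def)

lemma alt_tstar: "alt (tstar F) = tstar (alt F)"
proof
  fix ls :: "'a list"
  have "alt (tstar F) ls = cnj (alt (\<lambda>ls. F (rev (map invol ls))) ls)"
    unfolding tstar_def by (rule alt_cnj)
  also have "alt (\<lambda>ls. F (rev (map invol ls))) ls = alt F (rev (map invol ls))"
    using alt_map[of "\<lambda>ls. F (rev ls)" invol ls] by (simp add: alt_rev)
  finally show "alt (tstar F) ls = tstar (alt F) ls" by (simp add: tstar_def)
qed

lemma cnj_grade_weight [simp]: "cnj (grade_weight n p) = grade_weight n p"
  by (simp add: grade_weight_def)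

lemma tstar_tmul: "tstar (tmul l m) = tmul (tstar m) (tstar l)"
proof
  fix ls :: "'a list"
  let ?n = "length ls"
  have "tstar (tmul l m) ls = (\<Sum>p\<le>?n. grade_weight ?n p *
      (cnj (l (take p (rev (map invol ls)))) * cnj (m (drop p (rev (map invol ls))))))"
    by (simp add: tstar_def tmul_def)
  also have "\<dots> = (\<Sum>p\<le>?n. grade_weight ?n p * (tstar m (take p ls) * tstar l (drop p ls)))"
    by (rule sum.reindex_bij_witness[where i = "\<lambda>p. ?n - p" and j = "\<lambda>p. ?n - p"])
       (auto simp: tstar_def take_map drop_map grade_weight_diff take_rev drop_rev)
  finally show "tstar (tmul l m) ls = tmul (tstar m) (tstar l) ls" by (simp add: tmul_def)
qed

lemma tstar_tstar: "tstar (tstar F) = F"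
  by (simp add: tstar_def rev_map o_def invol_invol fun_eq_iff)

lift_definition gstar :: "'l::involutive_hilbert_space grass \<Rightarrow> 'l grass" is tstar
  by (simp add: alt_tstar)

lemma gstar_mult: "gstar (a * b) = gstar b * gstar a"
  by transfer (simp add: gmul_alt_tmul alt_tstar[symmetric] tstar_tmul)

lemma gstar_add: "gstar (a + b) = gstar a + gstar b"
  by transfer (simp add: tstar_def)

lemma gstar_1 [simp]: "gstar 1 = 1"
  by transfer (simp add: tstar_tens)

lemma gstar_gstar [simp]: "gstar (gstar a) = a"
  by transfer (simp add: tstar_tstar)

lemma gstar_ggen: "gstar (ggen k) = ggen (invol k)"
  by transfer (simp add: tstar_tens)

lemma gstar_gscal: "gstar (gscal c) = gscal (cnj c)"
  by transfer (auto simp: tstar_def tens_def)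

lemma gstar_prod_list: "gstar (prod_list as) = prod_list (map gstar (rev as))"
  by (induction as) (simp_all add: gstar_mult)

subsection \<open>Closure properties of \<open>Lam\<close>\<close>

lemma multi_antilinear_iff_update:
  "multi_antilinear F \<longleftrightarrow> (\<forall>xs k x y a b. k < length xs \<longrightarrow>
     F (xs[k := scaleC a x + scaleC b y]) = cnj a * F (xs[k := x]) + cnj b * F (xs[k := y]))"
  (is "_ = ?R")
proof
  assume F: "multi_antilinear F"
  show ?R
  proof (intro allI impI)
    fix xs :: "'a list" and k x y a b assume "k < length xs"
    then show "F (xs[k := scaleC a x + scaleC b y]) = cnj a * F (xs[k := x]) + cnj b * F (xs[k := y])"
      using F unfolding multi_antilinear_def by (simp add: upd_conv_take_nth_drop)
  qed
next
  assume R: ?R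
  show "multi_antilinear F"
    unfolding multi_antilinear_def
  proof (intro allI)
    fix us vs :: "'a list" and x y a b
    show "F (us @ (scaleC a x + scaleC b y) # vs) = cnj a * F (us @ x # vs) + cnj b * F (us @ y # vs)"
      using R[rule_format, of "length us" "us @ x # vs" a x b y] by simp
  qed
qed

lemma multi_antilinear_update:
  "multi_antilinear F \<Longrightarrow> k < length xs \<Longrightarrow>
     F (xs[k := scaleC a x + scaleC b y]) = cnj a * F (xs[k := x]) + cnj b * F (xs[k := y])"
  by (simp add: multi_antilinear_iff_update)

lemma permute_list_update:
  assumes s: "s permutes {..<length xs}" and k: "k < length xs"
  shows "permute_list s (xs[k := v]) = (permute_list s xs)[inv s k := v]" and "inv s k < length xs"
proof -
  show i: "inv s k < length xs" using permutes_in_image[OF permutes_inv[OF s]] k by simp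
  show "permute_list s (xs[k := v]) = (permute_list s xs)[inv s k := v]"
  proof (rule nth_equalityI)
    fix i assume "i < length (permute_list s (xs[k := v]))"
    then have "i < length xs" by simp
    moreover have "s i = k \<longleftrightarrow> inv s k = i" using permutes_inverses[OF s] by metis
    ultimately show "permute_list s (xs[k := v]) ! i = (permute_list s xs)[inv s k := v] ! i"
      using permutes_in_image[OF s, of i] i by (auto simp: permute_list_def nth_list_update)
  qed simp
qed

lemma multi_antilinear_sum:
  assumes "\<And>i. i \<in> I \<Longrightarrow> multi_antilinear (F i)"
  shows "multi_antilinear (\<lambda>ls. \<Sum>i\<in>I. c i * F i ls)"
  using assms unfolding multi_antilinear_def
  by (simp add: sum_distrib_left sum.distrib algebra_simps)

lemma multi_antilinear_tens: "multi_antilinear (tens fs)"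
  unfolding multi_antilinear_iff_update
proof (intro allI impI)
  fix xs :: "'a list" and k x y a b assume k: "k < length xs"
  show "tens fs (xs[k := scaleC a x + scaleC b y]) =
    cnj a * tens fs (xs[k := x]) + cnj b * tens fs (xs[k := y])"
  proof (cases "length xs = length fs")
    case True
    then have "k \<in> {..<length fs}" using k by simp
    then have "(\<Prod>i<length fs. cinner (xs[k := v] ! i) (fs ! i)) =
      cinner v (fs ! k) * (\<Prod>i\<in>{..<length fs} - {k}. cinner (xs ! i) (fs ! i))" for v
      using k by (subst prod.remove[of _ k]) (auto intro!: prod.cong)
    then show ?thesis using True
      by (simp add: tens_def cinner_add_left cinner_scaleC_left algebra_simps)
  qed (simp add: tens_def)
qed

lemma multi_antilinear_alt:
  assumes F: "multi_antilinear F" shows "multi_antilinear (alt F)"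
  unfolding multi_antilinear_iff_update
proof (intro allI impI)
  fix xs :: "'a list" and k x y a b assume k: "k < length xs"
  show "alt F (xs[k := scaleC a x + scaleC b y]) = cnj a * alt F (xs[k := x]) + cnj b * alt F (xs[k := y])"
  proof -
    let ?S = "{s. s permutes {..<length xs}}" let ?f = "\<lambda>s v. of_int (sign s) * F (permute_list s (xs[k := v]))"
    have "(\<Sum>s\<in>?S. ?f s (scaleC a x + scaleC b y)) = (\<Sum>s\<in>?S. cnj a * ?f s x + cnj b * ?f s y)"
      by (intro sum.cong)
        (simp_all add: permute_list_update k multi_antilinear_update[OF F] algebra_simps)
    then show ?thesis
      by (simp add: alt_def sum.distrib sum_distrib_left add_divide_distrib)
  qed
qed

lemma multi_antilinear_tmul:
  assumes "multi_antilinear l" "multi_antilinear m" shows "multi_antilinear (tmul l m)"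
  unfolding multi_antilinear_iff_update
proof (intro allI impI)
  fix xs :: "'a list" and k x y a b assume k: "k < length xs"
  have "l (take p (xs[k := scaleC a x + scaleC b y])) * m (drop p (xs[k := scaleC a x + scaleC b y])) =
    cnj a * (l (take p (xs[k := x])) * m (drop p (xs[k := x]))) +
    cnj b * (l (take p (xs[k := y])) * m (drop p (xs[k := y])))" for p
  proof (cases "k < p")
    case True
    then show ?thesis using k
      by (simp add: take_update_swap multi_antilinear_update[OF assms(1)] algebra_simps)
  next
    case False
    then show ?thesis using k
      by (simp add: drop_update_swap multi_antilinear_update[OF assms(2)] algebra_simps)
  qed
  then show "tmul l m (xs[k := scaleC a x + scaleC b y]) =
     cnj a * tmul l m (xs[k := x]) + cnj b * tmul l m (xs[k := y])"
    by (simp add: tmul_def sum.distrib sum_distrib_left algebra_simps)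
qed

lemma multi_antilinear_tstar:
  assumes "multi_antilinear (l :: 'a::involutive_hilbert_space tensor)"
  shows "multi_antilinear (tstar l)"
  using assms unfolding multi_antilinear_def tstar_def
  by (simp add: invol_add invol_scaleC)

text \<open>The square of the Hilbert-Schmidt norm in degree \<open>n\<close>, taken over one finite
  family \<open>A\<close>.\<close>

definition hs_norm :: "'a::chilbert_space tensor \<Rightarrow> 'a set \<Rightarrow> nat \<Rightarrow> real" where
  "hs_norm l A n = (\<Sum>as | as \<in> lists A \<and> length as = n. (cmod (l as))\<^sup>2)"

lemma finite_lists_length_le': "finite A \<Longrightarrow> finite {as \<in> lists A. length as \<le> n}"
  using finite_lists_length_le[of A n] by (simp add: lists_eq_set)

lemma hs_norm_nonneg: "hs_norm l A n \<ge> 0"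
  by (simp add: hs_norm_def sum_nonneg)

lemma sum_lists_le:
  assumes "finite A"
  shows "(\<Sum>as\<in>{as \<in> lists A. length as \<le> N}. f as) = (\<Sum>n\<le>N. \<Sum>as | as \<in> lists A \<and> length as = n. f as)"
proof -
  have "(\<Sum>n\<le>N. \<Sum>as\<in>{as \<in> {as \<in> lists A. length as \<le> N}. length as = n}. f as) =
    (\<Sum>as\<in>{as \<in> lists A. length as \<le> N}. f as)"
    by (rule sum.group) (use finite_lists_length_le'[OF assms] in auto)
  moreover have "(\<Sum>n\<le>N. \<Sum>as\<in>{as \<in> {as \<in> lists A. length as \<le> N}. length as = n}. f as) =
    (\<Sum>n\<le>N. \<Sum>as | as \<in> lists A \<and> length as = n. f as)"
    by (intro sum.cong) auto
  ultimately show ?thesis by simp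
qed

lemma Lam_iff:
  "l \<in> Lam \<longleftrightarrow> multi_antilinear l \<and> alt l = l \<and>
     (\<exists>C. \<forall>A N. finite A \<and> orthonormal A \<longrightarrow> (\<Sum>n\<le>N. hs_norm l A n / (fact n)\<^sup>2) \<le> C)"
proof -
  have "(\<Sum>as\<in>{as \<in> lists A. length as \<le> N}. (cmod (l as) / fact (length as))\<^sup>2) =
    (\<Sum>n\<le>N. hs_norm l A n / (fact n)\<^sup>2)" if "finite A" for A N
    unfolding sum_lists_le[OF that] hs_norm_def sum_divide_distrib
    by (intro sum.cong refl) (auto simp: power_divide)
  then have *: "(finite A \<and> orthonormal A \<longrightarrow> (\<Sum>as\<in>{as \<in> lists A. length as \<le> N}. (cmod (l as) / fact (length as))\<^sup>2) \<le> C)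
    = (finite A \<and> orthonormal A \<longrightarrow> (\<Sum>n\<le>N. hs_norm l A n / (fact n)\<^sup>2) \<le> C)" for A N C
    by auto
  show ?thesis by (simp only: Lam_def mem_Collect_eq *)
qed

text \<open>\<open>alt\<close> is a signed average over \<open>fact n\<close> rearrangements, each
  of which merely permutes the lists over \<open>A\<close>; convexity of the square does the
  rest.\<close>

lemma hs_norm_alt_le:
  assumes "finite A" shows "hs_norm (alt F) A n \<le> hs_norm F A n"
proof -
  let ?L = "{as \<in> lists A. length as = n}" let ?S = "{s. s permutes {..<n}}"
  have S: "finite ?S" "card ?S = fact n" by (simp_all add: finite_permutations card_permutations[OF refl])
  have "(cmod (alt F as))\<^sup>2 \<le> (\<Sum>s\<in>?S. (cmod (F (permute_list s as)))\<^sup>2) / fact n" if as: "as \<in> ?L" for as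
  proof -
    have "cmod (alt F as) \<le> (\<Sum>s\<in>?S. cmod (F (permute_list s as))) / fact n"
      using as unfolding alt_def
      by (auto simp: norm_divide norm_mult intro!: divide_right_mono order.trans[OF norm_sum] sum_mono)
        (simp add: sign_def)
    then have "(cmod (alt F as))\<^sup>2 \<le> ((\<Sum>s\<in>?S. cmod (F (permute_list s as))) / fact n)\<^sup>2"
      by (rule power_mono) simp
    also have "\<dots> \<le> ((\<Sum>s\<in>?S. (cmod (F (permute_list s as)))\<^sup>2) * fact n) / (fact n)\<^sup>2"
      unfolding power_divide
      using sum_squared_le_sum_of_squares[of "\<lambda>s. cmod (F (permute_list s as))" ?S] S(2)
      by (intro divide_right_mono) auto
    finally show ?thesis by (simp add: power2_eq_square)
  qed
  then have "hs_norm (alt F) A n \<le> (\<Sum>as\<in>?L. (\<Sum>s\<in>?S. (cmod (F (permute_list s as)))\<^sup>2) / fact n)"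
    unfolding hs_norm_def by (intro sum_mono)
  also have "\<dots> = (\<Sum>s\<in>?S. \<Sum>as\<in>?L. (cmod (F (permute_list s as)))\<^sup>2) / fact n"
    by (subst sum.swap) (simp add: sum_divide_distrib)
  also have "(\<Sum>s\<in>?S. \<Sum>as\<in>?L. (cmod (F (permute_list s as)))\<^sup>2) = (\<Sum>s\<in>?S. hs_norm F A n)"
  proof (rule sum.cong[OF refl])
    fix s assume "s \<in> ?S"
    then have s: "s permutes {..<n}" by simp
    then have si: "inv s permutes {..<n}" by (rule permutes_inv)
    have "permute_list (inv s) (permute_list s as) = as" "permute_list s (permute_list (inv s) as) = as"
      if "length as = n" for as :: "'a list"
      using permute_list_compose[of "inv s" as s] permute_list_compose[of s as "inv s"] s si that
      by (simp_all add: permutes_inv_o)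
    moreover have "set (permute_list s as) = set as" "set (permute_list (inv s) as) = set as"
      if "length as = n" for as :: "'a list"
      using set_permute_list[of s as] set_permute_list[of "inv s" as] s si that by auto
    ultimately show "(\<Sum>as\<in>?L. (cmod (F (permute_list s as)))\<^sup>2) = hs_norm F A n"
      unfolding hs_norm_def
      by (intro sum.reindex_bij_witness[where i = "permute_list (inv s)" and j = "permute_list s"])
         (auto simp: in_lists_conv_set)
  qed
  finally show ?thesis by (simp add: S(2))
qed

lemma hs_norm_tensor:
  assumes "finite A" "p \<le> n"
  shows "hs_norm (\<lambda>as. l (take p as) * m (drop p as)) A n = hs_norm l A p * hs_norm m A (n - p)"
proof -
  let ?L = "\<lambda>n. {as \<in> lists A. length as = n}"
  have "hs_norm l A p * hs_norm m A (n - p) =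
    (\<Sum>(us, vs)\<in>?L p \<times> ?L (n - p). (cmod (l us))\<^sup>2 * (cmod (m vs))\<^sup>2)"
    unfolding hs_norm_def sum_product by (simp add: sum.cartesian_product)
  also have "\<dots> = (\<Sum>as\<in>?L n. (cmod (l (take p as) * m (drop p as)))\<^sup>2)"
    by (rule sum.reindex_bij_witness[where i = "\<lambda>as. (take p as, drop p as)" and j = "\<lambda>(us, vs). us @ vs"])
       (use assms in \<open>auto simp: norm_mult power_mult_distrib in_lists_conv_set dest: in_set_takeD in_set_dropD\<close>)
  finally show ?thesis by (simp add: hs_norm_def)
qed

text \<open>For \<open>n \<ge> 2\<close> the two end terms give 2; the others are at most
  \<open>1 / n\<close>, hence at most \<open>2 / (n + 1)\<close>, and these sum to at most
  2.\<close>

lemma sum_inverse_binomial_le: "(\<Sum>p\<le>n. 1 / real (n choose p)) \<le> 4"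
proof (cases "n \<le> 1")
  case True
  then have "n = 0 \<or> n = 1" by auto
  then show ?thesis by auto
next
  case False
  have ge: "n \<le> n choose p" if "0 < p" "p < n" for p
    using that
  proof (induction n arbitrary: p)
    case (Suc n)
    obtain q where p: "p = Suc q" using Suc.prems by (cases p) auto
    show ?case
    proof (cases "p = n")
      case True
      then show ?thesis using binomial_symmetric[of n "Suc n"] by simp
    next
      case False
      then have "n \<le> n choose p" using Suc by auto
      moreover have "n choose q \<ge> 1" using Suc.prems p by (simp add: Suc_le_eq)
      ultimately show ?thesis by (simp add: p)
    qed
  qed simp
  have "(\<Sum>p\<le>n. 1 / real (n choose p)) \<le> (\<Sum>p\<le>n. (if p = 0 then 1 else 0) + (if p = n then 1 else 0) + 2 / real (n + 1))"
  proof (rule sum_mono)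
    fix p assume "p \<in> {..n}"
    then consider "p = 0" | "p = n" | "0 < p" "p < n" by fastforce
    then show "1 / real (n choose p) \<le> (if p = 0 then 1 else 0) + (if p = n then 1 else 0) + 2 / real (n + 1)"
    proof cases
      case 3
      then have "real n \<le> real (n choose p)" using ge[of p] by simp
      then have "1 / real (n choose p) \<le> 1 / real n" using 3 by (intro divide_left_mono) auto
      also have "\<dots> \<le> 2 / real (n + 1)" using 3 by (simp add: field_simps)
      finally show ?thesis using 3 by simp
    qed auto
  qed
  also have "\<dots> = 4" by (simp only: sum.distrib) (simp add: field_simps)
  finally show ?thesis .
qed

text \<open>The weights \<open>1 / (fact n)\<^sup>2\<close> make the product bounded: divided by
  \<open>fact n\<close>, the weight of the split at \<open>p\<close> is
  \<open>1 / (fact p * fact (n - p))\<close> times the inverse square root of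
  \<open>n choose p\<close>. Cauchy-Schwarz and \<open>sum_inverse_binomial_le\<close> give the
  constant 4.\<close>

lemma hs_norm_gmul_le:
  assumes A: "finite A"
  shows "hs_norm (gmul l m) A n / (fact n)\<^sup>2 \<le>
    4 * (\<Sum>p\<le>n. (hs_norm l A p / (fact p)\<^sup>2) * (hs_norm m A (n - p) / (fact (n - p))\<^sup>2))"
proof -
  let ?L = "{as \<in> lists A. length as = n}"
  define T where "T p = alt (\<lambda>as. l (take p as) * m (drop p as))" for p
  define c where "c p = sqrt (1 / real (n choose p))" for p
  define b where "b p as = cmod (T p as) / (fact p * fact (n - p))" for p as
  have g: "(cmod (gmul l m as) / fact n)\<^sup>2 \<le> 4 * (\<Sum>p\<le>n. (b p as)\<^sup>2)" if as: "as \<in> ?L" for as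
  proof -
    have w: "cmod (grade_weight n p) * x / fact n = c p * (x / (fact p * fact (n - p)))" if "p \<le> n" for p x
    proof -
      define q :: real where "q = fact p * fact (n - p)"
      have q: "q > 0" by (simp add: q_def)
      have "real (n choose p) = fact n / q" using that by (simp add: binomial_fact q_def)
      then have c: "c p = sqrt (q / fact n)" by (simp add: c_def)
      have gw: "cmod (grade_weight n p) = sqrt (fact n / q)" using q by (simp add: grade_weight_def q_def)
      have "sqrt (fact n / q) * q = sqrt (q / fact n) * fact n"
        using q by (simp add: real_sqrt_divide real_div_sqrt field_simps)
      then show ?thesis using q by (simp add: gw c q_def[symmetric] field_simps)
    qed
    have "cmod (gmul l m as) \<le> (\<Sum>p\<le>n. cmod (grade_weight n p) * cmod (T p as))"
      unfolding gmul_alt_tmul alt_tmul_sum T_def alt_perm_sum[symmetric]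
      using as by (auto simp: norm_mult alt_perm_sum norm_divide intro!: order.trans[OF norm_sum] sum_mono)
    then have "cmod (gmul l m as) / fact n \<le> (\<Sum>p\<le>n. cmod (grade_weight n p) * cmod (T p as)) / fact n"
      by (rule divide_right_mono) simp
    also have "\<dots> = (\<Sum>p\<le>n. c p * b p as)"
      unfolding sum_divide_distrib b_def by (rule sum.cong) (simp_all add: w)
    finally have "(cmod (gmul l m as) / fact n)\<^sup>2 \<le> (\<Sum>p\<le>n. c p * b p as)\<^sup>2"
      by (rule power_mono) simp
    also have "\<dots> \<le> (\<Sum>p\<le>n. (c p)\<^sup>2) * (\<Sum>p\<le>n. (b p as)\<^sup>2)" by (rule Cauchy_Schwarz_ineq_sum)
    also have "\<dots> \<le> 4 * (\<Sum>p\<le>n. (b p as)\<^sup>2)"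
      using sum_inverse_binomial_le[of n] by (intro mult_right_mono) (simp_all add: c_def sum_nonneg)
    finally show ?thesis .
  qed
  have "hs_norm (gmul l m) A n / (fact n)\<^sup>2 = (\<Sum>as\<in>?L. (cmod (gmul l m as) / fact n)\<^sup>2)"
    by (simp add: hs_norm_def sum_divide_distrib power_divide)
  also have "\<dots> \<le> (\<Sum>as\<in>?L. 4 * (\<Sum>p\<le>n. (b p as)\<^sup>2))" by (rule sum_mono) (rule g)
  also have "\<dots> = 4 * (\<Sum>p\<le>n. \<Sum>as\<in>?L. (b p as)\<^sup>2)"
    by (subst sum.swap) (simp add: sum_distrib_left)
  also have "(\<Sum>p\<le>n. \<Sum>as\<in>?L. (b p as)\<^sup>2) = (\<Sum>p\<le>n. hs_norm (T p) A n / (fact p * fact (n - p))\<^sup>2)"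
    by (simp add: b_def hs_norm_def power_divide sum_divide_distrib)
  also have "\<dots> \<le> (\<Sum>p\<le>n. (hs_norm l A p / (fact p)\<^sup>2) * (hs_norm m A (n - p) / (fact (n - p))\<^sup>2))"
  proof (rule sum_mono)
    fix p assume "p \<in> {..n}"
    then have "hs_norm (T p) A n \<le> hs_norm l A p * hs_norm m A (n - p)"
      unfolding T_def using hs_norm_alt_le[OF A] hs_norm_tensor[OF A, of p n l m] by (metis atMost_iff)
    then show "hs_norm (T p) A n / (fact p * fact (n - p))\<^sup>2 \<le>
      (hs_norm l A p / (fact p)\<^sup>2) * (hs_norm m A (n - p) / (fact (n - p))\<^sup>2)"
      by (simp add: power_mult_distrib divide_right_mono)
  qed
  finally show ?thesis by simp
qed

lemma Lam_gmul:
  assumes l: "l \<in> Lam" and m: "m \<in> Lam" shows "gmul l m \<in> Lam"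
proof -
  from l obtain C where C: "\<And>A N. finite A \<Longrightarrow> orthonormal A \<Longrightarrow> (\<Sum>n\<le>N. hs_norm l A n / (fact n)\<^sup>2) \<le> C"
    unfolding Lam_iff by blast
  from m obtain D where D: "\<And>A N. finite A \<Longrightarrow> orthonormal A \<Longrightarrow> (\<Sum>n\<le>N. hs_norm m A n / (fact n)\<^sup>2) \<le> D"
    unfolding Lam_iff by blast
  have "(\<Sum>n\<le>N. hs_norm (gmul l m) A n / (fact n)\<^sup>2) \<le> 4 * (C * D)" if A: "finite A" "orthonormal A" for A N
  proof -
    let ?u = "\<lambda>p. hs_norm l A p / (fact p)\<^sup>2" let ?v = "\<lambda>p. hs_norm m A p / (fact p)\<^sup>2"
    have uv: "?u p \<ge> 0" "?v p \<ge> 0" for p by (simp_all add: hs_norm_nonneg)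
    have "(\<Sum>n\<le>N. hs_norm (gmul l m) A n / (fact n)\<^sup>2) \<le> (\<Sum>n\<le>N. 4 * (\<Sum>p\<le>n. ?u p * ?v (n - p)))"
      by (rule sum_mono) (rule hs_norm_gmul_le[OF A(1)])
    also have "\<dots> = 4 * (\<Sum>(n, p)\<in>(SIGMA n:{..N}. {..n}). ?u p * ?v (n - p))"
      by (simp only: sum_distrib_left[symmetric]) (simp add: sum.Sigma)
    \<comment> \<open>Reindexed by the two degrees, the triangle is enlarged to a square, over which
      the sum factorises.\<close>
    also have "(\<Sum>(n, p)\<in>(SIGMA n:{..N}. {..n}). ?u p * ?v (n - p)) =
      (\<Sum>(p, q)\<in>(\<lambda>(n, p). (p, n - p)) ` (SIGMA n:{..N}. {..n}). ?u p * ?v q)"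
      by (subst sum.reindex) (auto simp: inj_on_def split_def)
    also have "\<dots> \<le> (\<Sum>(p, q)\<in>{..N} \<times> {..N}. ?u p * ?v q)"
      by (rule sum_mono2) (use uv in \<open>auto intro!: mult_nonneg_nonneg simp: hs_norm_nonneg\<close>)
    also have "\<dots> = (\<Sum>p\<le>N. ?u p) * (\<Sum>q\<le>N. ?v q)"
      by (simp add: sum_product sum.cartesian_product)
    also have "\<dots> \<le> C * D"
    proof (rule mult_mono)
      show "0 \<le> C" using C[OF A, of N] uv(1) by (meson order.trans sum_nonneg)
      show "0 \<le> (\<Sum>q\<le>N. ?v q)" by (intro sum_nonneg uv)
    qed (use C[OF A] D[OF A] in auto)
    finally show ?thesis by simp
  qed
  then have "\<exists>C. \<forall>A N. finite A \<and> orthonormal A \<longrightarrow> (\<Sum>n\<le>N. hs_norm (gmul l m) A n / (fact n)\<^sup>2) \<le> C"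
    by blast
  moreover have "multi_antilinear (gmul l m)" "alt (gmul l m) = gmul l m"
    using l m by (auto simp: Lam_iff gmul_alt_tmul intro!: multi_antilinear_alt multi_antilinear_tmul)
  ultimately show ?thesis by (simp add: Lam_iff)
qed

lemma Lam_add:
  assumes l: "l \<in> Lam" and m: "m \<in> Lam" shows "(\<lambda>ls. l ls + m ls) \<in> Lam"
proof -
  from l obtain C where C: "\<And>A N. finite A \<Longrightarrow> orthonormal A \<Longrightarrow> (\<Sum>n\<le>N. hs_norm l A n / (fact n)\<^sup>2) \<le> C"
    unfolding Lam_iff by blast
  from m obtain D where D: "\<And>A N. finite A \<Longrightarrow> orthonormal A \<Longrightarrow> (\<Sum>n\<le>N. hs_norm m A n / (fact n)\<^sup>2) \<le> D"
    unfolding Lam_iff by blast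
  have sq: "(cmod (x + y))\<^sup>2 \<le> 2 * (cmod x)\<^sup>2 + 2 * (cmod y)\<^sup>2" for x y
  proof -
    have "(cmod (x + y))\<^sup>2 \<le> (cmod x + cmod y)\<^sup>2" by (rule power_mono[OF norm_triangle_ineq]) simp
    also have "\<dots> \<le> 2 * (cmod x)\<^sup>2 + 2 * (cmod y)\<^sup>2"
      using sum_squares_ge_zero[of "cmod x - cmod y" 0] by (simp add: power2_eq_square algebra_simps)
    finally show ?thesis .
  qed
  have "(\<Sum>n\<le>N. hs_norm (\<lambda>ls. l ls + m ls) A n / (fact n)\<^sup>2) \<le> 2 * C + 2 * D" if A: "finite A" "orthonormal A" for A N
  proof -
    have "hs_norm (\<lambda>ls. l ls + m ls) A n \<le> 2 * hs_norm l A n + 2 * hs_norm m A n" for n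
      unfolding hs_norm_def sum_distrib_left sum.distrib[symmetric] by (rule sum_mono) (rule sq)
    then have "hs_norm (\<lambda>ls. l ls + m ls) A n / (fact n)\<^sup>2 \<le> 2 * (hs_norm l A n / (fact n)\<^sup>2) + 2 * (hs_norm m A n / (fact n)\<^sup>2)" for n
      by (simp add: field_simps divide_right_mono)
    then have "(\<Sum>n\<le>N. hs_norm (\<lambda>ls. l ls + m ls) A n / (fact n)\<^sup>2) \<le>
      (\<Sum>n\<le>N. 2 * (hs_norm l A n / (fact n)\<^sup>2) + 2 * (hs_norm m A n / (fact n)\<^sup>2))" by (intro sum_mono)
    also have "\<dots> = 2 * (\<Sum>n\<le>N. hs_norm l A n / (fact n)\<^sup>2) + 2 * (\<Sum>n\<le>N. hs_norm m A n / (fact n)\<^sup>2)"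
      by (simp add: sum.distrib sum_distrib_left)
    also have "\<dots> \<le> 2 * C + 2 * D" using C[OF A, of N] D[OF A, of N] by simp
    finally show ?thesis .
  qed
  then have "\<exists>C. \<forall>A N. finite A \<and> orthonormal A \<longrightarrow> (\<Sum>n\<le>N. hs_norm (\<lambda>ls. l ls + m ls) A n / (fact n)\<^sup>2) \<le> C"
    by blast
  moreover have "multi_antilinear (\<lambda>ls. l ls + m ls)"
    using l m by (auto simp: Lam_iff multi_antilinear_def algebra_simps)
  moreover have "alt (\<lambda>ls. l ls + m ls) = (\<lambda>ls. l ls + m ls)"
    using l m by (simp add: Lam_iff alt_add)
  ultimately show ?thesis by (simp add: Lam_iff)
qed

lemma Lam_tstar:
  assumes l: "l \<in> Lam" shows "tstar l \<in> Lam"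
proof -
  from l obtain C where C: "\<And>A N. finite A \<Longrightarrow> orthonormal A \<Longrightarrow> (\<Sum>n\<le>N. hs_norm l A n / (fact n)\<^sup>2) \<le> C"
    unfolding Lam_iff by blast
  have "hs_norm (tstar l) A n = hs_norm l (invol ` A) n" for A n
    unfolding hs_norm_def
  proof (rule sum.reindex_bij_witness[where i = "\<lambda>as. rev (map invol as)" and j = "\<lambda>as. rev (map invol as)"])
  qed (auto simp: rev_map o_def invol_invol tstar_def in_lists_conv_set)
  then have "(\<Sum>n\<le>N. hs_norm (tstar l) A n / (fact n)\<^sup>2) \<le> C" if "finite A" "orthonormal A" for A N
    using C[of "invol ` A" N] that by (simp add: orthonormal_invol)
  then have "\<exists>C. \<forall>A N. finite A \<and> orthonormal A \<longrightarrow> (\<Sum>n\<le>N. hs_norm (tstar l) A n / (fact n)\<^sup>2) \<le> C"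
    by blast
  then show ?thesis using l by (simp add: Lam_iff multi_antilinear_tstar alt_tstar)
qed

lemma Lam_sign_scale:
  assumes l: "l \<in> Lam" and s: "\<And>ls. m ls = c (length ls) * l ls" "\<And>n. cmod (c n) \<le> 1"
  shows "m \<in> Lam"
proof -
  have m: "m = (\<lambda>ls. c (length ls) * l ls)" using s by auto
  from l obtain C where C: "\<And>A N. finite A \<Longrightarrow> orthonormal A \<Longrightarrow> (\<Sum>n\<le>N. hs_norm l A n / (fact n)\<^sup>2) \<le> C"
    unfolding Lam_iff by blast
  have "cmod (m as) \<le> cmod (l as)" for as
    using mult_right_mono[OF s(2), of "cmod (l as)" "length as"] by (simp add: m norm_mult)
  then have "hs_norm m A n \<le> hs_norm l A n" for A n
    unfolding hs_norm_def by (intro sum_mono power_mono) auto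
  then have "(\<Sum>n\<le>N. hs_norm m A n / (fact n)\<^sup>2) \<le> C" if "finite A" "orthonormal A" for A N
    using C[OF that, of N] by (meson order.trans sum_mono divide_right_mono zero_le_power2)
  then have "\<exists>C. \<forall>A N. finite A \<and> orthonormal A \<longrightarrow> (\<Sum>n\<le>N. hs_norm m A n / (fact n)\<^sup>2) \<le> C"
    by blast
  moreover have "multi_antilinear m"
    using l by (simp add: Lam_iff m multi_antilinear_def algebra_simps)
  moreover have "alt m = m"
  proof
    fix ls
    have "alt m ls = alt (\<lambda>ys. c (length ls) * l ys) ls" by (rule alt_cong) (simp add: m)
    then show "alt m ls = m ls" using l by (simp add: alt_scale Lam_iff m)
  qed
  ultimately show ?thesis by (simp add: Lam_iff)
qed

lemma Lam_tens_short:
  assumes "length ks \<le> 1" shows "tens ks \<in> Lam"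
proof -
  have "(\<Sum>n\<le>N. hs_norm (tens ks) A n / (fact n)\<^sup>2) \<le> 1 + (\<Sum>k\<leftarrow>ks. (norm k)\<^sup>2)" if A: "finite A" "orthonormal A" for A N
  proof -
    have le: "hs_norm (tens ks) A n \<le> (if n = length ks then 1 + (\<Sum>k\<leftarrow>ks. (norm k)\<^sup>2) else 0)" for n
    proof (cases "n = length ks")
      case False
      then show ?thesis by (simp add: hs_norm_def tens_def)
    next
      case True
      consider "ks = []" | k where "ks = [k]" using assms by (cases ks) auto
      then show ?thesis
      proof cases
        case 1
        then have "{as. as \<in> lists A \<and> length as = n} = {[]}" using True by auto
        then show ?thesis using 1 True by (simp add: hs_norm_def tens_def)
      next
        case 2
        have "hs_norm (tens ks) A n = (\<Sum>a\<in>A. (cmod (cinner a k))\<^sup>2)"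
          unfolding hs_norm_def
        proof (rule sum.reindex_bij_witness[where i = "\<lambda>a. [a]" and j = hd])
        qed (auto simp: True 2 tens_def length_Suc_conv)
        also have "\<dots> \<le> (norm k)\<^sup>2" by (rule bessel[OF A(2,1)])
        finally show ?thesis using True 2 by simp
      qed
    qed
    have "hs_norm (tens ks) A n / (fact n)\<^sup>2 \<le> (if n = length ks then 1 + (\<Sum>k\<leftarrow>ks. (norm k)\<^sup>2) else 0)" for n
      using le[of n] hs_norm_nonneg[of "tens ks" A n] assms by (cases "n = length ks") (auto simp: le_Suc_eq)
    then have "(\<Sum>n\<le>N. hs_norm (tens ks) A n / (fact n)\<^sup>2) \<le>
      (\<Sum>n\<le>N. if n = length ks then 1 + (\<Sum>k\<leftarrow>ks. (norm k)\<^sup>2) else 0)" by (intro sum_mono)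
    also have "\<dots> \<le> 1 + (\<Sum>k\<leftarrow>ks. (norm k)\<^sup>2)"
    proof -
      have "0 \<le> (\<Sum>k\<leftarrow>ks. (norm k)\<^sup>2)" by (rule sum_list_nonneg) auto
      then show ?thesis by simp
    qed
    finally show ?thesis .
  qed
  then have "\<exists>C. \<forall>A N. finite A \<and> orthonormal A \<longrightarrow> (\<Sum>n\<le>N. hs_norm (tens ks) A n / (fact n)\<^sup>2) \<le> C"
    by blast
  then show ?thesis using assms by (simp add: Lam_iff alt_tens_short multi_antilinear_tens)
qed

definition glam :: "'l::involutive_hilbert_space grass set" where
  "glam = {a. gval a \<in> Lam}"

lemma glam_mult: "a \<in> glam \<Longrightarrow> b \<in> glam \<Longrightarrow> a * b \<in> glam"
  by (simp add: glam_def times_grass.rep_eq Lam_gmul)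

lemma glam_1 [simp]: "1 \<in> glam"
  by (simp add: glam_def one_grass.rep_eq Lam_tens_short)

lemma glam_0 [simp]: "0 \<in> glam"
  using Lam_sign_scale[OF Lam_tens_short[of "[]"], of "\<lambda>_. 0" "\<lambda>_. 0"]
  by (simp add: glam_def zero_grass.rep_eq)

lemma glam_ggen: "ggen k \<in> glam"
  by (simp add: glam_def ggen.rep_eq Lam_tens_short)

lemma glam_gstar: "a \<in> glam \<Longrightarrow> gstar a \<in> glam"
  by (simp add: glam_def gstar.rep_eq Lam_tstar)

lemma glam_galpha: "a \<in> glam \<Longrightarrow> galpha d a \<in> glam"
  unfolding glam_def mem_Collect_eq galpha.rep_eq
  by (rule Lam_sign_scale[where c = "\<lambda>n. (-1) ^ (d * n)"]) (auto simp: norm_power)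

lemma Lam_scale: "l \<in> Lam \<Longrightarrow> (\<lambda>ls. c * l ls) \<in> Lam"
proof -
  assume l: "l \<in> Lam"
  then obtain C where C: "\<And>A N. finite A \<Longrightarrow> orthonormal A \<Longrightarrow> (\<Sum>n\<le>N. hs_norm l A n / (fact n)\<^sup>2) \<le> C"
    unfolding Lam_iff by blast
  have "hs_norm (\<lambda>ls. c * l ls) A n = (cmod c)\<^sup>2 * hs_norm l A n" for A n
    by (simp add: hs_norm_def norm_mult power_mult_distrib sum_distrib_left)
  then have "(\<Sum>n\<le>N. hs_norm (\<lambda>ls. c * l ls) A n / (fact n)\<^sup>2) \<le> (cmod c)\<^sup>2 * C" if "finite A" "orthonormal A" for A N
    using mult_left_mono[OF C[OF that, of N], of "(cmod c)\<^sup>2"] by (simp add: sum_distrib_left)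
  then have "\<exists>C. \<forall>A N. finite A \<and> orthonormal A \<longrightarrow> (\<Sum>n\<le>N. hs_norm (\<lambda>ls. c * l ls) A n / (fact n)\<^sup>2) \<le> C"
    by blast
  moreover have "multi_antilinear (\<lambda>ls. c * l ls)"
    using l by (simp add: Lam_iff multi_antilinear_def algebra_simps)
  ultimately show ?thesis using l by (simp add: Lam_iff alt_scale)
qed

lemma glam_gscal: "gscal c \<in> glam"
  using Lam_scale[OF Lam_tens_short[of "[]"]] by (simp add: glam_def gscal.rep_eq)

lemma glam_prod_list: "set as \<subseteq> glam \<Longrightarrow> prod_list as \<in> glam"
  by (induction as) (auto intro: glam_mult)

section \<open>The one-particle space\<close>

lemma tens_module: "module (\<lambda>(c :: complex) (F :: 'a list \<Rightarrow> complex) gs. c * F gs)"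
  by unfold_locales (auto simp: fun_eq_iff algebra_simps)

lemma stens_module: "module (\<lambda>(c :: complex) (X :: 'l list \<Rightarrow> 'h list \<Rightarrow> complex) ls hs. c * X ls hs)"
  by unfold_locales (auto simp: fun_eq_iff algebra_simps)

abbreviation odd_vec :: "'h::super_hilbert_space \<Rightarrow> bool" where "odd_vec f \<equiv> f \<in> H1"

text \<open>A union rather than a sum, so that each member has a definite parity and lies on one
  side of the polarisation.\<close>

definition Epos :: "'h::super_hilbert_space set" where "Epos = E0 \<union> E1"
definition Eneg :: "'h::super_hilbert_space set" where "Eneg = invol ` Epos"

lemma orthogonality:
  fixes x y :: "'h::super_hilbert_space"
  shows "x \<in> E0 \<Longrightarrow> y \<in> E1 \<Longrightarrow> cinner y x = 0"
    "x \<in> E0 \<Longrightarrow> y \<in> E0 \<Longrightarrow> cinner (invol x) y = 0"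
    "x \<in> E1 \<Longrightarrow> y \<in> E1 \<Longrightarrow> cinner (invol x) y = 0"
    "x \<in> E0 \<Longrightarrow> y \<in> E1 \<Longrightarrow> cinner (invol y) x = 0"
    "x \<in> E0 \<Longrightarrow> y \<in> E1 \<Longrightarrow> cinner (invol x) y = 0"
    "x \<in> E0 \<Longrightarrow> y \<in> E1 \<Longrightarrow> cinner y (invol x) = 0"
    "x \<in> E0 \<Longrightarrow> y \<in> E1 \<Longrightarrow> cinner (invol x) (invol y) = 0"
    "x \<in> E0 \<Longrightarrow> y \<in> E1 \<Longrightarrow> cinner (invol y) (invol x) = 0"
proof -
  have s: "cinner a b = 0 \<Longrightarrow> cinner b a = 0" for a b :: 'h using cinner_commute[of b a] by simp
  show 1: "x \<in> E0 \<Longrightarrow> y \<in> E1 \<Longrightarrow> cinner y x = 0" by (rule s) (rule orth_E0_E1)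
  show "x \<in> E0 \<Longrightarrow> y \<in> E0 \<Longrightarrow> cinner (invol x) y = 0" by (rule s) (rule orth_E0_E0s)
  show "x \<in> E1 \<Longrightarrow> y \<in> E1 \<Longrightarrow> cinner (invol x) y = 0" by (rule s) (rule orth_E1_E1s)
  show 2: "x \<in> E0 \<Longrightarrow> y \<in> E1 \<Longrightarrow> cinner (invol y) x = 0" by (rule s) (rule orth_E0_E1s)
  show 3: "x \<in> E0 \<Longrightarrow> y \<in> E1 \<Longrightarrow> cinner (invol x) y = 0" using 2 by (metis cinner_invol_swap)
  show "x \<in> E0 \<Longrightarrow> y \<in> E1 \<Longrightarrow> cinner y (invol x) = 0" by (rule s) (rule 3)
  show "x \<in> E0 \<Longrightarrow> y \<in> E1 \<Longrightarrow> cinner (invol x) (invol y) = 0" by (simp add: cinner_invol orth_E0_E1)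
  show "x \<in> E0 \<Longrightarrow> y \<in> E1 \<Longrightarrow> cinner (invol y) (invol x) = 0" by (simp add: cinner_invol 1)
qed

lemma E_subset_H: "E0 \<subseteq> (H0 :: 'a::super_hilbert_space set)" "E1 \<subseteq> (H1 :: 'a set)"
  "invol ` E0 \<subseteq> (H0 :: 'a set)" "invol ` E1 \<subseteq> (H1 :: 'a set)"
proof -
  have "x \<in> H0" if "x \<in> E0" for x :: 'a
    unfolding H0_def mem_Collect_eq
    by (intro exI[of _ x] exI[of _ 0]) (use that zero_E0 in simp)
  moreover have "x \<in> H1" if "x \<in> E1" for x :: 'a
    unfolding H1_def mem_Collect_eq
    by (intro exI[of _ x] exI[of _ 0]) (use that zero_E1 in simp)
  moreover have "invol x \<in> H0" if "x \<in> E0" for x :: 'a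
    unfolding H0_def mem_Collect_eq
    by (intro exI[of _ 0] exI[of _ x]) (use that zero_E0 in simp)
  moreover have "invol x \<in> H1" if "x \<in> E1" for x :: 'a
    unfolding H1_def mem_Collect_eq
    by (intro exI[of _ 0] exI[of _ x]) (use that zero_E1 in simp)
  ultimately show "E0 \<subseteq> (H0 :: 'a set)" "E1 \<subseteq> (H1 :: 'a set)" "invol ` E0 \<subseteq> (H0 :: 'a set)" "invol ` E1 \<subseteq> (H1 :: 'a set)"
    by blast+
qed

lemma H0_add: assumes "x \<in> H0" "y \<in> H0" shows "x + y \<in> H0"
proof -
  obtain a b c d where *: "x = a + invol b" "y = c + invol d" "a \<in> E0" "b \<in> E0" "c \<in> E0" "d \<in> E0"
    using assms unfolding H0_def by blast
  then have "x + y = (a + c) + invol (b + d)" "a + c \<in> E0" "b + d \<in> E0"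
    by (simp_all add: invol_add add_E0)
  then show ?thesis unfolding H0_def by blast
qed

lemma H1_add: assumes "x \<in> H1" "y \<in> H1" shows "x + y \<in> H1"
proof -
  obtain a b c d where *: "x = a + invol b" "y = c + invol d" "a \<in> E1" "b \<in> E1" "c \<in> E1" "d \<in> E1"
    using assms unfolding H1_def by blast
  then have "x + y = (a + c) + invol (b + d)" "a + c \<in> E1" "b + d \<in> E1"
    by (simp_all add: invol_add add_E1)
  then show ?thesis unfolding H1_def by blast
qed

lemma H0_scaleC: assumes "x \<in> H0" shows "scaleC c x \<in> H0"
proof -
  obtain a b where *: "x = a + invol b" "a \<in> E0" "b \<in> E0"
    using assms unfolding H0_def by blast
  then have "scaleC c x = scaleC c a + invol (scaleC (cnj c) b)" "scaleC c a \<in> E0" "scaleC (cnj c) b \<in> E0"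
    by (simp_all add: invol_scaleC scaleC_add_right scaleC_E0)
  then show ?thesis unfolding H0_def by blast
qed

lemma H1_scaleC: assumes "x \<in> H1" shows "scaleC c x \<in> H1"
proof -
  obtain a b where *: "x = a + invol b" "a \<in> E1" "b \<in> E1"
    using assms unfolding H1_def by blast
  then have "scaleC c x = scaleC c a + invol (scaleC (cnj c) b)" "scaleC c a \<in> E1" "scaleC (cnj c) b \<in> E1"
    by (simp_all add: invol_scaleC scaleC_add_right scaleC_E1)
  then show ?thesis unfolding H1_def by blast
qed

lemma H0_diff: "x \<in> H0 \<Longrightarrow> y \<in> H0 \<Longrightarrow> x - y \<in> H0"
  using H0_add[of x "- y"] H0_scaleC[of y "-1"] by simp

lemma H1_diff: "x \<in> H1 \<Longrightarrow> y \<in> H1 \<Longrightarrow> x - y \<in> H1"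
  using H1_add[of x "- y"] H1_scaleC[of y "-1"] by simp

lemma E1_diff: "x \<in> E1 \<Longrightarrow> y \<in> E1 \<Longrightarrow> x - y \<in> E1"
  using add_E1[of x "- y"] scaleC_E1[of y "-1"] by simp

lemma invol_diff: "invol (x - y) = invol x - invol (y :: 'a::involutive_hilbert_space)"
  using invol_add[of "x - y" y] by simp

lemma zero_H0 [simp]: "0 \<in> H0" and zero_H1 [simp]: "0 \<in> H1"
  using E_subset_H(1,2) zero_E0 zero_E1 by blast+

lemma H0_H1_orth: "x \<in> H0 \<Longrightarrow> y \<in> H1 \<Longrightarrow> cinner x y = 0"
  unfolding H0_def H1_def
  by (auto simp: cinner_add_left cinner_add_right orthogonality orth_E0_E1 orth_E0_E1s)

lemma H1_H0_orth: "x \<in> H1 \<Longrightarrow> y \<in> H0 \<Longrightarrow> cinner x y = 0"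
  using H0_H1_orth[of y x] cinner_commute[of x y] by simp

lemma H0_H1_disjoint: "x \<in> H0 \<Longrightarrow> x \<in> H1 \<Longrightarrow> x = 0"
  using H0_H1_orth[of x x] by simp

lemma H0_H1_decomp: "\<exists>a\<in>H0. \<exists>b\<in>H1. x = a + b"
  using decomposition[of x] unfolding H0_def H1_def by blast

lemma invol_H0: "x \<in> H0 \<Longrightarrow> invol x \<in> H0"
  unfolding H0_def by (fastforce simp: invol_add invol_invol add.commute)

lemma invol_H1: "x \<in> H1 \<Longrightarrow> invol x \<in> H1"
  unfolding H1_def by (fastforce simp: invol_add invol_invol add.commute)

lemma invol_H1_iff: "invol x \<in> H1 \<longleftrightarrow> x \<in> H1"
  by (metis invol_H1 invol_invol)

section \<open>Homogeneous parts and the map \<open>jmap\<close>\<close>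

lemma even_part_eq:
  assumes "a \<in> H0" "b \<in> H1" shows "even_part (a + b) = a" "odd_part (a + b) = b"
proof -
  show "even_part (a + b) = a"
    unfolding even_part_def
  proof (rule the_equality)
    fix a' assume a': "a' \<in> H0 \<and> a + b - a' \<in> H1"
    then have "(a + b - a') - b \<in> H1" using assms by (blast intro: H1_diff)
    moreover have "(a + b - a') - b = a - a'" by simp
    moreover have "a - a' \<in> H0" using a' assms by (blast intro: H0_diff)
    ultimately show "a' = a" using H0_H1_disjoint[of "a - a'"] by simp
  qed (use assms in simp)
  then show "odd_part (a + b) = b" by (simp add: odd_part_def)
qed

lemma even_odd_parts: "even_part x \<in> H0" "odd_part x \<in> H1" "even_part x + odd_part x = x"
proof -
  obtain a b where "a \<in> H0" "b \<in> H1" "x = a + b" using H0_H1_decomp by blast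
  then show "even_part x \<in> H0" "odd_part x \<in> H1" "even_part x + odd_part x = x"
    using even_part_eq[of a b] by auto
qed

lemma jmap_eq:
  assumes "a \<in> H0" "b \<in> E1" "c \<in> E1" shows "jmap (a + b + invol c) = a + b - invol c"
  unfolding jmap_def
proof (rule the_equality)
  show "\<exists>a'\<in>H0. \<exists>b'\<in>E1. \<exists>c'\<in>invol ` E1. a + b + invol c = a' + b' + c' \<and> a + b - invol c = a' + b' - c'"
    using assms by blast
  fix y assume "\<exists>a'\<in>H0. \<exists>b'\<in>E1. \<exists>c'\<in>invol ` E1. a + b + invol c = a' + b' + c' \<and> y = a' + b' - c'"
  then obtain a' b' c' where *: "a' \<in> H0" "b' \<in> E1" "c' \<in> E1" "a + b + invol c = a' + (b' + invol c')"
    "y = a' + b' - invol c'" by (auto simp: add.assoc)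
  have 1: "b + invol c \<in> H1" "b' + invol c' \<in> H1" using assms * by (auto simp: H1_def)
  then have "a = a'" "b + invol c = b' + invol c'"
    using even_part_eq[of a "b + invol c"] even_part_eq[of a' "b' + invol c'"] assms *
    by (metis add.assoc)+
  \<comment> \<open>The difference of the two decompositions lies in \<open>E1\<close> and in its
    dual at once, and these are orthogonal.\<close>
  then have e: "b - b' = invol (c' - c)" by (simp add: invol_diff algebra_simps)
  moreover have "cinner (b - b') (invol (c' - c)) = 0"
    using assms * by (intro orth_E1_E1s E1_diff)
  ultimately have "b - b' = 0" by simp
  then show "y = a + b - invol c" using e \<open>a = a'\<close> * by (simp add: invol_diff)
qed

lemma H_decomp3: "\<exists>a\<in>H0. \<exists>b\<in>E1. \<exists>c\<in>E1. x = a + b + invol c"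
proof -
  obtain a b where "a \<in> H0" "b \<in> H1" "x = a + b" using H0_H1_decomp by blast
  then show ?thesis unfolding H1_def by (auto simp: add.assoc)
qed

lemma jmap_add: "jmap (x + y) = jmap x + jmap y"
proof -
  obtain a b c where x: "a \<in> H0" "b \<in> E1" "c \<in> E1" "x = a + b + invol c" using H_decomp3 by blast
  obtain a' b' c' where y: "a' \<in> H0" "b' \<in> E1" "c' \<in> E1" "y = a' + b' + invol c'" using H_decomp3 by blast
  have "x + y = (a + a') + (b + b') + invol (c + c')" by (simp add: x y invol_add)
  then have "jmap (x + y) = (a + a') + (b + b') - invol (c + c')"
    using x y by (simp only: jmap_eq H0_add add_E1)
  then show ?thesis
    using jmap_eq[OF x(1-3)] jmap_eq[OF y(1-3)] by (simp add: x y invol_add)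
qed

lemma jmap_scaleC: "jmap (scaleC k x) = scaleC k (jmap x)"
proof -
  obtain a b c where x: "a \<in> H0" "b \<in> E1" "c \<in> E1" "x = a + b + invol c" using H_decomp3 by blast
  have "scaleC k x = scaleC k a + scaleC k b + invol (scaleC (cnj k) c)"
    by (simp add: x scaleC_add_right invol_scaleC)
  then show ?thesis
    using jmap_eq[of "scaleC k a" "scaleC k b" "scaleC (cnj k) c"] jmap_eq[OF x(1-3)] x
    by (simp add: H0_scaleC scaleC_E1 invol_scaleC scaleC_add_right chilbert.scale_right_diff_distrib)
qed

lemma jmap_H0: "x \<in> H0 \<Longrightarrow> jmap x = x"
  using jmap_eq[of x 0 0] zero_E1 by simp

lemma jmap_E1: "x \<in> E1 \<Longrightarrow> jmap x = x"
  using jmap_eq[of 0 x 0] zero_E1 by simp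

lemma jmap_invol_E1: "x \<in> E1 \<Longrightarrow> jmap (invol x) = - invol x"
  using jmap_eq[of 0 0 x] zero_E1 by simp

lemma jmap_H1: assumes "x \<in> H1" shows "jmap x \<in> H1"
proof -
  obtain b c where x: "b \<in> E1" "c \<in> E1" "x = b + invol c" using assms unfolding H1_def by auto
  then have "jmap x = b - invol c" using jmap_eq[of 0 b c] by simp
  moreover have "b \<in> H1" "invol c \<in> H1" using x E_subset_H by blast+
  ultimately show ?thesis by (simp add: H1_diff)
qed

lemma cinner_jmap: "cinner (jmap x) y = cinner x (jmap y)" and cinner_jmap_jmap: "cinner (jmap x) (jmap y) = cinner x y"
proof -
  obtain a b c where x: "a \<in> H0" "b \<in> E1" "c \<in> E1" "x = a + b + invol c" using H_decomp3 by blast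
  obtain a' b' c' where y: "a' \<in> H0" "b' \<in> E1" "c' \<in> E1" "y = a' + b' + invol c'" using H_decomp3 by blast
  have h: "b \<in> H1" "invol c \<in> H1" "b' \<in> H1" "invol c' \<in> H1" using x y E_subset_H by blast+
  note o = H0_H1_orth[OF x(1) h(3)] H0_H1_orth[OF x(1) h(4)] H1_H0_orth[OF h(1) y(1)] H1_H0_orth[OF h(2) y(1)]
    orth_E1_E1s[OF x(2) y(3)] orthogonality(3)[OF x(3) y(2)]
  show "cinner (jmap x) y = cinner x (jmap y)" "cinner (jmap x) (jmap y) = cinner x y"
    using jmap_eq[OF x(1-3)] jmap_eq[OF y(1-3)]
    by (simp_all add: x(4) y(4) cinner_add_left cinner_add_right cinner_diff_left cinner_diff_right o)
qed

lemma norm_jmap: "norm (jmap x) = norm x"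
proof -
  have "complex_of_real ((norm (jmap x))\<^sup>2) = complex_of_real ((norm x)\<^sup>2)"
    unfolding cinner_self[symmetric] by (rule cinner_jmap_jmap)
  then have "(norm (jmap x))\<^sup>2 = (norm x)\<^sup>2" by (simp only: of_real_eq_iff)
  then show ?thesis by (simp add: power2_eq_iff_nonneg)
qed

section \<open>Symmetry and parity of the form \<open>omega\<close>\<close>

lemma omega_H0_H1: "f \<in> H0 \<Longrightarrow> g \<in> H1 \<Longrightarrow> omega f g = 0"
  by (simp add: omega_def H0_H1_orth invol_H0 jmap_H1)

lemma omega_H1_H0: "f \<in> H1 \<Longrightarrow> g \<in> H0 \<Longrightarrow> omega f g = 0"
  by (simp add: omega_def H1_H0_orth invol_H1 jmap_H0)

text \<open>On \<open>H1\<close> the form contracts \<open>E1\<close> parts with dual parts;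
  \<open>jmap\<close> reverses exactly one of the two cross terms, which turns the symmetric pairing
  into an antisymmetric one.\<close>

lemma omega_commute:
  assumes "f \<in> H0 \<union> H1" "g \<in> H0 \<union> H1"
  shows "omega g f = koszul odd_vec f g * omega f g"
proof -
  have 1: "omega g f = - omega f g" if H: "f \<in> H1" "g \<in> H1"
  proof -
    obtain b c where x: "b \<in> E1" "c \<in> E1" "f = b + invol c" using H unfolding H1_def by auto
    obtain b' c' where y: "b' \<in> E1" "c' \<in> E1" "g = b' + invol c'" using H unfolding H1_def by auto
    have "jmap f = b - invol c" "jmap g = b' - invol c'"
      using jmap_eq[of 0 b c] jmap_eq[of 0 b' c'] x y by simp_all
    then show ?thesis
      using x y
      by (simp add: omega_def invol_add invol_invol cinner_add_left cinner_diff_right orthogonality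
          orth_E1_E1s cinner_invol) (metis cinner_commute)
  qed
  have 2: "omega g f = omega f g" if "f \<in> H0" "g \<in> H0"
    using that by (simp add: omega_def jmap_H0 cinner_invol_swap)
  show ?thesis
    using assms 1 2 omega_H0_H1[of f g] omega_H0_H1[of g f] omega_H1_H0[of f g] omega_H1_H0[of g f]
    by (cases "f \<in> H1"; cases "g \<in> H1") (auto simp: koszul_def)
qed

lemma omega_parity:
  "f \<in> H0 \<union> H1 \<Longrightarrow> g \<in> H0 \<union> H1 \<Longrightarrow> omega f g \<noteq> 0 \<Longrightarrow> odd_vec f = odd_vec g"
  using omega_H0_H1 omega_H1_H0 by blast

lemma cinner_parity:
  "f \<in> H0 \<union> H1 \<Longrightarrow> g \<in> H0 \<union> H1 \<Longrightarrow> cinner f g \<noteq> 0 \<Longrightarrow> odd_vec f = odd_vec g"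
  using H0_H1_orth H1_H0_orth by blast

lemma Epos_subset: "Epos \<subseteq> H0 \<union> H1" and Eneg_subset: "Eneg \<subseteq> H0 \<union> H1"
  using E_subset_H by (auto simp: Epos_def Eneg_def)

lemma Epos_Eneg_orth: "x \<in> Epos \<Longrightarrow> y \<in> Eneg \<Longrightarrow> cinner x y = 0"
  by (auto simp: Epos_def Eneg_def orthogonality orth_E0_E0s orth_E1_E1s orth_E0_E1s)

lemma Eneg_Epos_orth: "x \<in> Eneg \<Longrightarrow> y \<in> Epos \<Longrightarrow> cinner x y = 0"
  using Epos_Eneg_orth[of y x] cinner_commute[of x y] by simp

lemma invol_Epos: "x \<in> Epos \<Longrightarrow> invol x \<in> Eneg" and invol_Eneg: "x \<in> Eneg \<Longrightarrow> invol x \<in> Epos"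
  by (auto simp: Eneg_def invol_invol)

lemma jmap_Epos: "x \<in> Epos \<Longrightarrow> jmap x = x"
  by (metis Epos_def Un_iff jmap_E1 jmap_H0 E_subset_H(1) subsetD)

lemma jmap_Eneg:
  assumes "x \<in> Eneg" shows "jmap x = (if odd_vec x then - x else x)"
proof -
  consider y where "y \<in> E1" "x = invol y" | y where "y \<in> E0" "x = invol y"
    using assms by (auto simp: Eneg_def Epos_def)
  then show ?thesis
  proof cases
    case 1
    then have "x \<in> H1" using E_subset_H by blast
    then show ?thesis using 1 by (simp add: jmap_invol_E1)
  next
    case 2
    then have "x \<in> H0" using E_subset_H by blast
    then show ?thesis using H0_H1_disjoint[of x] by (auto simp: jmap_H0)
  qed
qed

section \<open>Super-symmetric tensors\<close>

abbreviation homog :: "'h::super_hilbert_space list \<Rightarrow> bool" where "homog gs \<equiv> set gs \<subseteq> H0 \<union> H1"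

lemma chi_perm_koszul: "chi s fs = perm_koszul odd_vec s fs"
  by (simp add: chi_def perm_koszul_def)

definition splits :: "'h::super_hilbert_space list \<Rightarrow> 'h list list" where
  "splits gs = product_lists (map (\<lambda>g. [even_part g, odd_part g]) gs)"

lemma splits_Nil [simp]: "splits [] = [[]]" by (simp add: splits_def)

lemma splits_Cons [simp]: "splits (g # gs) = map ((#) (even_part g)) (splits gs) @ map ((#) (odd_part g)) (splits gs)"
  by (simp add: splits_def)

lemma in_splits: "hs \<in> set (splits gs) \<Longrightarrow> length hs = length gs \<and> homog hs"
  by (induction gs arbitrary: hs) (auto simp: even_odd_parts subset_iff, blast+)

lemma supersym_perm_sum:
  "supersym F gs = (\<Sum>hs\<leftarrow>splits gs. perm_sum odd_vec F hs / fact (length gs))"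
proof -
  have "(\<Sum>s | s permutes {..<length gs}. chi s fs * F (permute_list s fs)) = perm_sum odd_vec F fs"
    if "fs \<in> set (splits gs)" for fs
    using in_splits[OF that] by (simp add: perm_sum_def chi_perm_koszul)
  then show ?thesis
    unfolding supersym_def splits_def[symmetric] by (intro arg_cong[of _ _ sum_list] map_cong) auto
qed

lemma supersym_cong:
  assumes "\<And>hs. length hs = length gs \<Longrightarrow> homog hs \<Longrightarrow> perm_sum odd_vec F hs = perm_sum odd_vec G hs"
  shows "supersym F gs = supersym G gs"
  unfolding supersym_perm_sum
  by (intro arg_cong[of _ _ sum_list] map_cong) (auto dest!: in_splits simp: assms)

lemma supersym_scale: "supersym (\<lambda>gs. c * F gs) = (\<lambda>gs. c * supersym F gs)"
  by (rule ext) (rule supersym_cmult)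

lemma supersym_add: "supersym (\<lambda>gs. F gs + G gs) = (\<lambda>gs. supersym F gs + supersym G gs)"
  by (simp add: fun_eq_iff supersym_perm_sum perm_sum_add add_divide_distrib sum_list_addf)

text \<open>\<open>supersym\<close> is evaluated by splitting every argument into homogeneous parts;
  for a functional additive in each argument the parts add up again.\<close>

lemma sum_splits_additive:
  assumes "\<And>us x y vs. K (us @ (x + y) # vs) = K (us @ x # vs) + K (us @ y # vs)"
  shows "(\<Sum>hs\<leftarrow>splits gs. K hs :: complex) = K gs"
  using assms
proof (induction gs arbitrary: K)
  case (Cons g gs)
  have "(\<Sum>hs\<leftarrow>splits gs. K (x # hs)) = K (x # gs)" for x
    using Cons.prems[of "x # _"] by (intro Cons.IH) simp
  then have "(\<Sum>hs\<leftarrow>splits (g # gs). K hs) = K (even_part g # gs) + K (odd_part g # gs)"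
    by (simp add: o_def)
  also have "\<dots> = K (g # gs)"
    using Cons.prems[of "[]" "even_part g" "odd_part g" gs] by (simp add: even_odd_parts)
  finally show ?case .
qed simp

lemma multi_antilinear_additive:
  "multi_antilinear F \<Longrightarrow> F (us @ (x + y) # vs) = F (us @ x # vs) + F (us @ y # vs)"
  unfolding multi_antilinear_def
  by (metis chilbert.scale_one complex_cnj_one mult_1)

lemma multi_antilinear_zero:
  assumes "multi_antilinear F" "0 \<in> set gs" shows "F gs = 0"
proof -
  obtain us vs where "gs = us @ 0 # vs" using assms(2) by (auto simp: in_set_conv_decomp)
  then show ?thesis using multi_antilinear_additive[OF assms(1), of us 0 0 vs] by simp
qed

text \<open>Invariance under transposition: expansion along the first column on one side against
  expansion along the first row on the other.\<close>

lemma super_det_flip: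
  assumes "\<And>x y. b x y \<noteq> 0 \<Longrightarrow> x \<in> set fs \<Longrightarrow> y \<in> set gs \<Longrightarrow> P x = P y"
  shows "super_det P b fs gs = super_det P (\<lambda>x y. b y x) gs fs"
  using assms
proof (induction gs arbitrary: fs)
  case Nil
  then show ?case by (cases fs) auto
next
  case (Cons g gs)
  have "super_det P b fs (g # gs) = pull_sum P (\<lambda>f r. b f g * super_det P b r gs) fs"
    by (rule super_det_Cons_right) (rule Cons.prems)
  also have "\<dots> = pull_sum P (\<lambda>f r. b f g * super_det P (\<lambda>x y. b y x) gs r) fs"
  proof (rule pull_sum_cong')
    fix y r assume "set r \<subseteq> set fs"
    then have "super_det P b r gs = super_det P (\<lambda>x y. b y x) gs r"
      using Cons.prems by (intro Cons.IH) auto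
    then show "b y g * super_det P b r gs = b y g * super_det P (\<lambda>x y. b y x) gs r" by simp
  qed
  finally show ?case by simp
qed

lemma perm_sum_tens_right:
  "perm_sum P (\<lambda>hs. tens hs gs) fs = super_det P cinner gs fs"
  unfolding super_det_perm_sum[symmetric] by (rule perm_sum_cong) (auto simp: tens_def)

lemma perm_sum_tens_left:
  "perm_sum P (tens fs) gs = super_det P (\<lambda>f g. cinner g f) fs gs"
  unfolding super_det_perm_sum[symmetric] by (rule perm_sum_cong) (auto simp: tens_def)

text \<open>Self-adjointness of the projection onto supersymmetric tensors, seen as transposition
  invariance of the superdeterminant.\<close>

lemma perm_sum_tens:
  assumes "homog fs" "homog gs"
  shows "perm_sum odd_vec (tens fs) gs = perm_sum odd_vec (\<lambda>hs. tens hs gs) fs"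
  unfolding perm_sum_tens_left perm_sum_tens_right
  by (rule super_det_flip) (use assms cinner_parity in blast)

definition sqrt_fact :: "nat \<Rightarrow> complex" where
  "sqrt_fact n = complex_of_real (sqrt (fact n))"

lemma sqrt_fact_square: "sqrt_fact n * sqrt_fact n = fact n"
  by (simp add: sqrt_fact_def flip: of_real_mult)

lemma sqrt_fact_nonzero [simp]: "sqrt_fact n \<noteq> 0"
  by (simp add: sqrt_fact_def)

lemma sqrt_fact_0 [simp]: "sqrt_fact 0 = 1"
  by (simp add: sqrt_fact_def)

lemma fact_div_sqrt_fact: "fact n / sqrt_fact n = sqrt_fact n" "sqrt_fact n / fact n = 1 / sqrt_fact n"
  by (simp_all add: sqrt_fact_square[symmetric])

lemma sqrt_fact_Suc: "sqrt_fact (Suc n) = complex_of_real (sqrt (Suc n)) * sqrt_fact n"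
  by (simp add: sqrt_fact_def real_sqrt_mult)

text \<open>The product \<open>f\<^sub>1 \<odot> \<dots> \<odot> f\<^sub>n = \<surd>n! P(f\<^sub>1 \<otimes> \<dots> \<otimes> f\<^sub>n)\<close> for vectors of definite parity, with the
  self-adjoint projection moved to the other side.\<close>

definition sprod :: "'h::super_hilbert_space list \<Rightarrow> 'h tensor" where
  "sprod fs = (\<lambda>gs. perm_sum odd_vec (\<lambda>hs. tens hs gs) fs / sqrt_fact (length fs))"

lemma multi_antilinear_sprod: "multi_antilinear (sprod fs)"
proof -
  have "multi_antilinear (\<lambda>gs. \<Sum>s | s permutes {..<length fs}.
     (perm_koszul odd_vec s fs / sqrt_fact (length fs)) * tens (permute_list s fs) gs)"
    by (rule multi_antilinear_sum) (rule multi_antilinear_tens)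
  then show ?thesis by (simp add: sprod_def perm_sum_def sum_divide_distrib)
qed

text \<open>Self-adjointness moves the projection to \<open>fs\<close> on arguments of definite
  parity, and additivity of \<open>sprod\<close> extends this to all arguments.\<close>

lemma supersym_tens:
  assumes fs: "homog fs"
  shows "supersym (tens fs) = (\<lambda>gs. sprod fs gs / sqrt_fact (length fs))"
proof
  fix gs :: "'a list"
  have "supersym (tens fs) gs = (\<Sum>hs\<leftarrow>splits gs. sprod fs hs / sqrt_fact (length fs))"
    unfolding supersym_perm_sum
  proof (intro arg_cong[of _ _ sum_list] map_cong refl)
    fix hs assume hs: "hs \<in> set (splits gs)"
    note h = in_splits[OF hs]
    show "perm_sum odd_vec (tens fs) hs / fact (length gs) = sprod fs hs / sqrt_fact (length fs)"
    proof (cases "length gs = length fs")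
      case True
      then show ?thesis
        using h fs by (simp add: perm_sum_tens sprod_def sqrt_fact_square)
    next
      case False
      have "perm_sum odd_vec (\<lambda>hs'. tens hs' hs) fs = perm_sum odd_vec (\<lambda>_. 0) fs"
        using False h by (intro perm_sum_cong) (auto simp: tens_def dest: mset_eq_length)
      then have "perm_sum odd_vec (\<lambda>hs'. tens hs' hs) fs = 0" by (simp add: perm_sum_def)
      then show ?thesis using h fs by (simp add: perm_sum_tens sprod_def)
    qed
  qed
  also have "\<dots> = sprod fs gs / sqrt_fact (length fs)"
    by (rule sum_splits_additive) (simp add: multi_antilinear_additive[OF multi_antilinear_sprod] add_divide_distrib)
  finally show "supersym (tens fs) gs = sprod fs gs / sqrt_fact (length fs)" .
qed

lemma sprod_Nil: "sprod [] = tens []"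
  by (simp add: sprod_def)

lemma perm_sum_sprod:
  assumes "homog fs" "homog gs"
  shows "perm_sum odd_vec (sprod fs) gs = sqrt_fact (length fs) * perm_sum odd_vec (tens fs) gs"
proof (cases "length gs = length fs")
  case True
  have "perm_sum odd_vec (sprod fs) gs =
    perm_sum odd_vec (\<lambda>hs. (1 / sqrt_fact (length fs)) * perm_sum odd_vec (tens fs) hs) gs"
  proof (rule perm_sum_cong)
    fix hs assume "mset hs = mset gs"
    then have "homog hs" using assms(2) mset_eq_setD by blast
    then show "sprod fs hs = (1 / sqrt_fact (length fs)) * perm_sum odd_vec (tens fs) hs"
      using assms(1) by (simp add: sprod_def perm_sum_tens)
  qed
  also have "\<dots> = (fact (length gs) / sqrt_fact (length fs)) * perm_sum odd_vec (tens fs) gs"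
    unfolding perm_sum_cmult perm_sum_perm_sum by simp
  finally show ?thesis by (simp add: True fact_div_sqrt_fact)
next
  case False
  have z: "perm_sum odd_vec (\<lambda>hs'. tens hs' hs) fs = 0" if "mset hs = mset gs" for hs
  proof -
    have "perm_sum odd_vec (\<lambda>hs'. tens hs' hs) fs = perm_sum odd_vec (\<lambda>_. 0) fs"
      using False mset_eq_length[OF that] by (intro perm_sum_cong) (auto simp: tens_def dest!: mset_eq_length)
    then show ?thesis by (simp add: perm_sum_def)
  qed
  have "perm_sum odd_vec (sprod fs) gs = perm_sum odd_vec (\<lambda>_. 0) gs"
    by (rule perm_sum_cong) (simp add: sprod_def z)
  moreover have "perm_sum odd_vec (tens fs) gs = 0"
    using z[OF refl] assms by (simp add: perm_sum_tens)
  ultimately show ?thesis by (simp add: perm_sum_def)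
qed

lemma tmul_tens_single: "gs \<noteq> [] \<Longrightarrow>
  tmul (tens [f]) G gs = complex_of_real (sqrt (length gs)) * (cinner (hd gs) f * G (tl gs))"
proof -
  assume "gs \<noteq> []"
  then obtain g gs' where gs: "gs = g # gs'" by (cases gs) auto
  have "tmul (tens [f]) G gs = (\<Sum>p\<le>length gs. if p = 1 then grade_weight (length gs) 1 * (cinner g f * G gs') else 0)"
    unfolding tmul_def
    by (intro sum.cong refl) (auto simp: tens_def gs)
  also have "\<dots> = grade_weight (length gs) 1 * (cinner g f * G gs')" by (simp add: gs Suc_le_eq)
  finally show ?thesis by (simp add: gs grade_weight_def fact_reduce)
qed

lemma perm_sum_tmul_sprod:
  assumes f: "homog (f # fs)" and h: "homog hs"
  shows "perm_sum odd_vec (tmul (tens [f]) (sprod fs)) hs =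
    sqrt_fact (length (f # fs)) * perm_sum odd_vec (tens (f # fs)) hs"
proof (cases "hs = []")
  case True
  then show ?thesis by (simp add: tmul_def tens_def)
next
  case ne: False
  have "perm_sum odd_vec (tmul (tens [f]) (sprod fs)) hs =
    pull_sum odd_vec (\<lambda>y r. sqrt_fact (length (f # fs)) * (cinner y f * perm_sum odd_vec (tens fs) r)) hs"
    unfolding perm_sum_pull[OF ne]
  proof (rule pull_sum_cong')
    fix y r assume r: "length hs = Suc (length r)" "y \<in> set hs" "set r \<subseteq> set hs"
    have "perm_sum odd_vec (\<lambda>r'. tmul (tens [f]) (sprod fs) (y # r')) r =
      perm_sum odd_vec (\<lambda>r'. (complex_of_real (sqrt (length hs)) * cinner y f) * sprod fs r') r"
      by (rule perm_sum_cong) (use r in \<open>auto simp: tmul_tens_single dest!: mset_eq_length\<close>)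
    also have "\<dots> = (complex_of_real (sqrt (length hs)) * cinner y f) *
        (sqrt_fact (length fs) * perm_sum odd_vec (tens fs) r)"
      unfolding perm_sum_cmult using f h r by (subst perm_sum_sprod) auto
    also have "\<dots> = sqrt_fact (length (f # fs)) * (cinner y f * perm_sum odd_vec (tens fs) r)"
    proof (cases "length r = length fs")
      case False
      have "perm_sum odd_vec (tens fs) r = perm_sum odd_vec (\<lambda>_. 0) r"
        by (rule perm_sum_cong) (use False in \<open>auto simp: tens_def dest: mset_eq_length\<close>)
      then show ?thesis by (simp add: perm_sum_def)
    qed (use r in \<open>simp add: sqrt_fact_Suc\<close>)
    finally show "perm_sum odd_vec (\<lambda>r'. tmul (tens [f]) (sprod fs) (y # r')) r =
      sqrt_fact (length (f # fs)) * (cinner y f * perm_sum odd_vec (tens fs) r)" .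
  qed
  then show ?thesis by (simp only: pull_sum_cmult perm_sum_tens_left super_det.simps)
qed

text \<open>\<open>fprod\<close> projects after every multiplication. Inductively the inner
  projection is absorbed by the outer one, and the weights of the single multiplications accumulate
  to \<open>sqrt_fact\<close>.\<close>

lemma fprod_sprod: "homog fs \<Longrightarrow> fprod fs = sprod fs"
proof (induction fs)
  case Nil
  then show ?case by (simp add: fprod_def sprod_Nil)
next
  case (Cons f fs)
  then have "fprod (f # fs) = supersym (tmul (tens [f]) (sprod fs))"
    by (simp add: fprod_def fmul_supersym_tmul)
  also have "\<dots> = supersym (\<lambda>gs. sqrt_fact (length (f # fs)) * tens (f # fs) gs)"
    by (rule ext, rule supersym_cong) (simp only: perm_sum_cmult perm_sum_tmul_sprod[OF Cons.prems])
  also have "\<dots> = sprod (f # fs)"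
    by (simp only: supersym_scale supersym_tens[OF Cons.prems]) simp
  finally show ?case .
qed

section \<open>Spanning \<open>Sfin\<close> by sorted products\<close>

lemma sprod_swap: "sprod (us @ x # y # vs) = (\<lambda>gs. koszul odd_vec x y * sprod (us @ y # x # vs) gs)"
  by (simp add: sprod_def perm_sum_swap[of _ _ us x y vs])

lemma sprod_arg_swap:
  assumes "homog fs" "homog (us @ x # y # vs)"
  shows "sprod fs (us @ x # y # vs) = koszul odd_vec x y * sprod fs (us @ y # x # vs)"
  unfolding sprod_def using assms
  by (subst (1 2) perm_sum_tens[symmetric]) (auto simp: perm_sum_swap[of _ _ us x y vs])

text \<open>The sign is chosen before the prefix \<open>us\<close>, because the induction lengthens
  the prefix.\<close>

lemma sprod_move:
  "\<exists>c. \<forall>us. sprod (us @ f # as @ bs) = (\<lambda>gs. c * sprod (us @ as @ f # bs) gs)"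
proof (induction as)
  case Nil
  show ?case by (intro exI[of _ 1]) simp
next
  case (Cons a as)
  then obtain c where c: "\<And>us. sprod (us @ f # as @ bs) = (\<lambda>gs. c * sprod (us @ as @ f # bs) gs)" by blast
  have "sprod (us @ f # (a # as) @ bs) = (\<lambda>gs. koszul odd_vec f a * c * sprod (us @ (a # as) @ f # bs) gs)" for us
    using sprod_swap[of us f a "as @ bs"] c[of "us @ [a]"] by (simp add: mult.assoc)
  then show ?case by blast
qed

lemma sprod_sort:
  assumes "set fs \<subseteq> Epos \<union> Eneg"
  shows "\<exists>as bs c. set as \<subseteq> Eneg \<and> set bs \<subseteq> Epos \<and>
    (\<forall>us. sprod (us @ fs) = (\<lambda>gs. c * sprod (us @ as @ bs) gs))"
  using assms
proof (induction fs)
  case Nil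
  show ?case by (intro exI[of _ "[]"] exI[of _ 1]) simp
next
  case (Cons f fs)
  then obtain as bs c where *: "set as \<subseteq> Eneg" "set bs \<subseteq> Epos"
    "\<And>us. sprod (us @ fs) = (\<lambda>gs. c * sprod (us @ as @ bs) gs)" by auto
  have 1: "sprod (us @ f # fs) = (\<lambda>gs. c * sprod (us @ f # as @ bs) gs)" for us
    using *(3)[of "us @ [f]"] by simp
  show ?case
  proof (cases "f \<in> Eneg")
    case True
    then show ?thesis using * 1 by (intro exI[of _ "f # as"] exI[of _ bs] exI[of _ c]) auto
  next
    case False
    obtain d where "\<And>us. sprod (us @ f # as @ bs) = (\<lambda>gs. d * sprod (us @ as @ f # bs) gs)"
      using sprod_move[of f as bs] by blast
    then show ?thesis using * 1 False Cons.prems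
      by (intro exI[of _ as] exI[of _ "f # bs"] exI[of _ "c * d"]) (auto simp: mult.assoc)
  qed
qed

abbreviation tspan :: "'a tensor set \<Rightarrow> 'a tensor set" where
  "tspan \<equiv> module.span (\<lambda>c F gs. c * F gs)"

lemma tspan_induct [consumes 1, case_names zero add]:
  assumes "x \<in> tspan S" "P (\<lambda>_. 0)" "\<And>c F G. F \<in> S \<Longrightarrow> P G \<Longrightarrow> P (\<lambda>gs. c * F gs + G gs)"
  shows "P x"
  using module.span_induct_alt[OF tens_module assms(1), of P] assms(2,3)
  by (simp add: plus_fun_def zero_fun_def)

lemma tspan_base: "F \<in> S \<Longrightarrow> F \<in> tspan S"
  by (rule module.span_base[OF tens_module])

lemma tspan_zero: "(\<lambda>_. 0) \<in> tspan S"
  using module.span_zero[OF tens_module, of S] by (simp add: zero_fun_def)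

lemma tspan_add: "F \<in> tspan S \<Longrightarrow> G \<in> tspan S \<Longrightarrow> (\<lambda>gs. F gs + G gs) \<in> tspan S"
  using module.span_add[OF tens_module, of F S G] by (simp add: plus_fun_def)

lemma tspan_scale: "F \<in> tspan S \<Longrightarrow> (\<lambda>gs. c * F gs) \<in> tspan S"
  by (rule module.span_scale[OF tens_module])

lemma tspan_subset:
  assumes "F \<in> tspan S" "\<And>G. G \<in> S \<Longrightarrow> G \<in> tspan T" shows "F \<in> tspan T"
  using assms(1)
proof (induction rule: tspan_induct)
  case (add c F G)
  show ?case by (rule tspan_add[OF tspan_scale]) (use add assms(2) in auto)
qed (rule tspan_zero)

definition sorted_prods :: "'h::super_hilbert_space tensor set" where
  "sorted_prods = {sprod (as @ bs) | as bs. set as \<subseteq> Eneg \<and> set bs \<subseteq> Epos}"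

text \<open>The entries in \<open>us\<close> are already pure; each entry of \<open>vs\<close> is
  split into its components in \<open>E0\<close>, \<open>E1\<close> and their duals. Once all are
  pure, the product can be sorted.\<close>

lemma supersym_tens_span: "supersym (tens (us @ vs)) \<in> tspan sorted_prods" if "set us \<subseteq> Epos \<union> Eneg"
  using that
proof (induction vs arbitrary: us)
  case Nil
  then have h: "homog us" using Epos_subset Eneg_subset by blast
  obtain as bs c where *: "set as \<subseteq> Eneg" "set bs \<subseteq> Epos" 
    "\<And>us'. sprod (us' @ us) = (\<lambda>gs. c * sprod (us' @ as @ bs) gs)"
    using sprod_sort[OF Nil] by blast
  have "supersym (tens us) = (\<lambda>gs. (c / sqrt_fact (length us)) * sprod (as @ bs) gs)"
    using supersym_tens[OF h] *(3)[of "[]"] by simp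
  moreover have "sprod (as @ bs) \<in> sorted_prods" using * by (auto simp: sorted_prods_def)
  then have "(\<lambda>gs. (c / sqrt_fact (length us)) * sprod (as @ bs) gs) \<in> tspan sorted_prods"
    by (rule tspan_scale[OF tspan_base])
  ultimately have "supersym (tens us) \<in> tspan sorted_prods" by (simp only:)
  then show ?case by simp
next
  case (Cons v vs)
  obtain a b c d where v: "v = (a + invol b) + (c + invol d)" "a \<in> E0" "b \<in> E0" "c \<in> E1" "d \<in> E1"
    using decomposition[of v] by blast
  have add: "tens (us @ (x + y) # vs) = (\<lambda>gs. tens (us @ x # vs) gs + tens (us @ y # vs) gs)" for x y
  proof
    fix gs
    have c: "tens fs gs = cnj (tens gs fs)" for fs gs :: "'a list"
    proof -
      have "(\<Prod>i<length fs. cinner (gs ! i) (fs ! i)) = (\<Prod>i<length fs. cnj (cinner (fs ! i) (gs ! i)))"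
        by (rule prod.cong[OF refl]) (rule cinner_commute)
      then show ?thesis by (simp add: tens_def)
    qed
    show "tens (us @ (x + y) # vs) gs = tens (us @ x # vs) gs + tens (us @ y # vs) gs"
      unfolding c[of _ gs] multi_antilinear_additive[OF multi_antilinear_tens] by simp
  qed
  have pure: "supersym (tens (us @ x # vs)) \<in> tspan sorted_prods" if "x \<in> Epos \<union> Eneg" for x
    using Cons.IH[of "us @ [x]"] Cons.prems that by simp
  show ?case
    unfolding v(1) add supersym_add
    by (intro tspan_add pure) (use v in \<open>auto simp: Epos_def Eneg_def\<close>)
qed

lemma supersym_zero: "supersym (\<lambda>_. 0) = (\<lambda>_. 0)"
  using supersym_scale[of 0 "\<lambda>_. 0"] by simp

lemma supersym_span:
  assumes "F \<in> tspan S" "\<And>G. G \<in> S \<Longrightarrow> supersym G \<in> tspan T"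
  shows "supersym F \<in> tspan T"
  using assms(1)
proof (induction rule: tspan_induct)
  case zero
  show ?case unfolding supersym_zero by (rule tspan_zero)
next
  case (add c F G)
  show ?case unfolding supersym_add supersym_scale
    by (rule tspan_add[OF tspan_scale]) (use add assms(2) in auto)
qed

lemma Sfin_subset: "Sfin \<subseteq> tspan sorted_prods"
proof
  fix F :: "'a tensor" assume "F \<in> Sfin"
  then obtain G where "G \<in> tspan (range tens)" "F = supersym G" unfolding Sfin_def by blast
  moreover have "supersym H \<in> tspan sorted_prods" if H: "H \<in> range tens" for H :: "'a tensor"
  proof -
    obtain fs where "H = tens fs" using H by blast
    then show ?thesis using supersym_tens_span[of "[]" fs] by simp
  qed
  ultimately show "F \<in> tspan sorted_prods" using supersym_span[of G "range tens" sorted_prods] by simp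
qed

lemma Sfin_scale: assumes "F \<in> Sfin" shows "(\<lambda>gs. c * F gs) \<in> Sfin"
proof -
  obtain F' where F: "F' \<in> tspan (range tens)" "F = supersym F'" using assms unfolding Sfin_def by blast
  have "supersym (\<lambda>gs. c * F' gs) \<in> Sfin" unfolding Sfin_def by (intro imageI tspan_scale F(1))
  then show ?thesis by (simp only: supersym_scale F(2))
qed

lemma Sfin_add: assumes "F \<in> Sfin" "G \<in> Sfin" shows "(\<lambda>gs. F gs + G gs) \<in> Sfin"
proof -
  obtain F' where F: "F' \<in> tspan (range tens)" "F = supersym F'" using assms(1) unfolding Sfin_def by blast
  obtain G' where G: "G' \<in> tspan (range tens)" "G = supersym G'" using assms(2) unfolding Sfin_def by blast
  have "supersym (\<lambda>gs. F' gs + G' gs) \<in> Sfin" unfolding Sfin_def by (intro imageI tspan_add F(1) G(1))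
  then show ?thesis by (simp only: supersym_add F(2) G(2))
qed

lemma Sfin_zero: "(\<lambda>_. 0) \<in> Sfin"
  unfolding Sfin_def by (rule image_eqI[of _ _ "\<lambda>_. 0"]) (simp_all add: supersym_zero tspan_zero)

lemma sprod_in_Sfin: assumes "homog fs" shows "sprod fs \<in> Sfin"
proof -
  have "sprod fs = supersym (\<lambda>gs. sqrt_fact (length fs) * tens fs gs)"
    by (simp add: supersym_scale supersym_tens[OF assms])
  moreover have "(\<lambda>gs. sqrt_fact (length fs) * tens fs gs) \<in> tspan (range tens)"
    by (rule tspan_scale[OF tspan_base[OF rangeI]])
  ultimately show ?thesis unfolding Sfin_def by (simp only: imageI)
qed

lemma sprod_in_tens_span: "sprod fs \<in> tspan (range tens)"
proof -
  have "(\<lambda>gs. \<Sum>s\<in>S. c s * tens (g s) gs) \<in> tspan (range tens)" if "finite S" for S :: "(nat \<Rightarrow> nat) set" and c and g :: "_ \<Rightarrow> 'a list"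
    using that
  proof induction
    case (insert x F)
    show ?case unfolding sum.insert[OF insert(1,2)]
      by (rule tspan_add[OF tspan_scale[OF tspan_base[OF rangeI]] insert(3)])
  qed (simp add: tspan_zero)
  from this[OF finite_permutations[OF finite_lessThan], of "\<lambda>s. perm_koszul odd_vec s fs / sqrt_fact (length fs)" "\<lambda>s. permute_list s fs" "length fs"]
  show ?thesis by (simp add: sprod_def perm_sum_def sum_divide_distrib)
qed

section \<open>The Gaussian functional\<close>

definition gauss_args :: "'h::super_hilbert_space list \<Rightarrow> 'h list" where
  "gauss_args es = concat (map (\<lambda>e. [invol e, jmap e]) es)"

text \<open>The square root cancels the normalisation of \<open>sprod\<close> in degree
  \<open>2 * n\<close>; the rest is the denominator of Wick's formula.\<close>

definition gauss_coeff :: "nat \<Rightarrow> complex" where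
  "gauss_coeff n = sqrt_fact (2 * n) / (2 ^ n * fact n)"

text \<open>The functional contracts a tensor of degree \<open>2n\<close> with the \<open>n\<close>-th power of
  \<open>\<Sum>\<^sub>e e\<^sup>* \<otimes> j e\<close>. This sum does not converge in the Hilbert tensor product, but it can be evaluated
  on algebraic tensors.\<close>

definition gauss_sum :: "'h::super_hilbert_space tensor \<Rightarrow> complex" where
  "gauss_sum F = (\<Sum>\<^sub>\<infinity>es\<in>lists onb. gauss_coeff (length es) * F (gauss_args es))"

lemma tens_Cons_Cons: "tens (f # fs) (g # gs) = cinner g f * tens fs gs"
  by (simp add: tens_def prod.lessThan_Suc_shift del: prod.lessThan_Suc)

lemma length_gauss_args: "length (gauss_args es) = 2 * length es"
  by (induction es) (simp_all add: gauss_args_def)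

lemma tens_gauss_args:
  "length hs = 2 * n \<Longrightarrow> tens hs (gauss_args es) =
    (if length es = n then \<Prod>k<n. cinner (invol (es ! k)) (hs ! (2 * k)) * cinner (jmap (es ! k)) (hs ! (2 * k + 1)) else 0)"
proof (induction n arbitrary: hs es)
  case 0
  then show ?case by (cases es) (auto simp: gauss_args_def tens_def)
next
  case (Suc n)
  then obtain x y r where hs: "hs = x # y # r" "length r = 2 * n" by (auto simp: length_Suc_conv)
  show ?case
  proof (cases es)
    case Nil
    then show ?thesis using hs by (simp add: gauss_args_def tens_def)
  next
    case (Cons e es')
    have "tens hs (gauss_args es) = cinner (invol e) x * (cinner (jmap e) y * tens r (gauss_args es'))"
      by (simp add: Cons hs gauss_args_def tens_Cons_Cons)
    then show ?thesis
      using Suc.IH[OF hs(2), of es'] by (simp add: Cons hs prod.lessThan_Suc_shift del: prod.lessThan_Suc)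
  qed
qed

text \<open>Parseval contracts neighbouring slots: as \<open>j\<close> is self-adjoint, summing
  \<open>(e\<^sup>* | f) (j e | g)\<close> over the basis gives \<open>(f\<^sup>* | j g)\<close>,
  which is \<open>omega f g\<close>.\<close>

lemma has_sum_gauss_tens:
  "((\<lambda>es. gauss_coeff (length es) * tens hs (gauss_args es)) has_sum
     gauss_coeff (length hs div 2) * pairing omega hs) (lists onb)"
proof (cases "even (length hs)")
  case False
  then have "length (gauss_args es) \<noteq> length hs" for es :: "'a list"
    using length_gauss_args[of es] by (metis dvd_triv_left)
  then have "tens hs (gauss_args es) = 0" for es
    by (simp add: tens_def)
  then show ?thesis using False by (simp add: pairing_odd)
next
  case True
  then obtain n where n: "length hs = 2 * n" by (rule evenE)
  have "((\<lambda>e. cinner (invol e) f * cinner (jmap e) g) has_sum omega f g) onb" for f g :: 'a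
    using parseval[of "invol f" "jmap g"] by (simp add: omega_def cinner_invol_swap[of _ f] cinner_jmap)
  then have "((\<lambda>es. if length es = n then \<Prod>k<n. cinner (invol (es ! k)) (hs ! (2 * k)) * cinner (jmap (es ! k)) (hs ! (2 * k + 1)) else 0)
      has_sum (\<Prod>k<n. omega (hs ! (2 * k)) (hs ! (2 * k + 1)))) (lists onb)"
    by (intro has_sum_prod_lists)
  from has_sum_cmult_right[OF this, of "gauss_coeff n"]
  have "((\<lambda>es. gauss_coeff n * tens hs (gauss_args es)) has_sum gauss_coeff n * pairing omega hs) (lists onb)"
    by (simp only: tens_gauss_args[OF n] pairing_prod[OF n])
  moreover have "(\<lambda>es. gauss_coeff (length es) * tens hs (gauss_args es)) = (\<lambda>es. gauss_coeff n * tens hs (gauss_args es))"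
  proof
    fix es
    show "gauss_coeff (length es) * tens hs (gauss_args es) = gauss_coeff n * tens hs (gauss_args es)"
      by (cases "length es = n") (simp_all add: tens_def length_gauss_args n)
  qed
  ultimately show ?thesis by (simp only: n) simp
qed

lemma gauss_summable:
  assumes "F \<in> tspan (range tens)"
  shows "(\<lambda>es. gauss_coeff (length es) * F (gauss_args es)) summable_on lists onb"
  using assms
proof (induction rule: tspan_induct)
  case zero
  show ?case by simp
next
  case (add c F G)
  then obtain fs where F: "F = tens fs" by blast
  have "(\<lambda>es. c * (gauss_coeff (length es) * tens fs (gauss_args es)) + gauss_coeff (length es) * G (gauss_args es)) summable_on lists onb"
    by (intro summable_on_add summable_on_cmult_right add(2) has_sum_imp_summable[OF has_sum_gauss_tens])
  then show ?case by (simp add: F algebra_simps)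
qed

lemma gauss_sum_add:
  assumes "F \<in> tspan (range tens)" "G \<in> tspan (range tens)"
  shows "gauss_sum (\<lambda>gs. F gs + G gs) = gauss_sum F + gauss_sum G"
  unfolding gauss_sum_def using infsum_add[OF gauss_summable[OF assms(1)] gauss_summable[OF assms(2)]]
  by (simp add: algebra_simps)

lemma gauss_sum_scale: "gauss_sum (\<lambda>gs. c * F gs) = c * gauss_sum F"
  unfolding gauss_sum_def by (subst infsum_cmult_right'[symmetric]) (simp add: mult_ac)

lemma gauss_sum_tens: "gauss_sum (tens hs) = gauss_coeff (length hs div 2) * pairing omega hs"
  unfolding gauss_sum_def by (rule infsumI[OF has_sum_gauss_tens])

lemma gauss_sum_sum:
  assumes "finite S"
  shows "gauss_sum (\<lambda>gs. \<Sum>s\<in>S. c s * tens (g s) gs) = (\<Sum>s\<in>S. c s * gauss_sum (tens (g s)))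
    \<and> (\<lambda>gs. \<Sum>s\<in>S. c s * tens (g s) gs) \<in> tspan (range tens)"
  using assms
proof induction
  case empty
  show ?case using gauss_sum_scale[of 0 "\<lambda>_. 0"] by (simp add: tspan_zero)
next
  case (insert x S)
  then have S: "(\<lambda>gs. \<Sum>s\<in>S. c s * tens (g s) gs) \<in> tspan (range tens)" by simp
  have x: "(\<lambda>gs. c x * tens (g x) gs) \<in> tspan (range tens)"
    by (rule tspan_scale[OF tspan_base[OF rangeI]])
  have "gauss_sum (\<lambda>gs. c x * tens (g x) gs + (\<Sum>s\<in>S. c s * tens (g s) gs)) =
    c x * gauss_sum (tens (g x)) + (\<Sum>s\<in>S. c s * gauss_sum (tens (g s)))"
    using gauss_sum_add[OF x S] insert.IH by (simp add: gauss_sum_scale)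
  then show ?case using tspan_add[OF x S] by (simp add: insert.hyps)
qed

lemma gauss_sum_sprod: "gauss_sum (sprod fs) = wick odd_vec omega fs"
proof -
  let ?S = "{s. s permutes {..<length fs}}" let ?n = "length fs div 2"
  have "sprod fs = (\<lambda>gs. \<Sum>s\<in>?S. (perm_koszul odd_vec s fs / sqrt_fact (length fs)) * tens (permute_list s fs) gs)"
    by (simp add: sprod_def perm_sum_def sum_divide_distrib)
  then have "gauss_sum (sprod fs) =
    (\<Sum>s\<in>?S. (perm_koszul odd_vec s fs / sqrt_fact (length fs)) * gauss_sum (tens (permute_list s fs)))"
    using gauss_sum_sum[of ?S "\<lambda>s. perm_koszul odd_vec s fs / sqrt_fact (length fs)" "\<lambda>s. permute_list s fs"]
    by (simp add: finite_permutations)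
  also have "\<dots> = gauss_coeff ?n / sqrt_fact (length fs) * perm_sum odd_vec (pairing omega) fs"
    by (simp add: gauss_sum_tens perm_sum_def sum_distrib_left mult_ac)
  also have "\<dots> = wick odd_vec omega fs"
  proof (cases "even (length fs)")
    case True
    then show ?thesis by (simp add: gauss_coeff_def wick_def)
  next
    case False
    have "perm_sum odd_vec (pairing omega) fs = perm_sum odd_vec (\<lambda>_. 0) fs"
      using False by (intro perm_sum_cong pairing_odd) (metis size_mset)
    then show ?thesis using wick_odd[OF False] by (simp add: perm_sum_def)
  qed
  finally show ?thesis .
qed

lemma Sfin_tens_span: "Sfin \<subseteq> tspan (range tens)"
proof
  fix F :: "'a tensor" assume "F \<in> Sfin"
  then have "F \<in> tspan sorted_prods" using Sfin_subset by blast
  then show "F \<in> tspan (range tens)"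
    by (rule tspan_subset) (auto simp: sorted_prods_def sprod_in_tens_span)
qed

text \<open>The explicit sum is defined on tensors, not on products, and is linear where it
  converges. Wick's prescription is thus seen to be consistent without examining the linear
  relations between products.\<close>

lemma is_gauss_functional_gauss_sum: "is_gauss_functional gauss_sum"
  unfolding is_gauss_functional_def
proof (intro conjI ballI allI impI)
  fix F G :: "'a tensor" assume "F \<in> Sfin" "G \<in> Sfin"
  then show "gauss_sum (F + G) = gauss_sum F + gauss_sum G"
    using gauss_sum_add[of F G] Sfin_tens_span by (auto simp: plus_fun_def)
next
  show "gauss_sum (tens []) = 1" using gauss_sum_sprod[of "[]"] by (simp add: sprod_Nil)
next
  fix fs :: "'a list" assume "homog fs \<and> odd (length fs)"
  then show "gauss_sum (fprod fs) = 0" by (simp add: fprod_sprod gauss_sum_sprod wick_odd)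
next
  fix fs :: "'a list" and n assume fs: "homog fs \<and> length fs = 2 * n"
  have "pairing omega (permute_list s fs) = (\<Prod>k<n. omega (fs ! s (2 * k)) (fs ! s (2 * k + 1)))"
    if "s permutes {..<2 * n}" for s
    using that fs pairing_prod[of "permute_list s fs" n omega] by (simp add: permute_list_nth)
  then show "gauss_sum (fprod fs) = (\<Sum>s | s permutes {..<2 * n}.
      chi s fs * (\<Prod>k<n. omega (fs ! s (2 * k)) (fs ! s (2 * k + 1)))) / (2 ^ n * fact n)"
    using fs by (simp add: fprod_sprod gauss_sum_sprod wick_def perm_sum_def chi_perm_koszul)
qed (simp add: gauss_sum_scale)

text \<open>Only the defining conditions are used of the functional selected by \<open>SOME\<close>;
  in even degree they prescribe the same value as for \<open>gauss_sum\<close>.\<close>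

lemma gauss_functional:
  fixes F G :: "'a::super_hilbert_space tensor" and fs :: "'a list"
  shows gauss_functional_add: "F \<in> Sfin \<Longrightarrow> G \<in> Sfin \<Longrightarrow>
      gauss_functional (\<lambda>gs. F gs + G gs) = gauss_functional F + gauss_functional G"
    and gauss_functional_scale: "F \<in> Sfin \<Longrightarrow> gauss_functional (\<lambda>gs. c * F gs) = c * gauss_functional F"
    and gauss_functional_sprod: "homog fs \<Longrightarrow> gauss_functional (sprod fs) = wick odd_vec omega fs"
proof -
  have g: "is_gauss_functional (gauss_functional :: 'a tensor \<Rightarrow> complex)"
    unfolding gauss_functional_def by (rule someI[of is_gauss_functional, OF is_gauss_functional_gauss_sum])
  show "F \<in> Sfin \<Longrightarrow> G \<in> Sfin \<Longrightarrow> gauss_functional (\<lambda>gs. F gs + G gs) = gauss_functional F + gauss_functional G"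
    using g by (simp add: is_gauss_functional_def plus_fun_def)
  show "F \<in> Sfin \<Longrightarrow> gauss_functional (\<lambda>gs. c * F gs) = c * gauss_functional F"
    using g by (simp add: is_gauss_functional_def)
  assume fs: "homog fs"
  show "gauss_functional (sprod fs) = wick odd_vec omega fs"
  proof (cases "even (length fs)")
    case True
    then obtain n where n: "length fs = 2 * n" by (rule evenE)
    have "L (fprod fs) = (\<Sum>s | s permutes {..<2 * n}.
      chi s fs * (\<Prod>k<n. omega (fs ! s (2 * k)) (fs ! s (2 * k + 1)))) / (2 ^ n * fact n)"
      if "is_gauss_functional L" for L :: "'a tensor \<Rightarrow> complex"
      using that fs n unfolding is_gauss_functional_def by blast
    from this[OF g] this[OF is_gauss_functional_gauss_sum]
    have "gauss_functional (fprod fs) = gauss_sum (fprod fs)" by simp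
    then show ?thesis using fs by (simp add: fprod_sprod gauss_sum_sprod)
  next
    case False
    then have "gauss_functional (fprod fs) = 0" using g fs unfolding is_gauss_functional_def by blast
    then show ?thesis using fs False by (simp add: fprod_sprod wick_odd)
  qed
qed

section \<open>Evaluation of \<open>phi\<close>\<close>

lemma supersym_sum:
  "finite I \<Longrightarrow> supersym (\<lambda>hs. \<Sum>i\<in>I. c i * F i hs) hs = (\<Sum>i\<in>I. c i * supersym (F i) hs)"
  by (induction I rule: finite_induct) (simp_all add: supersym_zero supersym_add supersym_scale)

lemma alt_supersym:
  "alt (\<lambda>ls'. supersym (K ls') hs) ls = supersym (\<lambda>hs'. alt (\<lambda>ls'. K ls' hs') ls) hs"
proof -
  let ?S = "{s. s permutes {..<length ls}}"
  have "supersym (\<lambda>hs'. alt (\<lambda>ls'. K ls' hs') ls) hs =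
    supersym (\<lambda>hs'. \<Sum>s\<in>?S. (of_int (sign s) / fact (length ls)) * K (permute_list s ls) hs') hs"
    by (simp add: alt_def sum_divide_distrib)
  then show ?thesis
    by (subst (asm) supersym_sum) (simp_all add: finite_permutations alt_def sum_divide_distrib)
qed

text \<open>What evaluation requires of a point, in a form stable under sums, \<open>sstar\<close>
  and \<open>jext\<close>. The bound for each fixed Grassmann argument is the continuity that allows
  expansion in \<open>onb\<close>.\<close>

definition superpoint :: "('l::involutive_hilbert_space, 'h::super_hilbert_space) stensor \<Rightarrow> bool" where
  "superpoint z \<longleftrightarrow>
     (\<forall>ls hs. length hs \<noteq> 1 \<longrightarrow> z ls hs = 0) \<and>
     (\<forall>h. (\<lambda>ls. z ls [h]) \<in> Lam) \<and>
     (\<forall>ls. multi_antilinear (z ls)) \<and>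
     (\<forall>ls. \<exists>K. \<forall>h. cmod (z ls [h]) \<le> norm h * K) \<and>
     (\<forall>h\<in>H0. \<forall>ls. odd (length ls) \<longrightarrow> z ls [h] = 0) \<and>
     (\<forall>h\<in>H1. \<forall>ls. even (length ls) \<longrightarrow> z ls [h] = 0)"

text \<open>The Grassmann-valued coefficient of the point along \<open>h\<close>, antilinear in
  \<open>h\<close> for a \<open>superpoint\<close>.\<close>

definition zval :: "('l::involutive_hilbert_space, 'h::super_hilbert_space) stensor \<Rightarrow> 'h \<Rightarrow> 'l grass" where
  "zval z h = Grass (\<lambda>ls. z ls [h])"

lemma gval_zval:
  assumes "superpoint z" shows "gval (zval z h) = (\<lambda>ls. z ls [h])"
proof -
  have "(\<lambda>ls. z ls [h]) \<in> Lam" using assms by (simp add: superpoint_def)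
  then show ?thesis by (simp add: zval_def Grass_inverse Lam_def)
qed

lemma zval_glam: "superpoint z \<Longrightarrow> zval z h \<in> glam"
  by (simp add: glam_def gval_zval) (simp add: superpoint_def)

lemma zval_add:
  assumes "superpoint z" shows "zval z (h + h') = zval z h + zval z h'"
proof (rule grass_eqI)
  fix ls
  have "multi_antilinear (z ls)" using assms by (simp add: superpoint_def)
  from multi_antilinear_additive[OF this, of "[]" h h' "[]"]
  show "gval (zval z (h + h')) ls = gval (zval z h + zval z h') ls"
    using assms by (simp add: gval_zval plus_grass.rep_eq)
qed

lemma superpoint_antilinear:
  assumes "superpoint z"
  shows "z ls [x + y] = z ls [x] + z ls [y]" "z ls [scaleC c x] = cnj c * z ls [x]" "z ls [0] = 0"
proof -
  have m: "multi_antilinear (z ls)" using assms by (simp add: superpoint_def)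
  show "z ls [x + y] = z ls [x] + z ls [y]" using multi_antilinear_additive[OF m, of "[]" x y "[]"] by simp
  show 0: "z ls [0] = 0" using multi_antilinear_zero[OF m] by simp
  show "z ls [scaleC c x] = cnj c * z ls [x]"
    using m[unfolded multi_antilinear_def, rule_format, of "[]" c x 0 x "[]"] by simp
qed

lemma zval_ghom:
  assumes "superpoint z" "h \<in> H0 \<union> H1"
  shows "ghom (of_bool (odd_vec h)) (zval z h)"
proof (cases "odd_vec h")
  case True
  then show ?thesis using assms by (auto simp: ghom_def gval_zval superpoint_def)
next
  case False
  then show ?thesis using assms by (auto simp: ghom_def gval_zval superpoint_def)
qed

lemma zval_commute:
  assumes "superpoint z" "x \<in> H0 \<union> H1" "y \<in> H0 \<union> H1"
  shows "zval z x * zval z y = gscal (koszul odd_vec x y) * (zval z y * zval z x)"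
proof -
  have "zval z x * zval z y = zval z y * galpha (of_bool (odd_vec y)) (zval z x)"
    by (rule ghom_commute[OF zval_ghom[OF assms(1,3)]])
  also have "\<dots> = zval z y * (gscal (koszul odd_vec x y) * zval z x)"
    by (subst galpha_ghom[OF zval_ghom[OF assms(1,2)]]) (simp add: koszul_def)
  finally show ?thesis by (simp only: gscal_left_commute)
qed

lemma prod_zval_swap:
  assumes "superpoint z" "x \<in> H0 \<union> H1" "y \<in> H0 \<union> H1"
  shows "prod_list (map (zval z) (us @ x # y # vs)) =
    gscal (koszul odd_vec x y) * prod_list (map (zval z) (us @ y # x # vs))"
proof -
  have "prod_list (map (zval z) us) * (zval z x * zval z y * w) =
    prod_list (map (zval z) us) * (gscal (koszul odd_vec x y) * (zval z y * zval z x) * w)" for w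
    by (simp only: zval_commute[OF assms])
  then show ?thesis by (simp add: mult.assoc gscal_left_commute[of "prod_list (map (zval z) us)"])
qed

lemma tmul_superpoint:
  assumes "\<And>ls hs. length hs \<noteq> 1 \<Longrightarrow> z ls hs = 0"
  shows "(\<Sum>p\<le>length ls. \<Sum>q\<le>length hs. grade_weight (length ls) p * grade_weight (length hs) q *
     (z (take p ls) (take q hs) * Y (drop p ls) (drop q hs))) =
    (if hs = [] then 0 else complex_of_real (sqrt (length hs)) *
      tmul (\<lambda>ls. z ls [hd hs]) (\<lambda>ls. Y ls (tl hs)) ls)"
proof (cases hs)
  case Nil
  then show ?thesis using assms by simp
next
  case (Cons h hs')
  have "(\<Sum>q\<le>length hs. grade_weight (length ls) p * grade_weight (length hs) q *
     (z (take p ls) (take q hs) * Y (drop p ls) (drop q hs))) =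
     (\<Sum>q\<le>length hs. if q = 1 then complex_of_real (sqrt (length hs)) *
       (grade_weight (length ls) p * (z (take p ls) [h] * Y (drop p ls) hs')) else 0)" for p
    by (rule sum.cong) (auto simp: Cons assms grade_weight_def fact_reduce)
  also have "\<dots> p = complex_of_real (sqrt (length hs)) *
       (grade_weight (length ls) p * (z (take p ls) [h] * Y (drop p ls) hs'))" for p
    by (simp add: Cons Suc_le_eq)
  finally show ?thesis by (simp add: Cons tmul_def sum_distrib_left)
qed

text \<open>Coefficients along odd vectors are odd and anticommute, so the product is already
  supersymmetric and the projection fixes it.\<close>

lemma supersym_prod_zval:
  assumes z: "superpoint z"
  shows "supersym (\<lambda>hs. if length hs = n then c * gval (prod_list (map (zval z) hs)) ls else 0) hs =
    (if length hs = n then c * gval (prod_list (map (zval z) hs)) ls else 0)"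
proof -
  let ?T = "\<lambda>hs. if length hs = n then c * gval (prod_list (map (zval z) hs)) ls else 0"
  have "perm_sum odd_vec ?T gs / fact (length hs) = ?T gs" if "gs \<in> set (splits hs)" for gs
  proof -
    have "perm_sum odd_vec ?T gs = fact (length gs) * ?T gs"
    proof (rule perm_sum_symmetric[where S = "H0 \<union> H1"])
      fix us vs :: "'b list" and x y assume "homog (us @ x # y # vs)"
      then show "?T (us @ x # y # vs) = koszul odd_vec x y * ?T (us @ y # x # vs)"
        using prod_zval_swap[OF z, of x y us vs] by (auto simp: gval_gscal_mult)
    qed (use in_splits[OF that] in simp)
    then show ?thesis using in_splits[OF that] by simp
  qed
  then have "supersym ?T hs = (\<Sum>gs\<leftarrow>splits hs. ?T gs)"
    unfolding supersym_perm_sum by (intro arg_cong[of _ _ sum_list] map_cong) auto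
  also have "\<dots> = ?T hs"
    by (rule sum_splits_additive) (simp add: zval_add[OF z] algebra_simps plus_grass.rep_eq)
  finally show ?thesis .
qed

text \<open>As \<open>z\<close> has Fock degree 1, each multiplication only splits off the first
  argument, with weight \<open>sqrt n\<close> in degree \<open>n\<close>; these weights multiply to
  \<open>sqrt_fact n\<close>.\<close>

lemma spow_eq:
  assumes z: "superpoint z"
  shows "spow z n ls hs = (if length hs = n then sqrt_fact n * gval (prod_list (map (zval z) hs)) ls else 0)"
proof (induction n arbitrary: ls hs)
  case 0
  show ?case by (auto simp: tprod_def one_grass.rep_eq) (auto simp: tens_def)
next
  case (Suc n)
  have z0: "length hs \<noteq> 1 \<Longrightarrow> z ls hs = 0" for ls hs using z by (simp add: superpoint_def)
  let ?T = "\<lambda>hs. if length hs = Suc n then sqrt_fact (Suc n) * gval (prod_list (map (zval z) hs)) ls else 0"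
  have "spow z (Suc n) ls hs = alt (\<lambda>ls'. supersym (\<lambda>hs'. if hs' = [] then 0 else
     complex_of_real (sqrt (length hs')) * tmul (\<lambda>ls. z ls [hd hs']) (\<lambda>ls. spow z n ls (tl hs')) ls') hs) ls"
  proof -
    have "(\<Sum>p\<le>length ls'. \<Sum>q\<le>length hs'. grade_weight (length ls') p * grade_weight (length hs') q *
       (z (take p ls') (take q hs') * spow z n (drop p ls') (drop q hs'))) =
      (if hs' = [] then 0 else complex_of_real (sqrt (length hs')) *
        tmul (\<lambda>ls. z ls [hd hs']) (\<lambda>ls. spow z n ls (tl hs')) ls')" for ls' :: "'a list" and hs' :: "'b list"
      by (rule tmul_superpoint) (rule z0)
    then show ?thesis unfolding spow.simps smul_def by (intro arg_cong2[where f = alt] refl ext arg_cong2[where f = supersym])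
  qed
  also have "\<dots> = supersym (\<lambda>hs'. alt (\<lambda>ls'. if hs' = [] then 0 else
     complex_of_real (sqrt (length hs')) * tmul (\<lambda>ls. z ls [hd hs']) (\<lambda>ls. spow z n ls (tl hs')) ls') ls) hs"
    by (rule alt_supersym)
  also have "(\<lambda>hs'. alt (\<lambda>ls'. if hs' = [] then 0 else
     complex_of_real (sqrt (length hs')) * tmul (\<lambda>ls. z ls [hd hs']) (\<lambda>ls. spow z n ls (tl hs')) ls') ls) = ?T"
  proof
    fix hs' :: "'b list"
    show "alt (\<lambda>ls'. if hs' = [] then 0 else
       complex_of_real (sqrt (length hs')) * tmul (\<lambda>ls. z ls [hd hs']) (\<lambda>ls. spow z n ls (tl hs')) ls') ls = ?T hs'"
    proof (cases hs')
      case Nil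
      then show ?thesis by (simp add: alt_def)
    next
      case (Cons h r)
      have "(\<lambda>ls. spow z n ls r) = (\<lambda>ls. (if length r = n then sqrt_fact n else 0) * gval (prod_list (map (zval z) r)) ls)"
        by (auto simp: Suc.IH)
      then have "alt (\<lambda>ls'. if hs' = [] then 0 else
       complex_of_real (sqrt (length hs')) * tmul (\<lambda>ls. z ls [hd hs']) (\<lambda>ls. spow z n ls (tl hs')) ls') ls
       = complex_of_real (sqrt (Suc (length r))) * ((if length r = n then sqrt_fact n else 0) *
          alt (tmul (gval (zval z h)) (gval (prod_list (map (zval z) r)))) ls)"
        by (simp add: Cons tmul_scale_right alt_scale gval_zval[OF z])
      then show ?thesis
        by (simp add: Cons times_grass.rep_eq gmul_alt_tmul sqrt_fact_Suc)
    qed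
  qed
  also have "supersym ?T hs = ?T hs" by (rule supersym_prod_zval[OF z])
  finally show ?case .
qed

lemma sexp_eq:
  assumes z: "superpoint z"
  shows "sexp z ls hs = gval (prod_list (map (zval z) hs)) ls / sqrt_fact (length hs)"
proof -
  have "sexp z ls hs = (\<Sum>p. if p = length hs then spow z (length hs) ls hs / fact (length hs) else 0)"
    unfolding sexp_def by (intro suminf_cong) (simp add: spow_eq[OF z])
  also have "\<dots> = spow z (length hs) ls hs / fact (length hs)"
    by (subst suminf_finite[of "{length hs}"]) auto
  finally show ?thesis by (simp add: spow_eq[OF z] sqrt_fact_square[symmetric])
qed

section \<open>Summing the form over lists of basis vectors\<close>

lemma gval_mult_expand:
  "\<exists>J. \<forall>a b. gval (a * b) ls = (\<Sum>(c, u, v)\<leftarrow>J. c * gval a u * gval b v)"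
proof -
  let ?S = "{s. s permutes {..<length ls}}"
  have "finite (?S \<times> {..length ls})" by (simp add: finite_permutations)
  then obtain xs where xs: "set xs = ?S \<times> {..length ls}" "distinct xs"
    using finite_distinct_list by blast
  let ?J = "map (\<lambda>(s, p). (of_int (sign s) * grade_weight (length ls) p / fact (length ls),
     take p (permute_list s ls), drop p (permute_list s ls))) xs"
  have "gval (a * b) ls = (\<Sum>(c, u, v)\<leftarrow>?J. c * gval a u * gval b v)" for a b :: "'a grass"
  proof -
    have "gval (a * b) ls = (\<Sum>s\<in>?S. \<Sum>p\<le>length ls. of_int (sign s) * grade_weight (length ls) p / fact (length ls) *
      gval a (take p (permute_list s ls)) * gval b (drop p (permute_list s ls)))"
      by (simp add: times_grass.rep_eq gmul_def alt_def sum_distrib_left sum_divide_distrib mult_ac)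
    also have "\<dots> = (\<Sum>(s, p)\<in>?S \<times> {..length ls}. of_int (sign s) * grade_weight (length ls) p / fact (length ls) *
      gval a (take p (permute_list s ls)) * gval b (drop p (permute_list s ls)))"
      by (simp add: sum.cartesian_product)
    also have "\<dots> = (\<Sum>(c, u, v)\<leftarrow>?J. c * gval a u * gval b v)"
      unfolding xs(1)[symmetric]
      by (subst sum.distinct_set_conv_list[OF xs(2)]) (simp add: o_def split_def)
    finally show ?thesis .
  qed
  then show ?thesis by blast
qed

text \<open>At a fixed Grassmann argument a product is a finite combination of products of
  coefficients, with data \<open>J\<close> independent of the factors. The infinite sum over basis
  lists can then be carried out slot by slot.\<close>

lemma gval_prod_expand:
  "\<exists>J. \<forall>as M. length as = n \<longrightarrow>
     gval (prod_list (rev as) * M) ls = (\<Sum>(c, us, v)\<leftarrow>J. c * (\<Prod>i<n. gval (as ! i) (us ! i)) * gval M v)"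
proof (induction n)
  case 0
  show ?case by (intro exI[of _ "[(1, [], ls)]"]) simp
next
  case (Suc n)
  then obtain J :: "(complex \<times> 'a list list \<times> 'a list) list" where J: "\<And>as M. length as = n \<Longrightarrow>
     gval (prod_list (rev as) * M) ls = (\<Sum>(c, us, v)\<leftarrow>J. c * (\<Prod>i<n. gval (as ! i) (us ! i)) * gval M v)"
    by blast
  have "\<exists>K. \<forall>v a b. gval (a * b) v = (\<Sum>(c, u, w)\<leftarrow>K v. c * gval a u * gval (b :: 'a grass) w)"
    using gval_mult_expand by (intro choice) blast
  then obtain K where K: "\<And>v a b. gval (a * b) v = (\<Sum>(c, u, w)\<leftarrow>K v. c * gval a u * gval (b :: 'a grass) w)"
    by blast
  let ?J = "concat (map (\<lambda>(c, us, v). map (\<lambda>(c', u, w). (c * c', u # us, w)) (K v)) J)"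
  have "gval (prod_list (rev as) * M) ls = (\<Sum>(c, us, v)\<leftarrow>?J. c * (\<Prod>i<Suc n. gval (as ! i) (us ! i)) * gval M v)"
    if l: "length as = Suc n" for as M
  proof -
    obtain a as' where as: "as = a # as'" "length as' = n" using l by (auto simp: length_Suc_conv)
    have "gval (prod_list (rev as) * M) ls = (\<Sum>(c, us, v)\<leftarrow>J. c * (\<Prod>i<n. gval (as' ! i) (us ! i)) * gval (a * M) v)"
      using J[OF as(2), of "a * M"] by (simp add: as mult.assoc)
    also have "\<dots> = (\<Sum>(c, us, v)\<leftarrow>J. \<Sum>(c', u, w)\<leftarrow>K v. c * c' * (gval a u * (\<Prod>i<n. gval (as' ! i) (us ! i))) * gval M w)"
      unfolding K by (intro arg_cong[of _ _ sum_list] map_cong refl)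
        (auto simp: sum_list_const_mult[symmetric] mult_ac split_def)
    also have "\<dots> = (\<Sum>(c, us, v)\<leftarrow>?J. c * (\<Prod>i<Suc n. gval (as ! i) (us ! i)) * gval M v)"
      by (induction J) (auto simp: as o_def split_def prod.lessThan_Suc_shift simp del: prod.lessThan_Suc)
    finally show ?thesis .
  qed
  then show ?case by blast
qed

lemma has_sum_sum_list:
  fixes f :: "'a \<Rightarrow> 'b \<Rightarrow> complex"
  assumes "\<And>j. j \<in> set J \<Longrightarrow> (f j has_sum s j) A"
  shows "((\<lambda>x. \<Sum>j\<leftarrow>J. f j x) has_sum (\<Sum>j\<leftarrow>J. s j)) A"
  using assms by (induction J) (auto intro!: has_sum_add)

lemma superpoint_has_sum:
  assumes z: "superpoint z"
  shows "((\<lambda>b. cinner b f * z us [invol b]) has_sum z us [invol f]) onb"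
proof -
  obtain K where K: "\<And>h. cmod (z us [h]) \<le> norm h * K" using z unfolding superpoint_def by blast
  show ?thesis
  proof (rule has_sum_onb_functional[where T = "\<lambda>b. z us [invol b]"])
    show "cmod (z us [invol x]) \<le> norm x * K" for x using K[of "invol x"] by (simp add: norm_invol)
  qed (simp_all add: superpoint_antilinear[OF z] invol_add invol_scaleC)
qed

text \<open>Convergence and value in one relation: \<open>infsum\<close> returns 0 for a divergent
  series, so unconditional additivity is only available for \<open>has_sum\<close>.\<close>

definition phi_sums :: "('l::involutive_hilbert_space, 'h::super_hilbert_space) stensor \<Rightarrow>
    ('l, 'h) stensor \<Rightarrow> 'l grass \<Rightarrow> bool" where
  "phi_sums z X v \<longleftrightarrow> (\<forall>ls. ((\<lambda>bs. gmul (\<lambda>as. sexp z as (rev (map invol bs))) (\<lambda>as. X as bs) ls)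
     has_sum gval v ls) (lists onb))"

text \<open>The value at \<open>z\<close> of the monomial \<open>fs\<close>. The factors are
  reversed because the form evaluates the exponential at \<open>rev (map invol bs)\<close>.\<close>

definition zprod :: "('l::involutive_hilbert_space, 'h::super_hilbert_space) stensor \<Rightarrow> 'h list \<Rightarrow> 'l grass" where
  "zprod z fs = prod_list (map (\<lambda>f. zval z (invol f)) (rev fs))"

lemma phi_sums_sform: "phi_sums z X v \<Longrightarrow> sform (sexp z) X = gval v"
  unfolding phi_sums_def sform_def by (auto intro!: ext infsumI)

lemma phi_sums_zero: "phi_sums z (\<lambda>ls hs. 0) 0"
  by (simp add: phi_sums_def zero_grass.rep_eq gmul_def alt_def)

lemma phi_sums_add:
  assumes "phi_sums z X v" "phi_sums z Y w" shows "phi_sums z (\<lambda>ls hs. X ls hs + Y ls hs) (v + w)"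
  using assms unfolding phi_sums_def
  by (simp add: gmul_alt_tmul tmul_add_right alt_add plus_grass.rep_eq has_sum_add)

lemma phi_sums_scale:
  assumes "phi_sums z X v" shows "phi_sums z (\<lambda>ls hs. c * X ls hs) (gscal c * v)"
  using assms unfolding phi_sums_def
  by (simp add: gmul_alt_tmul tmul_scale_right alt_scale gval_gscal_mult has_sum_cmult_right)

text \<open>In each slot the expansion of \<open>f\<close> in the basis collapses, replacing the
  basis vector by \<open>f\<close>; the remaining root of a factorial comes from
  \<open>sexp_eq\<close>.\<close>

lemma phi_sums_tens:
  assumes z: "superpoint z"
  shows "phi_sums z (tprod (gval M) (tens fs)) (gscal (1 / sqrt_fact (length fs)) * (zprod z fs * M))"
  unfolding phi_sums_def
proof
  fix ls :: "'a list"
  let ?n = "length fs" let ?\<zeta> = "\<lambda>f. zval z (invol f)"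
  obtain J where J: "\<And>as M. length as = ?n \<Longrightarrow>
     gval (prod_list (rev as) * M) ls = (\<Sum>(c, us, v)\<leftarrow>J. c * (\<Prod>i<?n. gval (as ! i) (us ! i)) * gval M v)"
    using gval_prod_expand[of ?n ls] by blast
  have trm: "gmul (\<lambda>as. sexp z as (rev (map invol bs))) (\<lambda>as. tprod (gval M) (tens fs) as bs) ls =
    (1 / sqrt_fact ?n) * (\<Sum>(c, us, v)\<leftarrow>J. c * gval M v *
      (if length bs = ?n then \<Prod>i<?n. cinner (bs ! i) (fs ! i) * z (us ! i) [invol (bs ! i)] else 0))" for bs
  proof (cases "length bs = ?n")
    case True
    have "gmul (\<lambda>as. sexp z as (rev (map invol bs))) (\<lambda>as. tprod (gval M) (tens fs) as bs) ls =
      tens fs bs * ((1 / sqrt_fact ?n) * gval (prod_list (rev (map ?\<zeta> bs)) * M) ls)"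
      using True
      by (simp add: sexp_eq[OF z] tprod_def gmul_alt_tmul times_grass.rep_eq rev_map o_def
          tmul_scale_left[of "1 / sqrt_fact ?n", simplified] mult.commute[of _ "tens fs bs"] tmul_scale_right alt_scale
          alt_scale[of "1 / sqrt_fact ?n", simplified])
    also have "gval (prod_list (rev (map ?\<zeta> bs)) * M) ls =
      (\<Sum>(c, us, v)\<leftarrow>J. c * (\<Prod>i<?n. z (us ! i) [invol (bs ! i)]) * gval M v)"
      using True by (simp add: J gval_zval[OF z])
    finally show ?thesis
      using True by (simp add: tens_def sum_list_const_mult[symmetric] prod.distrib split_def mult_ac)
  next
    case False
    then have "(\<Sum>(c, us, v)\<leftarrow>J. c * gval M v *
      (if length bs = ?n then \<Prod>i<?n. cinner (bs ! i) (fs ! i) * z (us ! i) [invol (bs ! i)] else 0)) = 0"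
      by (induction J) auto
    then show ?thesis using False by (simp add: tprod_def tens_def gmul_def alt_def)
  qed
  have "((\<lambda>bs. \<Sum>j\<leftarrow>J. (case j of (c, us, v) \<Rightarrow> c * gval M v *
      (if length bs = ?n then \<Prod>i<?n. cinner (bs ! i) (fs ! i) * z (us ! i) [invol (bs ! i)] else 0)))
     has_sum (\<Sum>j\<leftarrow>J. (case j of (c, us, v) \<Rightarrow> c * gval M v * (\<Prod>i<?n. z (us ! i) [invol (fs ! i)])))) (lists onb)"
  proof (rule has_sum_sum_list)
    fix j :: "complex \<times> 'a list list \<times> 'a list"
    obtain c us v where j: "j = (c, us, v)" by (cases j) auto
    show "((\<lambda>bs. case j of (c, us, v) \<Rightarrow> c * gval M v *
      (if length bs = ?n then \<Prod>i<?n. cinner (bs ! i) (fs ! i) * z (us ! i) [invol (bs ! i)] else 0))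
     has_sum (case j of (c, us, v) \<Rightarrow> c * gval M v * (\<Prod>i<?n. z (us ! i) [invol (fs ! i)]))) (lists onb)"
      unfolding j prod.case
      by (intro has_sum_cmult_right has_sum_prod_lists superpoint_has_sum[OF z])
  qed
  moreover have "(\<Sum>j\<leftarrow>J. (case j of (c, us, v) \<Rightarrow> c * gval M v * (\<Prod>i<?n. z (us ! i) [invol (fs ! i)]))) =
    gval (zprod z fs * M) ls"
    using J[of "map ?\<zeta> fs" M] by (simp add: zprod_def rev_map gval_zval[OF z] mult_ac split_def)
  ultimately show "((\<lambda>bs. gmul (\<lambda>as. sexp z as (rev (map invol bs))) (\<lambda>as. tprod (gval M) (tens fs) as bs) ls)
     has_sum gval (gscal (1 / sqrt_fact ?n) * (zprod z fs * M)) ls) (lists onb)"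
    unfolding trm gval_gscal_mult by (intro has_sum_cmult_right) simp
qed

lemma zprod_swap:
  assumes "superpoint z" "x \<in> H0 \<union> H1" "y \<in> H0 \<union> H1"
  shows "zprod z (us @ x # y # vs) = gscal (koszul odd_vec x y) * zprod z (us @ y # x # vs)"
proof -
  have i: "invol x \<in> H0 \<union> H1" "invol y \<in> H0 \<union> H1" using assms invol_H0 invol_H1 by blast+
  have k: "koszul odd_vec (invol y) (invol x) = koszul odd_vec x y" by (auto simp: koszul_def invol_H1_iff)
  show ?thesis
    using prod_zval_swap[OF assms(1) i(2) i(1), of "map invol (rev vs)" "map invol (rev us)"]
    by (simp add: zprod_def o_def k)
qed

lemma phi_sums_sum:
  assumes "finite S" "\<And>s. s \<in> S \<Longrightarrow> phi_sums z (X s) (v s)"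
  shows "phi_sums z (\<lambda>ls hs. \<Sum>s\<in>S. c s * X s ls hs) (\<Sum>s\<in>S. gscal (c s) * v s)"
  using assms
proof (induction S)
  case (insert s S)
  have "phi_sums z (\<lambda>ls hs. c s * X s ls hs + (\<Sum>s\<in>S. c s * X s ls hs)) (gscal (c s) * v s + (\<Sum>s\<in>S. gscal (c s) * v s))"
    by (intro phi_sums_add phi_sums_scale) (use insert in auto)
  then show ?case by (simp add: insert.hyps)
qed (simp add: phi_sums_zero)

text \<open>The values \<open>zprod\<close> have the exchange symmetry of \<open>sprod\<close>, so
  all permutations contribute equally and their number compensates the two factors
  \<open>1 / sqrt_fact\<close>.\<close>

lemma phi_sums_sprod:
  assumes z: "superpoint z" and fs: "homog fs"
  shows "phi_sums z (tprod (gval M) (sprod fs)) (zprod z fs * M)"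
proof -
  let ?S = "{s. s permutes {..<length fs}}" let ?n = "length fs"
  let ?c = "\<lambda>s. perm_koszul odd_vec s fs / sqrt_fact ?n"
  have "phi_sums z (\<lambda>ls hs. \<Sum>s\<in>?S. ?c s * tprod (gval M) (tens (permute_list s fs)) ls hs)
     (\<Sum>s\<in>?S. gscal (?c s) * (gscal (1 / sqrt_fact (length (permute_list s fs))) * (zprod z (permute_list s fs) * M)))"
    by (intro phi_sums_sum phi_sums_tens[OF z]) (simp add: finite_permutations)
  moreover have "(\<lambda>ls hs. \<Sum>s\<in>?S. ?c s * tprod (gval M) (tens (permute_list s fs)) ls hs) = tprod (gval M) (sprod fs)"
    by (simp add: fun_eq_iff tprod_def sprod_def perm_sum_def sum_divide_distrib sum_distrib_left mult_ac)
  moreover have "(\<Sum>s\<in>?S. gscal (?c s) * (gscal (1 / sqrt_fact (length (permute_list s fs))) * (zprod z (permute_list s fs) * M)))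
    = zprod z fs * M"
  proof (rule grass_eqI)
    fix ls
    let ?G = "\<lambda>hs. gval (zprod z hs * M) ls"
    have "perm_sum odd_vec ?G fs = fact ?n * ?G fs"
    proof (rule perm_sum_symmetric[where S = "H0 \<union> H1"])
      fix us vs :: "'b list" and x y assume "homog (us @ x # y # vs)"
      then show "?G (us @ x # y # vs) = koszul odd_vec x y * ?G (us @ y # x # vs)"
        using zprod_swap[OF z, of x y us vs] by (simp add: mult.assoc gval_gscal_mult)
    qed (rule fs)
    then have "?G fs = perm_sum odd_vec ?G fs / (sqrt_fact ?n * sqrt_fact ?n)"
      by (simp add: sqrt_fact_square)
    then show "gval (\<Sum>s\<in>?S. gscal (?c s) * (gscal (1 / sqrt_fact (length (permute_list s fs))) * (zprod z (permute_list s fs) * M))) ls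
      = gval (zprod z fs * M) ls"
      by (simp add: gval_sum gval_gscal_mult perm_sum_def sum_divide_distrib)
  qed
  ultimately show ?thesis by simp
qed

section \<open>Points of \<open>ELam\<close>\<close>

lemma multi_antilinear_scale:
  assumes "multi_antilinear F" shows "F (us @ scaleC a x # vs) = cnj a * F (us @ x # vs)"
  using assms[unfolded multi_antilinear_def, rule_format, of us a x 0 x vs] by simp

lemma SLam_bound:
  assumes "X \<in> SLam"
  shows "\<exists>C. \<forall>A N h. finite A \<longrightarrow> orthonormal A \<longrightarrow> norm h = 1 \<longrightarrow>
    (\<Sum>as\<in>{as \<in> lists A. length as \<le> N}. (cmod (X as [h]) / fact (length as))\<^sup>2) \<le> C"
proof -
  obtain C where C: "\<And>A B N. finite A \<and> orthonormal A \<and> finite B \<and> orthonormal B \<Longrightarrow>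
        (\<Sum>as\<in>{as \<in> lists A. length as \<le> N}. \<Sum>bs\<in>{bs \<in> lists B. length bs \<le> N}.
            (cmod (X as bs) / fact (length as))\<^sup>2) \<le> C"
    using assms unfolding SLam_def by blast
  have "(\<Sum>as\<in>{as \<in> lists A. length as \<le> N}. (cmod (X as [h]) / fact (length as))\<^sup>2) \<le> C"
    if A: "finite A" "orthonormal A" and h: "norm h = 1" for A N h
  proof -
    \<comment> \<open>\<open>Suc N\<close> ensures that the list \<open>[h]\<close> is included even
      if \<open>N\<close> is 0.\<close>
    let ?L = "\<lambda>N. {as \<in> lists A. length as \<le> N}" and ?M = "{bs \<in> lists {h}. length bs \<le> Suc N}"
    have fin: "finite (?L k)" "finite ?M" for k
      using finite_lists_length_le'[OF A(1)] finite_lists_length_le'[of "{h}"] by auto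
    have "(\<Sum>as\<in>?L N. (cmod (X as [h]) / fact (length as))\<^sup>2) \<le>
      (\<Sum>as\<in>?L N. \<Sum>bs\<in>?M. (cmod (X as bs) / fact (length as))\<^sup>2)"
    proof (rule sum_mono)
      fix as
      have "(\<Sum>bs\<in>{[h]}. (cmod (X as bs) / fact (length as))\<^sup>2) \<le> (\<Sum>bs\<in>?M. (cmod (X as bs) / fact (length as))\<^sup>2)"
        by (rule sum_mono2[OF fin(2)]) auto
      then show "(cmod (X as [h]) / fact (length as))\<^sup>2 \<le> (\<Sum>bs\<in>?M. (cmod (X as bs) / fact (length as))\<^sup>2)"
        by simp
    qed
    also have "\<dots> \<le> (\<Sum>as\<in>?L (Suc N). \<Sum>bs\<in>?M. (cmod (X as bs) / fact (length as))\<^sup>2)"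
      by (rule sum_mono2[OF fin(1)]) (auto intro: sum_nonneg)
    also have "\<dots> \<le> C" using C[of A "{h}" "Suc N"] A orthonormal_singleton[OF h] by simp
    finally show ?thesis .
  qed
  then show ?thesis by blast
qed

lemma normalize: "h = scaleC (complex_of_real (norm h)) (scaleC (complex_of_real (1 / norm h)) (h :: 'a::chilbert_space))"
  by (cases "h = 0") (simp_all flip: of_real_mult)

lemma SLam_component_Lam:
  assumes X: "X \<in> SLam" shows "(\<lambda>ls. X ls [h]) \<in> Lam"
proof -
  have m: "multi_antilinear (\<lambda>ls. X ls [h])" "multi_antilinear (X ls)" and a: "alt (\<lambda>ls. X ls [h]) = (\<lambda>ls. X ls [h])" for ls h
    using X by (auto simp: SLam_def)
  obtain C where C: "\<And>A N h. finite A \<Longrightarrow> orthonormal A \<Longrightarrow> norm h = 1 \<Longrightarrow>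
    (\<Sum>as\<in>{as \<in> lists A. length as \<le> N}. (cmod (X as [h]) / fact (length as))\<^sup>2) \<le> C"
    using SLam_bound[OF X] by blast
  have unit: "(\<lambda>ls. X ls [b]) \<in> Lam" if "norm b = 1" for b
    unfolding Lam_def using m a C[OF _ _ that] by blast
  show ?thesis
  proof (cases "h = 0")
    case True
    then have "X ls [h] = 0" for ls using multi_antilinear_zero[OF m(2)] by simp
    then show ?thesis using glam_0 by (simp add: glam_def zero_grass.rep_eq)
  next
    case False
    let ?b = "scaleC (complex_of_real (1 / norm h)) h"
    have "X ls [h] = cnj (complex_of_real (norm h)) * X ls [?b]" for ls
      using multi_antilinear_scale[OF m(2), where us = "[]" and a = "complex_of_real (norm h)" and x = ?b and vs = "[]"]
        normalize[of h]
      by simp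
    then show ?thesis using Lam_scale[OF unit[OF norm_sgn_scaleC[OF False]]] by simp
  qed
qed

text \<open>The Hilbert-Schmidt bound controls Grassmann arguments taken from a finite orthonormal
  set; antilinearity passes to its span one argument at a time, \<open>us\<close> holding the
  arguments still taken from the set.\<close>

lemma SLam_bounded:
  assumes X: "X \<in> SLam" shows "\<exists>K. \<forall>h. cmod (X ls [h]) \<le> norm h * K"
proof -
  have m: "multi_antilinear (\<lambda>ls. X ls h)" "multi_antilinear (X ls)" for ls h
    using X by (auto simp: SLam_def)
  obtain C where C: "\<And>A N h. finite A \<Longrightarrow> orthonormal A \<Longrightarrow> norm h = 1 \<Longrightarrow>
    (\<Sum>as\<in>{as \<in> lists A. length as \<le> N}. (cmod (X as [h]) / fact (length as))\<^sup>2) \<le> C"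
    using SLam_bound[OF X] by blast
  define Bd where "Bd ls \<longleftrightarrow> (\<exists>K. \<forall>h. cmod (X ls [h]) \<le> norm h * K)" for ls
  obtain A where A: "finite A" "orthonormal A" "set ls \<subseteq> chilbert.span A"
    using orthonormal_finite_span[of "set ls"] by auto
  have base: "Bd us" if us: "us \<in> lists A" for us
  proof -
    have unit: "cmod (X us [b]) \<le> fact (length us) * sqrt C" if "norm b = 1" for b
    proof -
      have "(\<Sum>as\<in>{us}. (cmod (X as [b]) / fact (length as))\<^sup>2) \<le>
        (\<Sum>as\<in>{as \<in> lists A. length as \<le> length us}. (cmod (X as [b]) / fact (length as))\<^sup>2)"
        by (rule sum_mono2[OF finite_lists_length_le'[OF A(1)]]) (use us in auto)
      also have "\<dots> \<le> C" by (rule C[OF A(1,2) that])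
      finally have "cmod (X us [b]) / fact (length us) \<le> sqrt C" by (simp add: real_le_rsqrt)
      then show ?thesis by (simp add: field_simps)
    qed
    have "cmod (X us [h]) \<le> norm h * (fact (length us) * sqrt C)" for h
    proof (cases "h = 0")
      case True
      then show ?thesis using multi_antilinear_zero[OF m(2)] by simp
    next
      case False
      let ?b = "scaleC (complex_of_real (1 / norm h)) h"
      have "X us [h] = cnj (complex_of_real (norm h)) * X us [?b]"
        using multi_antilinear_scale[OF m(2), of us "[]" "complex_of_real (norm h)" ?b "[]"] normalize[of h] by simp
      then show ?thesis
        using mult_left_mono[OF unit[OF norm_sgn_scaleC[OF False]], of "norm h"] by (simp add: norm_mult)
    qed
    then show ?thesis unfolding Bd_def by blast
  qed
  have "Bd (us @ vs)" if "us \<in> lists A" "set vs \<subseteq> chilbert.span A" for us vs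
    using that
  proof (induction vs arbitrary: us)
    case Nil
    then show ?case using base by simp
  next
    case (Cons v vs)
    from Cons.prems(2) have "v \<in> chilbert.span A" by simp
    then show ?case
    proof (induction rule: chilbert.span_induct_alt)
      case base
      have "X (us @ 0 # vs) [h] = 0" for h by (rule multi_antilinear_zero[OF m(1)]) simp
      then show ?case unfolding Bd_def by (auto intro!: exI[of _ 0])
    next
      case (step c x y)
      have "Bd (us @ x # vs)" using Cons.IH[of "us @ [x]"] Cons.prems step by simp
      then obtain K where K: "\<And>h. cmod (X (us @ x # vs) [h]) \<le> norm h * K" unfolding Bd_def by blast
      obtain K' where K': "\<And>h. cmod (X (us @ y # vs) [h]) \<le> norm h * K'" using step unfolding Bd_def by blast
      have "cmod (X (us @ (scaleC c x + y) # vs) [h]) \<le> norm h * (cmod c * K + K')" for h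
      proof -
        have "X (us @ (scaleC c x + y) # vs) [h] = cnj c * X (us @ x # vs) [h] + X (us @ y # vs) [h]"
          unfolding multi_antilinear_additive[OF m(1)] multi_antilinear_scale[OF m(1)] ..
        then have "cmod (X (us @ (scaleC c x + y) # vs) [h]) \<le> cmod c * cmod (X (us @ x # vs) [h]) + cmod (X (us @ y # vs) [h])"
          by (metis norm_triangle_ineq norm_mult complex_mod_cnj)
        also have "\<dots> \<le> cmod c * (norm h * K) + norm h * K'"
          by (intro add_mono mult_left_mono K K') simp
        finally show ?thesis by (simp add: algebra_simps)
      qed
      then show ?case unfolding Bd_def by blast
    qed
  qed
  from this[of "[]" ls] show ?thesis using A(3) by (simp add: Bd_def)
qed

text \<open>For each parity of \<open>h\<close>, one of the two kinds of tensor vanishes by its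
  degree condition and the other because \<open>h\<close> is orthogonal to its subspace.\<close>

lemma lam_tensor_superpoint:
  assumes X: "X \<in> lam_tensor 0 E0 \<or> X \<in> lam_tensor 1 E1" shows "superpoint X"
proof -
  have S: "X \<in> SLam" using X by (auto simp: lam_tensor_def)
  have l: "X ls hs \<noteq> 0 \<Longrightarrow> length hs = 1" for ls hs using X by (auto simp: lam_tensor_def)
  have H0: "X ls [h] = 0" if "h \<in> H0" "odd (length ls)" for h ls
    using X
  proof
    assume "X \<in> lam_tensor 0 E0"
    then have "X ls [h] \<noteq> 0 \<longrightarrow> length ls mod 2 = 0 mod 2" unfolding lam_tensor_def by blast
    then show ?thesis using that by (auto simp: even_iff_mod_2_eq_zero)
  next
    assume X1: "X \<in> lam_tensor 1 E1"
    have "\<forall>v\<in>E1. cinner h v = 0" using that E_subset_H(2) H0_H1_orth by blast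
    then show ?thesis using X1 unfolding lam_tensor_def by blast
  qed
  have H1: "X ls [h] = 0" if "h \<in> H1" "even (length ls)" for h ls
    using X
  proof
    assume "X \<in> lam_tensor 1 E1"
    then have "X ls [h] \<noteq> 0 \<longrightarrow> length ls mod 2 = 1 mod 2" unfolding lam_tensor_def by blast
    then show ?thesis using that by (auto simp: even_iff_mod_2_eq_zero)
  next
    assume X0: "X \<in> lam_tensor 0 E0"
    have "\<forall>v\<in>E0. cinner h v = 0" using that E_subset_H(1) H1_H0_orth by blast
    then show ?thesis using X0 unfolding lam_tensor_def by blast
  qed
  have "multi_antilinear (X ls)" for ls using S by (simp add: SLam_def)
  then show ?thesis
    unfolding superpoint_def using l H0 H1 SLam_component_Lam[OF S] SLam_bounded[OF S] by blast
qed

lemma superpoint_add: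
  assumes x: "superpoint x" and y: "superpoint y" shows "superpoint (x + y)"
  unfolding superpoint_def plus_fun_def
proof (intro conjI allI ballI impI)
  show "(\<lambda>ls. x ls [h] + y ls [h]) \<in> Lam" for h using x y by (intro Lam_add) (simp_all add: superpoint_def)
  show "multi_antilinear (\<lambda>hs. x ls hs + y ls hs)" for ls
    using x y by (simp add: superpoint_def multi_antilinear_def algebra_simps)
  show "\<exists>K. \<forall>h. cmod (x ls [h] + y ls [h]) \<le> norm h * K" for ls
  proof -
    have "\<exists>K. \<forall>h. cmod (x ls [h]) \<le> norm h * K" "\<exists>K. \<forall>h. cmod (y ls [h]) \<le> norm h * K"
      using x y by (simp_all add: superpoint_def)
    then obtain K K' where K: "\<And>h. cmod (x ls [h]) \<le> norm h * K" "\<And>h. cmod (y ls [h]) \<le> norm h * K'"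
      by blast
    have "cmod (x ls [h] + y ls [h]) \<le> norm h * (K + K')" for h
      using norm_triangle_ineq[of "x ls [h]" "y ls [h]"] K(1)[of h] K(2)[of h] by (simp add: algebra_simps)
    then show ?thesis by blast
  qed
qed (use x y in \<open>auto simp: superpoint_def\<close>)

lemma superpoint_sstar:
  assumes z: "superpoint z" shows "superpoint (sstar z)"
  unfolding superpoint_def
proof (intro conjI allI ballI impI)
  have eq: "sstar z ls [h] = tstar (\<lambda>ls. z ls [invol h]) ls" for ls h by (simp add: sstar_def tstar_def)
  show "(\<lambda>ls. sstar z ls [h]) \<in> Lam" for h unfolding eq using z by (intro Lam_tstar) (simp add: superpoint_def)
  show "multi_antilinear (sstar z ls)" for ls
    using multi_antilinear_tstar[of "z (rev (map invol ls))"] z by (simp add: superpoint_def sstar_def tstar_def)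
  show "\<exists>K. \<forall>h. cmod (sstar z ls [h]) \<le> norm h * K" for ls
  proof -
    obtain K where "\<And>h. cmod (z (rev (map invol ls)) [h]) \<le> norm h * K" using z unfolding superpoint_def by blast
    from this[of "invol _"] show ?thesis by (auto simp: sstar_def norm_invol)
  qed
qed (use z in \<open>auto simp: superpoint_def sstar_def invol_H0 invol_H1\<close>)

lemma superpoint_jext:
  assumes z: "superpoint z" shows "superpoint (jext z)"
  unfolding superpoint_def
proof (intro conjI allI ballI impI)
  show "(\<lambda>ls. jext z ls [h]) \<in> Lam" for h using z by (simp add: superpoint_def jext_def)
  show "multi_antilinear (jext z ls)" for ls
    using z by (simp add: superpoint_def jext_def multi_antilinear_def jmap_add jmap_scaleC)
  show "\<exists>K. \<forall>h. cmod (jext z ls [h]) \<le> norm h * K" for ls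
  proof -
    obtain K where "\<And>h. cmod (z ls [h]) \<le> norm h * K" using z unfolding superpoint_def by blast
    from this[of "jmap _"] show ?thesis by (auto simp: jext_def norm_jmap)
  qed
qed (use z in \<open>auto simp: superpoint_def jext_def jmap_H0 jmap_H1\<close>)

lemma ELam_superpoint: "x \<in> ELam \<Longrightarrow> superpoint x"
  unfolding ELam_def using superpoint_add lam_tensor_superpoint by blast

lemma zval_plus:
  assumes "superpoint x" "superpoint y" shows "zval (x + y) h = zval x h + zval y h"
  using assms superpoint_add[OF assms] by (intro grass_eqI) (simp add: gval_zval plus_grass.rep_eq)

lemma zval_sstar:
  assumes "superpoint z" shows "zval (sstar z) h = gstar (zval z (invol h))"
  using assms superpoint_sstar[OF assms]
  by (intro grass_eqI) (simp add: gval_zval gstar.rep_eq sstar_def tstar_def)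

lemma zval_jext:
  assumes "superpoint z" shows "zval (jext z) h = zval z (jmap h)"
  using assms superpoint_jext[OF assms] by (intro grass_eqI) (simp add: gval_zval jext_def)

lemma zval_minus:
  assumes "superpoint z" shows "zval z (- h) = - zval z h"
  using zval_add[OF assms, of h "- h"] superpoint_antilinear(3)[OF assms]
  by (simp add: eq_neg_iff_add_eq_0 add.commute) (metis (no_types, lifting) add_cancel_right_left add.right_neutral zval_add[OF assms])

lemma ELam_zval_Eneg:
  assumes x: "x \<in> ELam" and h: "h \<in> Eneg" shows "zval x h = 0"
proof -
  obtain a b where x': "x = a + b" "a \<in> lam_tensor 0 E0" "b \<in> lam_tensor 1 E1" using x unfolding ELam_def by blast
  have "cinner h v = 0" if "v \<in> E0 \<union> E1" for v using Eneg_Epos_orth[OF h] that by (simp add: Epos_def)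
  then have "a ls [h] = 0" "b ls [h] = 0" for ls
    using x'(2,3) unfolding lam_tensor_def by blast+
  then show ?thesis
    using gval_zval[OF ELam_superpoint[OF x]] by (intro grass_eqI) (simp add: x' zero_grass.rep_eq)
qed

text \<open>A point of \<open>ELam\<close> has no coefficient along dual vectors. Hence a mixed
  point \<open>x + y\<close> with \<open>y\<close> on the dual side looks like
  \<open>x + sstar x\<close> to monomials from \<open>Eneg\<close> and like \<open>y\<close> to
  those from \<open>Epos\<close>. With this the two variables of the integrand separate.\<close>

lemma zval_real_point:
  assumes x: "x \<in> ELam"
  shows "f \<in> Eneg \<Longrightarrow> superpoint y \<Longrightarrow> (\<And>h. h \<in> Epos \<Longrightarrow> zval y h = 0) \<Longrightarrow>
      zval (x + y) (invol f) = zval (x + sstar x) (invol f)"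
    and "f \<in> Epos \<Longrightarrow> superpoint y \<Longrightarrow> zval (x + y) (invol f) = zval y (invol f)"
    and "gstar (zval (x + sstar x) f) = zval (x + sstar x) (invol f)"
proof -
  have sx: "superpoint x" "superpoint (sstar x)" using ELam_superpoint[OF x] superpoint_sstar by auto
  show "f \<in> Eneg \<Longrightarrow> superpoint y \<Longrightarrow> (\<And>h. h \<in> Epos \<Longrightarrow> zval y h = 0) \<Longrightarrow>
      zval (x + y) (invol f) = zval (x + sstar x) (invol f)"
    using sx by (simp add: zval_plus zval_sstar invol_Eneg ELam_zval_Eneg[OF x] invol_invol)
      (metis gstar_gstar ELam_zval_Eneg[OF x] gstar_add add_cancel_right_right)
  show "f \<in> Epos \<Longrightarrow> superpoint y \<Longrightarrow> zval (x + y) (invol f) = zval y (invol f)"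
    using sx by (simp add: zval_plus invol_Epos ELam_zval_Eneg[OF x])
  show "gstar (zval (x + sstar x) f) = zval (x + sstar x) (invol f)"
    using sx by (simp add: zval_plus zval_sstar gstar_add invol_invol add.commute)
qed

section \<open>The structure of \<open>SfinLam\<close>\<close>

lemma SfinLam_base: "l \<in> Lam \<Longrightarrow> F \<in> Sfin \<Longrightarrow> tprod l F \<in> SfinLam"
  unfolding SfinLam_def by (rule module.span_base[OF stens_module]) blast

lemma SfinLam_sprod: "M \<in> glam \<Longrightarrow> homog fs \<Longrightarrow> tprod (gval M) (sprod fs) \<in> SfinLam"
  by (simp add: SfinLam_base glam_def sprod_in_Sfin)

lemma SfinLam_add: "X \<in> SfinLam \<Longrightarrow> Y \<in> SfinLam \<Longrightarrow> X + Y \<in> SfinLam"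
  unfolding SfinLam_def by (rule module.span_add[OF stens_module])

lemma SfinLam_diff: "X \<in> SfinLam \<Longrightarrow> Y \<in> SfinLam \<Longrightarrow> X - Y \<in> SfinLam"
  unfolding SfinLam_def by (rule module.span_diff[OF stens_module])

lemma SfinLam_zero: "0 \<in> SfinLam"
  unfolding SfinLam_def by (rule module.span_zero[OF stens_module])

text \<open>Scalars are absorbed into the Grassmann coefficient \<open>M\<close>, so the only
  closure step left is addition.\<close>

lemma SfinLam_induct [consumes 1, case_names zero add prod]:
  fixes X :: "('l::involutive_hilbert_space, 'h::super_hilbert_space) stensor"
  assumes X: "X \<in> SfinLam" and zero: "P 0" and add: "\<And>X Y. P X \<Longrightarrow> P Y \<Longrightarrow> P (X + Y)"
    and prod: "\<And>M as bs. M \<in> glam \<Longrightarrow> set as \<subseteq> Eneg \<Longrightarrow> set bs \<subseteq> Epos \<Longrightarrow> P (tprod (gval M) (sprod (as @ bs)))"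
  shows "P X"
proof -
  have gv: "\<exists>M\<in>glam. gval M = l" if "l \<in> Lam" for l
  proof -
    have "gval (Grass l) = l" using that by (simp add: Grass_inverse Lam_def)
    then show ?thesis using that by (intro bexI[of _ "Grass l"]) (simp_all add: glam_def)
  qed
  have base: "P (tprod l F)" if F: "F \<in> tspan sorted_prods" and l: "l \<in> Lam" for l F
    using F l
  proof (induction arbitrary: rule: tspan_induct)
    case zero
    have "tprod l (\<lambda>_. 0) = (0 :: ('l, 'h) stensor)" by (simp add: tprod_def fun_eq_iff)
    then show ?case using assms(2) by (simp only:)
  next
    case (add c F G)
    obtain as bs where F: "F = sprod (as @ bs)" "set as \<subseteq> Eneg" "set bs \<subseteq> Epos"
      using add(1) unfolding sorted_prods_def by blast
    have "tprod l (\<lambda>gs. c * F gs + G gs) = tprod (\<lambda>ls. c * l ls) F + tprod l G"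
      by (simp add: tprod_def fun_eq_iff algebra_simps)
    moreover obtain M where M: "M \<in> glam" "gval M = (\<lambda>ls. c * l ls)" using gv[OF Lam_scale[OF add(3)]] by blast
    have "P (tprod (\<lambda>ls. c * l ls) F + tprod l G)"
      using prod[OF M(1) F(2,3)] add(2)[OF add(3)] by (intro assms(3)) (simp_all only: M(2) F(1))
    ultimately show ?case by (simp only:)
  qed
  from X show ?thesis
    unfolding SfinLam_def
  proof (induction rule: module.span_induct_alt[OF stens_module, consumes 1, case_names zero step])
    case zero
    show ?case by (rule assms(2))
  next
    case (step c X Y)
    then obtain l F where lF: "X = tprod l F" "l \<in> Lam" "F \<in> Sfin" by blast
    have "(\<lambda>ls hs. c * X ls hs) = tprod (\<lambda>ls. c * l ls) F" by (simp add: lF tprod_def fun_eq_iff)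
    then have "P (\<lambda>ls hs. c * X ls hs)" using base[OF _ Lam_scale[OF lF(2)]] lF(3) Sfin_subset by auto
    then show ?case using add step by blast
  qed
qed

lemma SfinLam_Sfin: "X \<in> SfinLam \<Longrightarrow> X ls \<in> Sfin"
proof (induction rule: SfinLam_induct)
  case zero
  show ?case using Sfin_zero by (simp add: zero_fun_def)
next
  case (add X Y)
  then show ?case using Sfin_add by (simp add: plus_fun_def)
next
  case (prod M as bs)
  have "homog (as @ bs)" using prod Epos_subset Eneg_subset by auto
  then show ?case unfolding tprod_def by (intro Sfin_scale sprod_in_Sfin)
qed

lemma gauss_functional_ext_add:
  assumes "X \<in> SfinLam" "Y \<in> SfinLam"
  shows "gauss_functional_ext (X + Y) = gauss_functional_ext X + gauss_functional_ext Y"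
proof
  fix ls
  show "gauss_functional_ext (X + Y) ls = (gauss_functional_ext X + gauss_functional_ext Y) ls"
    using gauss_functional_add[OF SfinLam_Sfin[OF assms(1)] SfinLam_Sfin[OF assms(2)], of ls ls]
    by (simp add: gauss_functional_ext_def plus_fun_def)
qed

lemma gauss_functional_ext_sprod:
  assumes "homog fs"
  shows "gauss_functional_ext (tprod (gval M) (sprod fs)) = gval (gscal (wick odd_vec omega fs) * M)"
  using assms by (simp add: fun_eq_iff gauss_functional_ext_def tprod_def gval_gscal_mult
      gauss_functional_scale sprod_in_Sfin gauss_functional_sprod)

section \<open>Uniqueness of the representing element\<close>

lemma orthogonal_vector_exists:
  fixes S :: "'l::chilbert_space set"
  assumes "infinite_dimensional TYPE('l)" "finite S"
  shows "\<exists>w. w \<noteq> 0 \<and> (\<forall>s\<in>S. cinner s w = 0)"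
proof -
  obtain A where A: "finite A" "orthonormal A" "S \<subseteq> chilbert.span A"
    using orthonormal_finite_span[OF assms(2)] by blast
  have "chilbert.span A \<noteq> UNIV" using assms(1) A(1) unfolding infinite_dimensional_def by blast
  then obtain x where x: "x \<notin> chilbert.span A" by blast
  have "x - orth_proj A x \<noteq> 0"
  proof
    assume "x - orth_proj A x = 0"
    then have "x = orth_proj A x" by simp
    then show False using x orth_proj_in_span[of A x] by simp
  qed
  moreover have "cinner s (x - orth_proj A x) = 0" if "s \<in> S" for s
    by (rule cinner_span_residual[OF A(2,1)]) (use that A(3) in blast)
  ultimately show ?thesis by blast
qed

text \<open>The real part of a vector orthogonal to \<open>S\<close> and its conjugates, or the
  imaginary unit times the vector when that real part vanishes.\<close>

lemma real_vector_exists: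
  fixes S :: "'l::involutive_hilbert_space set"
  assumes "infinite_dimensional TYPE('l)" "finite S"
  shows "\<exists>r. norm r = 1 \<and> invol r = r \<and> (\<forall>s\<in>S. cinner s r = 0)"
proof -
  obtain w where w: "w \<noteq> 0" "\<And>s. s \<in> S \<union> invol ` S \<Longrightarrow> cinner s w = 0"
    using orthogonal_vector_exists[OF assms(1), of "S \<union> invol ` S"] assms(2) by auto
  have w': "cinner s (invol w) = 0" if "s \<in> S" for s
    using w(2)[of "invol s"] that cinner_invol[of s "invol w"] by (simp add: invol_invol)
  define r where "r = (if w + invol w = 0 then scaleC \<i> w else w + invol w)"
  have "r \<noteq> 0"
  proof (cases "w + invol w = 0")
    case True
    have "norm (scaleC \<i> w) = norm w" by (simp add: norm_scaleC)
    then show ?thesis using w(1) True unfolding r_def by (metis norm_eq_zero)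
  qed (simp add: r_def)
  moreover have "invol r = r"
  proof (cases "w + invol w = 0")
    case True
    then have "invol w = - w" by (simp add: eq_neg_iff_add_eq_0 add.commute)
    then show ?thesis using True by (simp add: r_def invol_scaleC)
  qed (simp add: r_def invol_add invol_invol add.commute)
  moreover have "cinner s r = 0" if "s \<in> S" for s
    using that w(2)[of s] w'[OF that] by (simp add: r_def cinner_add_right cinner_scaleC_right)
  ultimately have "norm (scaleC (complex_of_real (1 / norm r)) r) = 1"
    "invol (scaleC (complex_of_real (1 / norm r)) r) = scaleC (complex_of_real (1 / norm r)) r"
    "\<And>s. s \<in> S \<Longrightarrow> cinner s (scaleC (complex_of_real (1 / norm r)) r) = 0"
    using norm_sgn_scaleC[of r] by (auto simp: invol_scaleC cinner_scaleC_right)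
  then show ?thesis by blast
qed

text \<open>Since \<xi> is always accompanied by its star, a generator must be orthogonal to its own
  conjugate. For orthonormal real \<open>r\<close> and \<open>t\<close> the vector
  \<open>(r + i t) / sqrt 2\<close> is.\<close>

lemma generator_exists:
  fixes S :: "'l::involutive_hilbert_space set"
  assumes "infinite_dimensional TYPE('l)" "finite S"
  shows "\<exists>k. cinner k k = 1 \<and> cinner (invol k) k = 0 \<and> (\<forall>s\<in>S. cinner s k = 0 \<and> cinner s (invol k) = 0)"
proof -
  obtain r where r: "norm r = 1" "invol r = r" "\<And>s. s \<in> S \<Longrightarrow> cinner s r = 0"
    using real_vector_exists[OF assms] by blast
  obtain t where t: "norm t = 1" "invol t = t" "\<And>s. s \<in> insert r S \<Longrightarrow> cinner s t = 0"
    using real_vector_exists[OF assms(1), of "insert r S"] assms(2) by auto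
  have rt: "cinner r t = 0" "cinner t r = 0" "cinner r r = 1" "cinner t t = 1"
    using t(3)[of r] cinner_commute[of t r] r t by (auto simp: cinner_self)
  define c where "c = complex_of_real (1 / sqrt 2)"
  have c: "cnj c * c = 1 / 2" "cnj c = c" by (simp_all add: c_def flip: of_real_mult)
  have e: "\<i> * (x * \<i>) = - x" for x
  proof -
    have "\<i> * (x * \<i>) = x * (\<i> * \<i>)" by (simp only: mult_ac)
    then show ?thesis by simp
  qed
  define k where "k = scaleC c (r + scaleC \<i> t)"
  have ik: "invol k = scaleC c (r + scaleC (- \<i>) t)"
    by (simp add: k_def invol_scaleC invol_add r t c)
  have "cinner k k = cnj c * c * 2"
    unfolding k_def cinner_scaleC_left cinner_scaleC_right cinner_add_left cinner_add_right
    by (simp add: rt e)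
  moreover have "cinner (invol k) k = 0"
    unfolding ik unfolding k_def cinner_scaleC_left cinner_scaleC_right cinner_add_left cinner_add_right
    by (simp add: rt e)
  moreover have "cinner s k = 0 \<and> cinner s (invol k) = 0" if "s \<in> S" for s
    unfolding ik unfolding k_def using r(3)[OF that] t(3)[of s] that
    by (simp add: cinner_scaleC_right cinner_add_right cinner_diff_right)
  ultimately show ?thesis using c by (intro exI[of _ k]) simp
qed

lemma generator_sequence_exists:
  fixes S :: "'l::involutive_hilbert_space set"
  assumes "infinite_dimensional TYPE('l)" "finite S"
  shows "\<exists>k :: nat \<Rightarrow> 'l. \<forall>i<n. cinner (k i) (k i) = 1 \<and> cinner (invol (k i)) (k i) = 0 \<and>
    (\<forall>s\<in>S. cinner s (k i) = 0 \<and> cinner s (invol (k i)) = 0) \<and>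
    (\<forall>j<i. cinner (k j) (k i) = 0 \<and> cinner (k j) (invol (k i)) = 0)"
proof (induction n)
  case (Suc n)
  then obtain k :: "nat \<Rightarrow> 'l" where k: "\<And>i. i < n \<Longrightarrow> cinner (k i) (k i) = 1 \<and> cinner (invol (k i)) (k i) = 0 \<and>
    (\<forall>s\<in>S. cinner s (k i) = 0 \<and> cinner s (invol (k i)) = 0) \<and>
    (\<forall>j<i. cinner (k j) (k i) = 0 \<and> cinner (k j) (invol (k i)) = 0)" by blast
  obtain m where m: "cinner m m = 1" "cinner (invol m) m = 0"
    "\<And>s. s \<in> S \<union> k ` {..<n} \<Longrightarrow> cinner s m = 0 \<and> cinner s (invol m) = 0"
    using generator_exists[OF assms(1), of "S \<union> k ` {..<n}"] assms(2) by auto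
  show ?case
  proof (intro exI[of _ "k(n := m)"] allI impI)
    fix i assume "i < Suc n"
    then consider "i = n" | "i < n" by linarith
    then show "cinner ((k(n := m)) i) ((k(n := m)) i) = 1 \<and> cinner (invol ((k(n := m)) i)) ((k(n := m)) i) = 0 \<and>
      (\<forall>s\<in>S. cinner s ((k(n := m)) i) = 0 \<and> cinner s (invol ((k(n := m)) i)) = 0) \<and>
      (\<forall>j<i. cinner ((k(n := m)) j) ((k(n := m)) i) = 0 \<and> cinner ((k(n := m)) j) (invol ((k(n := m)) i)) = 0)"
      using m k[of i] by cases auto
  qed
qed simp

lemma generators_exist:
  fixes S :: "'l::involutive_hilbert_space set"
  assumes "infinite_dimensional TYPE('l)" "finite S"
  obtains k :: "nat \<Rightarrow> 'l" where
    "\<And>i j. i < n \<Longrightarrow> j < n \<Longrightarrow> cinner (k i) (k j) = (if i = j then 1 else 0)"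
    "\<And>i j. i < n \<Longrightarrow> j < n \<Longrightarrow> cinner (k i) (invol (k j)) = 0"
    "\<And>i s. i < n \<Longrightarrow> s \<in> S \<Longrightarrow> cinner s (k i) = 0"
    "\<And>i s. i < n \<Longrightarrow> s \<in> S \<Longrightarrow> cinner s (invol (k i)) = 0"
proof -
  obtain k :: "nat \<Rightarrow> 'l" where k: "\<And>i. i < n \<Longrightarrow> cinner (k i) (k i) = 1 \<and> cinner (invol (k i)) (k i) = 0 \<and>
    (\<forall>s\<in>S. cinner s (k i) = 0 \<and> cinner s (invol (k i)) = 0) \<and>
    (\<forall>j<i. cinner (k j) (k i) = 0 \<and> cinner (k j) (invol (k i)) = 0)"
    using generator_sequence_exists[OF assms, of n] by blast
  have zero: "cinner x y = 0 \<Longrightarrow> cinner y x = 0" for x y :: 'l using cinner_commute[of y x] by simp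
  show ?thesis
  proof (rule that)
    fix i j assume ij: "i < n" "j < n"
    consider "i = j" | "i < j" | "j < i" by linarith
    then show "cinner (k i) (k j) = (if i = j then 1 else 0)"
      using k[OF ij(1)] k[OF ij(2)] zero by cases auto
    consider "i = j" | "i < j" | "j < i" by linarith
    then show "cinner (k i) (invol (k j)) = 0"
    proof cases
      case 3
      then have "cinner (k j) (invol (k i)) = 0" using k[OF ij(1)] by blast
      then show ?thesis using zero cinner_invol_swap by metis
    qed (use k[OF ij(1)] k[OF ij(2)] zero in auto)
  qed (use k in auto)
qed

section \<open>Products of Grassmann generators\<close>

definition gprod :: "'l::chilbert_space list \<Rightarrow> 'l grass" where
  "gprod ks = prod_list (map ggen ks)"

lemma gprod_append: "gprod (as @ bs) = gprod as * gprod bs"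
  by (simp add: gprod_def)

lemma gprod_concat: "gprod (concat kss) = prod_list (map gprod kss)"
  by (induction kss) (simp_all add: gprod_append, simp add: gprod_def)

lemma gstar_gprod: "gstar (gprod ks) = gprod (rev (map invol ks))"
  by (simp add: gprod_def gstar_prod_list rev_map o_def gstar_ggen)

lemma ghom_gprod: "ghom (length ks) (gprod ks)"
proof (induction ks)
  case Nil
  show ?case by (simp add: gprod_def ghom_1)
next
  case (Cons k ks)
  then show ?case using ghom_mult[OF ghom_ggen[of k] Cons] by (simp add: gprod_def)
qed

lemma gprod_glam: "gprod ks \<in> glam"
  unfolding gprod_def by (rule glam_prod_list) (auto intro: glam_ggen)

lemma ggen_mult_nonzero:
  assumes "gval (ggen k * b) L \<noteq> 0"
  obtains L1 y L2 where "L = L1 @ y # L2" "cinner y k \<noteq> 0" "gval b (L1 @ L2) \<noteq> 0"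
proof -
  have "L \<noteq> []"
  proof
    assume "L = []"
    then have "gval (ggen k * b) L = 0"
      by (simp add: times_grass.rep_eq gmul_alt_tmul alt_perm_sum tmul_def ggen.rep_eq tens_def)
    then show False using assms by simp
  qed
  then have "pull_sum (\<lambda>_. True) (\<lambda>y r. cinner y k * gval b r) L \<noteq> 0"
    using assms by (simp add: gval_ggen_mult)
  then obtain us y vs where "L = us @ y # vs" "cinner y k * gval b (us @ vs) \<noteq> 0"
    by (rule pull_sum_neq_0)
  then show ?thesis using that by auto
qed

text \<open>Each generator in front must be contracted with an entry of \<open>L\<close> that is not
  orthogonal to it, hence with itself, and uses that entry up.\<close>

lemma gprod_mult_nonzero:
  assumes "\<And>k g. k \<in> set ks \<Longrightarrow> g \<in> set L \<Longrightarrow> cinner g k \<noteq> 0 \<Longrightarrow> g = k"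
    and "gval (gprod ks * b) L \<noteq> 0"
  shows "mset ks \<subseteq># mset L"
  using assms
proof (induction ks arbitrary: L)
  case (Cons k ks)
  have "gval (ggen k * (gprod ks * b)) L \<noteq> 0"
    using Cons.prems(2) by (simp add: gprod_def mult.assoc)
  then obtain L1 y L2 where L: "L = L1 @ y # L2" "cinner y k \<noteq> 0" "gval (gprod ks * b) (L1 @ L2) \<noteq> 0"
    by (rule ggen_mult_nonzero)
  then have "y = k" using Cons.prems(1)[of k y] by simp
  moreover have "mset ks \<subseteq># mset (L1 @ L2)"
    by (rule Cons.IH) (use L Cons.prems(1) in auto)
  ultimately show ?case using L(1) by simp
qed simp

text \<open>Multiplication by fresh generators loses nothing: contracting them in order leaves the
  coefficient at \<open>ls\<close>, and the inverse square roots of the lengths do not depend on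
  \<open>b\<close>.\<close>

lemma gprod_mult_value:
  assumes "\<And>i j. i < length ks \<Longrightarrow> j < length ks \<Longrightarrow> cinner (ks ! i) (ks ! j) = (if i = j then 1 else 0)"
    and "\<And>k l. k \<in> set ks \<Longrightarrow> l \<in> set ls \<Longrightarrow> cinner l k = 0"
  shows "\<exists>c. c \<noteq> 0 \<and> (\<forall>b. gval (gprod ks * b) (ks @ ls) = c * gval b ls)"
  using assms
proof (induction ks)
  case Nil
  show ?case by (intro exI[of _ 1]) (simp add: gprod_def)
next
  case (Cons k ks)
  have "\<exists>c. c \<noteq> 0 \<and> (\<forall>b. gval (gprod ks * b) (ks @ ls) = c * gval b ls)"
  proof (rule Cons.IH)
    fix i j assume "i < length ks" "j < length ks"
    then show "cinner (ks ! i) (ks ! j) = (if i = j then 1 else 0)"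
      using Cons.prems(1)[of "Suc i" "Suc j"] by simp
  qed (use Cons.prems(2) in auto)
  then obtain c where c: "c \<noteq> 0" "\<And>b. gval (gprod ks * b) (ks @ ls) = c * gval b ls" by blast
  let ?d = "complex_of_real (1 / sqrt (length (k # ks @ ls)))"
  have kk: "cinner k k = 1" using Cons.prems(1)[of 0 0] by simp
  have z: "cinner y k = 0" if "y \<in> set (ks @ ls)" for y
  proof (cases "y \<in> set ls")
    case False
    then have "y \<in> set ks" using that by simp
    then obtain i where "i < length ks" "y = ks ! i" by (auto simp: in_set_conv_nth)
    then show ?thesis using Cons.prems(1)[of "Suc i" 0] by simp
  qed (use Cons.prems(2) in auto)
  have "gval (gprod (k # ks) * b) ((k # ks) @ ls) = ?d * c * gval b ls" for b
  proof -
    have "gval (gprod (k # ks) * b) (k # ks @ ls) = ?d * pull_sum (\<lambda>_. True) (\<lambda>y r. cinner y k * gval (gprod ks * b) r) (k # ks @ ls)"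
      using gval_ggen_mult[of "k # ks @ ls" k "gprod ks * b"] by (simp add: gprod_def mult.assoc)
    also have "pull_sum (\<lambda>_. True) (\<lambda>y r. cinner y k * gval (gprod ks * b) r) (k # ks @ ls) = gval (gprod ks * b) (ks @ ls)"
    proof -
      have "pull_sum (\<lambda>_. True) (\<lambda>y r. koszul (\<lambda>_. True) y k * (cinner y k * gval (gprod ks * b) (k # r))) (ks @ ls) = 0"
      proof (rule pull_sum_eq_0)
        fix y r us vs assume "ks @ ls = us @ y # vs"
        then have "y \<in> set (ks @ ls)" by simp
        then show "koszul (\<lambda>_. True) y k * (cinner y k * gval (gprod ks * b) (k # r)) = 0" using z by simp
      qed
      then show ?thesis by (simp add: kk)
    qed
    finally show ?thesis by (simp add: c)
  qed
  then show ?case using c(1) by (intro exI[of _ "?d * c"]) auto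
qed

section \<open>Values at a finite combination of letters\<close>

abbreviation words :: "'a set \<Rightarrow> nat \<Rightarrow> 'a list set" where
  "words W n \<equiv> {ws. ws \<in> lists W \<and> length ws = n}"

lemma sum_words_Suc:
  assumes "finite W"
  shows "(\<Sum>ws\<in>words W (Suc n). f ws) = (\<Sum>a\<in>W. \<Sum>ws\<in>words W n. f (a # ws))"
proof -
  have "(\<Sum>a\<in>W. \<Sum>ws\<in>words W n. f (a # ws)) = (\<Sum>(a, ws)\<in>W \<times> words W n. f (a # ws))"
    by (simp add: sum.cartesian_product)
  also have "\<dots> = (\<Sum>ws\<in>words W (Suc n). f ws)"
    by (rule sum.reindex_bij_witness[where i = "\<lambda>ws. (hd ws, tl ws)" and j = "\<lambda>(a, ws). a # ws"])
      (auto simp: length_Suc_conv)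
  finally show ?thesis by simp
qed

text \<open>Expansion of a noncommutative product of sums: choosing one summand per factor amounts
  to choosing a word.\<close>

lemma prod_list_words:
  assumes "finite W"
  shows "prod_list (map (\<lambda>f. \<Sum>a\<in>W. gscal (cinner (v a) f) * u a) fs) =
    (\<Sum>ws\<in>words W (length fs). gscal (tens fs (map v ws)) * prod_list (map u ws))"
proof (induction fs)
  case Nil
  have "words W 0 = {[]}" by auto
  then show ?case by (simp add: tens_def)
next
  case (Cons f fs)
  have "prod_list (map (\<lambda>f. \<Sum>a\<in>W. gscal (cinner (v a) f) * u a) (f # fs)) =
    (\<Sum>a\<in>W. \<Sum>ws\<in>words W (length fs). gscal (cinner (v a) f) * u a * (gscal (tens fs (map v ws)) * prod_list (map u ws)))"
    by (simp add: Cons.IH sum_product)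
  also have "\<dots> = (\<Sum>a\<in>W. \<Sum>ws\<in>words W (length fs). gscal (tens (f # fs) (map v (a # ws))) * prod_list (map u (a # ws)))"
    by (intro sum.cong refl)
      (simp add: tens_Cons_Cons gscal_mult mult.assoc gscal_left_commute[of "u _"])
  finally show ?case by (simp add: sum_words_Suc[OF assms])
qed

lemma tens_rev: "tens (rev fs) gs = tens fs (rev gs)"
proof (cases "length gs = length fs")
  case True
  let ?n = "length fs"
  have "tens (rev fs) gs = (\<Prod>i<?n. cinner (gs ! i) (rev fs ! i))" using True by (simp add: tens_def)
  also have "\<dots> = (\<Prod>i<?n. cinner (gs ! (?n - Suc i)) (rev fs ! (?n - Suc i)))"
    by (rule prod.nat_diff_reindex[symmetric])
  also have "\<dots> = (\<Prod>i<?n. cinner (rev gs ! i) (fs ! i))"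
    by (rule prod.cong) (use True in \<open>auto simp: rev_nth\<close>)
  finally show ?thesis using True by (simp add: tens_def)
qed (simp add: tens_def)

definition hatval :: "('l::chilbert_space, 'h) stensor \<Rightarrow> 'h list \<Rightarrow> 'l grass" where
  "hatval X hs = Grass (\<lambda>ls. X ls hs)"

lemma gval_hatval: "alt (\<lambda>ls. X ls hs) = (\<lambda>ls. X ls hs) \<Longrightarrow> gval (hatval X hs) ls = X ls hs"
  by (simp add: hatval_def Grass_inverse)

lemma SfinLam_alt: "X \<in> SfinLam \<Longrightarrow> alt (\<lambda>ls. X ls hs) = (\<lambda>ls. X ls hs)"
proof (induction rule: SfinLam_induct)
  case zero
  show ?case using alt_scale[of 0 "\<lambda>_. 0"] by simp
next
  case (add X Y)
  then show ?case by (simp add: alt_add)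
next
  case (prod M as bs)
  have "alt (\<lambda>ls. gval M ls * c) = (\<lambda>ls. gval M ls * c)" for c
    using alt_scale[of c "gval M"] gval[of M] by (simp add: mult.commute)
  then show ?case by (simp add: tprod_def)
qed

lemma SfinLam_multi_antilinear: "X \<in> SfinLam \<Longrightarrow> multi_antilinear (X ls)"
proof (induction rule: SfinLam_induct)
  case zero
  show ?case by (simp add: multi_antilinear_def)
next
  case (add X Y)
  then show ?case by (simp add: multi_antilinear_def algebra_simps)
next
  case (prod M as bs)
  show ?case using multi_antilinear_sprod[of "as @ bs"] by (simp add: multi_antilinear_def tprod_def algebra_simps)
qed

lemma SfinLam_swap:
  "X \<in> SfinLam \<Longrightarrow> homog (us @ x # y # vs) \<Longrightarrow> X ls (us @ x # y # vs) = koszul odd_vec x y * X ls (us @ y # x # vs)"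
proof (induction rule: SfinLam_induct)
  case (add X Y)
  then show ?case by (simp add: algebra_simps)
next
  case (prod M as bs)
  have "homog (as @ bs)" using prod Epos_subset Eneg_subset by auto
  from sprod_arg_swap[OF this prod(4)] show ?case by (simp add: tprod_def)
qed simp

lemma hatval_add:
  assumes "\<And>hs. alt (\<lambda>ls. X ls hs) = (\<lambda>ls. X ls hs)" "\<And>hs. alt (\<lambda>ls. Y ls hs) = (\<lambda>ls. Y ls hs)"
  shows "hatval (\<lambda>ls hs. X ls hs + Y ls hs) hs = hatval X hs + hatval Y hs"
  using assms by (intro grass_eqI) (simp add: gval_hatval plus_grass.rep_eq alt_add)

lemma hatval_scale:
  assumes "\<And>hs. alt (\<lambda>ls. X ls hs) = (\<lambda>ls. X ls hs)"
  shows "hatval (\<lambda>ls hs. c * X ls hs) hs = gscal c * hatval X hs"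
  using assms by (intro grass_eqI) (simp add: gval_hatval gval_gscal_mult alt_scale)

text \<open>At a point that is a finite combination of letters, the value of \<open>X\<close> is a
  finite sum over words. Asking for it at every cutoff \<open>N\<close> above some \<open>N0\<close>
  lets expansions of different Fock degree be added.\<close>

definition word_expansion :: "('l::involutive_hilbert_space, 'h::super_hilbert_space) stensor \<Rightarrow> 'a set \<Rightarrow>
    ('a \<Rightarrow> 'h) \<Rightarrow> ('a \<Rightarrow> 'l grass) \<Rightarrow> ('l, 'h) stensor \<Rightarrow> bool" where
  "word_expansion z W v u X \<longleftrightarrow> (\<forall>hs. alt (\<lambda>ls. X ls hs) = (\<lambda>ls. X ls hs)) \<and>
     (\<exists>N0. \<forall>N\<ge>N0. phi_sums z X (\<Sum>n\<le>N. gscal (1 / sqrt_fact n) *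
        (\<Sum>ws\<in>words W n. prod_list (map u ws) * hatval X (rev (map v ws)))))"

lemma word_expansion_add:
  assumes "word_expansion z W v u X" "word_expansion z W v u Y"
  shows "word_expansion z W v u (\<lambda>ls hs. X ls hs + Y ls hs)"
proof -
  from assms obtain N1 N2 where N: "\<And>N. N \<ge> N1 \<Longrightarrow> phi_sums z X (\<Sum>n\<le>N. gscal (1 / sqrt_fact n) *
        (\<Sum>ws\<in>words W n. prod_list (map u ws) * hatval X (rev (map v ws))))"
    "\<And>N. N \<ge> N2 \<Longrightarrow> phi_sums z Y (\<Sum>n\<le>N. gscal (1 / sqrt_fact n) *
        (\<Sum>ws\<in>words W n. prod_list (map u ws) * hatval Y (rev (map v ws))))"
    unfolding word_expansion_def by blast
  have a: "\<And>hs. alt (\<lambda>ls. X ls hs) = (\<lambda>ls. X ls hs)" "\<And>hs. alt (\<lambda>ls. Y ls hs) = (\<lambda>ls. Y ls hs)"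
    using assms by (simp_all add: word_expansion_def)
  show ?thesis
    unfolding word_expansion_def
  proof (intro conjI allI exI[of _ "max N1 N2"] impI)
    fix N assume "N \<ge> max N1 N2"
    then show "phi_sums z (\<lambda>ls hs. X ls hs + Y ls hs) (\<Sum>n\<le>N. gscal (1 / sqrt_fact n) *
        (\<Sum>ws\<in>words W n. prod_list (map u ws) * hatval (\<lambda>ls hs. X ls hs + Y ls hs) (rev (map v ws))))"
      using phi_sums_add[OF N(1)[of N] N(2)[of N]]
      by (simp add: hatval_add[OF a] distrib_left sum.distrib)
  qed (simp add: alt_add a)
qed

lemma word_expansion_scale:
  assumes "word_expansion z W v u X"
  shows "word_expansion z W v u (\<lambda>ls hs. c * X ls hs)"
proof -
  from assms obtain N1 where N: "\<And>N. N \<ge> N1 \<Longrightarrow> phi_sums z X (\<Sum>n\<le>N. gscal (1 / sqrt_fact n) *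
        (\<Sum>ws\<in>words W n. prod_list (map u ws) * hatval X (rev (map v ws))))"
    unfolding word_expansion_def by blast
  have a: "\<And>hs. alt (\<lambda>ls. X ls hs) = (\<lambda>ls. X ls hs)"
    using assms by (simp add: word_expansion_def)
  show ?thesis
    unfolding word_expansion_def
  proof (intro conjI allI exI[of _ N1] impI)
    fix N assume "N \<ge> N1"
    have "(\<Sum>n\<le>N. gscal (1 / sqrt_fact n) *
        (\<Sum>ws\<in>words W n. prod_list (map u ws) * hatval (\<lambda>ls hs. c * X ls hs) (rev (map v ws)))) =
      gscal c * (\<Sum>n\<le>N. gscal (1 / sqrt_fact n) *
        (\<Sum>ws\<in>words W n. prod_list (map u ws) * hatval X (rev (map v ws))))"
      unfolding hatval_scale[OF a] gscal_left_commute[of "prod_list _"] sum_distrib_left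
      by (intro sum.cong refl) (rule gscal_left_commute)
    then show "phi_sums z (\<lambda>ls hs. c * X ls hs) (\<Sum>n\<le>N. gscal (1 / sqrt_fact n) *
        (\<Sum>ws\<in>words W n. prod_list (map u ws) * hatval (\<lambda>ls hs. c * X ls hs) (rev (map v ws))))"
      using phi_sums_scale[OF N[OF \<open>N \<ge> N1\<close>], of c] by (simp only:)
  qed (simp add: alt_scale a)
qed

lemma alt_zero: "alt (\<lambda>ls. 0) = (\<lambda>ls. 0)"
  using alt_scale[of 0 "\<lambda>_. 0"] by simp

lemma hatval_zero: "hatval (\<lambda>ls hs. 0) hs = 0"
  by (intro grass_eqI) (simp add: gval_hatval alt_zero zero_grass.rep_eq)

lemma word_expansion_zero: "word_expansion z W v u (\<lambda>ls hs. 0)"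
  by (simp add: word_expansion_def alt_zero hatval_zero phi_sums_zero)

lemma word_expansion_tens:
  assumes z: "superpoint z" and W: "finite W"
    and zv: "\<And>f. zval z (invol f) = (\<Sum>a\<in>W. gscal (cinner (v a) f) * u a)"
  shows "word_expansion z W v u (tprod (gval M) (tens fs))"
  unfolding word_expansion_def
proof (intro conjI allI exI[of _ "length fs"] impI)
  let ?X = "tprod (gval M) (tens fs)"
  show a: "alt (\<lambda>ls. ?X ls hs) = (\<lambda>ls. ?X ls hs)" for hs
    using alt_scale[of "tens fs hs" "gval M"] gval[of M] by (simp add: tprod_def mult.commute)
  fix N assume N: "N \<ge> length fs"
  have h: "hatval ?X hs = gscal (tens fs hs) * M" for hs
    by (intro grass_eqI, simp add: gval_hatval[where X = ?X, OF a] gval_gscal_mult, simp add: tprod_def)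
  have "zprod z fs = prod_list (map (\<lambda>f. \<Sum>a\<in>W. gscal (cinner (v a) f) * u a) (rev fs))"
    by (simp add: zprod_def zv)
  also have "\<dots> = (\<Sum>ws\<in>words W (length fs). gscal (tens fs (rev (map v ws))) * prod_list (map u ws))"
    by (simp add: prod_list_words[OF W] tens_rev)
  finally have "zprod z fs * M = (\<Sum>ws\<in>words W (length fs). prod_list (map u ws) * hatval ?X (rev (map v ws)))"
    by (simp add: h sum_distrib_right mult.assoc gscal_left_commute[of "prod_list _"])
  moreover have "(\<Sum>n\<le>N. gscal (1 / sqrt_fact n) *
      (\<Sum>ws\<in>words W n. prod_list (map u ws) * hatval ?X (rev (map v ws)))) =
    (\<Sum>n\<le>N. if n = length fs then gscal (1 / sqrt_fact n) *
      (\<Sum>ws\<in>words W n. prod_list (map u ws) * hatval ?X (rev (map v ws))) else 0)"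
  proof (intro sum.cong refl)
    fix n
    have "hatval ?X (rev (map v ws)) = 0" if "length ws \<noteq> length fs" for ws
    proof -
      have "tens fs (rev (map v ws)) = 0" using that by (simp add: tens_def)
      then show ?thesis by (simp add: h)
    qed
    then show "gscal (1 / sqrt_fact n) * (\<Sum>ws\<in>words W n. prod_list (map u ws) * hatval ?X (rev (map v ws))) =
      (if n = length fs then gscal (1 / sqrt_fact n) *
      (\<Sum>ws\<in>words W n. prod_list (map u ws) * hatval ?X (rev (map v ws))) else 0)"
      by (auto intro!: sum.neutral)
  qed
  ultimately show "phi_sums z ?X (\<Sum>n\<le>N. gscal (1 / sqrt_fact n) *
      (\<Sum>ws\<in>words W n. prod_list (map u ws) * hatval ?X (rev (map v ws))))"
    using phi_sums_tens[OF z, of M fs] N by simp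
qed

lemma word_expansion_SfinLam:
  assumes X: "X \<in> SfinLam" and z: "superpoint z" and W: "finite W"
    and zv: "\<And>f. zval z (invol f) = (\<Sum>a\<in>W. gscal (cinner (v a) f) * u a)"
  shows "word_expansion z W v u X"
  using X
proof (induction rule: SfinLam_induct)
  case zero
  show ?case using word_expansion_zero by (simp add: zero_fun_def)
next
  case (add X Y)
  then show ?case using word_expansion_add by (simp add: plus_fun_def)
next
  case (prod M as bs)
  let ?fs = "as @ bs" let ?S = "{s. s permutes {..<length ?fs}}"
  have "word_expansion z W v u (\<lambda>ls hs. \<Sum>s\<in>S. c s * tprod (gval M) (tens (g s)) ls hs)"
    if "finite S" for S :: "(nat \<Rightarrow> nat) set" and c g
    using that
  proof induction
    case (insert s S)
    show ?case unfolding sum.insert[OF insert(1,2)]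
      by (rule word_expansion_add[OF word_expansion_scale[OF word_expansion_tens[OF z W zv]] insert(3)])
  qed (simp add: word_expansion_zero)
  from this[of ?S "\<lambda>s. perm_koszul odd_vec s ?fs / sqrt_fact (length ?fs)" "\<lambda>s. permute_list s ?fs"]
  have "word_expansion z W v u (\<lambda>ls hs. \<Sum>s\<in>?S. (perm_koszul odd_vec s ?fs / sqrt_fact (length ?fs)) * tprod (gval M) (tens (permute_list s ?fs)) ls hs)"
    using finite_permutations[OF finite_lessThan] by blast
  moreover have "(\<lambda>ls hs. \<Sum>s\<in>?S. (perm_koszul odd_vec s ?fs / sqrt_fact (length ?fs)) * tprod (gval M) (tens (permute_list s ?fs)) ls hs)
     = tprod (gval M) (sprod ?fs)"
    by (simp add: fun_eq_iff tprod_def sprod_def perm_sum_def sum_divide_distrib sum_distrib_left mult_ac)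
  ultimately show ?case by simp
qed

section \<open>Construction of points of \<open>ELam\<close>\<close>

lemma SLam_iff:
  "X \<in> SLam \<longleftrightarrow> (\<forall>hs. multi_antilinear (\<lambda>ls. X ls hs)) \<and> (\<forall>ls. multi_antilinear (X ls)) \<and>
     (\<forall>hs. alt (\<lambda>ls. X ls hs) = (\<lambda>ls. X ls hs)) \<and> (\<forall>ls. supersym (X ls) = X ls) \<and>
     (\<exists>C. \<forall>A B N. finite A \<and> orthonormal A \<and> finite B \<and> orthonormal B \<longrightarrow>
        (\<Sum>as\<in>{as \<in> lists A. length as \<le> N}. \<Sum>bs\<in>{bs \<in> lists B. length bs \<le> N}.
            (cmod (X as bs) / fact (length as))\<^sup>2) \<le> C)"
  unfolding SLam_def by blast

lemma SLam_add:
  assumes X: "X \<in> SLam" and Y: "Y \<in> SLam" shows "X + Y \<in> SLam"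
proof -
  let ?s = "\<lambda>X A B N. \<Sum>as\<in>{as \<in> lists A. length as \<le> N}. \<Sum>bs\<in>{bs \<in> lists B. length bs \<le> N}.
            (cmod (X as bs) / fact (length as))\<^sup>2"
  obtain C where C: "\<And>A B N. finite A \<and> orthonormal A \<and> finite B \<and> orthonormal B \<Longrightarrow> ?s X A B N \<le> C"
    using X unfolding SLam_iff by blast
  obtain D where D: "\<And>A B N. finite A \<and> orthonormal A \<and> finite B \<and> orthonormal B \<Longrightarrow> ?s Y A B N \<le> D"
    using Y unfolding SLam_iff by blast
  have sq: "(cmod (x + y) / c)\<^sup>2 \<le> 2 * (cmod x / c)\<^sup>2 + 2 * (cmod y / c)\<^sup>2" for x y c
  proof -
    have "(cmod (x + y))\<^sup>2 \<le> (cmod x + cmod y)\<^sup>2" by (rule power_mono[OF norm_triangle_ineq]) simp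
    also have "\<dots> \<le> 2 * (cmod x)\<^sup>2 + 2 * (cmod y)\<^sup>2"
      using sum_squares_ge_zero[of "cmod x - cmod y" 0] by (simp add: power2_eq_square algebra_simps)
    finally have "(cmod (x + y))\<^sup>2 / c\<^sup>2 \<le> (2 * (cmod x)\<^sup>2 + 2 * (cmod y)\<^sup>2) / c\<^sup>2" by (rule divide_right_mono) simp
    then show ?thesis by (simp add: power_divide add_divide_distrib)
  qed
  have "?s (\<lambda>as bs. X as bs + Y as bs) A B N \<le> 2 * C + 2 * D"
    if "finite A \<and> orthonormal A \<and> finite B \<and> orthonormal B" for A B N
  proof -
    have "?s (\<lambda>as bs. X as bs + Y as bs) A B N \<le>
      (\<Sum>as\<in>{as \<in> lists A. length as \<le> N}. \<Sum>bs\<in>{bs \<in> lists B. length bs \<le> N}.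
        2 * (cmod (X as bs) / fact (length as))\<^sup>2 + 2 * (cmod (Y as bs) / fact (length as))\<^sup>2)"
      by (intro sum_mono sq)
    also have "\<dots> = 2 * ?s X A B N + 2 * ?s Y A B N" by (simp add: sum.distrib sum_distrib_left)
    finally show ?thesis using C[OF that, of N] D[OF that, of N] by simp
  qed
  then have "\<exists>C. \<forall>A B N. finite A \<and> orthonormal A \<and> finite B \<and> orthonormal B \<longrightarrow> ?s (\<lambda>as bs. X as bs + Y as bs) A B N \<le> C"
    by blast
  moreover have "multi_antilinear (\<lambda>ls. X ls hs + Y ls hs)" "multi_antilinear (\<lambda>hs. X ls hs + Y ls hs)" for ls hs
    using X Y by (simp_all add: SLam_iff multi_antilinear_def algebra_simps)
  moreover have "alt (\<lambda>ls. X ls hs + Y ls hs) = (\<lambda>ls. X ls hs + Y ls hs)" for hs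
    using X Y by (simp add: SLam_iff alt_add)
  moreover have "supersym (\<lambda>hs. X ls hs + Y ls hs) = (\<lambda>hs. X ls hs + Y ls hs)" for ls
    using X Y by (simp add: SLam_iff supersym_add)
  ultimately show ?thesis unfolding SLam_iff plus_fun_def by blast
qed

lemma SLam_zero:
  "(\<lambda>ls hs. 0) \<in> (SLam :: ('l::involutive_hilbert_space, 'h::super_hilbert_space) stensor set)"
proof -
  have "\<exists>C::real. \<forall>A B (N::nat). finite A \<and> orthonormal (A :: 'l set) \<and> finite B \<and> orthonormal (B :: 'h set) \<longrightarrow>
    (\<Sum>as\<in>{as \<in> lists A. length as \<le> N}. \<Sum>bs\<in>{bs \<in> lists B. length bs \<le> N}. (cmod 0 / fact (length as))\<^sup>2) \<le> C"
    by (intro exI[of _ 0]) simp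
  moreover have "multi_antilinear (\<lambda>ls::'l list. 0)" "multi_antilinear (\<lambda>hs::'h list. 0)"
    by (simp_all add: multi_antilinear_def)
  ultimately show ?thesis unfolding SLam_iff alt_zero supersym_zero by blast
qed

lemma ELam_add:
  assumes "x \<in> ELam" "y \<in> ELam" shows "x + y \<in> ELam"
proof -
  obtain a b where x: "x = a + b" "a \<in> lam_tensor 0 E0" "b \<in> lam_tensor 1 E1" using assms unfolding ELam_def by blast
  obtain a' b' where y: "y = a' + b'" "a' \<in> lam_tensor 0 E0" "b' \<in> lam_tensor 1 E1" using assms unfolding ELam_def by blast
  have add: "X + Y \<in> lam_tensor d V" if X: "X \<in> lam_tensor d V" and Y: "Y \<in> lam_tensor d V"
    for X Y :: "('a, 'b) stensor" and d V
    unfolding lam_tensor_def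
  proof (intro CollectI conjI allI impI)
    show "X + Y \<in> SLam" using X Y by (intro SLam_add) (simp_all add: lam_tensor_def)
    have nz: "length hs = 1 \<and> length ls mod 2 = d mod 2" if "X ls hs \<noteq> 0 \<or> Y ls hs \<noteq> 0" for ls hs
      using X Y that unfolding lam_tensor_def by blast
    show "length hs = 1" "length ls mod 2 = d mod 2" if "(X + Y) ls hs \<noteq> 0" for ls hs
    proof -
      have "X ls hs \<noteq> 0 \<or> Y ls hs \<noteq> 0" using that by (cases "X ls hs = 0") simp_all
      from nz[OF this] show "length hs = 1" "length ls mod 2 = d mod 2" by blast+
    qed
    show "(X + Y) ls [g] = 0" if "\<forall>v\<in>V. cinner g v = 0" for ls g
    proof -
      have "X ls [g] = 0" "Y ls [g] = 0" using X Y that unfolding lam_tensor_def by blast+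
      then show ?thesis by simp
    qed
  qed
  have "x + y = (a + a') + (b + b')" by (simp add: x y algebra_simps)
  then show ?thesis unfolding ELam_def using add[OF x(2) y(2)] add[OF x(3) y(3)] by blast
qed

lemma lam_tensor_zero: "(\<lambda>ls hs. 0) \<in> lam_tensor d V"
  by (simp add: lam_tensor_def SLam_zero)

lemma ELam_0: "(\<lambda>ls hs. 0) \<in> ELam"
  unfolding ELam_def using lam_tensor_zero[of 0 E0] lam_tensor_zero[of 1 E1]
  by (auto simp: plus_fun_def intro!: exI[of _ "\<lambda>ls hs. 0"])

lemma supersym_tens_single: "e \<in> H0 \<union> H1 \<Longrightarrow> supersym (tens [e]) = tens [e]"
  using supersym_tens[of "[e]"] perm_sum_pull[of "[e]"] by (simp add: sprod_def sqrt_fact_def)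

lemma tprod_SLam:
  assumes M: "M \<in> glam" and e: "e \<in> H0 \<union> H1"
  shows "tprod (gval M) (tens [e]) \<in> SLam"
proof -
  have Ml: "gval M \<in> Lam" using M by (simp add: glam_def)
  obtain C where C: "\<And>A N. finite A \<Longrightarrow> orthonormal A \<Longrightarrow>
      (\<Sum>as\<in>{as \<in> lists A. length as \<le> N}. (cmod (gval M as) / fact (length as))\<^sup>2) \<le> C"
    using Ml unfolding Lam_def by blast
  have "tens [e] \<in> {l. \<exists>C. \<forall>A N. finite A \<and> orthonormal A \<longrightarrow> (\<Sum>n\<le>N. hs_norm l A n / (fact n)\<^sup>2) \<le> C}"
  proof -
    have "(\<Sum>n\<le>N. hs_norm (tens [e]) A n / (fact n)\<^sup>2) \<le> (norm e)\<^sup>2" if A: "finite A" "orthonormal A" for A N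
    proof -
      have "hs_norm (tens [e]) A n / (fact n)\<^sup>2 \<le> (if n = 1 then (norm e)\<^sup>2 else 0)" for n
      proof (cases "n = 1")
        case True
        have "hs_norm (tens [e]) A 1 = (\<Sum>a\<in>A. (cmod (cinner a e))\<^sup>2)"
          unfolding hs_norm_def
          by (rule sum.reindex_bij_witness[where i = "\<lambda>a. [a]" and j = hd]) (auto simp: tens_def length_Suc_conv)
        then show ?thesis using True bessel[OF A(2,1), of e] by simp
      qed (simp add: hs_norm_def tens_def)
      then have "(\<Sum>n\<le>N. hs_norm (tens [e]) A n / (fact n)\<^sup>2) \<le> (\<Sum>n\<le>N. if n = 1 then (norm e)\<^sup>2 else 0)"
        by (intro sum_mono)
      also have "\<dots> \<le> (norm e)\<^sup>2" by auto
      finally show ?thesis .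
    qed
    then show ?thesis by blast
  qed
  then obtain D where D: "\<And>A N. finite A \<Longrightarrow> orthonormal A \<Longrightarrow> (\<Sum>n\<le>N. hs_norm (tens [e]) A n / (fact n)\<^sup>2) \<le> D"
    by blast
  have D': "(\<Sum>bs\<in>{bs \<in> lists B. length bs \<le> N}. (cmod (tens [e] bs))\<^sup>2) \<le> D" if "finite B" "orthonormal B" for B N
  proof -
    have "(\<Sum>bs\<in>{bs \<in> lists B. length bs \<le> N}. (cmod (tens [e] bs))\<^sup>2) = (\<Sum>n\<le>N. hs_norm (tens [e]) B n / (fact n)\<^sup>2)"
      unfolding sum_lists_le[OF that(1)] hs_norm_def sum_divide_distrib
      by (intro sum.cong refl) (auto simp: tens_def)
    then show ?thesis using D[OF that] by simp
  qed
  have "(\<Sum>as\<in>{as \<in> lists A. length as \<le> N}. \<Sum>bs\<in>{bs \<in> lists B. length bs \<le> N}.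
     (cmod (tprod (gval M) (tens [e]) as bs) / fact (length as))\<^sup>2) \<le> C * D"
    if A: "finite A \<and> orthonormal A \<and> finite B \<and> orthonormal B" for A B N
  proof -
    have "(\<Sum>as\<in>{as \<in> lists A. length as \<le> N}. \<Sum>bs\<in>{bs \<in> lists B. length bs \<le> N}.
       (cmod (tprod (gval M) (tens [e]) as bs) / fact (length as))\<^sup>2) =
       (\<Sum>as\<in>{as \<in> lists A. length as \<le> N}. (cmod (gval M as) / fact (length as))\<^sup>2) *
       (\<Sum>bs\<in>{bs \<in> lists B. length bs \<le> N}. (cmod (tens [e] bs))\<^sup>2)"
      unfolding sum_product
      by (intro sum.cong refl) (simp add: tprod_def norm_mult power_mult_distrib power_divide)
    also have "\<dots> \<le> C * D"
    proof (rule mult_mono)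
      show "0 \<le> C" using C[of A N] A by (meson order.trans sum_nonneg zero_le_power2)
    qed (use C D' A in \<open>auto intro: sum_nonneg\<close>)
    finally show ?thesis .
  qed
  then have "\<exists>C. \<forall>A B N. finite A \<and> orthonormal A \<and> finite B \<and> orthonormal B \<longrightarrow>
    (\<Sum>as\<in>{as \<in> lists A. length as \<le> N}. \<Sum>bs\<in>{bs \<in> lists B. length bs \<le> N}.
     (cmod (tprod (gval M) (tens [e]) as bs) / fact (length as))\<^sup>2) \<le> C" by blast
  moreover have "multi_antilinear (\<lambda>ls. tprod (gval M) (tens [e]) ls hs)" "multi_antilinear (tprod (gval M) (tens [e]) ls)" for ls hs
    using Ml multi_antilinear_tens[of "[e]"] by (simp_all add: Lam_def multi_antilinear_def tprod_def algebra_simps)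
  moreover have "alt (\<lambda>ls. tprod (gval M) (tens [e]) ls hs) = (\<lambda>ls. tprod (gval M) (tens [e]) ls hs)" for hs
    using alt_scale[of "tens [e] hs" "gval M"] gval[of M] by (simp add: tprod_def mult.commute)
  moreover have "supersym (tprod (gval M) (tens [e]) ls) = tprod (gval M) (tens [e]) ls" for ls
    using supersym_scale[of "gval M ls" "tens [e]"] supersym_tens_single[OF e] by (simp add: tprod_def)
  ultimately show ?thesis unfolding SLam_iff by blast
qed

text \<open>The elementary points from which the test point is assembled; the coefficient must have
  the parity of the vector.\<close>

lemma tprod_ELam:
  assumes M: "M \<in> glam" and e: "e \<in> Epos" and g: "ghom (of_bool (odd_vec e)) M"
  shows "tprod (gval M) (tens [e]) \<in> ELam"
proof -
  let ?X = "tprod (gval M) (tens [e])"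
  have S: "?X \<in> SLam" using tprod_SLam[OF M] e Epos_subset by blast
  have lam: "?X \<in> lam_tensor d V" if "e \<in> V" "ghom d M" for d V
    unfolding lam_tensor_def
  proof (intro CollectI conjI allI impI S)
    fix ls :: "'a list" and hs :: "'b list"
    assume "?X ls hs \<noteq> 0"
    then have nz: "gval M ls \<noteq> 0" "tens [e] hs \<noteq> 0" by (auto simp: tprod_def)
    show "length hs = 1" using nz(2) by (auto simp: tens_def split: if_splits)
    have "even (length ls + d)" using nz(1) that(2) by (auto simp: ghom_def)
    then show "length ls mod 2 = d mod 2" by presburger
  next
    fix ls :: "'a list" and h assume "\<forall>v\<in>V. cinner h v = 0"
    then show "?X ls [h] = 0" using that(1) by (simp add: tprod_def tens_def)
  qed
  show ?thesis
  proof (cases "odd_vec e")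
    case True
    have "e \<in> E1"
    \<comment> \<open>An odd vector in \<open>E0\<close> lies in \<open>H0\<close> as well as in
      \<open>H1\<close>, so it is 0 and belongs to \<open>E1\<close> too.\<close>
    proof (cases "e \<in> E1")
      case False
      then have "e \<in> H0" using e E_subset_H(1) by (auto simp: Epos_def)
      then show ?thesis using H0_H1_disjoint True zero_E1 by blast
    qed
    then have "?X \<in> lam_tensor 1 E1" using g True by (intro lam) auto
    moreover have "?X = (\<lambda>ls hs. 0) + ?X" by (simp add: fun_eq_iff)
    ultimately show ?thesis unfolding ELam_def using lam_tensor_zero[of 0 E0] by blast
  next
    case False
    then have "e \<in> E0" using e E_subset_H(2) by (auto simp: Epos_def)
    then have "?X \<in> lam_tensor 0 E0" using g False by (intro lam) auto
    moreover have "?X = ?X + (\<lambda>ls hs. 0)" by (simp add: fun_eq_iff)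
    ultimately show ?thesis unfolding ELam_def using lam_tensor_zero[of 1 E1] by blast
  qed
qed

lemma multi_antilinear_pure_zero:
  assumes F: "multi_antilinear F" and "\<And>hs. length hs = n \<Longrightarrow> set hs \<subseteq> Epos \<union> Eneg \<Longrightarrow> F hs = 0"
    and "length hs = n"
  shows "F hs = 0"
proof -
  have "F (us @ vs) = 0" if "set us \<subseteq> Epos \<union> Eneg" "length us + length vs = n" for us vs
    using that
  proof (induction vs arbitrary: us)
    case Nil
    then show ?case using assms(2) by simp
  next
    case (Cons v vs)
    obtain a b c d where v: "v = (a + invol b) + (c + invol d)" "a \<in> E0" "b \<in> E0" "c \<in> E1" "d \<in> E1"
      using decomposition[of v] by blast
    have pure: "F (us @ x # vs) = 0" if "x \<in> Epos \<union> Eneg" for x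
      using Cons.IH[of "us @ [x]"] Cons.prems that by simp
    have "a \<in> Epos \<union> Eneg" "invol b \<in> Epos \<union> Eneg" "c \<in> Epos \<union> Eneg" "invol d \<in> Epos \<union> Eneg"
      using v by (auto simp: Epos_def Eneg_def)
    then show ?case unfolding v(1) multi_antilinear_additive[OF F] by (simp add: pure)
  qed
  from this[of "[]" hs] show ?thesis using assms(3) by simp
qed

text \<open>With no odd entries \<open>perm_sum\<close> is plain symmetrisation: it multiplies a
  symmetric function by a factorial and does not change when the list is permuted.\<close>

lemma symmetric_mset_eq:
  assumes "\<And>us x y vs. set (us @ x # y # vs) \<subseteq> S \<Longrightarrow> G (us @ x # y # vs) = G (us @ y # x # vs)"
    and "set xs \<subseteq> S" "mset ys = mset xs"
  shows "G ys = (G xs :: complex)"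
proof -
  have avg: "perm_sum (\<lambda>_. False) G zs = fact (length zs) * G zs" if "set zs \<subseteq> S" for zs
    by (rule perm_sum_symmetric[OF _ that]) (simp add: koszul_def assms(1))
  obtain s where s: "s permutes {..<length xs}" "permute_list s xs = ys"
    using assms(3) by (metis mset_eq_permutation)
  have "perm_sum (\<lambda>_. False) G ys = perm_sum (\<lambda>_. False) G xs"
    using perm_sum_permute[OF s(1), of "\<lambda>_. False" G] s(2) by (simp add: perm_koszul_def)
  moreover have "set ys = set xs" "length ys = length xs"
    using assms(3) by (auto dest: mset_eq_setD mset_eq_length)
  ultimately show ?thesis using avg[of xs] avg[of ys] assms(2) by simp
qed

lemma count_concat_ge:
  assumes "x \<in> set (f a)" shows "count (mset ws) a \<le> count (mset (concat (map f ws))) x"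
proof (induction ws)
  case (Cons w ws)
  have "count (mset (f w)) x \<ge> (if w = a then 1 else 0)" using assms by (simp add: Suc_le_eq)
  moreover have "count (mset (w # ws)) a = count (mset ws) a + (if w = a then 1 else 0)"
    "count (mset (concat (map f (w # ws)))) x = count (mset (f w)) x + count (mset (concat (map f ws))) x" by simp_all
  ultimately show ?case using Cons by linarith
qed simp

section \<open>A real test point with prescribed letters\<close>

lemma zval_tprod:
  assumes "superpoint (tprod (gval M) (tens [e]))"
  shows "zval (tprod (gval M) (tens [e])) h = gscal (cinner h e) * M"
  by (rule grass_eqI) (simp add: gval_zval[OF assms] gval_gscal_mult, simp add: tprod_def tens_def)

text \<open>A letter \<open>(i, b)\<close> names one summand of the test point: the vector
  \<open>w i\<close> with the generators \<open>q i\<close>, or, if \<open>b\<close> holds, the star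
  of this summand.\<close>

definition letter_vec :: "(nat \<Rightarrow> 'h::super_hilbert_space) \<Rightarrow> nat \<times> bool \<Rightarrow> 'h" where
  "letter_vec w a = (if snd a then invol (w (fst a)) else w (fst a))"

definition letter_gens :: "(nat \<Rightarrow> 'l::involutive_hilbert_space list) \<Rightarrow> nat \<times> bool \<Rightarrow> 'l list" where
  "letter_gens q a = (if snd a then rev (map invol (q (fst a))) else q (fst a))"

text \<open>For each \<open>i\<close> one of \<open>w i\<close> and its star lies in
  \<open>Epos\<close>; that one defines a point of \<open>ELam\<close>, and adding
  \<open>sstar\<close> supplies the other, so both letters occur symmetrically.\<close>

lemma real_point_exists:
  fixes w :: "nat \<Rightarrow> 'h::super_hilbert_space" and q :: "nat \<Rightarrow> 'l::involutive_hilbert_space list"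
  assumes "\<And>i. i < n \<Longrightarrow> w i \<in> Epos \<union> Eneg"
    and "\<And>i. i < n \<Longrightarrow> even (length (q i)) = (\<not> odd_vec (w i))"
  shows "\<exists>x\<in>ELam. \<forall>h. zval (x + sstar x) h =
    (\<Sum>a\<in>{..<n} \<times> UNIV. gscal (cinner h (letter_vec w a)) * gprod (letter_gens q a))"
proof -
  let ?t = "\<lambda>h a. gscal (cinner h (letter_vec w a)) * gprod (letter_gens q a)"
  have step: "\<exists>e\<in>ELam. \<forall>h. zval (e + sstar e) h = ?t h (i, False) + ?t h (i, True)" if i: "i < n" for i
  proof -
    obtain b where b: "letter_vec w (i, b) \<in> Epos"
    proof (cases "w i \<in> Epos")
      case True
      then show ?thesis using that[of False] by (simp add: letter_vec_def)
    next
      case False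
      then show ?thesis using that[of True] assms(1)[OF i] by (simp add: letter_vec_def invol_Eneg)
    qed
    let ?v = "letter_vec w (i, b)" and ?M = "gprod (letter_gens q (i, b))"
    let ?e = "tprod (gval ?M) (tens [?v])"
    have "odd_vec ?v = odd_vec (w i)" by (simp add: letter_vec_def invol_H1_iff)
    moreover have "length (letter_gens q (i, b)) = length (q i)" by (simp add: letter_gens_def)
    ultimately have "ghom (of_bool (odd_vec ?v)) ?M"
      using assms(2)[OF i] by (intro ghom_cong[OF ghom_gprod]) auto
    then have e: "?e \<in> ELam" by (intro tprod_ELam gprod_glam b)
    have s: "superpoint ?e" by (rule ELam_superpoint[OF e])
    have v': "letter_vec w (i, \<not> b) = invol ?v" by (simp add: letter_vec_def invol_invol)
    have g': "letter_gens q (i, \<not> b) = rev (map invol (letter_gens q (i, b)))"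
      by (simp add: letter_gens_def rev_map o_def invol_invol)
    have "zval (?e + sstar ?e) h = ?t h (i, b) + ?t h (i, \<not> b)" for h
    proof -
      have c: "cnj (cinner (invol h) ?v) = cinner h (invol ?v)"
        using cinner_invol[of h "invol ?v"] by (simp add: invol_invol)
      have "zval (sstar ?e) h = gscal (cinner h (invol ?v)) * gstar ?M"
        by (simp add: zval_sstar[OF s] zval_tprod[OF s] gstar_mult gstar_gscal gscal_commute c)
      then show ?thesis
        by (simp add: zval_plus[OF s superpoint_sstar[OF s]] zval_tprod[OF s] gstar_gprod v' g')
    qed
    then have "\<forall>h. zval (?e + sstar ?e) h = ?t h (i, False) + ?t h (i, True)"
      by (cases b) (simp_all add: add.commute)
    then show ?thesis using e by blast
  qed
  have "\<exists>x\<in>ELam. \<forall>h. zval (x + sstar x) h = (\<Sum>i<m. ?t h (i, False) + ?t h (i, True))" if "m \<le> n" for m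
    using that
  proof (induction m)
    case 0
    let ?o = "\<lambda>ls hs. 0 :: complex"
    have s: "superpoint (?o :: ('l, 'h) stensor)" by (rule ELam_superpoint[OF ELam_0])
    have "zval (?o :: ('l, 'h) stensor) h = 0" for h
      by (rule grass_eqI) (simp add: gval_zval[OF s] zero_grass.rep_eq)
    then have "zval (?o + sstar ?o :: ('l, 'h) stensor) h = 0" for h
      using gstar_add[of 0 0] by (simp add: zval_plus[OF s superpoint_sstar[OF s]] zval_sstar[OF s])
    then show ?case using ELam_0 by (intro bexI[of _ ?o] allI) (simp_all only: lessThan_0 sum.empty)
  next
    case (Suc m)
    from Suc.IH[OF Suc_leD[OF Suc.prems]] obtain x where x: "x \<in> ELam"
      "\<And>h. zval (x + sstar x) h = (\<Sum>i<m. ?t h (i, False) + ?t h (i, True))" by blast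
    obtain e where e: "e \<in> ELam" "\<And>h. zval (e + sstar e) h = ?t h (m, False) + ?t h (m, True)"
      using step[OF Suc_le_lessD[OF Suc.prems]] by blast
    have "x + e + sstar (x + e) = (x + sstar x) + (e + sstar e)" by (simp add: sstar_def fun_eq_iff)
    moreover have "zval (x + sstar x + (e + sstar e)) h = zval (x + sstar x) h + zval (e + sstar e) h" for h
      using x(1) e(1) by (intro zval_plus superpoint_add superpoint_sstar ELam_superpoint)
    ultimately have "zval (x + e + sstar (x + e)) h = (\<Sum>i<Suc m. ?t h (i, False) + ?t h (i, True))" for h
      by (simp only: x(2) e(2) sum.lessThan_Suc)
    then show ?case using ELam_add[OF x(1) e(1)] by blast
  qed
  from this[OF order_refl] obtain x where x: "x \<in> ELam"
    "\<And>h. zval (x + sstar x) h = (\<Sum>i<n. ?t h (i, False) + ?t h (i, True))" by blast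
  have "(\<Sum>i<n. ?t h (i, False) + ?t h (i, True)) = (\<Sum>a\<in>{..<n} \<times> UNIV. ?t h a)" for h
    by (simp add: sum.cartesian_product' UNIV_bool add.commute)
  then show ?thesis using x by metis
qed

lemma distinct_concat_upt:
  fixes J :: "nat \<Rightarrow> nat list"
  assumes "\<And>i. distinct (J i)" "\<And>i. set (J i) \<subseteq> {2 * i, Suc (2 * i)}"
  shows "distinct (concat (map J [0..<n])) \<and> set (concat (map J [0..<n])) \<subseteq> {..<2 * n}"
proof (induction n)
  case (Suc n)
  then show ?case using assms[of n] by fastforce
qed simp

lemma mset_eq_distinct_words:
  assumes "distinct xs" "distinct ys" "set xs \<subseteq> set ys" "length ys \<le> length xs"
  shows "mset xs = mset ys"
proof -
  have "set xs = set ys"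
    using assms by (intro card_seteq) (simp_all add: distinct_card)
  then show ?thesis using assms by (simp add: set_eq_iff_mset_eq_distinct)
qed

lemma hatval_swap:
  assumes "X \<in> SfinLam" "homog (us @ x # y # vs)"
  shows "hatval X (us @ x # y # vs) = gscal (koszul odd_vec x y) * hatval X (us @ y # x # vs)"
  using SfinLam_swap[OF assms]
  by (intro grass_eqI) (simp only: gval_hatval[OF SfinLam_alt[OF assms(1)]] gval_gscal_mult)

lemma prod_swap_letters:
  assumes "ghom (of_bool p) (u x)" "ghom (of_bool r) (u y)"
  shows "prod_list (map u (us @ x # y # vs)) =
    gscal (if p \<and> r then -1 else 1) * prod_list (map u (us @ y # x # vs))"
proof -
  have "u x * u y = u y * galpha (of_bool r) (u x)" by (rule ghom_commute[OF assms(2)])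
  also have "\<dots> = gscal (if p \<and> r then -1 else 1) * (u y * u x)"
    by (simp add: galpha_ghom[OF assms(1)] gscal_left_commute)
  finally have "prod_list (map u us) * (u x * u y * t) =
    gscal (if p \<and> r then -1 else 1) * (prod_list (map u us) * (u y * u x * t))" for t
    by (simp only: mult.assoc gscal_left_commute)
  then show ?thesis by (simp only: map_append list.map prod_list.append prod_list.Cons mult.assoc)
qed

text \<open>The test point: attach to each vector \<open>w i\<close> fresh Grassmann generators, one if \<open>w i\<close> is odd
  and two if it is even. The coefficient of the product of all generators then isolates the
  value of \<open>X\<close> at \<open>hs\<close>.\<close>

lemma SfinLam_vanishes_pure:
  fixes X :: "('l::involutive_hilbert_space, 'h::super_hilbert_space) stensor"
  assumes inf: "infinite_dimensional TYPE('l)" and X: "X \<in> SfinLam"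
    and van: "\<And>x. x \<in> ELam \<Longrightarrow> sform (sexp (x + sstar x)) X = (\<lambda>_. 0)"
    and low: "\<And>ls hs. length hs < n \<Longrightarrow> X ls hs = 0"
    and hs: "length hs = n" "set hs \<subseteq> Epos \<union> Eneg"
  shows "X ls hs = 0"
proof -
  obtain k :: "nat \<Rightarrow> 'l" where
    kk: "\<And>i j. i < 2 * n \<Longrightarrow> j < 2 * n \<Longrightarrow> cinner (k i) (k j) = (if i = j then 1 else 0)"
    and kk': "\<And>i j. i < 2 * n \<Longrightarrow> j < 2 * n \<Longrightarrow> cinner (k i) (invol (k j)) = 0"
    and lk: "\<And>i s. i < 2 * n \<Longrightarrow> s \<in> set ls \<Longrightarrow> cinner s (k i) = 0"
    and lk': "\<And>i s. i < 2 * n \<Longrightarrow> s \<in> set ls \<Longrightarrow> cinner s (invol (k i)) = 0"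
    by (rule generators_exist[OF inf, of "set ls" "2 * n"]) auto
  \<comment> \<open>The word expansion reverses and stars its letters; compensating for this here
    makes the distinguished word \<open>w0\<close> pick out \<open>hs\<close>.\<close>
  define w where "w i = invol (rev hs ! i)" for i
  \<comment> \<open>The number of generators has the parity of the vector. An even vector gets two
    instead of none, so that its letter cannot usefully occur twice either. Indices
    \<open>2 * i\<close> and \<open>Suc (2 * i)\<close> keep different \<open>i\<close>
    apart.\<close>
  define J where "J i = (if odd_vec (w i) then [2 * i] else [2 * i, Suc (2 * i)])" for i
  define q where "q i = map k (J i)" for i
  define W :: "(nat \<times> bool) set" where "W = {..<n} \<times> UNIV"
  define u where "u a = gprod (letter_gens q a)" for a
  define v where "v a = invol (letter_vec w a)" for a
  define js where "js = concat (map J [0..<n])"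
  define gens where "gens = concat (map q [0..<n])"
  define L where "L = gens @ ls"
  define w0 where "w0 = map (\<lambda>i. (i, False)) [0..<n]"
  \<comment> \<open>The contribution of the word \<open>ws\<close>, up to its normalisation, to the
    coefficient at \<open>L\<close>, where \<open>L\<close> lists all unstarred generators followed
    by \<open>ls\<close>.\<close>
  define T where "T ws = gval (prod_list (map u ws) * hatval X (rev (map v ws))) L" for ws
  have js: "distinct js" "set js \<subseteq> {..<2 * n}"
    using distinct_concat_upt[of J n] by (auto simp: js_def J_def)
  have gens: "gens = map k js" by (simp add: gens_def js_def map_concat o_def q_def[abs_def])
  have inj: "inj_on k {..<2 * n}"
  proof (rule inj_onI)
    fix i j assume "i \<in> {..<2 * n}" "j \<in> {..<2 * n}" "k i = k j"
    then show "i = j" using kk[of i i] kk[of i j] by (auto split: if_splits)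
  qed
  have k_ls: "k i \<notin> set ls" if "i < 2 * n" for i using lk[OF that, of "k i"] kk[OF that that] by auto
  have L_mem: "g \<in> set L \<Longrightarrow> (\<exists>j<2 * n. g = k j) \<or> g \<in> set ls" for g
    using js(2) by (auto simp: L_def gens)
  have w_pure: "w i \<in> Epos \<union> Eneg" if "i < n" for i
  proof -
    have "rev hs ! i \<in> set (rev hs)" using that hs(1) by (intro nth_mem) simp
    then have "rev hs ! i \<in> Epos \<union> Eneg" using hs(2) by auto
    then show ?thesis using invol_Epos[of "rev hs ! i"] invol_Eneg[of "rev hs ! i"] by (auto simp: w_def)
  qed
  have "even (length (q i)) = (\<not> odd_vec (w i))" for i by (simp add: q_def J_def)
  then obtain x where x: "x \<in> ELam" "\<And>h. zval (x + sstar x) h = (\<Sum>a\<in>W. gscal (cinner h (letter_vec w a)) * u a)"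
    using real_point_exists[of n w q] w_pure unfolding u_def W_def by blast
  have z: "superpoint (x + sstar x)"
    using x(1) by (intro superpoint_add superpoint_sstar) (simp_all add: ELam_superpoint)
  have fW: "finite W" by (simp add: W_def)
  have "word_expansion (x + sstar x) W v u X"
    by (rule word_expansion_SfinLam[OF X z fW]) (simp add: x(2) v_def cinner_invol_swap)
  then obtain N0 where N0: "\<And>N. N \<ge> N0 \<Longrightarrow> phi_sums (x + sstar x) X (\<Sum>m\<le>N. gscal (1 / sqrt_fact m) *
        (\<Sum>ws\<in>words W m. prod_list (map u ws) * hatval X (rev (map v ws))))"
    unfolding word_expansion_def by blast
  define N where "N = max N0 n"
  let ?V = "\<Sum>m\<le>N. gscal (1 / sqrt_fact m) *
        (\<Sum>ws\<in>words W m. prod_list (map u ws) * hatval X (rev (map v ws)))"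
  have "N0 \<le> N" by (simp add: N_def)
  then have "gval ?V = (\<lambda>_. 0)" using phi_sums_sform[OF N0] van[OF x(1)] by simp
  moreover have "gval ?V L = (\<Sum>m\<le>N. 1 / sqrt_fact m * (\<Sum>ws\<in>words W m. T ws))"
    by (simp only: gval_sum gval_gscal_mult T_def)
  ultimately have sum0: "(\<Sum>m\<le>N. 1 / sqrt_fact m * (\<Sum>ws\<in>words W m. T ws)) = 0" by simp

  have T_low: "T ws = 0" if "length ws < n" for ws
  proof -
    have "hatval X (rev (map v ws)) = 0"
      using low that by (intro grass_eqI) (simp add: gval_hatval[OF SfinLam_alt[OF X]] zero_grass.rep_eq)
    then show ?thesis by (simp add: T_def zero_grass.rep_eq)
  qed

  \<comment> \<open>Starred generators are orthogonal to \<open>L\<close>, and each unstarred one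
    occurs there once. A contributing word therefore has unstarred letters only, each at most once,
    and among such words only the rearrangements of \<open>w0\<close> have length at least
    \<open>n\<close>.\<close>
  have T_high: "mset ws = mset w0" if ws: "ws \<in> lists W" "n \<le> length ws" and nz: "T ws \<noteq> 0" for ws
  proof -
    have gen_form: "\<exists>j<2 * n. g = k j \<or> g = invol (k j)" if "g \<in> set (letter_gens q a)" "a \<in> W" for g a
    proof -
      have "set (J (fst a)) \<subseteq> {..<2 * n}" using that(2) by (auto simp: J_def W_def)
      then show ?thesis using that(1) by (auto simp: letter_gens_def q_def split: if_splits)
    qed
    have sub: "mset (concat (map (letter_gens q) ws)) \<subseteq># mset L"
    proof (rule gprod_mult_nonzero)
      show "gval (gprod (concat (map (letter_gens q) ws)) * hatval X (rev (map v ws))) L \<noteq> 0"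
        using nz by (simp add: T_def gprod_concat o_def u_def[abs_def])
      fix g g' assume g: "g \<in> set (concat (map (letter_gens q) ws))" "g' \<in> set L" "cinner g' g \<noteq> 0"
      obtain a where "a \<in> set ws" "g \<in> set (letter_gens q a)" using g(1) by auto
      then obtain j where j: "j < 2 * n" "g = k j \<or> g = invol (k j)" using gen_form ws(1) by blast
      from L_mem[OF g(2)] show "g' = g"
      proof
        assume "\<exists>j<2 * n. g' = k j"
        then obtain j' where "j' < 2 * n" "g' = k j'" by blast
        then show ?thesis using g(3) j kk[of j' j] kk'[of j' j] by (auto split: if_splits)
      qed (use g(3) j lk lk' in auto)
    qed
    have un: "\<not> s" if mem: "(i, s) \<in> set ws" for i s
    proof
      assume s: s
      have i: "i < n" using mem ws(1) by (auto simp: W_def)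
      have "invol (k (2 * i)) \<in> set (letter_gens q (i, s))" using s by (simp add: letter_gens_def q_def J_def)
      then have "invol (k (2 * i)) \<in># mset (concat (map (letter_gens q) ws))" using mem by auto
      then have "invol (k (2 * i)) \<in> set L" using mset_subset_eqD[OF sub] by simp
      moreover have "cinner (invol (k (2 * i))) (invol (k (2 * i))) = 1"
        using kk[of "2 * i" "2 * i"] i by (simp add: cinner_invol)
      ultimately show False
        using L_mem[of "invol (k (2 * i))"] kk'[of _ "2 * i"] lk'[of "2 * i" "invol (k (2 * i))"] i by auto
    qed
    have "count (mset ws) a \<le> 1" for a
    proof (cases "a \<in> set ws")
      case True
      obtain i where a: "a = (i, False)" using un True by (cases a) auto
      have i: "i < n" using True a ws(1) by (auto simp: W_def)
      have "k (2 * i) \<in> set (letter_gens q a)" by (simp add: a letter_gens_def q_def J_def)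
      then have "count (mset ws) a \<le> count (mset (concat (map (letter_gens q) ws))) (k (2 * i))"
        by (rule count_concat_ge)
      also have "\<dots> \<le> count (mset L) (k (2 * i))" using sub by (rule mset_subset_eq_count)
      also have "\<dots> = count (mset gens) (k (2 * i))"
        using k_ls[of "2 * i"] i by (simp add: L_def)
      also have "distinct gens" unfolding gens distinct_map using js inj by (blast intro: inj_on_subset)
      then have "count (mset gens) (k (2 * i)) \<le> 1" by (simp add: distinct_count_atmost_1)
      finally show ?thesis .
    next
      case False
      then have "count (mset ws) a = 0" by (simp add: count_eq_zero_iff)
      then show ?thesis by linarith
    qed
    then have "count (mset ws) a = (if a \<in> set ws then 1 else 0)" for a
    proof (cases "a \<in> set ws")
      case True
      then have "count (mset ws) a \<ge> 1" by (simp add: Suc_le_eq)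
      moreover have "count (mset ws) a \<le> 1" by fact
      ultimately show ?thesis using True by (simp only: if_True le_antisym)
    qed (simp add: count_eq_zero_iff)
    then have "distinct ws" by (simp add: distinct_count_atmost_1)
    moreover have "distinct w0" by (simp add: w0_def distinct_map inj_on_def)
    moreover have "set ws \<subseteq> set w0"
    proof
      fix a assume a: "a \<in> set ws"
      obtain i where "a = (i, False)" using un a by (cases a) auto
      then show "a \<in> set w0" using a ws(1) by (auto simp: w0_def W_def)
    qed
    ultimately show ?thesis using ws(2) by (intro mset_eq_distinct_words) (simp_all add: w0_def)
  qed

  have lv: "letter_vec w a \<in> H0 \<union> H1" "v a \<in> H0 \<union> H1" "odd_vec (v a) = odd_vec (letter_vec w a)"
    "ghom (of_bool (odd_vec (v a))) (u a)" if "a \<in> W" for a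
  proof -
    have "w (fst a) \<in> H0 \<union> H1" using w_pure[of "fst a"] that Epos_subset Eneg_subset by (auto simp: W_def)
    then show "letter_vec w a \<in> H0 \<union> H1" "v a \<in> H0 \<union> H1"
      by (auto simp: letter_vec_def v_def invol_H0 invol_H1 invol_invol)
    show p: "odd_vec (v a) = odd_vec (letter_vec w a)" by (simp add: v_def invol_H1_iff)
    have "odd_vec (letter_vec w a) = odd_vec (w (fst a))" by (simp add: letter_vec_def invol_H1_iff)
    then show "ghom (of_bool (odd_vec (v a))) (u a)"
      unfolding p u_def by (intro ghom_cong[OF ghom_gprod]) (auto simp: letter_gens_def q_def J_def)
  qed
  \<comment> \<open>Exchanging two letters changes the sign of the generator product and of the
    value of \<open>X\<close> alike, so the rearrangements of \<open>w0\<close> contribute equally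
    and cannot cancel.\<close>
  have T_swap: "T (us @ a # b # vs) = T (us @ b # a # vs)" if "set (us @ a # b # vs) \<subseteq> W" for us a b vs
  proof -
    let ?s = "koszul odd_vec (v a) (v b)"
    have ab: "a \<in> W" "b \<in> W" using that by auto
    have h: "homog (rev (map v vs) @ v b # v a # rev (map v us))" using that lv(2) by auto
    have "prod_list (map u (us @ a # b # vs)) = gscal ?s * prod_list (map u (us @ b # a # vs))"
      unfolding koszul_def by (rule prod_swap_letters[where u = u and x = a and y = b, OF lv(4)[OF ab(1)] lv(4)[OF ab(2)]])
    moreover have "hatval X (rev (map v (us @ a # b # vs))) = gscal ?s * hatval X (rev (map v (us @ b # a # vs)))"
      using hatval_swap[OF X h] by (simp add: koszul_commute[of _ "v b"])
    moreover have "gscal ?s * P * (gscal ?s * Q) = P * Q" for P Q :: "'l grass"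
    proof -
      have "gscal ?s * P * (gscal ?s * Q) = gscal (?s * ?s) * (P * Q)"
        by (simp only: mult.assoc gscal_left_commute[of P] gscal_mult)
      then show ?thesis by (simp add: koszul_def)
    qed
    ultimately show ?thesis by (simp only: T_def)
  qed
  have w0W: "set w0 \<subseteq> W" by (auto simp: w0_def W_def)
  have T_val: "T ws = (if mset ws = mset w0 then T w0 else 0)" if "ws \<in> words W n" for ws
    using T_high[of ws] that symmetric_mset_eq[of W T w0 ws] T_swap w0W by auto

  have "(\<Sum>ws\<in>words W m. T ws) = 0" if "m \<noteq> n" for m
  proof (rule sum.neutral, rule ballI)
    fix ws assume ws: "ws \<in> words W m"
    show "T ws = 0"
    proof (rule ccontr)
      assume nz: "T ws \<noteq> 0"
      then have "n \<le> length ws" using T_low not_le by blast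
      then have "mset ws = mset w0" using T_high nz ws by blast
      from mset_eq_length[OF this] have "length ws = n" by (simp add: w0_def)
      then show False using ws that by simp
    qed
  qed
  then have "(\<Sum>m\<le>N. 1 / sqrt_fact m * (\<Sum>ws\<in>words W m. T ws)) =
    (\<Sum>m\<le>N. if m = n then 1 / sqrt_fact n * (\<Sum>ws\<in>words W n. T ws) else 0)"
    by (intro sum.cong) auto
  then have "(\<Sum>ws\<in>words W n. T ws) = 0" using sum0 by (simp add: N_def)
  moreover have fin: "finite (words W n)" using finite_lists_length_eq[OF fW, of n] by (simp add: in_lists_conv_set subset_eq)
  have "(\<Sum>ws\<in>words W n. T ws) = (\<Sum>ws\<in>words W n. if mset ws = mset w0 then T w0 else 0)"
    by (rule sum.cong[OF refl T_val])
  then have "(\<Sum>ws\<in>words W n. T ws) = of_nat (card {ws \<in> words W n. mset ws = mset w0}) * T w0"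
    using fin by (simp add: sum.If_cases Int_def)
  moreover have "w0 \<in> {ws \<in> words W n. mset ws = mset w0}" using w0W by (auto simp: w0_def)
  then have "card {ws \<in> words W n. mset ws = mset w0} \<noteq> 0"
    using finite_subset[OF _ fin, of "{ws \<in> words W n. mset ws = mset w0}"]
    by (metis (no_types, lifting) card_0_eq empty_iff mem_Collect_eq subsetI)
  ultimately have T0: "T w0 = 0" by simp

  have "rev (map v w0) = hs"
  proof (rule nth_equalityI)
    fix i assume "i < length (rev (map v w0))"
    then have i: "i < n" by (simp add: w0_def)
    then have "n - Suc (n - Suc i) = i" "n - Suc i < n" by auto
    then show "rev (map v w0) ! i = hs ! i"
      using i by (simp add: w0_def rev_nth v_def letter_vec_def w_def invol_invol hs(1))
  qed (simp add: w0_def hs(1))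
  moreover have "prod_list (map u w0) = gprod gens"
    by (simp add: gens_def gprod_concat w0_def u_def letter_gens_def o_def)
  ultimately have "T w0 = gval (gprod gens * hatval X hs) (gens @ ls)" by (simp add: T_def L_def)
  moreover have "\<exists>c. c \<noteq> 0 \<and> (\<forall>b. gval (gprod gens * b) (gens @ ls) = c * gval b ls)"
  proof (rule gprod_mult_value)
    fix i j assume ij: "i < length gens" "j < length gens"
    then have "js ! i \<in> {..<2 * n}" "js ! j \<in> {..<2 * n}"
      using js(2) by (simp_all only: gens length_map) (meson nth_mem subsetD)+
    then show "cinner (gens ! i) (gens ! j) = (if i = j then 1 else 0)"
      using ij js(1) by (simp add: gens kk nth_eq_iff_index_eq)
  next
    fix g l assume "g \<in> set gens" "l \<in> set ls"
    then show "cinner l g = 0" using lk js(2) by (auto simp: gens)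
  qed
  ultimately have "gval (hatval X hs) ls = 0" using T0 by auto
  then show ?thesis by (simp add: gval_hatval[OF SfinLam_alt[OF X]])
qed

text \<open>Induction over the Fock degree: words shorter than \<open>n\<close> could also
  contribute to the coefficient at the test generators, so the lower components have to vanish
  first.\<close>

lemma SfinLam_vanishes:
  fixes X :: "('l::involutive_hilbert_space, 'h::super_hilbert_space) stensor"
  assumes inf: "infinite_dimensional TYPE('l)" and X: "X \<in> SfinLam"
    and van: "\<And>x. x \<in> ELam \<Longrightarrow> sform (sexp (x + sstar x)) X = (\<lambda>_. 0)"
  shows "X ls hs = 0"
proof (induction "length hs" arbitrary: ls hs rule: less_induct)
  case less
  show ?case
  proof (rule multi_antilinear_pure_zero[OF SfinLam_multi_antilinear[OF X] _ refl])
    fix gs :: "'h list" assume gs: "length gs = length hs" "set gs \<subseteq> Epos \<union> Eneg"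
    show "X ls gs = 0"
      by (rule SfinLam_vanishes_pure[OF inf X van _ gs]) (simp_all add: less)
  qed
qed

section \<open>Gaussian integrals\<close>

lemma phi_sums_exists:
  assumes "X \<in> SfinLam" "superpoint z" shows "\<exists>v. phi_sums z X v"
  using assms(1)
proof (induction rule: SfinLam_induct)
  case zero
  show ?case using phi_sums_zero[of z] by (auto simp: zero_fun_def)
next
  case (add X Y)
  then obtain v w where vw: "phi_sums z X v" "phi_sums z Y w" by blast
  have "X + Y = (\<lambda>ls hs. X ls hs + Y ls hs)" by (simp add: plus_fun_def)
  then show ?case using phi_sums_add[OF vw] by metis
next
  case (prod M as bs)
  then have "homog (as @ bs)" using Epos_subset Eneg_subset by auto
  then show ?case using phi_sums_sprod[OF assms(2)] by blast
qed

lemma phi_add: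
  assumes "X \<in> SfinLam" "Y \<in> SfinLam" "superpoint (x + y)"
  shows "phi (X + Y) x y = phi X x y + phi Y x y"
proof -
  obtain v w where vw: "phi_sums (x + y) X v" "phi_sums (x + y) Y w"
    using phi_sums_exists[OF assms(1,3)] phi_sums_exists[OF assms(2,3)] by blast
  have "X + Y = (\<lambda>ls hs. X ls hs + Y ls hs)" by (simp add: plus_fun_def)
  then have "phi (X + Y) x y = gval (v + w)" using phi_sums_sform[OF phi_sums_add[OF vw]] by (simp only: phi_def)
  then show ?thesis using phi_sums_sform[OF vw(1)] phi_sums_sform[OF vw(2)]
    by (simp add: phi_def plus_grass.rep_eq plus_fun_def)
qed

lemma phi_zero: "phi 0 x y = 0"
  using phi_sums_sform[OF phi_sums_zero, of "x + y"] by (simp add: phi_def zero_fun_def zero_grass.rep_eq)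

lemma phi_sprod:
  assumes "superpoint (x + y)" "homog fs"
  shows "phi (tprod (gval M) (sprod fs)) x y = gval (zprod (x + y) fs * M)"
  using phi_sums_sform[OF phi_sums_sprod[OF assms]] by (simp add: phi_def)

lemma superpoint_real: "x \<in> ELam \<Longrightarrow> superpoint (x + sstar x)"
  by (intro superpoint_add superpoint_sstar ELam_superpoint)

text \<open>This makes the definite description in \<open>gauss_integral\<close> meaningful: the
  difference of two representing elements vanishes at all real points.\<close>

lemma represents_unique:
  fixes X :: "('l::involutive_hilbert_space, 'h::super_hilbert_space) stensor"
  assumes inf: "infinite_dimensional TYPE('l)" and X: "represents X f" and Y: "represents Y f"
  shows "X = Y"
proof -
  have XY: "X \<in> SfinLam" "Y \<in> SfinLam" using X Y by (simp_all add: represents_def)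
  have "(X - Y) ls hs = 0" for ls hs
  proof (rule SfinLam_vanishes[OF inf SfinLam_diff[OF XY]])
    fix x :: "('l, 'h) stensor" assume x: "x \<in> ELam"
    obtain v w where vw: "phi_sums (x + sstar x) X v" "phi_sums (x + sstar x) Y w"
      using phi_sums_exists[OF _ superpoint_real[OF x]] XY by blast
    have "gval v = gval w"
      using X Y x phi_sums_sform[OF vw(1)] phi_sums_sform[OF vw(2)] by (simp add: represents_def phi_def)
    then have "v = w" by (simp add: gval_inject)
    then have "v + gscal (- 1) * w = 0"
      by (intro grass_eqI) (simp add: plus_grass.rep_eq gval_gscal_mult zero_grass.rep_eq)
    moreover have "(\<lambda>ls hs. X ls hs + - 1 * Y ls hs) = X - Y" by (simp add: fun_eq_iff)
    ultimately have "phi_sums (x + sstar x) (X - Y) 0"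
      using phi_sums_add[OF vw(1) phi_sums_scale[OF vw(2), of "- 1"]] by (simp only:)
    then show "sform (sexp (x + sstar x)) (X - Y) = (\<lambda>_. 0)"
      using phi_sums_sform zero_grass.rep_eq by metis
  qed
  then show ?thesis by (simp add: fun_eq_iff)
qed

text \<open>Existence of a representing element and the value of its functional in one relation,
  which is additive by itself; uniqueness enters only in reading off
  \<open>gauss_integral\<close>.\<close>

definition has_gauss_integral :: "(('l::involutive_hilbert_space, 'h::super_hilbert_space) stensor \<Rightarrow>
    'l tensor) \<Rightarrow> 'l tensor \<Rightarrow> bool" where
  "has_gauss_integral f v \<longleftrightarrow> (\<exists>X. represents X f \<and> gauss_functional_ext X = v)"

lemma has_gauss_integral:
  fixes f :: "('l::involutive_hilbert_space, 'h::super_hilbert_space) stensor \<Rightarrow> 'l tensor"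
  assumes "infinite_dimensional TYPE('l)" "has_gauss_integral f v"
  shows "gauss_integrable f" "gauss_integral f = v"
proof -
  obtain X where X: "represents X f" "gauss_functional_ext X = v"
    using assms(2) unfolding has_gauss_integral_def by blast
  then show "gauss_integrable f" unfolding gauss_integrable_def by blast
  have "(THE X. represents X f) = X"
    using X(1) represents_unique[OF assms(1)] by (intro the_equality)
  then show "gauss_integral f = v" using X(2) by (simp add: gauss_integral_def)
qed

lemma has_gauss_integral_cong:
  assumes "\<And>x. x \<in> ELam \<Longrightarrow> f x = g x" "has_gauss_integral f v"
  shows "has_gauss_integral g v"
  using assms by (simp add: has_gauss_integral_def represents_def)

lemma has_gauss_integral_add:
  assumes "has_gauss_integral f v" "has_gauss_integral g w"
  shows "has_gauss_integral (\<lambda>x. f x + g x) (v + w)"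
proof -
  obtain X Y where XY: "represents X f" "gauss_functional_ext X = v" "represents Y g" "gauss_functional_ext Y = w"
    using assms unfolding has_gauss_integral_def by blast
  have S: "X \<in> SfinLam" "Y \<in> SfinLam" using XY by (simp_all add: represents_def)
  have "represents (X + Y) (\<lambda>x. f x + g x)"
    unfolding represents_def
  proof (intro conjI ballI SfinLam_add S)
    fix x :: "('a, 'b) stensor" assume x: "x \<in> ELam"
    have "f x = phi X x (sstar x)" "g x = phi Y x (sstar x)" using XY x by (simp_all add: represents_def)
    then show "f x + g x = phi (X + Y) x (sstar x)" by (simp only: phi_add[OF S superpoint_real[OF x]])
  qed
  moreover have "gauss_functional_ext (X + Y) = v + w" using gauss_functional_ext_add[OF S] XY by simp
  ultimately show ?thesis unfolding has_gauss_integral_def by blast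
qed

text \<open>The constant stands to the right of the monomial, as in \<open>phi_sprod\<close>. For
  this reason the integrand is brought into the form monomial times constant before each
  integration.\<close>

lemma has_gauss_integral_zprod:
  assumes "M \<in> glam" "homog fs" and f: "\<And>x. x \<in> ELam \<Longrightarrow> f x = gval (zprod (x + sstar x) fs * M)"
  shows "has_gauss_integral f (gval (gscal (wick odd_vec omega fs) * M))"
proof -
  have "represents (tprod (gval M) (sprod fs)) f"
    using assms by (simp add: represents_def SfinLam_sprod phi_sprod superpoint_real)
  then show ?thesis
    unfolding has_gauss_integral_def using gauss_functional_ext_sprod[OF assms(2), of M] by blast
qed

lemma has_gauss_integral_zero:
  "has_gauss_integral (\<lambda>x :: ('l::involutive_hilbert_space, 'h::super_hilbert_space) stensor. 0) 0"
proof -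
  have "has_gauss_integral (\<lambda>x :: ('l, 'h) stensor. 0) (gval (gscal (wick odd_vec omega ([] :: 'h list)) * 0))"
    by (rule has_gauss_integral_zprod) (simp_all add: zero_grass.rep_eq zero_fun_def)
  then show ?thesis by (simp add: zero_grass.rep_eq zero_fun_def)
qed

text \<open>The inner integral is required for \<open>y\<close> in \<open>ELam\<close> only;
  \<open>G\<close> may be any function agreeing with it there.\<close>

definition has_double_integral :: "(('l::involutive_hilbert_space, 'h::super_hilbert_space) stensor \<Rightarrow>
    ('l, 'h) stensor \<Rightarrow> 'l tensor) \<Rightarrow> 'l tensor \<Rightarrow> bool" where
  "has_double_integral F v \<longleftrightarrow> (\<exists>G. (\<forall>y\<in>ELam. has_gauss_integral (\<lambda>x. F x y) (G y)) \<and> has_gauss_integral G v)"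

lemma has_double_integral:
  fixes F :: "('l::involutive_hilbert_space, 'h::super_hilbert_space) stensor \<Rightarrow> ('l, 'h) stensor \<Rightarrow> 'l tensor"
  assumes "infinite_dimensional TYPE('l)" "has_double_integral F v"
  shows "\<forall>y\<in>ELam. gauss_integrable (\<lambda>x. F x y)"
    and "gauss_integrable (\<lambda>y. gauss_integral (\<lambda>x. F x y))"
    and "gauss_integral (\<lambda>y. gauss_integral (\<lambda>x. F x y)) = v"
proof -
  obtain G where G: "\<And>y. y \<in> ELam \<Longrightarrow> has_gauss_integral (\<lambda>x. F x y) (G y)" "has_gauss_integral G v"
    using assms(2) unfolding has_double_integral_def by blast
  show "\<forall>y\<in>ELam. gauss_integrable (\<lambda>x. F x y)" using has_gauss_integral[OF assms(1) G(1)] by blast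
  have "G y = gauss_integral (\<lambda>x. F x y)" if "y \<in> ELam" for y
    using has_gauss_integral(2)[OF assms(1) G(1)[OF that]] by simp
  from has_gauss_integral_cong[OF this G(2)]
  have "has_gauss_integral (\<lambda>y. gauss_integral (\<lambda>x. F x y)) v" .
  from has_gauss_integral[OF assms(1) this]
  show "gauss_integrable (\<lambda>y. gauss_integral (\<lambda>x. F x y))" "gauss_integral (\<lambda>y. gauss_integral (\<lambda>x. F x y)) = v" .
qed

lemma has_double_integral_cong:
  assumes F: "\<And>x y. x \<in> ELam \<Longrightarrow> y \<in> ELam \<Longrightarrow> F x y = F' x y" and "has_double_integral F v"
  shows "has_double_integral F' v"
proof -
  obtain G where G: "\<And>y. y \<in> ELam \<Longrightarrow> has_gauss_integral (\<lambda>x. F x y) (G y)" "has_gauss_integral G v"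
    using assms(2) unfolding has_double_integral_def by blast
  have "has_gauss_integral (\<lambda>x. F' x y) (G y)" if "y \<in> ELam" for y
    by (rule has_gauss_integral_cong[OF F[OF _ that] G(1)[OF that]])
  then show ?thesis unfolding has_double_integral_def using G(2) by blast
qed

lemma has_double_integral_add:
  assumes "has_double_integral F v" "has_double_integral F' v'"
  shows "has_double_integral (\<lambda>x y. F x y + F' x y) (v + v')"
proof -
  obtain G where G: "\<And>y. y \<in> ELam \<Longrightarrow> has_gauss_integral (\<lambda>x. F x y) (G y)" "has_gauss_integral G v"
    using assms(1) unfolding has_double_integral_def by blast
  obtain G' where G': "\<And>y. y \<in> ELam \<Longrightarrow> has_gauss_integral (\<lambda>x. F' x y) (G' y)" "has_gauss_integral G' v'"
    using assms(2) unfolding has_double_integral_def by blast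
  show ?thesis
    unfolding has_double_integral_def
    by (intro exI[of _ "\<lambda>y. G y + G' y"] conjI ballI has_gauss_integral_add G G')
qed

lemma has_double_integral_zero: "has_double_integral (\<lambda>x y. 0) 0"
  unfolding has_double_integral_def
  by (intro exI[of _ "\<lambda>y. 0"] conjI ballI has_gauss_integral_zero)

section \<open>The inner product\<close>

lemma has_sum_tens_tens:
  "((\<lambda>bs. cnj (tens fs bs) * tens gs bs) has_sum tens gs fs) (lists onb)"
proof (cases "length gs = length fs")
  case True
  have "((\<lambda>bs. if length bs = length fs then \<Prod>i<length fs. cinner (fs ! i) (bs ! i) * cinner (bs ! i) (gs ! i) else 0)
    has_sum (\<Prod>i<length fs. cinner (fs ! i) (gs ! i))) (lists onb)"
    by (rule has_sum_prod_lists) (rule parseval)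
  moreover have "cnj (tens fs bs) * tens gs bs =
    (if length bs = length fs then \<Prod>i<length fs. cinner (fs ! i) (bs ! i) * cinner (bs ! i) (gs ! i) else 0)" for bs
    by (simp add: tens_def True prod.distrib cinner_commute[symmetric])
  ultimately show ?thesis using True by (simp add: tens_def)
next
  case False
  then have "(\<lambda>bs. cnj (tens fs bs) * tens gs bs) = (\<lambda>_. 0)" "tens gs fs = 0" by (simp_all add: tens_def fun_eq_iff)
  then show ?thesis by simp
qed

lemma has_sum_finite_sum:
  fixes f :: "'i \<Rightarrow> 'a \<Rightarrow> complex"
  assumes "\<And>i. i \<in> I \<Longrightarrow> (f i has_sum s i) A"
  shows "((\<lambda>x. \<Sum>i\<in>I. f i x) has_sum (\<Sum>i\<in>I. s i)) A"
  using assms by (induction I rule: infinite_finite_induct) (auto intro: has_sum_add)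

lemma cnj_perm_koszul: "cnj (perm_koszul P s xs) = perm_koszul P s xs"
  by (simp add: perm_koszul_def)

lemma has_sum_tens_sprod:
  "((\<lambda>bs. cnj (tens hs bs) * sprod gs bs) has_sum sprod gs hs) (lists onb)"
proof -
  let ?S = "{s. s permutes {..<length gs}}"
  have "((\<lambda>bs. \<Sum>s\<in>?S. perm_koszul odd_vec s gs / sqrt_fact (length gs) * (cnj (tens hs bs) * tens (permute_list s gs) bs))
    has_sum (\<Sum>s\<in>?S. perm_koszul odd_vec s gs / sqrt_fact (length gs) * tens (permute_list s gs) hs)) (lists onb)"
    by (intro has_sum_finite_sum has_sum_cmult_right has_sum_tens_tens) 
  then show ?thesis
    by (simp add: sprod_def perm_sum_def sum_divide_distrib sum_distrib_left sum_distrib_right mult_ac)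
qed

text \<open>The Gram formula. Summing against the tensors of the left factor evaluates the right
  factor at them, by \<open>has_sum_tens_sprod\<close>, and self-adjointness turns the remaining
  signed sum into the superdeterminant.\<close>

lemma has_sum_sprod_sprod:
  assumes "homog fs" "homog gs"
  shows "((\<lambda>bs. cnj (sprod fs bs) * sprod gs bs) has_sum super_det odd_vec cinner fs gs) (lists onb)"
proof -
  let ?S = "{s. s permutes {..<length fs}}" and ?n = "length fs"
  have sq: "cnj (sqrt_fact n) = sqrt_fact n" for n by (simp add: sqrt_fact_def)
  have "((\<lambda>bs. \<Sum>s\<in>?S. perm_koszul odd_vec s fs / sqrt_fact ?n * (cnj (tens (permute_list s fs) bs) * sprod gs bs))
    has_sum (\<Sum>s\<in>?S. perm_koszul odd_vec s fs / sqrt_fact ?n * sprod gs (permute_list s fs))) (lists onb)"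
    by (intro has_sum_finite_sum has_sum_cmult_right has_sum_tens_sprod)
  moreover have "(\<Sum>s\<in>?S. perm_koszul odd_vec s fs / sqrt_fact ?n * (cnj (tens (permute_list s fs) bs) * sprod gs bs)) =
    cnj (sprod fs bs) * sprod gs bs" for bs
    by (simp add: sprod_def[of fs] perm_sum_def sum_divide_distrib sum_distrib_left sum_distrib_right mult_ac
        cnj_perm_koszul sq)
  moreover have "(\<Sum>s\<in>?S. perm_koszul odd_vec s fs / sqrt_fact ?n * sprod gs (permute_list s fs)) =
    super_det odd_vec cinner fs gs"
  proof -
    have "(\<Sum>s\<in>?S. perm_koszul odd_vec s fs / sqrt_fact ?n * sprod gs (permute_list s fs)) =
      perm_sum odd_vec (sprod gs) fs / sqrt_fact ?n"
      by (simp add: perm_sum_def sum_divide_distrib)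
    also have "\<dots> = sqrt_fact (length gs) * perm_sum odd_vec (tens gs) fs / sqrt_fact ?n"
      by (simp add: perm_sum_sprod assms)
    \<comment> \<open>The two roots of factorials cancel when the lengths agree; otherwise both
      sides are 0.\<close>
    also have "\<dots> = perm_sum odd_vec (tens gs) fs"
      by (cases "length gs = ?n") (simp_all add: perm_sum_def tens_def)
    also have "\<dots> = perm_sum odd_vec (\<lambda>hs. tens hs fs) gs" by (rule perm_sum_tens[OF assms(2,1)])
    also have "\<dots> = super_det odd_vec cinner fs gs"
      unfolding super_det_perm_sum[symmetric] tens_def
      by (intro arg_cong[where f = "\<lambda>G. perm_sum odd_vec G gs"] ext) auto
    finally show ?thesis .
  qed
  ultimately show ?thesis by simp
qed

definition sinner_sums :: "('l::involutive_hilbert_space, 'h::super_hilbert_space) stensor \<Rightarrow>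
    ('l, 'h) stensor \<Rightarrow> 'l tensor \<Rightarrow> bool" where
  "sinner_sums X Y v \<longleftrightarrow> (\<forall>ls. ((\<lambda>bs. gmul (\<lambda>as. sstar X as (rev (map invol bs))) (\<lambda>as. Y as bs) ls)
     has_sum v ls) (lists onb))"

lemma sinner_sums: "sinner_sums X Y v \<Longrightarrow> sinner X Y = v"
  unfolding sinner_sums_def sinner_def sform_def by (auto intro!: ext infsumI)

lemma sinner_sums_add_left:
  assumes "sinner_sums X Y v" "sinner_sums X' Y w" shows "sinner_sums (X + X') Y (v + w)"
proof -
  have "(\<lambda>as. sstar (X + X') as hs) = (\<lambda>as. sstar X as hs + sstar X' as hs)" for hs
    by (simp add: sstar_def)
  then show ?thesis
    using assms unfolding sinner_sums_def
    by (simp add: gmul_alt_tmul tmul_add_left alt_add has_sum_add)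
qed

lemma sinner_sums_add_right:
  assumes "sinner_sums X Y v" "sinner_sums X Y' w" shows "sinner_sums X (Y + Y') (v + w)"
  using assms unfolding sinner_sums_def
  by (simp add: gmul_alt_tmul tmul_add_right alt_add has_sum_add)

lemma sinner_sums_zero: "sinner_sums 0 Y 0" "sinner_sums X 0 0"
  by (simp_all add: sinner_sums_def sstar_def gmul_def alt_def)

text \<open>Reversal and involution in \<open>sstar\<close> undo those in the form, so the Fock part
  of the left factor enters as a complex conjugate and its coefficient as
  \<open>gstar M\<close>.\<close>

lemma sinner_sums_sprod:
  assumes "homog fs" "homog gs"
  shows "sinner_sums (tprod (gval M) (sprod fs)) (tprod (gval M') (sprod gs))
    (gval (gscal (super_det odd_vec cinner fs gs) * (gstar M * M')))"
  unfolding sinner_sums_def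
proof
  fix ls :: "'b list"
  let ?X = "tprod (gval M) (sprod fs)" and ?Y = "tprod (gval M') (sprod gs)"
  have "(\<lambda>as. sstar ?X as (rev (map invol bs))) = (\<lambda>as. cnj (sprod fs bs) * gval (gstar M) as)" for bs
    by (simp add: sstar_def tprod_def gstar.rep_eq tstar_def rev_map o_def invol_invol mult.commute)
  moreover have "(\<lambda>as. ?Y as bs) = (\<lambda>as. sprod gs bs * gval M' as)" for bs by (simp add: tprod_def mult.commute)
  moreover have "gmul (\<lambda>as. c * gval (gstar M) as) (\<lambda>as. d * gval M' as) ls = gval (gstar M * M') ls * (c * d)" for c d
  proof -
    have "gmul (\<lambda>as. c * gval (gstar M) as) (\<lambda>as. d * gval M' as) ls = c * (d * gval (gstar M * M') ls)"
      by (simp only: gmul_alt_tmul tmul_scale_left tmul_scale_right alt_scale times_grass.rep_eq)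
    then show ?thesis by simp
  qed
  ultimately have "gmul (\<lambda>as. sstar ?X as (rev (map invol bs))) (\<lambda>as. ?Y as bs) ls =
      gval (gstar M * M') ls * (cnj (sprod fs bs) * sprod gs bs)" for bs
    by (simp only:)
  moreover have "((\<lambda>bs. gval (gstar M * M') ls * (cnj (sprod fs bs) * sprod gs bs)) has_sum
      gval (gstar M * M') ls * super_det odd_vec cinner fs gs) (lists onb)"
    by (intro has_sum_cmult_right has_sum_sprod_sprod assms)
  ultimately show "((\<lambda>bs. gmul (\<lambda>as. sstar ?X as (rev (map invol bs))) (\<lambda>as. ?Y as bs) ls) has_sum
      gval (gscal (super_det odd_vec cinner fs gs) * (gstar M * M')) ls) (lists onb)"
    by (simp add: gval_gscal_mult mult.commute)
qed

section \<open>The double integral\<close>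

lemma zprod_append: "zprod z (fs @ gs) = zprod z gs * zprod z fs"
  by (simp add: zprod_def)

lemma zprod_glam: "superpoint z \<Longrightarrow> zprod z fs \<in> glam"
  unfolding zprod_def by (rule glam_prod_list) (auto intro: zval_glam)

lemma ghom_zprod:
  assumes "superpoint z" "homog fs" shows "ghom (length (filter odd_vec fs)) (zprod z fs)"
  using assms(2)
proof (induction fs)
  case Nil
  show ?case by (simp add: zprod_def ghom_1)
next
  case (Cons f fs)
  have "invol f \<in> H0 \<union> H1" using Cons.prems by (auto intro: invol_H0 invol_H1)
  from zval_ghom[OF assms(1) this] have "ghom (of_bool (odd_vec f)) (zval z (invol f))"
    by (simp only: invol_H1_iff)
  moreover have "ghom (length (filter odd_vec fs)) (zprod z fs)" using Cons by simp
  ultimately have "ghom (length (filter odd_vec fs) + of_bool (odd_vec f)) (zprod z fs * zval z (invol f))"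
    by (intro ghom_mult)
  moreover have "zprod z (f # fs) = zprod z fs * zval z (invol f)" by (simp add: zprod_def)
  moreover have "length (filter odd_vec (f # fs)) = length (filter odd_vec fs) + of_bool (odd_vec f)" by simp
  ultimately show ?case by (simp only:)
qed

lemma zprod_cong: "(\<And>f. f \<in> set fs \<Longrightarrow> zval z (invol f) = zval z' (invol f)) \<Longrightarrow> zprod z fs = zprod z' fs"
  unfolding zprod_def by (intro arg_cong[where f = prod_list] map_cong) auto

lemma zprod_scale:
  assumes "\<And>f. f \<in> set fs \<Longrightarrow> zval z (invol f) = gscal (e f) * zval z' (invol f)"
  shows "zprod z fs = gscal (prod_list (map e fs)) * zprod z' fs"
  using assms
proof (induction fs)
  case (Cons f fs)
  have "zprod z (f # fs) = zprod z fs * zval z (invol f)" "zprod z' (f # fs) = zprod z' fs * zval z' (invol f)"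
    by (simp_all add: zprod_def)
  moreover have "zprod z fs = gscal (prod_list (map e fs)) * zprod z' fs" using Cons by simp
  moreover have "zval z (invol f) = gscal (e f) * zval z' (invol f)" using Cons.prems by simp
  moreover have "gscal a * p * (gscal b * r) = gscal (b * a) * (p * r)" for a b and p r :: "'b grass"
    by (simp only: mult.assoc gscal_left_commute[of p] gscal_mult gscal_left_commute[of "gscal a"])
  ultimately show ?case by simp
qed (simp add: zprod_def)

lemma gstar_zprod:
  assumes "x \<in> ELam" shows "gstar (zprod (x + sstar x) fs) = zprod (x + sstar x) (rev (map invol fs))"
  by (simp add: zprod_def gstar_prod_list rev_map o_def zval_real_point(3)[OF assms])

section \<open>Wick's formula on the two halves of the one-particle space\<close>

lemma super_det_scale:
  "super_det P (\<lambda>x y. e x * b x y) fs gs = prod_list (map e fs) * super_det P b fs gs"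
proof (induction fs arbitrary: gs)
  case (Cons f fs)
  then show ?case by (simp add: pull_sum_cmult[symmetric] mult_ac)
qed simp

text \<open>The eigenvalue of \<open>jmap\<close> on \<open>invol f\<close> for \<open>f\<close> in
  \<open>Epos\<close>.\<close>

definition jsign :: "'h::super_hilbert_space \<Rightarrow> complex" where
  "jsign f = (if odd_vec f then -1 else 1)"

lemma prod_jsign_square: "prod_list (map jsign fs) * prod_list (map jsign fs) = 1"
  by (induction fs) (auto simp: jsign_def)

lemma cnj_prod_jsign: "cnj (prod_list (map jsign fs)) = prod_list (map jsign fs)"
  by (induction fs) (auto simp: jsign_def)

text \<open>Here the starred vectors lie in \<open>Epos\<close>, where \<open>jmap\<close> is the
  identity, so \<open>omega\<close> contracts by the inner product itself.\<close>

lemma wick_Eneg: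
  assumes "set fs \<subseteq> Eneg" "set gs \<subseteq> Eneg"
  shows "wick odd_vec omega (gs @ rev (map invol fs)) = super_det odd_vec cinner fs gs"
proof (rule wick_conv_super_det[where S = "H0 \<union> H1" and A = Eneg])
  show "omega x y = 0" if "x \<in> Eneg" "y \<in> Eneg" for x y :: 'a
  proof -
    have "cinner (invol x) y = 0" using that invol_Eneg Epos_Eneg_orth by blast
    then have "cinner (invol x) (- y) = 0" using cinner_scaleC_right[of "invol x" "- 1" y] by simp
    then show ?thesis using \<open>cinner (invol x) y = 0\<close> by (simp add: omega_def jmap_Eneg[OF that(2)])
  qed
  show "omega (invol x) (invol y) = 0" if "x \<in> Eneg" "y \<in> Eneg" for x y :: 'a
    using that Eneg_Epos_orth[of x "invol y"] by (simp add: omega_def invol_invol jmap_Epos invol_Eneg)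
  show "omega y (invol x) = cinner x y" if "x \<in> Eneg" "y \<in> Eneg" for x y :: 'a
    using that by (simp add: omega_def jmap_Epos invol_Eneg cinner_invol cinner_commute[of x y])
  show "Eneg \<subseteq> H0 \<union> (H1 :: 'a set)" "invol ` Eneg \<subseteq> H0 \<union> (H1 :: 'a set)"
    using Eneg_subset Epos_subset invol_Eneg by blast+
  show "omega y x = koszul odd_vec x y * omega x y" if "x \<in> H0 \<union> H1" "y \<in> H0 \<union> H1" for x y :: 'a
    by (rule omega_commute[OF that])
  show "odd_vec x = odd_vec y" if "x \<in> H0 \<union> H1" "y \<in> H0 \<union> H1" "omega x y \<noteq> 0" for x y :: 'a
    by (rule omega_parity[OF that])
qed (use assms invol_H1_iff in blast)+

text \<open>Now the starred vectors lie in \<open>Eneg\<close>, where \<open>jmap\<close> acts by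
  the eigenvalue \<open>jsign\<close>; being a factor of each row, it comes out in front of the
  superdeterminant.\<close>

lemma wick_Epos:
  assumes "set fs \<subseteq> Epos" "set gs \<subseteq> Epos"
  shows "wick odd_vec omega (gs @ rev (map invol fs)) = prod_list (map jsign fs) * super_det odd_vec cinner fs gs"
proof -
  have j: "cinner z (jmap (invol x)) = jsign x * cinner z (invol x)" if "x \<in> Epos" for x z :: 'a
    using jmap_Eneg[OF invol_Epos[OF that]] cinner_scaleC_right[of z "- 1" "invol x"]
    by (simp add: jsign_def invol_H1_iff)
  have "wick odd_vec omega (gs @ rev (map invol fs)) = super_det odd_vec (\<lambda>x y. jsign x * cinner x y) fs gs"
  proof (rule wick_conv_super_det[where S = "H0 \<union> H1" and A = Epos])
    show "omega x y = 0" if "x \<in> Epos" "y \<in> Epos" for x y :: 'a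
      using that Eneg_Epos_orth[of "invol x" y] by (simp add: omega_def jmap_Epos invol_Epos)
    show "omega (invol x) (invol y) = 0" if "x \<in> Epos" "y \<in> Epos" for x y :: 'a
      using that Epos_Eneg_orth[of x "invol y"] by (simp add: omega_def invol_invol j invol_Epos)
    show "omega y (invol x) = jsign x * cinner x y" if "x \<in> Epos" "y \<in> Epos" for x y :: 'a
    proof -
      have "cinner (invol y) (invol x) = cinner x y" by (simp only: cinner_invol cinner_commute[of x y] complex_cnj_cnj)
      then show ?thesis by (simp only: omega_def j[OF that(1)])
    qed
    show "Epos \<subseteq> H0 \<union> (H1 :: 'a set)" "invol ` Epos \<subseteq> H0 \<union> (H1 :: 'a set)"
      using Epos_subset Eneg_subset invol_Epos by blast+
    show "omega y x = koszul odd_vec x y * omega x y" if "x \<in> H0 \<union> H1" "y \<in> H0 \<union> H1" for x y :: 'a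
      by (rule omega_commute[OF that])
    show "odd_vec x = odd_vec y" if "x \<in> H0 \<union> H1" "y \<in> H0 \<union> H1" "omega x y \<noteq> 0" for x y :: 'a
      by (rule omega_parity[OF that])
  qed (use assms invol_H1_iff in blast)+
  then show ?thesis by (rule trans) (rule super_det_scale)
qed

text \<open>Separation of variables: factors from \<open>Eneg\<close> see only \<xi>, those from
  \<open>Epos\<close> only \<eta>, and \<open>jext\<close> contributes \<open>jsign\<close> for each
  of the latter.\<close>

lemma zprod_jext_point:
  assumes x: "x \<in> ELam" and y: "y \<in> ELam" and as: "set as \<subseteq> Eneg" and bs: "set bs \<subseteq> Epos"
  shows "zprod (x + jext (sstar y)) (as @ bs) =
    gscal (prod_list (map jsign bs)) * (zprod (y + sstar y) bs * zprod (x + sstar x) as)"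
proof -
  let ?z = "x + jext (sstar y)"
  have sy: "superpoint (sstar y)" "superpoint (jext (sstar y))"
    using ELam_superpoint[OF y] superpoint_sstar superpoint_jext by blast+
  have y0: "zval (jext (sstar y)) h = 0" if "h \<in> Epos" for h
  proof -
    have "gstar (0 :: 'a grass) = 0" using gstar_add[of "0 :: 'a grass" 0] by simp
    then show ?thesis
      using that ELam_superpoint[OF y]
      by (simp add: zval_jext[OF sy(1)] jmap_Epos zval_sstar ELam_zval_Eneg[OF y] invol_Epos)
  qed
  have "zprod ?z as = zprod (x + sstar x) as"
    using as by (intro zprod_cong zval_real_point(1)[OF x _ sy(2) y0]) auto
  moreover have "zprod ?z bs = gscal (prod_list (map jsign bs)) * zprod (y + sstar y) bs"
  proof (rule zprod_scale)
    fix f assume "f \<in> set bs"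
    then have f: "f \<in> Epos" using bs by blast
    have "zval ?z (invol f) = zval (sstar y) (jmap (invol f))"
      using zval_real_point(2)[OF x f sy(2)] by (simp add: zval_jext[OF sy(1)])
    also have "\<dots> = gscal (jsign f) * zval (sstar y) (invol f)"
    proof (cases "odd_vec f")
      case True
      have "gscal (- 1) * a = - a" for a :: "'a grass"
        by (rule grass_eqI) (simp add: gval_gscal_mult uminus_grass.rep_eq)
      then show ?thesis
        using True jmap_Eneg[OF invol_Epos[OF f]] by (simp add: jsign_def invol_H1_iff zval_minus[OF sy(1)])
    next
      case False
      then show ?thesis using jmap_Eneg[OF invol_Epos[OF f]] by (simp add: jsign_def invol_H1_iff)
    qed
    also have "zval (sstar y) (invol f) = zval (y + sstar y) (invol f)"
      by (rule zval_real_point(2)[OF y f sy(1), symmetric])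
    finally show "zval ?z (invol f) = gscal (jsign f) * zval (y + sstar y) (invol f)" .
  qed
  ultimately show ?thesis by (simp add: zprod_append mult.assoc)
qed

lemma zprod_sstar_point:
  assumes x: "x \<in> ELam" and y: "y \<in> ELam" and cs: "set cs \<subseteq> Eneg" and ds: "set ds \<subseteq> Epos"
  shows "zprod (x + sstar y) (cs @ ds) = zprod (y + sstar y) ds * zprod (x + sstar x) cs"
proof -
  have sy: "superpoint (sstar y)" using ELam_superpoint[OF y] superpoint_sstar by blast
  have y0: "zval (sstar y) h = 0" if "h \<in> Epos" for h
  proof -
    have "gstar (0 :: 'a grass) = 0" using gstar_add[of "0 :: 'a grass" 0] by simp
    then show ?thesis
      using that ELam_superpoint[OF y] by (simp add: zval_sstar ELam_zval_Eneg[OF y] invol_Epos)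
  qed
  have "zprod (x + sstar y) cs = zprod (x + sstar x) cs"
    using cs by (intro zprod_cong zval_real_point(1)[OF x _ sy y0]) auto
  moreover have "zprod (x + sstar y) ds = zprod (y + sstar y) ds"
  proof (rule zprod_cong)
    fix f assume "f \<in> set ds"
    then have f: "f \<in> Epos" using ds by blast
    show "zval (x + sstar y) (invol f) = zval (y + sstar y) (invol f)"
      unfolding zval_real_point(2)[OF x f sy] by (rule zval_real_point(2)[OF y f sy, symmetric])
  qed
  ultimately show ?thesis by (simp add: zprod_append)
qed

section \<open>The integrand and its iterated integral\<close>

definition pairing_integrand :: "('l::involutive_hilbert_space, 'h::super_hilbert_space) stensor \<Rightarrow>
    ('l, 'h) stensor \<Rightarrow> ('l, 'h) stensor \<Rightarrow> ('l, 'h) stensor \<Rightarrow> 'l tensor" where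
  "pairing_integrand X Y x y = gmul (tstar (phi X x (jext (sstar y)))) (phi Y x (sstar y))"

lemma integrand_points:
  assumes "x \<in> ELam" "y \<in> ELam"
  shows "superpoint (x + jext (sstar y))" "superpoint (x + sstar y)"
  using assms by (intro superpoint_add superpoint_jext superpoint_sstar; simp add: ELam_superpoint)+

lemma integrand_add_left:
  assumes "X \<in> SfinLam" "X' \<in> SfinLam" "x \<in> ELam" "y \<in> ELam"
  shows "pairing_integrand (X + X') Y x y = pairing_integrand X Y x y + pairing_integrand X' Y x y"
proof -
  have "phi (X + X') x (jext (sstar y)) = phi X x (jext (sstar y)) + phi X' x (jext (sstar y))"
    by (rule phi_add[OF assms(1,2) integrand_points(1)[OF assms(3,4)]])
  moreover have "tstar (F + G) = (\<lambda>ls. tstar F ls + tstar G ls)" for F G :: "'a tensor"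
    by (simp add: tstar_def fun_eq_iff)
  ultimately show ?thesis
    by (simp add: pairing_integrand_def gmul_alt_tmul tmul_add_left alt_add plus_fun_def)
qed

lemma integrand_add_right:
  assumes "Y \<in> SfinLam" "Y' \<in> SfinLam" "x \<in> ELam" "y \<in> ELam"
  shows "pairing_integrand X (Y + Y') x y = pairing_integrand X Y x y + pairing_integrand X Y' x y"
proof -
  have "phi (Y + Y') x (sstar y) = phi Y x (sstar y) + phi Y' x (sstar y)"
    by (rule phi_add[OF assms(1,2) integrand_points(2)[OF assms(3,4)]])
  then show ?thesis
    by (simp add: pairing_integrand_def gmul_alt_tmul tmul_add_right alt_add plus_fun_def)
qed

lemma integrand_zero: "pairing_integrand 0 Y x y = 0" "pairing_integrand X 0 x y = 0"
  by (simp_all add: pairing_integrand_def phi_zero tstar_def gmul_def alt_def fun_eq_iff)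

text \<open>Taking the star reverses the factors of the first function, so up to the scalar the
  integrand reads \<open>gstar M\<close>, A, B, D, C, \<open>M'\<close> with A and C monomials in
  \<xi>, B and D in \<eta>. Moving C to the left of B D and then A C to the left of
  \<open>gstar M\<close> leaves grading automorphisms as the only trace.\<close>

lemma integrand_sprod:
  assumes x: "x \<in> ELam" and y: "y \<in> ELam"
    and as: "set as \<subseteq> Eneg" and bs: "set bs \<subseteq> Epos" and cs: "set cs \<subseteq> Eneg" and ds: "set ds \<subseteq> Epos"
  shows "pairing_integrand (tprod (gval M) (sprod (as @ bs))) (tprod (gval M') (sprod (cs @ ds))) x y =
    gval (zprod (x + sstar x) (cs @ rev (map invol as)) * (gscal (prod_list (map jsign bs)) *
      (galpha (length (filter odd_vec as) + length (filter odd_vec cs)) (gstar M) *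
       galpha (length (filter odd_vec cs)) (zprod (y + sstar y) (ds @ rev (map invol bs))) * M')))"
proof -
  let ?\<epsilon> = "gscal (prod_list (map jsign bs)) :: 'a grass"
  let ?a = "length (filter odd_vec as)" and ?c = "length (filter odd_vec cs)"
  let ?A = "zprod (x + sstar x) (rev (map invol as))" and ?C = "zprod (x + sstar x) cs"
  let ?B = "zprod (y + sstar y) (rev (map invol bs))" and ?D = "zprod (y + sstar y) ds"
  have h: "homog (as @ bs)" "homog (cs @ ds)" "homog (rev (map invol as))" "homog cs"
    using as bs cs ds Epos_subset Eneg_subset by (auto intro: invol_H0 invol_H1)
  have "gstar (zprod (x + jext (sstar y)) (as @ bs) * M) =
      gstar M * (gstar (zprod (x + sstar x) as) * gstar (zprod (y + sstar y) bs) * gstar ?\<epsilon>)"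
    by (simp only: zprod_jext_point[OF x y as bs] gstar_mult mult.assoc)
  also have "\<dots> = ?\<epsilon> * (gstar M * (?A * ?B))"
    by (simp add: gstar_zprod[OF x] gstar_zprod[OF y] gstar_gscal cnj_prod_jsign gscal_commute gscal_left_commute[of "gstar M"])
  finally have l: "gstar (zprod (x + jext (sstar y)) (as @ bs) * M) = ?\<epsilon> * (gstar M * (?A * ?B))" .
  have r: "zprod (x + sstar y) (cs @ ds) * M' = ?D * ?C * M'"
    by (simp only: zprod_sstar_point[OF x y cs ds])
  have "ghom ?c ?C" by (rule ghom_zprod[OF superpoint_real[OF x] h(4)])
  from ghom_commute[OF this] have "?B * ?D * ?C = ?C * galpha ?c (?B * ?D)" .
  from arg_cong[OF this, of "\<lambda>u. u * t" for t] have C: "?B * (?D * (?C * t)) = ?C * (galpha ?c (?B * ?D) * t)" for t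
    by (simp only: mult.assoc)
  have fa: "length (filter odd_vec (rev (map invol as))) = ?a"
    by (simp add: rev_filter[symmetric] filter_map o_def invol_H1_iff)
  have "ghom ?a ?A" using ghom_zprod[OF superpoint_real[OF x] h(3)] by (simp only: fa)
  from ghom_mult[OF this \<open>ghom ?c ?C\<close>] have "ghom (?a + ?c) (?A * ?C)" .
  from ghom_commute[OF this] have "gstar M * (?A * ?C) = ?A * ?C * galpha (?a + ?c) (gstar M)" .
  from arg_cong[OF this, of "\<lambda>u. u * t" for t]
  have AC: "gstar M * (?A * (?C * t)) = ?A * (?C * (galpha (?a + ?c) (gstar M) * t))" for t
    by (simp only: mult.assoc)
  have "gstar (zprod (x + jext (sstar y)) (as @ bs) * M) * (zprod (x + sstar y) (cs @ ds) * M') =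
    ?\<epsilon> * (gstar M * (?A * (?B * (?D * (?C * M')))))"
    by (simp only: l r mult.assoc)
  also have "\<dots> = ?\<epsilon> * (?A * (?C * (galpha (?a + ?c) (gstar M) * (galpha ?c (?B * ?D) * M'))))"
    by (simp only: C AC)
  also have "\<dots> = ?A * ?C * (?\<epsilon> * (galpha (?a + ?c) (gstar M) * galpha ?c (?B * ?D) * M'))"
    by (simp only: mult.assoc gscal_left_commute[of ?A] gscal_left_commute[of ?C])
  also have "?A * ?C = zprod (x + sstar x) (cs @ rev (map invol as))" by (simp only: zprod_append)
  also have "?B * ?D = zprod (y + sstar y) (ds @ rev (map invol bs))" by (simp only: zprod_append)
  finally have "gstar (zprod (x + jext (sstar y)) (as @ bs) * M) * (zprod (x + sstar y) (cs @ ds) * M') =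
    zprod (x + sstar x) (cs @ rev (map invol as)) * (?\<epsilon> * (galpha (?a + ?c) (gstar M) *
       galpha ?c (zprod (y + sstar y) (ds @ rev (map invol bs))) * M'))" .
  then show ?thesis
    unfolding pairing_integrand_def phi_sprod[OF integrand_points(1)[OF x y] h(1)]
      phi_sprod[OF integrand_points(2)[OF x y] h(2)] gstar.rep_eq[symmetric] times_grass.rep_eq[symmetric]
    by (simp only:)
qed

text \<open>Wick's formula is applied first in \<xi> and then in \<eta>. The parity argument for the
  signs is available only where a superdeterminant is nonzero, so each integration treats the
  vanishing case separately.\<close>

lemma double_integral_sprod:
  assumes M: "M \<in> glam" "M' \<in> glam"
    and as: "set as \<subseteq> Eneg" and bs: "set bs \<subseteq> Epos" and cs: "set cs \<subseteq> Eneg" and ds: "set ds \<subseteq> Epos"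
  shows "has_double_integral (pairing_integrand (tprod (gval M) (sprod (as @ bs))) (tprod (gval M') (sprod (cs @ ds))))
    (gval (gscal (super_det odd_vec cinner (as @ bs) (cs @ ds)) * (gstar M * M')))"
proof -
  let ?\<epsilon> = "prod_list (map jsign bs)"
  let ?fs = "cs @ rev (map invol as)" and ?gs = "ds @ rev (map invol bs)"
  let ?a = "length (filter odd_vec as)" and ?c = "length (filter odd_vec cs)"
  let ?p = "length (filter odd_vec ?gs)"
  let ?K = "\<lambda>y. zprod (y + sstar y) ?gs"
  let ?W1 = "super_det odd_vec cinner as cs" and ?W2 = "super_det odd_vec cinner bs ds"
  have hom: "homog ?fs" "homog ?gs"
    using as bs cs ds Epos_subset Eneg_subset by (auto intro: invol_H0 invol_H1)
  have par: "odd_vec u = odd_vec v" if "cinner u v \<noteq> 0" "u \<in> Epos \<union> Eneg" "v \<in> Epos \<union> Eneg" for u v :: 'b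
    using cinner_parity[OF _ _ that(1)] that(2,3) Epos_subset Eneg_subset by blast
  have W1: "even ?a = even ?c" if "?W1 \<noteq> 0"
    by (rule super_det_parity[OF _ that]) (rule par, use as cs in auto)
  have W2: "even ?p" if "?W2 \<noteq> 0"
  proof -
    have "even (length (filter odd_vec bs)) = even (length (filter odd_vec ds))"
      by (rule super_det_parity[OF _ that]) (rule par, use bs ds in auto)
    moreover have "length (filter odd_vec (rev (map invol bs))) = length (filter odd_vec bs)"
      by (simp add: rev_filter[symmetric] filter_map o_def invol_H1_iff)
    ultimately show ?thesis by simp
  qed
  \<comment> \<open>What remains to the right of the \<eta>-monomial after the inner integration:
    the power of -1 is the effect of \<open>galpha ?c\<close> on the monomial, and
    \<open>galpha ?p\<close> arises from moving the monomial in front of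
    \<open>gstar M\<close>.\<close>
  let ?R = "gscal (?W1 * ?\<epsilon> * (- 1) ^ (?c * ?p)) * (galpha ?p (gstar M) * M')"
  have R: "?R \<in> glam" by (intro glam_mult glam_gscal glam_galpha glam_gstar M)
  have inner: "has_gauss_integral (\<lambda>x. pairing_integrand (tprod (gval M) (sprod (as @ bs)))
      (tprod (gval M') (sprod (cs @ ds))) x y) (gval (?K y * ?R))" if y: "y \<in> ELam" for y
  proof -
    let ?N = "gscal ?\<epsilon> * (galpha (?a + ?c) (gstar M) * galpha ?c (?K y) * M')"
    have "?N \<in> glam"
      by (intro glam_mult glam_gscal glam_galpha glam_gstar M zprod_glam superpoint_real y)
    then have "has_gauss_integral (\<lambda>x. pairing_integrand (tprod (gval M) (sprod (as @ bs)))
      (tprod (gval M') (sprod (cs @ ds))) x y) (gval (gscal (wick odd_vec omega ?fs) * ?N))"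
      by (rule has_gauss_integral_zprod[OF _ hom(1)]) (rule integrand_sprod[OF _ y as bs cs ds])
    moreover have "gscal (wick odd_vec omega ?fs) * ?N = ?K y * ?R"
    proof (cases "?W1 = 0")
      case True
      then show ?thesis by (simp add: wick_Eneg[OF as cs])
    next
      case False
      have K: "ghom ?p (?K y)" by (rule ghom_zprod[OF superpoint_real[OF y] hom(2)])
      have "galpha (?a + ?c) (gstar M) = gstar M" using W1[OF False] by (intro galpha_even) simp
      moreover have "galpha ?c (?K y) = gscal ((- 1) ^ (?c * ?p)) * ?K y" by (rule galpha_ghom[OF K])
      ultimately have "gscal (wick odd_vec omega ?fs) * ?N =
        gscal ?W1 * (gscal ?\<epsilon> * (gscal ((- 1) ^ (?c * ?p)) * (gstar M * ?K y * M')))"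
        by (simp only: wick_Eneg[OF as cs] gscal_left_commute[of "gstar M"] mult.assoc)
      also have "gstar M * ?K y = ?K y * galpha ?p (gstar M)" by (rule ghom_commute[OF K])
      finally show ?thesis by (simp only: gscal_mult mult.assoc gscal_left_commute[of "?K y"])
    qed
    ultimately show ?thesis by (simp only:)
  qed
  have outer: "has_gauss_integral (\<lambda>y. gval (?K y * ?R)) (gval (gscal (wick odd_vec omega ?gs) * ?R))"
    by (rule has_gauss_integral_zprod[OF R hom(2) refl])
  have "super_det odd_vec cinner (as @ bs) (cs @ ds) = ?W1 * ?W2"
    using as bs cs ds Epos_Eneg_orth Eneg_Epos_orth by (intro super_det_append) blast+
  moreover have "gscal (wick odd_vec omega ?gs) * ?R = gscal (?W1 * ?W2) * (gstar M * M')"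
  proof (cases "?W2 = 0")
    case True
    then show ?thesis by (simp add: wick_Epos[OF bs ds])
  next
    case False
    have "gscal w * (gscal q * t) = gscal (w * q) * t" for w q and t :: "'a grass" by (simp only: gscal_mult mult.assoc)
    \<comment> \<open>The power of -1 is 1 because \<open>?p\<close> is even, and the
      \<open>jsign\<close> factor in \<open>?R\<close> meets the equal one from
      \<open>wick_Epos\<close>.\<close>
    moreover have "wick odd_vec omega ?gs * (?W1 * ?\<epsilon> * (- 1) ^ (?c * ?p)) = ?W1 * ?W2"
      using prod_jsign_square[of bs] W2[OF False] by (simp add: wick_Epos[OF bs ds] mult_ac)
    moreover have "galpha ?p (gstar M) = gstar M" using W2[OF False] by (rule galpha_even)
    ultimately show ?thesis by (simp only:)
  qed
  ultimately have outer': "has_gauss_integral (\<lambda>y. gval (?K y * ?R))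
      (gval (gscal (super_det odd_vec cinner (as @ bs) (cs @ ds)) * (gstar M * M')))"
    using outer by (simp only:)
  show ?thesis
    unfolding has_double_integral_def
    by (intro exI[of _ "\<lambda>y. gval (?K y * ?R)"] conjI ballI inner outer')
qed

text \<open>A common value \<open>v\<close> is exhibited for both sides, which reduces the equation
  to additivity and the case of products.\<close>

lemma sinner_double_integral:
  fixes X Y :: "('l::involutive_hilbert_space, 'h::super_hilbert_space) stensor"
  assumes X: "X \<in> SfinLam" and Y: "Y \<in> SfinLam"
  shows "\<exists>v. sinner_sums X Y v \<and> has_double_integral (pairing_integrand X Y) v"
proof -
  \<comment> \<open>Membership in \<open>SfinLam\<close> is made part of the induction claim because
    additivity of the integrand depends on it.\<close>
  have base: "Y \<in> SfinLam \<and> (\<exists>v. sinner_sums X Y v \<and> has_double_integral (pairing_integrand X Y) v)"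
    if X: "X = tprod (gval M) (sprod (as @ bs))" "M \<in> glam" "set as \<subseteq> Eneg" "set bs \<subseteq> Epos"
    for X :: "('l, 'h) stensor" and M as bs
    using Y
  proof (induction rule: SfinLam_induct)
    case zero
    have "has_double_integral (pairing_integrand X 0) 0"
      by (rule has_double_integral_cong[OF _ has_double_integral_zero]) (simp only: integrand_zero)
    then show ?case using SfinLam_zero sinner_sums_zero(2)[of X] by blast
  next
    case (add Y Y')
    then obtain v w where vw: "sinner_sums X Y v" "has_double_integral (pairing_integrand X Y) v"
      "sinner_sums X Y' w" "has_double_integral (pairing_integrand X Y') w" and S: "Y \<in> SfinLam" "Y' \<in> SfinLam"
      by blast
    have "has_double_integral (pairing_integrand X (Y + Y')) (v + w)"
      by (rule has_double_integral_cong[OF _ has_double_integral_add[OF vw(2,4)]])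
        (rule integrand_add_right[OF S, symmetric])
    then show ?case using SfinLam_add[OF S] sinner_sums_add_right[OF vw(1,3)] by blast
  next
    case (prod M' cs ds)
    have h: "homog (as @ bs)" "homog (cs @ ds)" using X prod Epos_subset Eneg_subset by auto
    show ?case
      using SfinLam_sprod[OF prod(1) h(2)] sinner_sums_sprod[OF h, of M M']
        double_integral_sprod[OF X(2) prod(1) X(3,4) prod(2,3)] unfolding X(1) by blast
  qed
  have "X \<in> SfinLam \<and> (\<exists>v. sinner_sums X Y v \<and> has_double_integral (pairing_integrand X Y) v)"
    using X
  proof (induction rule: SfinLam_induct)
    case zero
    have "has_double_integral (pairing_integrand 0 Y) 0"
      by (rule has_double_integral_cong[OF _ has_double_integral_zero]) (simp only: integrand_zero)
    then show ?case using SfinLam_zero sinner_sums_zero(1)[of Y] by blast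
  next
    case (add X X')
    then obtain v w where vw: "sinner_sums X Y v" "has_double_integral (pairing_integrand X Y) v"
      "sinner_sums X' Y w" "has_double_integral (pairing_integrand X' Y) w" and S: "X \<in> SfinLam" "X' \<in> SfinLam"
      by blast
    have "has_double_integral (pairing_integrand (X + X') Y) (v + w)"
      by (rule has_double_integral_cong[OF _ has_double_integral_add[OF vw(2,4)]])
        (rule integrand_add_left[OF S, symmetric])
    then show ?case using SfinLam_add[OF S] sinner_sums_add_left[OF vw(1,3)] by blast
  next
    case (prod M as bs)
    have "homog (as @ bs)" using prod Epos_subset Eneg_subset by auto
    from SfinLam_sprod[OF prod(1) this] base[OF refl prod(1-3)] show ?case by blast
  qed
  then show ?thesis by blast
qed

theorem lemma8:
  fixes X Y :: "('l::involutive_hilbert_space, 'h::super_hilbert_space) stensor"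
  assumes "infinite_dimensional TYPE('l)"
    and "X \<in> SfinLam" and "Y \<in> SfinLam"
  shows "(\<forall>y\<in>ELam. gauss_integrable (\<lambda>x.
            gmul (tstar (phi X x (jext (sstar y)))) (phi Y x (sstar y)))) \<and>
         gauss_integrable (\<lambda>y. gauss_integral (\<lambda>x.
            gmul (tstar (phi X x (jext (sstar y)))) (phi Y x (sstar y)))) \<and>
         sinner X Y = gauss_integral (\<lambda>y. gauss_integral (\<lambda>x.
            gmul (tstar (phi X x (jext (sstar y)))) (phi Y x (sstar y))))"
proof -
  obtain v where v: "sinner_sums X Y v" "has_double_integral (pairing_integrand X Y) v"
    using sinner_double_integral[OF assms(2,3)] by blast
  have "pairing_integrand X Y = (\<lambda>x y. gmul (tstar (phi X x (jext (sstar y)))) (phi Y x (sstar y)))"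
    by (simp add: pairing_integrand_def fun_eq_iff)
  from has_double_integral[OF assms(1) v(2)[unfolded this]] sinner_sums[OF v(1)]
  show ?thesis by (simp only: simp_thms)
qed

end
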